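(* Let $n\ge 2$, let $\Omega\subset\mathbb{R}^n$ be a bounded open set, and let $k\in\mathbb{N}$ with $1\le k<n$. Let $\nu$ be a positive Borel measure on $\Omega$ such that, for some $d\in(0,n]$, (i) there is a constant $C_d'>0$ with $\nu(B(x,r))\le C_d' r^d$ for all $x\in\mathbb{R}^n$ and all $r>0$; (ii) there exist $x_0\in\Omega$, $\varrho_0>0$ and $C_0>0$ such that $C_0\varrho^d\le \nu(B(x_0,\varrho)\cap\Omega)$ for all $0<\varrho\le\varrho_0$. Let $\gamma<d\,\omega_n^{\frac kn}\sqrt{\ell_n^k}$. Then there exists a positive constant $C=C(n,k,\Omega,C_d',\gamma)$ such that $$\int_\Omega \exp\left(\gamma|u(x)|\right)\,d\nu\le C$$ for every $u\in W_0^kL^{\frac nk,\infty}(\Omega)$ with $\|\,|\nabla^k u|\,\|_{L^{\frac nk,\infty}(\Omega)}\le 1$. Moreover, the result is sharp in the sense that for any $\gamma>d\,\omega_n^{\frac kn}\sqrt{\ell_n^k}$ the integral $\int_\Omega \exp(\gamma|u(x)|)\,d\nu$ cannot be uniformly bounded over all $u\in W_0^kL^{\frac nk,\infty}(\Omega)$ with $\|\,|\nabla^k u|\,\|_{L^{\frac nk,\infty}(\Omega)}\le 1$.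
   Context: $B(x,r)$ is the ball of radius $r$ centered at $x$; $\nu$ is regarded as a measure on $\mathbb{R}^n$ vanishing outside $\Omega$, so $\nu(B(x,r))=\nu(B(x,r)\cap\Omega)$. $|E|$ is the Lebesgue measure of $E$, and $\omega_n$ is the Lebesgue measure of the unit ball of $\mathbb{R}^n$. $C=C(\dots)$ means a constant depending only on the listed quantities (dependence on $C_d'$ being understood together with its exponent $d$). $\nabla^k u$ is the tensor of all $n^k$ partial derivatives $\partial^k u/\partial x_{i_1}\cdots\partial x_{i_k}$, $i_1,\dots,i_k\in\{1,\dots,n\}$, and $|\nabla^k u|$ is its Euclidean norm in $\mathbb{R}^{n^k}$. $\ell_n^k$ is the constant determined by $|\nabla^k\log|x||=\sqrt{\ell_n^k}\,/|x|^k$ for all $x\in\mathbb{R}^n\setminus\{0\}$. For a measurable function $g$ on $\Omega$, its non-increasing rearrangement is $g^*(t)=\inf\{\lambda>0:\ |\{x\in\Omega:|g(x)|>\lambda\}|\le t\}$, $t>0$. For $1\le p<\infty$, $\|g\|_{L^{p,\infty}(\Omega)}=\sup_{0<s<|\Omega|}s^{1/p}g^*(s)$. $W_0^kL^{p,\infty}(\Omega)$ is the set of real-valued functions $u$ on $\Omega$ whose continuation by $0$ outside $\Omega$ is $k$-times weakly differentiable in the whole of $\mathbb{R}^n$ and which satisfy $\|\,|\nabla^k u|\,\|_{L^{p,\infty}(\Omega)}<\infty$. In integrals against $\nu$, $u$ denotes its precise representative $u(x)=\lim_{r\to0}\frac1{|B(x,r)|}\int_{B(x,r)}u(y)\,dy$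 (with $u$ extended by $0$), at the points $x$ where this limit exists. *)

theory Defs
  imports "HOL-Analysis.Analysis"
begin

definition partial_deriv :: "'n::finite \<Rightarrow> (real ^ 'n \<Rightarrow> real) \<Rightarrow> real ^ 'n \<Rightarrow> real" where
  "partial_deriv i f x = deriv (\<lambda>t. f (x + t *\<^sub>R axis i 1)) 0"

text \<open>A list \<open>[i\<^sub>1, \<dots>, i\<^sub>k]\<close> of coordinate indices stands for
  \<open>\<partial>\<^sup>k / \<partial>x\<^sub>i\<^sub>1 \<cdots> \<partial>x\<^sub>i\<^sub>k\<close>; the lists of length \<open>k\<close> therefore enumerate
  the \<open>n\<^sup>k\<close> entries of the tensor \<open>\<nabla>\<^sup>k f\<close>.\<close>

definition iter_partial_deriv :: "'n::finite list \<Rightarrow> (real ^ 'n \<Rightarrow> real) \<Rightarrow> real ^ 'n \<Rightarrow> real" where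
  "iter_partial_deriv is f = foldr partial_deriv is f"

definition tensor_norm :: "nat \<Rightarrow> ('n::finite list \<Rightarrow> real ^ 'n \<Rightarrow> real) \<Rightarrow> real ^ 'n \<Rightarrow> real" where
  "tensor_norm k T x = sqrt (\<Sum>is\<in>{is. length is = k}. (T is x)\<^sup>2)"

text \<open>If all iterated partial derivatives are (Frechet) differentiable everywhere then they are
  all continuous, so the first conjunct is membership in \<open>C\<^sup>\<infinity>\<close>.\<close>

definition test_function :: "(real ^ 'n::finite \<Rightarrow> real) \<Rightarrow> bool" where
  "test_function \<phi> \<longleftrightarrow>
     (\<forall>is x. iter_partial_deriv is \<phi> differentiable (at x)) \<and> compact (closure {x. \<phi> x \<noteq> 0})"

definition locally_integrable :: "(real ^ 'n::finite \<Rightarrow> real) \<Rightarrow> bool" where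
  "locally_integrable f \<longleftrightarrow> (\<forall>K. compact K \<longrightarrow> set_integrable lebesgue K f)"

definition has_weak_deriv ::
  "(real ^ 'n::finite \<Rightarrow> real) \<Rightarrow> 'n list \<Rightarrow> (real ^ 'n \<Rightarrow> real) \<Rightarrow> bool" where
  "has_weak_deriv u is g \<longleftrightarrow> locally_integrable u \<and> locally_integrable g \<and>
     (\<forall>\<phi>. test_function \<phi> \<longrightarrow>
        (\<integral>x. u x * iter_partial_deriv is \<phi> x \<partial>lebesgue) =
        (- 1) ^ length is * (\<integral>x. g x * \<phi> x \<partial>lebesgue))"

text \<open>Weak derivatives are unique up to Lebesgue null sets; \<open>weak_deriv\<close> picks a version.
  Below it enters only through distribution functions, which do not depend on the version.\<close>

definition weak_deriv :: "(real ^ 'n::finite \<Rightarrow> real) \<Rightarrow> 'n list \<Rightarrow> real ^ 'n \<Rightarrow> real" where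
  "weak_deriv u is = (SOME g. has_weak_deriv u is g)"

definition weakly_differentiable :: "nat \<Rightarrow> (real ^ 'n::finite \<Rightarrow> real) \<Rightarrow> bool" where
  "weakly_differentiable k u \<longleftrightarrow> (\<forall>is. length is \<le> k \<longrightarrow> (\<exists>g. has_weak_deriv u is g))"

definition rearrangement :: "(real ^ 'n::finite) set \<Rightarrow> (real ^ 'n \<Rightarrow> real) \<Rightarrow> real \<Rightarrow> ennreal" where
  "rearrangement \<Omega> g t =
     Inf {ennreal c |c. c > 0 \<and> emeasure lebesgue {x \<in> \<Omega>. \<bar>g x\<bar> > c} \<le> ennreal t}"

definition weak_Lp_norm :: "real \<Rightarrow> (real ^ 'n::finite) set \<Rightarrow> (real ^ 'n \<Rightarrow> real) \<Rightarrow> ennreal" where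
  "weak_Lp_norm p \<Omega> g =
     (SUP s\<in>{s. 0 < s \<and> ennreal s < emeasure lebesgue \<Omega>}.
        ennreal (s powr (1 / p)) * rearrangement \<Omega> g s)"

text \<open>A function on \<open>\<Omega>\<close> is represented by a total function whose values off \<open>\<Omega>\<close> are irrelevant.\<close>

definition zero_ext :: "(real ^ 'n::finite) set \<Rightarrow> (real ^ 'n \<Rightarrow> real) \<Rightarrow> real ^ 'n \<Rightarrow> real" where
  "zero_ext \<Omega> u x = (if x \<in> \<Omega> then u x else 0)"

definition grad_norm :: "nat \<Rightarrow> (real ^ 'n::finite) set \<Rightarrow> (real ^ 'n \<Rightarrow> real) \<Rightarrow> real ^ 'n \<Rightarrow> real" where
  "grad_norm k \<Omega> u = tensor_norm k (weak_deriv (zero_ext \<Omega> u))"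

definition W0_weak_Lp :: "nat \<Rightarrow> real \<Rightarrow> (real ^ 'n::finite) set \<Rightarrow> (real ^ 'n \<Rightarrow> real) set" where
  "W0_weak_Lp k p \<Omega> =
     {u. weakly_differentiable k (zero_ext \<Omega> u) \<and> weak_Lp_norm p \<Omega> (grad_norm k \<Omega> u) < \<infinity>}"

definition ball_average :: "(real ^ 'n::finite \<Rightarrow> real) \<Rightarrow> real ^ 'n \<Rightarrow> real \<Rightarrow> real" where
  "ball_average u x r = (LINT y:ball x r|lebesgue. u y) / measure lebesgue (ball x r)"

definition has_precise_value :: "(real ^ 'n::finite \<Rightarrow> real) \<Rightarrow> real ^ 'n \<Rightarrow> bool" where
  "has_precise_value u x \<longleftrightarrow> (\<exists>l. (ball_average u x \<longlongrightarrow> l) (at_right 0))"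

definition precise_rep :: "(real ^ 'n::finite \<Rightarrow> real) \<Rightarrow> real ^ 'n \<Rightarrow> real" where
  "precise_rep u x = Lim (at_right 0) (ball_average u x)"

text \<open>The integral of \<open>exp (\<gamma> |u|)\<close> over \<open>\<Omega>\<close> with respect to \<open>\<nu>\<close>, the integrand being taken
  at the points where the precise representative of \<open>u\<close> is defined.\<close>

definition exp_integral ::
  "(real ^ 'n::finite) measure \<Rightarrow> (real ^ 'n) set \<Rightarrow> real \<Rightarrow> (real ^ 'n \<Rightarrow> real) \<Rightarrow> ennreal" where
  "exp_integral \<nu> \<Omega> \<gamma> u =
     (\<integral>\<^sup>+x\<in>{x \<in> \<Omega>. has_precise_value (zero_ext \<Omega> u) x}.
        ennreal (exp (\<gamma> * \<bar>precise_rep (zero_ext \<Omega> u) x\<bar>)) \<partial>\<nu>)"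

text \<open>The constant \<open>\<ell>\<^sub>n\<^sup>k\<close>; it is unique because \<open>sqrt\<close> is injective on all of \<open>real\<close>.\<close>

definition ell :: "'n::finite itself \<Rightarrow> nat \<Rightarrow> real" where
  "ell T k = (THE l. \<forall>x::real ^ 'n. x \<noteq> 0 \<longrightarrow>
     tensor_norm k (\<lambda>is. iter_partial_deriv is (\<lambda>y. ln (norm y))) x = sqrt l / norm x ^ k)"

definition omega :: "'n::finite itself \<Rightarrow> real" where
  "omega T = measure lebesgue (ball (0 :: real ^ 'n) 1)"

definition critical_exponent :: "'n::finite itself \<Rightarrow> nat \<Rightarrow> real \<Rightarrow> real" where
  "critical_exponent T k d = d * omega T powr (real k / real CARD('n)) * sqrt (ell T k)"

text \<open>A Borel measure on \<open>\<Omega>\<close>, regarded as a measure on the whole space vanishing off \<open>\<Omega>\<close>.\<close>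

definition borel_measure_on :: "(real ^ 'n::finite) set \<Rightarrow> (real ^ 'n) measure \<Rightarrow> bool" where
  "borel_measure_on \<Omega> \<nu> \<longleftrightarrow> sets \<nu> = sets borel \<and> emeasure \<nu> (- \<Omega>) = 0"

definition upper_growth :: "real \<Rightarrow> real \<Rightarrow> (real ^ 'n::finite) measure \<Rightarrow> bool" where
  "upper_growth d C \<nu> \<longleftrightarrow> (\<forall>x r. r > 0 \<longrightarrow> emeasure \<nu> (ball x r) \<le> ennreal (C * r powr d))"

definition lower_growth :: "real \<Rightarrow> (real ^ 'n::finite) set \<Rightarrow> (real ^ 'n) measure \<Rightarrow> bool" where
  "lower_growth d \<Omega> \<nu> \<longleftrightarrow> (\<exists>x\<^sub>0\<in>\<Omega>. \<exists>\<rho>\<^sub>0>0. \<exists>C\<^sub>0>0. \<forall>\<rho>. 0 < \<rho> \<and> \<rho> \<le> \<rho>\<^sub>0 \<longrightarrow>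
     ennreal (C\<^sub>0 * \<rho> powr d) \<le> emeasure \<nu> (ball x\<^sub>0 \<rho> \<inter> \<Omega>))"

end

theory Submission
  imports Defs "HOL-Computational_Algebra.Polynomial"
begin

text \<open>
  Write \<open>\<ell>\<close> for \<open>ell\<close> and \<open>\<omega>\<close> for \<open>omega\<close>. By conformal invariance of the logarithm up to constants, the divergence of
  the tensor \<open>|y|^(2k-n) \<nabla>^k ln |y|\<close> is a multiple of \<open>|y|^(-n)\<close> off the origin; testing it against cutoffs that vary
  slowly in \<open>ln |y|\<close> shows that this multiple is zero and that the distributional divergence is a multiple
  of the Dirac measure, of modulus \<open>\<ell> n \<omega>\<close>. Hence at every point where the Riesz potential on the right is finite,
  the precise representative exists and satisfies
  \<open>|u(x)| \<le> (n \<omega> sqrt \<ell>)^(-1) \<integral> |x - y|^(k-n) |\<nabla>^k u(y)| dy\<close>. The weak derivatives vanish almost everywhere off \<open>\<Omega>\<close>,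
  so only \<open>y \<in> \<Omega>\<close> matters, and there \<open>|{|\<nabla>^k u| > b}| \<le> b^(-n/k)\<close>.

  Split the potential at \<open>|x - y| = r\<close>. Rearranging level sets into balls, the far part is at most
  \<open>n \<omega>^(1-k/n) ln (1/r)\<close> plus a constant. The near part exceeds 1 only on an open set of \<open>\<nu>\<close>-measure \<open>O(r^d)\<close>, by a
  dyadic covering argument. With \<open>r = e^(-m)\<close> this gives \<open>|u| \<le> m / (\<omega>^(k/n) sqrt \<ell>) + O(1)\<close> off a set of measure
  \<open>O(e^(-md))\<close>, and \<open>exp (\<gamma> |u|)\<close> is summed over the layers \<open>m\<close>. For sharpness take \<open>u(x) = a G(\<delta> ln |x - x\<^sub>0|) / \<delta>\<close> with a
  cutoff \<open>G\<close> of slope close to \<open>-1\<close>, and let \<open>\<delta>\<close> tend to 0.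
\<close>

section \<open>Smooth functions and the chain rule\<close>

text \<open>Precise values must be controlled point by point, since \<nu> may charge Lebesgue null
  sets; hence the representation is derived through ball averages at a given point. The boundary of
  \<Omega> may have positive measure, so that weak derivatives vanish there needs a proof. The
  weight |y|^(2k-n) keeps the kernel tensor parallel to the derivative tensor of ln |y|, so
  Cauchy-Schwarz loses nothing on the logarithm. The coefficient n \<omega>^(1-k/n) of the far part,
  divided by n \<omega> sqrt \<ell>, is 1 / (\<omega>^(k/n) sqrt \<ell>); this is the origin of the
  critical exponent. In the variable t = ln |y| the measure |y|^(-n) dy is n \<omega> dt. A profile
  G(\<delta> t) has a total drop independent of \<delta>, whereas errors of order \<delta>^2 live on
  a length of order 1/\<delta> and are negligible. A divergence c |y|^(-n) with c nonzero would
  contribute a term of order 1/\<delta> while everything else stays bounded, which forces c = 0. The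
  same cutoffs, nearly linear in ln |y|, are the extremal functions. The exceptional sets are unions
  of balls, hence open and directly controlled by the upper growth of \<nu>.\<close>

definition smooth_on :: "(real ^ 'n::finite) set \<Rightarrow> (real ^ 'n \<Rightarrow> real) \<Rightarrow> bool" where
  "smooth_on U f \<longleftrightarrow> (\<forall>is. \<forall>x\<in>U. iter_partial_deriv is f differentiable (at x))"

lemma iter_partial_deriv_Nil [simp]: "iter_partial_deriv [] f = f"
  by (simp add: iter_partial_deriv_def)

lemma iter_partial_deriv_Cons [simp]:
  "iter_partial_deriv (i # is) f = partial_deriv i (iter_partial_deriv is f)"
  by (simp add: iter_partial_deriv_def)

lemma iter_partial_deriv_append:
  "iter_partial_deriv (is @ js) f = iter_partial_deriv is (iter_partial_deriv js f)"
  by (simp add: iter_partial_deriv_def)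

lemma has_derivative_line:
  fixes f :: "real ^ 'n::finite \<Rightarrow> real"
  assumes "(f has_derivative f') (at x)"
  shows "((\<lambda>t. f (x + t *\<^sub>R v)) has_real_derivative f' v) (at 0)"
proof -
  have f: "(f has_derivative f') (at (x + 0 *\<^sub>R v))" using assms by simp
  have "((\<lambda>t::real. x + t *\<^sub>R v) has_derivative (\<lambda>t. t *\<^sub>R v)) (at 0)"
    by (auto intro!: derivative_eq_intros)
  from has_derivative_compose[OF this f]
  have "((\<lambda>t. f (x + t *\<^sub>R v)) has_derivative (\<lambda>t. f' (t *\<^sub>R v))) (at 0)" .
  moreover have "f' (t *\<^sub>R v) = f' v * t" for t
    using linear_scale[OF has_derivative_linear[OF assms]] by simp
  ultimately show ?thesis by (simp add: has_field_derivative_def)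
qed

lemma partial_deriv_eq:
  fixes f :: "real ^ 'n::finite \<Rightarrow> real"
  assumes "(f has_derivative f') (at x)"
  shows "partial_deriv i f x = f' (axis i 1)"
  unfolding partial_deriv_def by (rule DERIV_imp_deriv[OF has_derivative_line[OF assms]])

lemma has_derivative_partial_deriv:
  fixes f :: "real ^ 'n::finite \<Rightarrow> real"
  assumes "f differentiable (at x)"
  shows "(f has_derivative (\<lambda>h. \<Sum>i\<in>UNIV. h $ i * partial_deriv i f x)) (at x)"
proof -
  obtain f' where f': "(f has_derivative f') (at x)" using assms by (auto simp: differentiable_def)
  have lin: "linear f'" by (rule has_derivative_linear[OF f'])
  have "f' h = (\<Sum>i\<in>UNIV. h $ i * partial_deriv i f x)" for h
  proof -
    have "f' h = f' (\<Sum>i\<in>UNIV. (h $ i) *\<^sub>R axis i 1)"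
      by (subst basis_expansion[of h, symmetric]) (simp add: vector_scalar_mult_def scalar_mult_eq_scaleR)
    also have "\<dots> = (\<Sum>i\<in>UNIV. h $ i * f' (axis i 1))"
      by (simp add: linear_sum[OF lin] linear_scale[OF lin])
    finally show ?thesis by (simp add: partial_deriv_eq[OF f'])
  qed
  then have "f' = (\<lambda>h. \<Sum>i\<in>UNIV. h $ i * partial_deriv i f x)" by auto
  with f' show ?thesis by simp
qed

lemma partial_deriv_cong:
  assumes "open U" "x \<in> U" "\<And>y. y \<in> U \<Longrightarrow> f y = g y"
  shows "partial_deriv i f x = partial_deriv i g (x :: real ^ 'n::finite)"
  unfolding partial_deriv_def
proof (rule deriv_cong_ev)
  have "((\<lambda>t::real. x + t *\<^sub>R axis i 1) \<longlongrightarrow> x + 0 *\<^sub>R axis i 1) (nhds 0)"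
    by (intro tendsto_intros filterlim_ident)
  then have "\<forall>\<^sub>F t in nhds 0. x + t *\<^sub>R axis i 1 \<in> U"
    using assms(1,2) by (auto dest: topological_tendstoD)
  then show "\<forall>\<^sub>F t in nhds 0. f (x + t *\<^sub>R axis i 1) = g (x + t *\<^sub>R axis i 1)"
    by eventually_elim (use assms(3) in auto)
qed simp

lemma iter_partial_deriv_cong:
  assumes "open U" "\<And>y. y \<in> U \<Longrightarrow> f y = g y"
  shows "x \<in> U \<Longrightarrow> iter_partial_deriv is f x = iter_partial_deriv is g (x :: real ^ 'n::finite)"
  by (induction "is" arbitrary: x) (use assms in \<open>auto intro: partial_deriv_cong\<close>)

lemma differentiable_cong_open:
  fixes f :: "real ^ 'n::finite \<Rightarrow> real"
  assumes "open U" "x \<in> U" "\<And>y. y \<in> U \<Longrightarrow> f y = g y" "f differentiable (at x)"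
  shows "g differentiable (at x)"
  using assms has_derivative_transform_within_open[of f _ x UNIV U g] unfolding differentiable_def by auto

lemma smooth_on_cong:
  assumes "open U" "\<And>y. y \<in> U \<Longrightarrow> f y = g y" "smooth_on U f"
  shows "smooth_on U g"
  unfolding smooth_on_def
proof (intro allI ballI)
  fix "is" x assume "x \<in> U"
  with assms show "iter_partial_deriv is g differentiable at x"
    using differentiable_cong_open[of U x "iter_partial_deriv is f", OF assms(1) _ iter_partial_deriv_cong[OF assms(1,2)]]
    by (simp add: smooth_on_def)
qed

lemma smooth_on_subset: "smooth_on U f \<Longrightarrow> V \<subseteq> U \<Longrightarrow> smooth_on V f"
  by (auto simp: smooth_on_def)

lemma smooth_on_Un: "smooth_on U f \<Longrightarrow> smooth_on V f \<Longrightarrow> smooth_on (U \<union> V) f"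
  by (auto simp: smooth_on_def)

lemma smooth_on_iter: "smooth_on U f \<Longrightarrow> smooth_on U (iter_partial_deriv is f)"
  by (auto simp: smooth_on_def iter_partial_deriv_append[symmetric])

lemma smooth_on_partial: "smooth_on U f \<Longrightarrow> smooth_on U (partial_deriv i f)"
  using smooth_on_iter[of U f "[i]"] by simp

lemma smooth_on_differentiable: "smooth_on U f \<Longrightarrow> x \<in> U \<Longrightarrow> f differentiable (at x)"
  using iter_partial_deriv_Nil unfolding smooth_on_def by metis

text \<open>Smoothness without computing higher derivatives: it suffices to exhibit a class of
  differentiable functions closed under partial derivatives up to equality on \<open>U\<close>. The
  proofs for affine functions, products and compositions choose such classes.\<close>

lemma smooth_on_coinduct:
  assumes U: "open U" and f: "f \<in> A"
    and diff: "\<And>f x. f \<in> A \<Longrightarrow> x \<in> U \<Longrightarrow> f differentiable (at x)"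
    and step: "\<And>f i. f \<in> A \<Longrightarrow> \<exists>g\<in>A. \<forall>x\<in>U. partial_deriv i f x = g x"
  shows "smooth_on U f"
proof -
  have *: "\<exists>g\<in>A. \<forall>x\<in>U. iter_partial_deriv is f x = g x" for "is"
  proof (induction "is")
    case Nil show ?case using f by auto
  next
    case (Cons i js)
    then obtain g where g: "g \<in> A" "\<forall>x\<in>U. iter_partial_deriv js f x = g x" by blast
    obtain h where h: "h \<in> A" "\<forall>x\<in>U. partial_deriv i g x = h x" using step[OF g(1)] by blast
    have "partial_deriv i (iter_partial_deriv js f) x = h x" if "x \<in> U" for x
      using partial_deriv_cong[OF U that, of "iter_partial_deriv js f" g i] g h that by auto
    with h show ?case by auto
  qed
  show ?thesis unfolding smooth_on_def
  proof (intro allI ballI)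
    fix "is" x assume x: "x \<in> U"
    obtain g where g: "g \<in> A" "\<forall>x\<in>U. iter_partial_deriv is f x = g x" using * by blast
    show "iter_partial_deriv is f differentiable at x"
      by (rule differentiable_cong_open[OF U x, of g]) (use g x diff in auto)
  qed
qed

text \<open>By the product rule, the closure of a set of generators under sums and products is
  closed under partial derivatives as soon as the derivatives of the generators lie in it. This
  replaces the Leibniz formula for higher derivatives of products.\<close>

inductive_set algebra_hull :: "(real ^ 'n::finite \<Rightarrow> real) set \<Rightarrow> (real ^ 'n \<Rightarrow> real) set"
  for B where
  base: "f \<in> B \<Longrightarrow> f \<in> algebra_hull B"
| add: "f \<in> algebra_hull B \<Longrightarrow> g \<in> algebra_hull B \<Longrightarrow> (\<lambda>x. f x + g x) \<in> algebra_hull B"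
| mult: "f \<in> algebra_hull B \<Longrightarrow> g \<in> algebra_hull B \<Longrightarrow> (\<lambda>x. f x * g x) \<in> algebra_hull B"

lemma partial_deriv_add:
  fixes f g :: "real ^ 'n::finite \<Rightarrow> real"
  assumes "f differentiable (at x)" "g differentiable (at x)"
  shows "partial_deriv i (\<lambda>x. f x + g x) x = partial_deriv i f x + partial_deriv i g x"
proof -
  from assms obtain f' g' where "(f has_derivative f') (at x)" "(g has_derivative g') (at x)"
    by (auto simp: differentiable_def)
  then show ?thesis using partial_deriv_eq[OF has_derivative_add, of f f' x g g' i]
    partial_deriv_eq[of f f' x i] partial_deriv_eq[of g g' x i] by simp
qed

lemma partial_deriv_mult:
  fixes f g :: "real ^ 'n::finite \<Rightarrow> real"
  assumes "f differentiable (at x)" "g differentiable (at x)"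
  shows "partial_deriv i (\<lambda>x. f x * g x) x = partial_deriv i f x * g x + f x * partial_deriv i g x"
proof -
  from assms obtain f' g' where fg: "(f has_derivative f') (at x)" "(g has_derivative g') (at x)"
    by (auto simp: differentiable_def)
  show ?thesis using partial_deriv_eq[OF has_derivative_mult[OF fg], of i]
    partial_deriv_eq[OF fg(1), of i] partial_deriv_eq[OF fg(2), of i] by simp
qed

lemma partial_deriv_sum:
  fixes f :: "'a \<Rightarrow> real ^ 'n::finite \<Rightarrow> real"
  assumes "finite J" "\<And>j. j \<in> J \<Longrightarrow> f j differentiable (at x)"
  shows "partial_deriv i (\<lambda>x. \<Sum>j\<in>J. f j x) x = (\<Sum>j\<in>J. partial_deriv i (f j) x)"
proof -
  have "((\<lambda>x. \<Sum>j\<in>J. f j x) has_derivative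
      (\<lambda>h. \<Sum>j\<in>J. \<Sum>i\<in>UNIV. h $ i * partial_deriv i (f j) x)) (at x)"
    using assms by (intro has_derivative_sum has_derivative_partial_deriv)
  from partial_deriv_eq[OF this] show ?thesis
    by (simp add: axis_def if_distrib if_distribR cong: if_cong)
qed

lemma partial_deriv_const [simp]: "partial_deriv i (\<lambda>x. c) x = 0"
  unfolding partial_deriv_def by simp

lemma partial_deriv_cmult:
  fixes f :: "real ^ 'n::finite \<Rightarrow> real"
  assumes "f differentiable (at x)"
  shows "partial_deriv i (\<lambda>x. c * f x) x = c * partial_deriv i f x"
  using partial_deriv_mult[of "\<lambda>_. c" x f i] assms by simp

lemma partial_deriv_compose:
  fixes f :: "real ^ 'n::finite \<Rightarrow> real"
  assumes "f differentiable (at x)" "g differentiable (at (f x))"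
  shows "partial_deriv i (\<lambda>x. g (f x)) x = deriv g (f x) * partial_deriv i f x"
proof -
  have g: "(g has_derivative (*) (deriv g (f x))) (at (f x))"
    using assms(2) by (metis DERIV_deriv_iff_real_differentiable has_field_derivative_def)
  obtain f' where f: "(f has_derivative f') (at x)" using assms by (auto simp: differentiable_def)
  show ?thesis using partial_deriv_eq[OF has_derivative_compose[OF f g], of i] partial_deriv_eq[OF f] by simp
qed

lemma smooth_on_algebra_hull:
  assumes U: "open U"
    and diff: "\<And>f x. f \<in> B \<Longrightarrow> x \<in> U \<Longrightarrow> f differentiable (at x)"
    and step: "\<And>f i. f \<in> B \<Longrightarrow> \<exists>g\<in>algebra_hull B. \<forall>x\<in>U. partial_deriv i f x = g x"
    and f: "f \<in> algebra_hull B"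
  shows "smooth_on U f"
proof (rule smooth_on_coinduct[OF U f])
  show d: "f differentiable (at x)" if "f \<in> algebra_hull B" "x \<in> U" for f x
    using that by induction (auto intro: diff differentiable_add differentiable_mult)
  show "\<exists>g\<in>algebra_hull B. \<forall>x\<in>U. partial_deriv i f x = g x" if "f \<in> algebra_hull B" for f i
    using that
  proof induction
    case (base f) then show ?case by (rule step)
  next
    case (add f g)
    then obtain f1 g1 where "f1 \<in> algebra_hull B" "g1 \<in> algebra_hull B"
      "\<forall>x\<in>U. partial_deriv i f x = f1 x" "\<forall>x\<in>U. partial_deriv i g x = g1 x" by blast
    with add show ?case
      by (intro bexI[of _ "\<lambda>x. f1 x + g1 x"]) (auto simp: partial_deriv_add d intro: algebra_hull.intros)
  next
    case (mult f g)
    then obtain f1 g1 where "f1 \<in> algebra_hull B" "g1 \<in> algebra_hull B"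
      "\<forall>x\<in>U. partial_deriv i f x = f1 x" "\<forall>x\<in>U. partial_deriv i g x = g1 x" by blast
    with mult show ?case
      by (intro bexI[of _ "\<lambda>x. f1 x * g x + f x * g1 x"])
        (auto simp: partial_deriv_mult d intro: algebra_hull.intros)
  qed
qed

lemma smooth_on_algebra_hull_smooth:
  assumes U: "open U" and f: "f \<in> algebra_hull {f. smooth_on U f}"
  shows "smooth_on U f"
  using U _ _ f
proof (rule smooth_on_algebra_hull)
  show "f differentiable (at x)" if "f \<in> {f. smooth_on U f}" "x \<in> U" for f x
    using that smooth_on_differentiable by auto
  show "\<exists>g\<in>algebra_hull {f. smooth_on U f}. \<forall>x\<in>U. partial_deriv i f x = g x"
    if "f \<in> {f. smooth_on U f}" for f i
    using that smooth_on_partial by (intro bexI[of _ "partial_deriv i f"]) (auto intro: algebra_hull.base)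
qed

lemma smooth_on_add: "open U \<Longrightarrow> smooth_on U f \<Longrightarrow> smooth_on U g \<Longrightarrow> smooth_on U (\<lambda>x. f x + g x)"
  by (rule smooth_on_algebra_hull_smooth) (auto intro: algebra_hull.intros)

lemma smooth_on_mult: "open U \<Longrightarrow> smooth_on U f \<Longrightarrow> smooth_on U g \<Longrightarrow> smooth_on U (\<lambda>x. f x * g x)"
  by (rule smooth_on_algebra_hull_smooth) (auto intro: algebra_hull.intros)

lemma smooth_on_affine: 
  assumes "open U" shows "smooth_on U (\<lambda>x. a \<bullet> x + b)"
proof (rule smooth_on_coinduct[OF assms, of _ "range (\<lambda>(a, b) x. a \<bullet> x + b)"])
  show "(\<lambda>x. a \<bullet> x + b) \<in> range (\<lambda>(a, b) x. a \<bullet> x + b)" by auto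
  have *: "((\<lambda>x. a \<bullet> x + b) has_derivative (\<lambda>h. a \<bullet> h)) (at x)" for a b and x :: "real ^ 'a"
    by (auto intro!: derivative_eq_intros)
  then show "f differentiable (at x)" if "f \<in> range (\<lambda>(a, b) x. a \<bullet> x + b)" for f and x :: "real ^ 'a"
    using that by (auto simp: differentiable_def)
  show "\<exists>g\<in>range (\<lambda>(a, b) x. a \<bullet> x + b). \<forall>x\<in>U. partial_deriv i f x = g x"
    if f: "f \<in> range (\<lambda>(a, b) x. a \<bullet> x + b)" for f and i :: 'a
  proof -
    obtain a b where f: "f = (\<lambda>x. a \<bullet> x + b)" using f by auto
    show ?thesis unfolding f partial_deriv_eq[OF *]
      by (intro bexI[of _ "\<lambda>x. 0 \<bullet> x + a \<bullet> axis i 1"]) (auto intro: range_eqI[of _ _ "(0, _)"])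
  qed
qed

lemma smooth_on_const: "open U \<Longrightarrow> smooth_on U (\<lambda>x. c)"
  using smooth_on_affine[of U 0 c] by simp

lemma smooth_on_component: "open U \<Longrightarrow> smooth_on U (\<lambda>x. x $ i)"
  using smooth_on_affine[of U "axis i 1" 0] by (simp add: inner_axis')

lemma smooth_on_cmult: "open U \<Longrightarrow> smooth_on U f \<Longrightarrow> smooth_on U (\<lambda>x. c * f x)"
  by (intro smooth_on_mult smooth_on_const)

lemma smooth_on_sum:
  "open U \<Longrightarrow> (\<And>j. j \<in> J \<Longrightarrow> smooth_on U (f j)) \<Longrightarrow> smooth_on U (\<lambda>x. \<Sum>j\<in>J. f j x)"
  by (induction J rule: infinite_finite_induct) (auto intro: smooth_on_const smooth_on_add)

lemma smooth_on_prod: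
  "open U \<Longrightarrow> (\<And>j. j \<in> J \<Longrightarrow> smooth_on U (f j)) \<Longrightarrow> smooth_on U (\<lambda>x. \<Prod>j\<in>J. f j x)"
  by (induction J rule: infinite_finite_induct) (auto intro: smooth_on_const smooth_on_mult)

lemma smooth_on_diff: 
  assumes "open U" "smooth_on U f" "smooth_on U g" shows "smooth_on U (\<lambda>x. f x - g x)"
  using smooth_on_add[OF assms(1,2) smooth_on_cmult[OF assms(1,3), of "-1"]] by simp

lemma smooth_on_norm_square:
  "open U \<Longrightarrow> smooth_on U (\<lambda>x. (norm (x - a))\<^sup>2)"
  unfolding power2_norm_eq_inner inner_vec_def inner_real_def
  by (intro smooth_on_sum smooth_on_mult) (auto simp: intro: smooth_on_diff smooth_on_component smooth_on_const)

text \<open>The generators are the functions smooth on \<open>U\<close> together with all g^(m) o f: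
  the chain rule turns g^(m) o f into g^(m+1) o f times a partial derivative of f, a product of two
  generators.\<close>

lemma smooth_on_compose:
  assumes U: "open U" and f: "smooth_on U f"
    and g: "\<And>m x. x \<in> U \<Longrightarrow> (deriv ^^ m) g differentiable (at (f x))"
  shows "smooth_on U (\<lambda>x. g (f x))"
proof -
  define B where "B = {h. smooth_on U h} \<union> range (\<lambda>m x. (deriv ^^ m) g (f x))"
  have fd: "f differentiable (at x)" if "x \<in> U" for x using f that by (rule smooth_on_differentiable)
  show ?thesis using U
  proof (rule smooth_on_algebra_hull[of _ B])
    have "(\<lambda>x. (deriv ^^ 0) g (f x)) \<in> B" unfolding B_def by blast
    then show "(\<lambda>x. g (f x)) \<in> algebra_hull B" by (auto intro: algebra_hull.base)
    show "h differentiable (at x)" if "h \<in> B" "x \<in> U" for h x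
      using that g[OF \<open>x \<in> U\<close>] differentiable_compose[of "(deriv ^^ _) g" f x UNIV] fd
      by (auto simp: B_def smooth_on_differentiable intro: differentiable_at_withinI)
    show "\<exists>k\<in>algebra_hull B. \<forall>x\<in>U. partial_deriv i h x = k x" if hB: "h \<in> B" for h i
    proof (cases "smooth_on U h")
      case True
      then show ?thesis using smooth_on_partial[of U h i]
        by (intro bexI[of _ "partial_deriv i h"]) (auto simp: B_def intro: algebra_hull.base)
    next
      case False
      then obtain m where h: "h = (\<lambda>x. (deriv ^^ m) g (f x))" using hB by (auto simp: B_def)
      have "(\<lambda>x. (deriv ^^ Suc m) g (f x)) \<in> B" unfolding B_def by blast
      moreover have "partial_deriv i f \<in> B" using smooth_on_partial[OF f] by (simp add: B_def)
      ultimately have "(\<lambda>x. (deriv ^^ Suc m) g (f x) * partial_deriv i f x) \<in> algebra_hull B"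
        by (intro algebra_hull.intros)
      moreover have "\<forall>x\<in>U. partial_deriv i h x = (deriv ^^ Suc m) g (f x) * partial_deriv i f x"
        unfolding h using partial_deriv_compose[OF fd g] by simp
      ultimately show ?thesis
        by (intro bexI[of _ "\<lambda>x. (deriv ^^ Suc m) g (f x) * partial_deriv i f x"])
    qed
  qed
qed

section \<open>Derivative tensors under affine and conformal maps\<close>

lemma finite_lists_length [simp]: "finite {is :: 'a::finite list. length is = k}"
  using finite_lists_length_eq[of "UNIV :: 'a set" k] by simp

lemma sum_lists_Suc:
  fixes F :: "'a::finite list \<Rightarrow> 'b::comm_monoid_add"
  shows "(\<Sum>is\<in>{is. length is = Suc k}. F is) = (\<Sum>i\<in>UNIV. \<Sum>js\<in>{js. length js = k}. F (i # js))"
proof -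
  have "(\<Sum>i\<in>UNIV. \<Sum>js\<in>{js. length js = k}. F (i # js)) =
      (\<Sum>(i, js)\<in>UNIV \<times> {js. length js = k}. F (i # js))"
    by (rule sum.cartesian_product)
  also have "\<dots> = (\<Sum>is\<in>{is. length is = Suc k}. F is)"
    by (rule sum.reindex_bij_witness[of _ "\<lambda>is. (hd is, tl is)" "\<lambda>(i, js). i # js"])
      (auto simp: length_Suc_conv)
  finally show ?thesis ..
qed

text \<open>Entries of a tensor power of \<open>A\<close>, the products of A_(j,i) over
  corresponding positions: the coefficients by which the chain rule expresses derivatives of f(a + A
  y) in those of f. Only lists of equal length matter.\<close>

fun tensor_coef :: "real ^ 'n ^ 'n \<Rightarrow> 'n list \<Rightarrow> 'n list \<Rightarrow> real" where
  "tensor_coef A (j # js) (i # is) = A $ j $ i * tensor_coef A js is"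
| "tensor_coef A js is = 1"

lemma tensor_coef_snoc:
  "length js = length is \<Longrightarrow> tensor_coef A (js @ [j]) (is @ [i]) = tensor_coef A js is * A $ j $ i"
  by (induction js "is" rule: list_induct2) auto

lemma tensor_coef_rev: "length js = length is \<Longrightarrow> tensor_coef A (rev js) (rev is) = tensor_coef A js is"
  by (induction js "is" rule: list_induct2) (auto simp: tensor_coef_snoc)

lemma tensor_coef_mat:
  "length js = length is \<Longrightarrow> tensor_coef (mat c) js is = (if js = is then c ^ length is else 0)"
  by (induction js "is" rule: list_induct2) (auto simp: mat_def)

lemma partial_deriv_affine:
  fixes f :: "real ^ 'n::finite \<Rightarrow> real"
  assumes "f differentiable (at (a + A *v y))"
  shows "(\<lambda>y. f (a + A *v y)) differentiable (at y)"
    and "partial_deriv i (\<lambda>y. f (a + A *v y)) y = (\<Sum>j\<in>UNIV. A $ j $ i * partial_deriv j f (a + A *v y))"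
proof -
  have "((\<lambda>y. a + A *v y) has_derivative (\<lambda>h. A *v h)) (at y)"
    by (auto intro!: derivative_eq_intros linear_imp_has_derivative matrix_vector_mul_linear)
  from has_derivative_compose[OF this has_derivative_partial_deriv[OF assms]]
  have *: "((\<lambda>y. f (a + A *v y)) has_derivative
      (\<lambda>h. \<Sum>j\<in>UNIV. (A *v h) $ j * partial_deriv j f (a + A *v y))) (at y)" .
  then show "(\<lambda>y. f (a + A *v y)) differentiable (at y)" by (auto simp: differentiable_def)
  have "(A *v axis i 1) $ j = A $ j $ i" for j
    by (simp add: matrix_vector_mult_def axis_def if_distrib if_distribR cong: if_cong)
  then show "partial_deriv i (\<lambda>y. f (a + A *v y)) y = (\<Sum>j\<in>UNIV. A $ j $ i * partial_deriv j f (a + A *v y))"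
    by (simp add: partial_deriv_eq[OF *])
qed

lemma open_affine_vimage: "open U \<Longrightarrow> open {y. a + A *v y \<in> (U :: (real ^ 'n::finite) set)}"
  using open_vimage[of U "\<lambda>y. a + A *v y",
      OF _ continuous_on_add[OF continuous_on_const matrix_vector_mult_linear_continuous_on]]
  by (simp add: vimage_def)

lemma iter_partial_deriv_affine:
  fixes f :: "real ^ 'n::finite \<Rightarrow> real"
  assumes U: "open U" and f: "smooth_on U f" and y: "a + A *v y \<in> U"
  shows "iter_partial_deriv is (\<lambda>y. f (a + A *v y)) y =
    (\<Sum>js\<in>{js. length js = length is}. tensor_coef A js is * iter_partial_deriv js f (a + A *v y))"
  using y
proof (induction "is" arbitrary: y)
  case Nil then show ?case by simp
next
  case (Cons i "is")
  define V where "V = {y. a + A *v y \<in> U}"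
  have V: "open V" unfolding V_def using U by (rule open_affine_vimage)
  have d: "iter_partial_deriv js f differentiable (at (a + A *v y))" for js
    using f Cons.prems by (auto simp: smooth_on_def)
  have "iter_partial_deriv (i # is) (\<lambda>y. f (a + A *v y)) y =
    partial_deriv i (\<lambda>y. \<Sum>js\<in>{js. length js = length is}. tensor_coef A js is * iter_partial_deriv js f (a + A *v y)) y"
    unfolding iter_partial_deriv_Cons
    by (rule partial_deriv_cong[OF V]) (use Cons in \<open>auto simp: V_def\<close>)
  also have "\<dots> = (\<Sum>js\<in>{js. length js = length is}. tensor_coef A js is *
      (\<Sum>j\<in>UNIV. A $ j $ i * partial_deriv j (iter_partial_deriv js f) (a + A *v y)))"
    using partial_deriv_affine[OF d]
    by (subst partial_deriv_sum) (auto simp: partial_deriv_cmult intro!: differentiable_mult)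
  also have "\<dots> = (\<Sum>js\<in>{js. length js = length is}. \<Sum>j\<in>UNIV.
      tensor_coef A (j # js) (i # is) * iter_partial_deriv (j # js) f (a + A *v y))"
    by (simp add: sum_distrib_left mult_ac)
  also have "\<dots> = (\<Sum>js\<in>{js. length js = length (i # is)}.
      tensor_coef A js (i # is) * iter_partial_deriv js f (a + A *v y))"
    unfolding length_Cons sum_lists_Suc by (rule sum.swap)
  finally show ?case .
qed

lemma smooth_on_affine_compose:
  fixes f :: "real ^ 'n::finite \<Rightarrow> real" and A :: "real ^ 'n ^ 'n"
  assumes U: "open U" and f: "smooth_on U f"
  shows "smooth_on {y. a + A *v y \<in> U} (\<lambda>y. f (a + A *v y))"
  unfolding smooth_on_def
proof (intro allI ballI)
  fix "is" y assume y: "y \<in> {y. a + A *v y \<in> U}"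
  have d: "iter_partial_deriv js f differentiable (at (a + A *v y))" for js
    using f y by (auto simp: smooth_on_def)
  show "iter_partial_deriv is (\<lambda>y. f (a + A *v y)) differentiable at y"
  proof (rule differentiable_cong_open[OF open_affine_vimage[OF U] y])
    show "(\<lambda>y. \<Sum>js\<in>{js. length js = length is}. tensor_coef A js is * iter_partial_deriv js f (a + A *v y))
      differentiable at y"
      using partial_deriv_affine[OF d] by (auto intro!: differentiable_sum differentiable_mult)
  qed (simp add: iter_partial_deriv_affine[OF U f])
qed

lemma mat_matrix_vector: "mat c *v y = c *\<^sub>R (y :: real ^ 'n::finite)"
  by (simp add: vec_eq_iff matrix_vector_mult_def mat_def if_distrib if_distribR cong: if_cong)

lemma iter_partial_deriv_scale:
  fixes f :: "real ^ 'n::finite \<Rightarrow> real"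
  assumes U: "open U" and f: "smooth_on U f" and y: "a + c *\<^sub>R y \<in> U"
  shows "iter_partial_deriv is (\<lambda>y. f (a + c *\<^sub>R y)) y = c ^ length is * iter_partial_deriv is f (a + c *\<^sub>R y)"
  using iter_partial_deriv_affine[OF U f, of a "mat c" y "is"] y
  by (simp add: mat_matrix_vector tensor_coef_mat if_distrib if_distribR cong: if_cong)

lemma smooth_on_scale_compose:
  fixes f :: "real ^ 'n::finite \<Rightarrow> real"
  assumes "open U" "smooth_on U f"
  shows "smooth_on {y. a + c *\<^sub>R y \<in> U} (\<lambda>y. f (a + c *\<^sub>R y))"
  using smooth_on_affine_compose[OF assms, of a "mat c"] by (simp add: mat_matrix_vector)

text \<open>The hypothesis says that A times its transpose is s times the identity. The sum over
  lists factors position by position, so the tensor powers satisfy the same relation with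
  s^k.\<close>

lemma tensor_coef_orthogonal:
  fixes A :: "real ^ 'n::finite ^ 'n"
  assumes A: "\<And>j m. (\<Sum>i\<in>UNIV. A $ j $ i * A $ m $ i) = (if j = m then s else 0)"
    and "length js = k" "length ms = k"
  shows "(\<Sum>is\<in>{is. length is = k}. tensor_coef A js is * tensor_coef A ms is) = (if js = ms then s ^ k else 0)"
  using assms(2,3)
proof (induction k arbitrary: js ms)
  case 0 then show ?case by simp
next
  case (Suc k)
  then obtain j js' m ms' where [simp]: "js = j # js'" "ms = m # ms'" "length js' = k" "length ms' = k"
    by (auto simp: length_Suc_conv)
  have "(\<Sum>is\<in>{is. length is = Suc k}. tensor_coef A js is * tensor_coef A ms is) =
     (\<Sum>i\<in>UNIV. \<Sum>is\<in>{is. length is = k}. A $ j $ i * A $ m $ i * (tensor_coef A js' is * tensor_coef A ms' is))"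
    by (simp add: sum_lists_Suc mult_ac)
  also have "\<dots> = (\<Sum>i\<in>UNIV. A $ j $ i * A $ m $ i) * (\<Sum>is\<in>{is. length is = k}. tensor_coef A js' is * tensor_coef A ms' is)"
    by (simp add: sum_product)
  also have "\<dots> = (if js = ms then s ^ Suc k else 0)" by (simp add: A Suc.IH)
  finally show ?case .
qed

text \<open>Both tensors are pulled back by the same multiple of an orthogonal matrix, so their
  Euclidean inner product is multiplied by s^k. With a = b this is the behaviour of the tensor
  norm.\<close>

lemma tensor_coef_inner:
  fixes A :: "real ^ 'n::finite ^ 'n" and a b :: "'n list \<Rightarrow> real"
  assumes A: "\<And>j m. (\<Sum>i\<in>UNIV. A $ j $ i * A $ m $ i) = (if j = m then s else 0)"
  shows "(\<Sum>is\<in>{is. length is = k}. (\<Sum>js\<in>{js. length js = k}. tensor_coef A js is * a js) *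
      (\<Sum>js\<in>{js. length js = k}. tensor_coef A js is * b js)) = s ^ k * (\<Sum>js\<in>{js. length js = k}. a js * b js)"
proof -
  let ?S = "{js :: 'n list. length js = k}"
  have "(\<Sum>is\<in>?S. (\<Sum>js\<in>?S. tensor_coef A js is * a js) * (\<Sum>js\<in>?S. tensor_coef A js is * b js)) =
    (\<Sum>is\<in>?S. \<Sum>js\<in>?S. \<Sum>ms\<in>?S. a js * b ms * (tensor_coef A js is * tensor_coef A ms is))"
    by (simp add: sum_product mult_ac)
  also have "\<dots> = (\<Sum>js\<in>?S. \<Sum>is\<in>?S. \<Sum>ms\<in>?S. a js * b ms * (tensor_coef A js is * tensor_coef A ms is))"
    by (rule sum.swap)
  also have "\<dots> = (\<Sum>js\<in>?S. \<Sum>ms\<in>?S. \<Sum>is\<in>?S. a js * b ms * (tensor_coef A js is * tensor_coef A ms is))"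
    by (intro sum.cong refl sum.swap)
  also have "\<dots> = (\<Sum>js\<in>?S. \<Sum>ms\<in>?S. a js * b ms * (if js = ms then s ^ k else 0))"
    by (intro sum.cong refl) (simp add: sum_distrib_left[symmetric] tensor_coef_orthogonal[OF A])
  also have "\<dots> = s ^ k * (\<Sum>js\<in>?S. a js * b js)"
    by (simp add: if_distrib sum_distrib_left mult_ac cong: if_cong)
  finally show ?thesis .
qed

text \<open>Rotations act transitively on spheres and a dilation adjusts the radius. Such a matrix
  relates the values at \<open>y\<close> of everything built from the norm to the values at
  \<open>x\<close>.\<close>

lemma conformal_matrix_exists:
  fixes x y :: "real ^ 'n::finite"
  assumes x: "x \<noteq> 0" and y: "y \<noteq> 0"
  obtains A :: "real ^ 'n ^ 'n" where "A *v y = x" "\<And>z. norm (A *v z) = norm x / norm y * norm z"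
    "\<And>j m. (\<Sum>i\<in>UNIV. A $ j $ i * A $ m $ i) = (if j = m then (norm x / norm y)\<^sup>2 else 0)"
proof -
  define l where "l = norm x / norm y"
  have l: "l > 0" using x y by (simp add: l_def)
  have "norm (l *\<^sub>R y) = norm x" using y l by (simp add: l_def)
  from orthogonal_transformation_exists[OF this]
  obtain f where f: "orthogonal_transformation f" "f (l *\<^sub>R y) = x" by blast
  have lin: "linear f" and om: "orthogonal_matrix (matrix f)"
    using f(1) by (auto simp: orthogonal_transformation_matrix)
  define A where "A = l *\<^sub>R matrix f"
  have Av: "A *v z = l *\<^sub>R f z" for z
    by (simp add: A_def scaleR_matrix_vector_assoc[symmetric] matrix_works lin)
  show thesis
  proof (rule that[of A])
    show "A *v y = x" using f(2) by (simp add: Av linear_scale[OF lin])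
    show "norm (A *v z) = norm x / norm y * norm z" for z
      using l f(1) by (simp add: Av orthogonal_transformation_norm l_def[symmetric])
    show "(\<Sum>i\<in>UNIV. A $ j $ i * A $ m $ i) = (if j = m then (norm x / norm y)\<^sup>2 else 0)" for j m
    proof -
      have "(matrix f ** transpose (matrix f)) $ j $ m = (mat 1 :: real^'n^'n) $ j $ m"
        using om by (simp add: orthogonal_matrix_def)
      then have "(\<Sum>i\<in>UNIV. matrix f $ j $ i * matrix f $ m $ i) = (if j = m then 1 else 0)"
        by (simp add: matrix_matrix_mult_def transpose_def mat_def)
      moreover have "(\<Sum>i\<in>UNIV. A $ j $ i * A $ m $ i) = l\<^sup>2 * (\<Sum>i\<in>UNIV. matrix f $ j $ i * matrix f $ m $ i)"
        by (simp add: A_def sum_distrib_left power2_eq_square mult_ac)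
      ultimately show ?thesis by (simp add: l_def)
    qed
  qed
qed

section \<open>One-variable profiles; powers and logarithm of the norm\<close>

definition smooth1_on :: "real set \<Rightarrow> (real \<Rightarrow> real) \<Rightarrow> bool" where
  "smooth1_on V g \<longleftrightarrow> (\<forall>m. \<forall>t\<in>V. (deriv ^^ m) g differentiable (at t))"

lemma smooth1_on_coinduct:
  assumes V: "open V" and f: "f \<in> A"
    and step: "\<And>f. f \<in> A \<Longrightarrow> \<exists>g\<in>A. \<forall>t\<in>V. (f has_real_derivative g t) (at t)"
  shows "smooth1_on V f"
proof -
  have *: "\<exists>g\<in>A. \<forall>t\<in>V. (deriv ^^ m) f t = g t" for m
  proof (induction m)
    case 0 then show ?case using f by auto
  next
    case (Suc m)
    then obtain g where g: "g \<in> A" "\<forall>t\<in>V. (deriv ^^ m) f t = g t" by blast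
    obtain h where h: "h \<in> A" "\<forall>t\<in>V. (g has_real_derivative h t) (at t)" using step[OF g(1)] by blast
    have "deriv ((deriv ^^ m) f) t = h t" if "t \<in> V" for t
    proof -
      have "\<forall>\<^sub>F s in nhds t. (deriv ^^ m) f s = g s"
        using eventually_nhds_in_open[OF V that] by eventually_elim (use g in auto)
      then have "deriv ((deriv ^^ m) f) t = deriv g t" by (rule deriv_cong_ev) simp
      with h that show ?thesis by (auto intro: DERIV_imp_deriv)
    qed
    then show ?case using h by auto
  qed
  show ?thesis unfolding smooth1_on_def
  proof (intro allI ballI)
    fix m t assume t: "t \<in> V"
    obtain g where g: "g \<in> A" "\<forall>t\<in>V. (deriv ^^ m) f t = g t" using * by blast
    obtain h where h: "\<forall>t\<in>V. (g has_real_derivative h t) (at t)" using step[OF g(1)] by blast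
    have "((deriv ^^ m) f has_real_derivative h t) (at t)"
      using h t g has_field_derivative_transform_within_open[of g "h t" t V "(deriv ^^ m) f"] V by auto
    then show "(deriv ^^ m) f differentiable at t" by (auto simp: real_differentiable_def)
  qed
qed

lemma smooth_on_compose1:
  assumes "open U" "smooth_on U f" "smooth1_on V g" "f ` U \<subseteq> V"
  shows "smooth_on U (\<lambda>x. g (f x))"
proof (rule smooth_on_compose[OF assms(1,2)])
  fix m x assume "x \<in> U"
  then have "f x \<in> V" using assms(4) by blast
  then show "(deriv ^^ m) g differentiable (at (f x))" using assms(3) unfolding smooth1_on_def by blast
qed

lemma smooth1_on_deriv: "smooth1_on V g \<Longrightarrow> smooth1_on V (deriv g)"
  unfolding smooth1_on_def by (metis funpow_swap1 o_apply funpow_simps_right(2))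

text \<open>The factor \<open>c\<close> absorbs the exponents that differentiation produces, so the
  class is closed under derivatives on the positive half-line.\<close>

lemma power_function_derivative:
  fixes f :: "real \<Rightarrow> real"
  assumes "f \<in> {\<lambda>t. c * t powr a |c a. True}"
  shows "\<exists>g\<in>{\<lambda>t. c * t powr a |c a. True}. \<forall>t\<in>{0<..}. (f has_real_derivative g t) (at t)"
proof -
  obtain c a where f: "f = (\<lambda>t. c * t powr a)" using assms by blast
  show ?thesis
  proof (rule bexI[of _ "\<lambda>t. (c * a) * t powr (a - 1)"])
    show "(\<lambda>t. (c * a) * t powr (a - 1)) \<in> {\<lambda>t. c * t powr a |c a. True}"
      by (rule CollectI, rule exI[of _ "c * a"], rule exI[of _ "a - 1"]) simp
    show "\<forall>t\<in>{0<..}. (f has_real_derivative (c * a) * t powr (a - 1)) (at t)"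
      unfolding f using DERIV_cmult[OF has_real_derivative_powr, of _ c a] by (simp add: mult.assoc)
  qed
qed

lemma smooth1_on_powr: "smooth1_on {0<..} (\<lambda>t. t powr a)"
proof -
  have "(\<lambda>t. 1 * t powr a) \<in> {\<lambda>t. c * t powr a |c a. True}" by blast
  then have "smooth1_on {0<..} (\<lambda>t. 1 * t powr a)"
    by (rule smooth1_on_coinduct[OF open_greaterThan]) (rule power_function_derivative)
  then show ?thesis by simp
qed

lemma smooth1_on_ln: "smooth1_on {0<..} (ln :: real \<Rightarrow> real)"
proof (rule smooth1_on_coinduct[of _ _ "insert ln {\<lambda>t. c * t powr a |c a. True}"])
  show "\<exists>g\<in>insert ln {\<lambda>t. c * t powr a |c a. True}. \<forall>t\<in>{0<..}. (f has_real_derivative g t) (at t)"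
    if f: "f \<in> insert ln {\<lambda>t. c * t powr a |c a. True}" for f :: "real \<Rightarrow> real"
  proof (cases "f = ln")
    case True
    have "(\<lambda>t. 1 * t powr - 1) \<in> {\<lambda>t. c * t powr a |(c::real) (a::real). True}" by blast
    moreover have "\<forall>t\<in>{0<..}. (f has_real_derivative 1 * t powr - 1) (at t)"
      unfolding True by (auto intro!: derivative_eq_intros simp: powr_minus field_simps)
    ultimately show ?thesis by (intro bexI[of _ "\<lambda>t. 1 * t powr - 1"]) auto
  next
    case False
    then have "f \<in> {\<lambda>t. c * t powr a |c a. True}" using f by blast
    from power_function_derivative[OF this] obtain g where
      "g \<in> {\<lambda>t. c * t powr a |c a. True}" "\<forall>t\<in>{0<..}. (f has_real_derivative g t) (at t)" ..
    then show ?thesis by (intro bexI[of _ g] insertI2)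
  qed
qed auto

lemma open_minus_zero [simp]: "open (- {0 :: real ^ 'n::finite})"
  by (simp add: open_Compl)

text \<open>The norm is handled through its square, which is a polynomial, followed by a power with
  half the exponent on the positive half-line.\<close>

lemma smooth_on_norm_powr: "smooth_on (- {0}) (\<lambda>y :: real ^ 'n::finite. norm y powr a)"
proof (rule smooth_on_cong)
  show "smooth_on (- {0}) (\<lambda>y :: real ^ 'n. ((norm (y - 0))\<^sup>2) powr (a / 2))"
    by (rule smooth_on_compose1[OF _ smooth_on_norm_square smooth1_on_powr]) auto
  show "((norm (y - 0))\<^sup>2) powr (a / 2) = norm y powr a" if "y \<in> - {0}" for y :: "real ^ 'n"
    using that by (simp add: powr_powr powr_realpow[symmetric] del: powr_numeral)
qed simp

lemma smooth_on_ln_norm: "smooth_on (- {0}) (\<lambda>y :: real ^ 'n::finite. ln (norm y))"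
proof (rule smooth_on_cong)
  show "smooth_on (- {0}) (\<lambda>y :: real ^ 'n. 1 / 2 * ln ((norm (y - 0))\<^sup>2))"
    by (intro smooth_on_cmult smooth_on_compose1[OF _ smooth_on_norm_square smooth1_on_ln]) auto
  show "1 / 2 * ln ((norm (y - 0))\<^sup>2) = ln (norm y)" if "y \<in> - {0}" for y :: "real ^ 'n"
    using that by (simp add: ln_realpow)
qed simp

section \<open>Conformal behaviour of the logarithm and the constant \<open>ell\<close>\<close>

lemma iter_partial_deriv_add_const:
  fixes f :: "real ^ 'n::finite \<Rightarrow> real"
  assumes U: "open U" and f: "smooth_on U f" and "is \<noteq> []" "x \<in> U"
  shows "iter_partial_deriv is (\<lambda>x. f x + c) x = iter_partial_deriv is f x"
proof -
  obtain js i where "is": "is = js @ [i]" using \<open>is \<noteq> []\<close> by (metis rev_exhaust)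
  have "partial_deriv i (\<lambda>x. f x + c) y = partial_deriv i f y" if "y \<in> U" for y
    using partial_deriv_add[of f y "\<lambda>_. c" i] smooth_on_differentiable[OF f that] by simp
  then show ?thesis unfolding "is" iter_partial_deriv_append using \<open>x \<in> U\<close>
    by (intro iter_partial_deriv_cong[OF U, of "iter_partial_deriv [i] (\<lambda>x. f x + c)" "iter_partial_deriv [i] f"]) auto
qed

text \<open>A similarity adds the constant ln s to ln |y|, and a constant is invisible to one or
  more derivatives; this is why the empty list is excluded. The derivative tensor of the logarithm
  at y is therefore the pull-back of the one at A y.\<close>

lemma iter_partial_deriv_ln_norm_conformal:
  fixes A :: "real ^ 'n::finite ^ 'n"
  assumes A: "\<And>z. norm (A *v z) = s * norm z" and s: "s > 0" and y: "y \<noteq> 0" and k: "is \<noteq> []"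
  shows "iter_partial_deriv is (\<lambda>y. ln (norm y)) y = (\<Sum>js\<in>{js. length js = length is}.
    tensor_coef A js is * iter_partial_deriv js (\<lambda>y. ln (norm y)) (A *v y))"
proof -
  have "iter_partial_deriv is (\<lambda>y. ln (norm y)) y = iter_partial_deriv is (\<lambda>y. ln (norm y) + ln s) y"
    by (rule iter_partial_deriv_add_const[symmetric, OF _ smooth_on_ln_norm]) (use y k in auto)
  also have "\<dots> = iter_partial_deriv is (\<lambda>y. ln (norm (0 + A *v y))) y"
    by (rule iter_partial_deriv_cong[of "- {0}"]) (use y s A in \<open>auto simp: ln_mult\<close>)
  also have "\<dots> = (\<Sum>js\<in>{js. length js = length is}.
    tensor_coef A js is * iter_partial_deriv js (\<lambda>y. ln (norm y)) (0 + A *v y))"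
  proof (rule iter_partial_deriv_affine[OF _ smooth_on_ln_norm])
    have "norm (A *v y) \<noteq> 0" unfolding A using s y by simp
    then show "0 + A *v y \<in> - {0}" by auto
  qed simp
  finally show ?thesis by simp
qed

definition log_tensor_square :: "'n::finite itself \<Rightarrow> nat \<Rightarrow> real ^ 'n \<Rightarrow> real" where
  "log_tensor_square T k x = (\<Sum>is\<in>{is. length is = k}. (iter_partial_deriv is (\<lambda>y. ln (norm y)) x)\<^sup>2)"

lemma log_tensor_square_conformal:
  fixes x y :: "real ^ 'n::finite"
  assumes x: "x \<noteq> 0" and y: "y \<noteq> 0" and k: "k \<ge> 1"
  shows "log_tensor_square TYPE('n) k y = (norm x / norm y) ^ (2 * k) * log_tensor_square TYPE('n) k x"
proof -
  obtain A :: "real ^ 'n ^ 'n" where A: "A *v y = x" "\<And>z. norm (A *v z) = norm x / norm y * norm z"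
    "\<And>j m. (\<Sum>i\<in>UNIV. A $ j $ i * A $ m $ i) = (if j = m then (norm x / norm y)\<^sup>2 else 0)"
    using conformal_matrix_exists[OF x y] by blast
  define a where "a = (\<lambda>js. iter_partial_deriv js (\<lambda>y :: real ^ 'n. ln (norm y)) x)"
  have "iter_partial_deriv is (\<lambda>y. ln (norm y)) y = (\<Sum>js\<in>{js. length js = k}. tensor_coef A js is * a js)"
    if "length is = k" for "is"
  proof -
    have "is \<noteq> []" using that k by auto
    then show ?thesis
      using iter_partial_deriv_ln_norm_conformal[OF A(2) _ y, of "is"] x y by (simp add: a_def that A(1))
  qed
  then have "log_tensor_square TYPE('n) k y = (\<Sum>is\<in>{is. length is = k}.
      (\<Sum>js\<in>{js. length js = k}. tensor_coef A js is * a js) * (\<Sum>js\<in>{js. length js = k}. tensor_coef A js is * a js))"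
    unfolding log_tensor_square_def power2_eq_square by (intro sum.cong) auto
  also have "\<dots> = ((norm x / norm y)\<^sup>2) ^ k * (\<Sum>js\<in>{js. length js = k}. a js * a js)"
    by (rule tensor_coef_inner[OF A(3)])
  finally show ?thesis by (simp add: a_def log_tensor_square_def power2_eq_square power_mult[symmetric] power_mult)
qed

text \<open>By the conformal rule, |x|^(2k) times the square sum does not depend on x, so a constant
  as required by the definition of \<open>ell\<close> exists; its value at one unit vector
  determines it. After this lemma the definite description is never unfolded again.\<close>

lemma ell_properties:
  fixes x :: "real ^ 'n::finite"
  assumes k: "k \<ge> 1"
  shows "ell TYPE('n) k \<ge> 0"
    and "x \<noteq> 0 \<Longrightarrow> log_tensor_square TYPE('n) k x = ell TYPE('n) k / norm x ^ (2 * k)"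
proof -
  define e :: "real ^ 'n" where "e = axis undefined 1"
  have e: "norm e = 1" "e \<noteq> 0" by (auto simp: e_def norm_axis_1)
  define l where "l = log_tensor_square TYPE('n) k e"
  have l0: "l \<ge> 0" by (auto simp: l_def log_tensor_square_def intro: sum_nonneg)
  have sq: "log_tensor_square TYPE('n) k x = l / norm x ^ (2 * k)" if "x \<noteq> 0" for x :: "real ^ 'n"
    using log_tensor_square_conformal[OF e(2) that k] by (simp add: e l_def power_divide)
  have T: "tensor_norm k (\<lambda>is. iter_partial_deriv is (\<lambda>y. ln (norm y))) x = sqrt l / norm x ^ k"
    if "x \<noteq> 0" for x :: "real ^ 'n"
    using sq[OF that] unfolding tensor_norm_def log_tensor_square_def
    by (simp add: real_sqrt_divide power_even_eq)
  have "ell TYPE('n) k = l" unfolding ell_def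
  proof (rule the_equality)
    show "\<forall>x::real ^ 'n. x \<noteq> 0 \<longrightarrow> tensor_norm k (\<lambda>is. iter_partial_deriv is (\<lambda>y. ln (norm y))) x = sqrt l / norm x ^ k"
      using T by blast
    fix l' assume "\<forall>x::real ^ 'n. x \<noteq> 0 \<longrightarrow> tensor_norm k (\<lambda>is. iter_partial_deriv is (\<lambda>y. ln (norm y))) x = sqrt l' / norm x ^ k"
    then have "sqrt l' / norm e ^ k = sqrt l / norm e ^ k" using e T by metis
    then show "l' = l" using e by simp
  qed
  with l0 sq show "ell TYPE('n) k \<ge> 0" and "x \<noteq> 0 \<Longrightarrow> log_tensor_square TYPE('n) k x = ell TYPE('n) k / norm x ^ (2 * k)"
    by auto
qed

section \<open>Cutoffs and test functions\<close>

lemma deriv_translate: "deriv (\<lambda>t::real. g (a + t)) 0 = deriv g a"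
  unfolding deriv_def using DERIV_shift[of g _ 0 a] by (simp add: add.commute)

text \<open>Transfers the closure properties known in several variables to one variable, by viewing
  a function of t as a function on \<open>real ^ 1\<close>.\<close>

lemma smooth1_on_UNIV_iff: "smooth1_on UNIV f \<longleftrightarrow> smooth_on UNIV (\<lambda>x :: real ^ 1. f (x $ 1))"
proof
  assume "smooth1_on UNIV f"
  then show "smooth_on UNIV (\<lambda>x :: real ^ 1. f (x $ 1))"
    by (rule smooth_on_compose1[OF open_UNIV smooth_on_component[OF open_UNIV]]) simp
next
  assume f: "smooth_on UNIV (\<lambda>x :: real ^ 1. f (x $ 1))"
  have p: "partial_deriv 1 (\<lambda>x :: real ^ 1. g (x $ 1)) = (\<lambda>x. deriv g (x $ 1))" for g
    by (rule ext) (simp add: partial_deriv_def axis_def deriv_translate)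
  have i: "iter_partial_deriv (replicate m 1) (\<lambda>x :: real ^ 1. f (x $ 1)) = (\<lambda>x. (deriv ^^ m) f (x $ 1))" for m
    by (induction m) (simp_all add: p)
  show "smooth1_on UNIV f" unfolding smooth1_on_def
  proof (intro allI ballI)
    fix m and t :: real
    have "(\<lambda>x :: real ^ 1. (deriv ^^ m) f (x $ 1)) differentiable (at (vec t))"
      using f unfolding smooth_on_def i[symmetric] by blast
    then obtain f' where "((\<lambda>x :: real ^ 1. (deriv ^^ m) f (x $ 1)) has_derivative f') (at (vec t))"
      by (auto simp: differentiable_def)
    from has_derivative_line[OF this, of "axis 1 1"]
    have "((\<lambda>s. (deriv ^^ m) f (s + t)) has_real_derivative f' (axis 1 1)) (at 0)"
      by (simp add: axis_def add.commute)
    then have "((deriv ^^ m) f has_real_derivative f' (axis 1 1)) (at (0 + t))"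
      by (simp only: DERIV_shift)
    then show "(deriv ^^ m) f differentiable (at t)" by (auto simp: real_differentiable_def)
  qed
qed

lemma smooth1_on_mult: "smooth1_on UNIV f \<Longrightarrow> smooth1_on UNIV g \<Longrightarrow> smooth1_on UNIV (\<lambda>t. f t * g t)"
  unfolding smooth1_on_UNIV_iff by (rule smooth_on_mult) auto

lemma smooth1_on_affine_compose:
  assumes "smooth1_on UNIV f" shows "smooth1_on UNIV (\<lambda>t. f (a * t + b))"
  unfolding smooth1_on_UNIV_iff
proof (rule smooth_on_compose1[OF open_UNIV _ assms])
  show "smooth_on UNIV (\<lambda>x :: real ^ 1. a * x $ 1 + b)"
    by (intro smooth_on_add smooth_on_cmult smooth_on_component smooth_on_const) auto
qed simp

lemma smooth1_on_affine_image:
  assumes "smooth1_on UNIV f" shows "smooth1_on UNIV (\<lambda>t. a * f t + b)"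
  using assms unfolding smooth1_on_UNIV_iff
  by (intro smooth_on_add smooth_on_cmult smooth_on_const) auto

lemma smooth1_on_antiderivative:
  assumes F: "\<And>t. (F has_real_derivative f t) (at t)" and f: "smooth1_on UNIV f"
  shows "smooth1_on UNIV F"
  unfolding smooth1_on_def
proof (intro allI ballI)
  fix m t
  have d: "deriv F = f" using F by (auto intro: DERIV_imp_deriv)
  show "(deriv ^^ m) F differentiable (at t)"
  proof (cases m)
    case 0 then show ?thesis using F[of t] by (auto simp: real_differentiable_def)
  next
    case (Suc m')
    then have "(deriv ^^ m) F = (deriv ^^ m') f" by (simp add: funpow_Suc_right d del: funpow.simps)
    then show ?thesis using f by (auto simp: smooth1_on_def)
  qed
qed

lemma smooth1_on_differentiable: "smooth1_on V f \<Longrightarrow> t \<in> V \<Longrightarrow> f differentiable (at t)"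
  unfolding smooth1_on_def by (metis funpow_0)

lemma smooth1_on_DERIV: "smooth1_on V f \<Longrightarrow> t \<in> V \<Longrightarrow> (f has_real_derivative deriv f t) (at t)"
  using smooth1_on_differentiable DERIV_deriv_iff_real_differentiable by blast

lemma smooth1_on_isCont: "smooth1_on UNIV f \<Longrightarrow> isCont f t"
  using smooth1_on_DERIV DERIV_isCont by blast

lemma tendsto_poly_mult_exp_minus: "((\<lambda>x::real. poly p x * exp (- x)) \<longlongrightarrow> 0) at_top"
proof -
  have "((\<lambda>x::real. \<Sum>i\<le>degree p. coeff p i * (x ^ i / exp x)) \<longlongrightarrow> (\<Sum>i\<le>degree p. coeff p i * 0)) at_top"
    by (intro tendsto_intros tendsto_power_div_exp_0)
  then show ?thesis
    by (simp add: poly_altdef sum_distrib_right exp_minus sum_divide_distrib field_simps)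
qed

text \<open>The classical flat function exp(-1/t), with a polynomial in 1/t as a factor so that the
  family is closed under differentiation.\<close>

definition flat_exp :: "real poly \<Rightarrow> real \<Rightarrow> real" where
  "flat_exp p t = (if t > 0 then poly p (inverse t) * exp (- inverse t) else 0)"

text \<open>With s = 1/t the derivative of p(s) exp(-s) is s^2 (p(s) - p'(s)) exp(-s), whence the
  polynomial on the right. At t = 0 the difference quotient from the right is s p(s) exp(-s), which
  tends to 0.\<close>

lemma flat_exp_derivative: "(flat_exp p has_real_derivative flat_exp ([:0, 0, 1:] * (p - pderiv p)) t) (at t)"
proof -
  consider "t > 0" | "t = 0" | "t < 0" by linarith
  then show ?thesis
  proof cases
    case 1
    have "((\<lambda>t. poly p (inverse t) * exp (- inverse t)) has_real_derivative
        poly ([:0, 0, 1:] * (p - pderiv p)) (inverse t) * exp (- inverse t)) (at t)"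
      using 1 by (auto intro!: derivative_eq_intros simp: power2_eq_square algebra_simps)
    then have "(flat_exp p has_real_derivative
        poly ([:0, 0, 1:] * (p - pderiv p)) (inverse t) * exp (- inverse t)) (at t)"
      by (rule has_field_derivative_transform_within_open[of _ _ _ "{0<..}"]) (use 1 in \<open>auto simp: flat_exp_def\<close>)
    then show ?thesis using 1 by (simp add: flat_exp_def)
  next
    case 3
    have "((\<lambda>t. 0 :: real) has_real_derivative 0) (at t)" by simp
    then have "(flat_exp p has_real_derivative 0) (at t)"
      by (rule has_field_derivative_transform_within_open[of _ _ _ "{..<0}"]) (use 3 in \<open>auto simp: flat_exp_def\<close>)
    then show ?thesis using 3 by (simp add: flat_exp_def)
  next
    case 2
    have "((\<lambda>y. (flat_exp p y - flat_exp p 0) / (y - 0)) \<longlongrightarrow> 0) (at_left 0)"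
      by (rule tendsto_eventually) (auto simp: flat_exp_def eventually_at_filter)
    moreover have "((\<lambda>y. (flat_exp p y - flat_exp p 0) / (y - 0)) \<longlongrightarrow> 0) (at_right 0)"
    proof -
      have "((\<lambda>y::real. poly (pCons 0 p) (inverse y) * exp (- inverse y)) \<longlongrightarrow> 0) (at_right 0)"
        by (rule filterlim_compose[OF tendsto_poly_mult_exp_minus filterlim_inverse_at_top_right])
      then show ?thesis
        by (rule Lim_transform_eventually)
          (auto simp: eventually_at_filter flat_exp_def field_simps)
    qed
    ultimately have "((\<lambda>y. (flat_exp p y - flat_exp p 0) / (y - 0)) \<longlongrightarrow> 0) (at 0)"
      by (simp add: filterlim_at_split)
    then show ?thesis using 2 by (simp add: has_field_derivative_iff flat_exp_def)
  qed
qed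

lemma smooth1_on_flat_exp: "smooth1_on UNIV (flat_exp p)"
proof (rule smooth1_on_coinduct[of _ _ "range flat_exp"])
  fix f assume "f \<in> range flat_exp"
  then obtain p where "f = flat_exp p" by auto
  then show "\<exists>g\<in>range flat_exp. \<forall>t\<in>UNIV. (f has_real_derivative g t) (at t)"
    using flat_exp_derivative[of p] by blast
qed auto

lemma antiderivative_exists:
  fixes f :: "real \<Rightarrow> real"
  assumes "\<And>t. isCont f t"
  obtains F where "\<And>t. (F has_real_derivative f t) (at t)"
proof -
  have "\<exists>F. \<forall>x. (-\<infinity>::ereal) < x \<longrightarrow> x < (\<infinity>::ereal) \<longrightarrow> (F has_vector_derivative f x) (at x)"
    by (rule einterval_antiderivative) (use assms in auto)
  then show thesis using that by (auto simp: has_real_derivative_iff_has_vector_derivative)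
qed

definition smooth_step :: "real \<Rightarrow> real" where
  "smooth_step = (SOME s. smooth1_on UNIV s \<and> (\<forall>t\<le>0. s t = 0) \<and> (\<forall>t\<ge>1. s t = 1) \<and> (\<forall>t. 0 \<le> s t \<and> s t \<le> 1))"

text \<open>The normalised antiderivative of a nonnegative bump. The interval from \<open>c\<close>
  to \<open>d\<close>, where the bump is at least \<open>m\<close>, bounds the total mass
  \<open>I\<close> from below and thereby the slope p / I from above.\<close>

lemma smooth_transition_exists:
  assumes p: "smooth1_on UNIV p" "\<And>t. 0 \<le> p t" and ab: "a < b"
    and out: "\<And>t. t \<le> a \<Longrightarrow> p t = 0" "\<And>t. t \<ge> b \<Longrightarrow> p t = 0"
    and cd: "a \<le> c" "c < d" "d \<le> b" and m: "m \<ge> 0" "\<And>t. c < t \<Longrightarrow> t < d \<Longrightarrow> m \<le> p t" "\<And>t. c < t \<Longrightarrow> t < d \<Longrightarrow> 0 < p t"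
  obtains s I where "smooth1_on UNIV s" "\<And>t. t \<le> a \<Longrightarrow> s t = 0" "\<And>t. t \<ge> b \<Longrightarrow> s t = 1"
    "\<And>t. 0 \<le> s t" "\<And>t. s t \<le> 1" "\<And>t. (s has_real_derivative p t / I) (at t)" "I > 0" "I \<ge> m * (d - c)"
proof -
  obtain F where F: "\<And>t. (F has_real_derivative p t) (at t)"
    using antiderivative_exists[of p] smooth1_on_isCont[OF p(1)] by blast
  have mono: "F x \<le> F y" if "x \<le> y" for x y
    using DERIV_nonneg_imp_nondecreasing[OF that, of F] F p(2) by blast
  have Fc: "isCont F t" for t using F DERIV_isCont by blast
  obtain z where z: "c < z" "z < d" "F d - F c = (d - c) * p z"
    using MVT2[of c d F p] F cd by auto
  have I0: "F d - F c > 0" using z m(3)[of z] cd by auto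
  have I1: "F d - F c \<ge> m * (d - c)" using z m(2)[of z] cd by (simp add: mult.commute mult_left_mono)
  define I where "I = F b - F a"
  have I: "I > 0" "I \<ge> m * (d - c)" using I0 I1 mono[of a c] mono[of d b] cd by (auto simp: I_def)
  have left: "F t = F a" if ta: "t \<le> a" for t
  proof (cases "t = a")
    case False
    then obtain z where "t < z" "z < a" "F a - F t = (a - t) * p z"
      using MVT2[of t a F p] F ta by auto
    then show ?thesis using out(1)[of z] by simp
  qed simp
  have right: "F t = F b" if tb: "t \<ge> b" for t
  proof (cases "t = b")
    case False
    then obtain z where "b < z" "z < t" "F t - F b = (t - b) * p z"
      using MVT2[of b t F p] F tb by auto
    then show ?thesis using out(2)[of z] by simp
  qed simp
  define s where "s = (\<lambda>t. (1 / I) * F t + (- F a / I))"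
  have s: "s t = (F t - F a) / I" for t unfolding s_def diff_divide_distrib by simp
  show thesis
  proof (rule that[of s I])
    show "smooth1_on UNIV s" unfolding s_def
      by (rule smooth1_on_affine_image) (rule smooth1_on_antiderivative[OF F p(1)])
    show "s t = 0" if "t \<le> a" for t using left[OF that] by (simp add: s)
    show "s t = 1" if "t \<ge> b" for t using right[OF that] I by (simp add: s I_def)
    show "0 \<le> s t" for t
    proof -
      have "F a \<le> F t" using left[of t] mono[of a t] by linarith
      then show ?thesis using I(1) by (simp add: s)
    qed
    show "s t \<le> 1" for t
    proof -
      have "F t \<le> F b" using right[of t] mono[of t b] by linarith
      then have "F t - F a \<le> I" by (simp add: I_def)
      then show ?thesis using I(1) by (simp add: s)
    qed
    show "(s has_real_derivative p t / I) (at t)" for t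
      unfolding s_def using I by (auto intro!: derivative_eq_intros F)
  qed (use I in auto)
qed

lemma smooth_step:
  "smooth1_on UNIV smooth_step" "t \<le> 0 \<Longrightarrow> smooth_step t = 0" "t \<ge> 1 \<Longrightarrow> smooth_step t = 1"
  "0 \<le> smooth_step t" "smooth_step t \<le> 1"
proof -
  \<comment> \<open>A bump positive exactly on (0, 1): the first factor vanishes for t \<le> 0, the
    second for t \<ge> 1.\<close>
  define p where "p = (\<lambda>t. flat_exp 1 t * flat_exp 1 ((-1) * t + 1))"
  have "smooth1_on UNIV p" unfolding p_def
    by (intro smooth1_on_mult smooth1_on_flat_exp smooth1_on_affine_compose)
  then obtain s I where "smooth1_on UNIV s" "\<And>t. t \<le> 0 \<Longrightarrow> s t = 0" "\<And>t. t \<ge> 1 \<Longrightarrow> s t = 1"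
    "\<And>t. 0 \<le> s t" "\<And>t. s t \<le> 1"
    using smooth_transition_exists[of p 0 1 0 1 0 thesis] by (force simp: p_def flat_exp_def)
  then have "\<exists>s. smooth1_on UNIV s \<and> (\<forall>t\<le>0. s t = 0) \<and> (\<forall>t\<ge>1. s t = 1) \<and> (\<forall>t. 0 \<le> s t \<and> s t \<le> 1)"
    by blast
  from someI_ex[OF this, folded smooth_step_def]
  show "smooth1_on UNIV smooth_step" "t \<le> 0 \<Longrightarrow> smooth_step t = 0" "t \<ge> 1 \<Longrightarrow> smooth_step t = 1"
    "0 \<le> smooth_step t" "smooth_step t \<le> 1" by auto
qed

text \<open>A drop of 1 over an interval of length 1 - \<tau> needs a slope steeper than -1; slope
  -(1 + e) suffices if the derivative is constant on almost all of the interval. The gap \<tau>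
  confines the support of G(\<delta> ln |y|) to |y| \<le> exp(-\<tau>/\<delta>), a ball that shrinks
  with \<delta>.\<close>

lemma cutoff_exists:
  fixes e :: real
  assumes e: "e > 0"
  obtains G \<tau> where "smooth1_on UNIV G" "0 < \<tau>" "\<tau> < 1" "\<And>t. t \<le> -1 \<Longrightarrow> G t = 1" "\<And>t. t \<ge> - \<tau> \<Longrightarrow> G t = 0"
    "\<And>t. 0 \<le> G t" "\<And>t. G t \<le> 1" "\<And>t. deriv G t \<le> 0" "\<And>t. - deriv G t \<le> 1 + e"
proof -
  \<comment> \<open>Chosen so that (1 + e) (1 - 3 \<tau>) \<ge> 1: the plateau of the bump has
    length 1 - 3 \<tau>, hence the slope is at most 1 / (1 - 3 \<tau>).\<close>
  define \<tau> where "\<tau> = min (1/6) (e / (6 * (1 + e)))"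
  have \<tau>: "0 < \<tau>" "\<tau> \<le> 1/6" using e by (auto simp: \<tau>_def)
  have "\<tau> \<le> e / (6 * (1 + e))" by (simp add: \<tau>_def)
  then have "3 * \<tau> * (1 + e) \<le> e" using e by (simp add: field_simps)
  then have slope: "1 \<le> (1 + e) * (1 - 3 * \<tau>)" by (simp add: algebra_simps)
  define p where "p = (\<lambda>t. smooth_step ((1 / \<tau>) * t + 1 / \<tau>) * smooth_step ((- 1 / \<tau>) * t + (- 1)))"
  have ps: "smooth1_on UNIV p" unfolding p_def
    by (intro smooth1_on_mult smooth1_on_affine_compose smooth_step)
  have p1: "0 \<le> p t" "p t \<le> 1" for t using smooth_step(4,5) by (auto simp: p_def intro: mult_le_one)
  have pl: "p t = 0" if "t \<le> -1" for t
  proof -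
    have "(1 / \<tau>) * t + 1 / \<tau> \<le> 0" using \<tau> that by (simp add: field_simps)
    then show ?thesis by (simp add: p_def smooth_step(2))
  qed
  have pr: "p t = 0" if "t \<ge> - \<tau>" for t
  proof -
    have "(- 1 / \<tau>) * t + (- 1) \<le> 0" using \<tau> that by (simp add: field_simps)
    then show ?thesis by (simp add: p_def smooth_step(2))
  qed
  have pm: "p t = 1" if "-1 + \<tau> < t" "t < - 2 * \<tau>" for t
  proof -
    have "(1 / \<tau>) * t + 1 / \<tau> \<ge> 1" "(- 1 / \<tau>) * t + (- 1) \<ge> 1" using \<tau> that by (auto simp: field_simps)
    then show ?thesis by (simp add: p_def smooth_step(3))
  qed
  obtain s I where s: "smooth1_on UNIV s" "\<And>t. t \<le> -1 \<Longrightarrow> s t = 0" "\<And>t. t \<ge> - \<tau> \<Longrightarrow> s t = 1"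
    "\<And>t. 0 \<le> s t" "\<And>t. s t \<le> 1" "\<And>t. (s has_real_derivative p t / I) (at t)" "I > 0" "I \<ge> 1 * (- 2 * \<tau> - (- 1 + \<tau>))"
    by (rule smooth_transition_exists[of p "-1" "- \<tau>" "- 1 + \<tau>" "- 2 * \<tau>" 1])
      (use ps p1 pl pr pm \<tau> in auto)
  have I: "I \<ge> 1 - 3 * \<tau>" using s(8) by simp
  define G where "G = (\<lambda>t. (-1) * s t + 1)"
  have dG: "deriv G t = - (p t / I)" for t
    unfolding G_def by (rule DERIV_imp_deriv) (auto intro!: derivative_eq_intros s(6))
  show thesis
  proof (rule that[of G \<tau>])
    show "smooth1_on UNIV G" unfolding G_def by (rule smooth1_on_affine_image[OF s(1)])
    show "deriv G t \<le> 0" for t using p1(1)[of t] s(7) by (simp add: dG)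
    show "- deriv G t \<le> 1 + e" for t
    proof -
      have "1 \<le> (1 + e) * I" by (rule order_trans[OF slope mult_left_mono[OF I]]) (use e in simp)
      then have "p t \<le> (1 + e) * I" using p1(2)[of t] by linarith
      then show ?thesis using s(7) by (simp add: dG pos_divide_le_eq)
    qed
  qed (use s \<tau> in \<open>auto simp: G_def\<close>)
qed

section \<open>Test functions: support, bounds, Taylor estimate\<close>

lemma test_function_iff: "test_function \<phi> \<longleftrightarrow> smooth_on UNIV \<phi> \<and> compact (closure {x. \<phi> x \<noteq> 0})"
  by (simp add: test_function_def smooth_on_def)

lemma test_functionI:
  assumes "smooth_on UNIV \<phi>" "\<And>x. norm x > R \<Longrightarrow> \<phi> x = 0"
  shows "test_function \<phi>"
proof -
  have "{x. \<phi> x \<noteq> 0} \<subseteq> cball 0 R" using assms(2) by (force simp: not_less)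
  then have "bounded {x. \<phi> x \<noteq> 0}" by (rule bounded_subset[OF bounded_cball])
  with assms(1) show ?thesis by (simp add: test_function_iff compact_closure)
qed

lemma test_function_support:
  assumes "test_function \<phi>"
  obtains R where "R > 0" "\<And>x. norm x > R \<Longrightarrow> \<phi> x = 0"
proof -
  have "bounded {x. \<phi> x \<noteq> 0}" using assms by (simp add: test_function_iff compact_closure)
  then obtain R where "R > 0" "\<forall>x\<in>{x. \<phi> x \<noteq> 0}. norm x \<le> R" by (auto simp: bounded_pos)
  then show thesis by (intro that[of R]) (auto simp: not_le[symmetric])
qed

lemma test_function_smooth: "test_function \<phi> \<Longrightarrow> smooth_on UNIV \<phi>"
  by (simp add: test_function_iff)

lemma test_function_mult:
  assumes f: "smooth_on UNIV f" and \<phi>: "test_function \<phi>"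
  shows "test_function (\<lambda>x. f x * \<phi> x)"
proof -
  obtain R where "\<And>x. norm x > R \<Longrightarrow> \<phi> x = 0" using test_function_support[OF \<phi>] by blast
  then show ?thesis
    by (intro test_functionI[of _ R] smooth_on_mult f test_function_smooth[OF \<phi>]) auto
qed

lemma test_function_partial:
  assumes \<phi>: "test_function \<phi>"
  shows "test_function (partial_deriv i \<phi>)"
proof -
  obtain R where R: "\<And>x. norm x > R \<Longrightarrow> \<phi> x = 0" using test_function_support[OF \<phi>] by blast
  have "open {x :: real ^ 'a. norm x > R}" by (intro open_Collect_less continuous_intros)
  then have "partial_deriv i \<phi> x = 0" if "norm x > R" for x
    using partial_deriv_cong[of "{x. norm x > R}" x \<phi> "\<lambda>_. 0" i] R that by simp
  then show ?thesis
    by (intro test_functionI[of _ R] smooth_on_partial test_function_smooth[OF \<phi>])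
qed

lemma test_function_iter: "test_function \<phi> \<Longrightarrow> test_function (iter_partial_deriv is \<phi>)"
  by (induction "is") (auto intro: test_function_partial)

lemma smooth_on_isCont: "smooth_on U f \<Longrightarrow> x \<in> U \<Longrightarrow> isCont f x"
  using smooth_on_differentiable differentiable_imp_continuous_within by blast

lemma smooth_on_continuous_on: "smooth_on U f \<Longrightarrow> continuous_on U f"
  using smooth_on_isCont continuous_at_imp_continuous_on by blast

lemma smooth_borel: "smooth_on UNIV f \<Longrightarrow> f \<in> borel_measurable borel"
  by (intro borel_measurable_continuous_onI smooth_on_continuous_on)

lemma test_function_borel [measurable_dest]: "test_function f \<Longrightarrow> f \<in> borel_measurable borel"
  by (intro smooth_borel test_function_smooth)

lemma test_function_bounded:
  assumes "test_function \<phi>"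
  obtains B where "B \<ge> 0" "\<And>x. \<bar>\<phi> x\<bar> \<le> B"
proof -
  obtain R where R: "\<And>x. norm x > R \<Longrightarrow> \<phi> x = 0" using test_function_support[OF assms] by blast
  have "compact (\<phi> ` cball 0 R)"
    by (intro compact_continuous_image compact_cball
        continuous_on_subset[OF smooth_on_continuous_on[OF test_function_smooth[OF assms]] subset_UNIV])
  then obtain B where "\<forall>y\<in>\<phi> ` cball 0 R. norm y \<le> B"
    using compact_imp_bounded bounded_iff by blast
  then have B: "\<bar>\<phi> x\<bar> \<le> B" if "x \<in> cball 0 R" for x using that by auto
  show thesis
  proof (rule that[of "max B 0"])
    show "\<bar>\<phi> x\<bar> \<le> max B 0" for x
      using B[of x] R[of x] by (cases "norm x > R") (auto simp: max_def)
  qed simp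
qed

lemma smooth_mvt:
  fixes \<phi> :: "real ^ 'n::finite \<Rightarrow> real"
  assumes "smooth_on UNIV \<phi>"
  obtains s where "0 < s" "s < 1" "\<phi> (x + h) - \<phi> x = (\<Sum>i\<in>UNIV. h $ i * partial_deriv i \<phi> (x + s *\<^sub>R h))"
proof -
  have "((\<lambda>t. \<phi> (x + t *\<^sub>R h)) has_real_derivative (\<Sum>i\<in>UNIV. h $ i * partial_deriv i \<phi> (x + t *\<^sub>R h))) (at t)" for t
  proof -
    have "((\<lambda>t'. \<phi> (x + t *\<^sub>R h + t' *\<^sub>R h)) has_real_derivative (\<Sum>i\<in>UNIV. h $ i * partial_deriv i \<phi> (x + t *\<^sub>R h))) (at 0)"
      using has_derivative_line[OF has_derivative_partial_deriv[OF smooth_on_differentiable[OF assms]]] by simp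
    then have "((\<lambda>t'. \<phi> (x + (t' + t) *\<^sub>R h)) has_real_derivative (\<Sum>i\<in>UNIV. h $ i * partial_deriv i \<phi> (x + t *\<^sub>R h))) (at 0)"
      by (simp add: algebra_simps)
    then show ?thesis using DERIV_shift[of "\<lambda>t. \<phi> (x + t *\<^sub>R h)" _ 0 t] by simp
  qed
  from MVT2[of 0 1 "\<lambda>t. \<phi> (x + t *\<^sub>R h)", OF _ this] that show thesis by auto
qed

lemma sum_component_bound:
  fixes h :: "real ^ 'n::finite"
  assumes "\<And>i. \<bar>g i\<bar> \<le> B"
  shows "\<bar>\<Sum>i\<in>UNIV. h $ i * g i\<bar> \<le> real CARD('n) * B * norm h"
proof -
  have "\<bar>\<Sum>i\<in>UNIV. h $ i * g i\<bar> \<le> (\<Sum>i\<in>UNIV. \<bar>h $ i * g i\<bar>)" by (rule sum_abs)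
  also have "\<dots> \<le> (\<Sum>i\<in>(UNIV :: 'n set). norm h * B)"
    by (rule sum_mono) (auto simp: abs_mult intro!: mult_mono assms component_le_norm_cart)
  finally show ?thesis by (simp add: mult_ac)
qed

lemma test_function_lipschitz:
  fixes \<phi> :: "real ^ 'n::finite \<Rightarrow> real"
  assumes \<phi>: "test_function \<phi>"
  obtains C where "C \<ge> 0" "\<And>x h. \<bar>\<phi> (x + h) - \<phi> x\<bar> \<le> C * norm h"
proof -
  have "\<forall>i. \<exists>B. B \<ge> 0 \<and> (\<forall>x. \<bar>partial_deriv i \<phi> x\<bar> \<le> B)"
    using test_function_bounded[OF test_function_partial[OF \<phi>]] by blast
  from choice[OF this] have "\<exists>B. \<forall>i. B i \<ge> 0 \<and> (\<forall>x. \<bar>partial_deriv i \<phi> x\<bar> \<le> B i)" .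
  then obtain B where B: "\<And>i. B i \<ge> 0" "\<And>i x. \<bar>partial_deriv i \<phi> x\<bar> \<le> B i" by blast
  define M where "M = (\<Sum>i\<in>UNIV. B i)"
  have M: "M \<ge> 0" using B by (auto simp: M_def intro: sum_nonneg)
  have BM: "B i \<le> M" for i using member_le_sum[of i UNIV B] B(1) by (auto simp: M_def)
  have pM: "\<bar>partial_deriv i \<phi> x\<bar> \<le> M" for i x using B(2)[of i x] BM[of i] by linarith
  have "\<bar>\<phi> (x + h) - \<phi> x\<bar> \<le> real CARD('n) * M * norm h" for x h
  proof -
    obtain s where s: "\<phi> (x + h) - \<phi> x = (\<Sum>i\<in>UNIV. h $ i * partial_deriv i \<phi> (x + s *\<^sub>R h))"
      using smooth_mvt[OF test_function_smooth[OF \<phi>], of x h] by blast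
    show ?thesis unfolding s by (rule sum_component_bound) (rule pM)
  qed
  with M show thesis by (intro that[of "real CARD('n) * M"]) auto
qed

text \<open>The quadratic remainder is uniform in the base point, as differentiation under the
  integral sign requires. It combines the mean value form with the Lipschitz bounds of the partial
  derivatives.\<close>

lemma test_function_taylor:
  fixes \<phi> :: "real ^ 'n::finite \<Rightarrow> real"
  assumes \<phi>: "test_function \<phi>"
  obtains C where "C \<ge> 0"
    "\<And>x h. \<bar>\<phi> (x + h) - \<phi> x - (\<Sum>i\<in>UNIV. h $ i * partial_deriv i \<phi> x)\<bar> \<le> C * (norm h)\<^sup>2"
proof -
  have "\<forall>i. \<exists>B. B \<ge> 0 \<and> (\<forall>x h. \<bar>partial_deriv i \<phi> (x + h) - partial_deriv i \<phi> x\<bar> \<le> B * norm h)"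
  proof
    fix i
    show "\<exists>B. B \<ge> 0 \<and> (\<forall>x h. \<bar>partial_deriv i \<phi> (x + h) - partial_deriv i \<phi> x\<bar> \<le> B * norm h)"
    proof (rule test_function_lipschitz[OF test_function_partial[OF \<phi>, of i]])
      fix C assume "0 \<le> C" "\<And>x h. \<bar>partial_deriv i \<phi> (x + h) - partial_deriv i \<phi> x\<bar> \<le> C * norm h"
      then show ?thesis by (intro exI[of _ C]) auto
    qed
  qed
  from choice[OF this] have "\<exists>B. \<forall>i. B i \<ge> 0 \<and> (\<forall>x h. \<bar>partial_deriv i \<phi> (x + h) - partial_deriv i \<phi> x\<bar> \<le> B i * norm h)" .
  then obtain B where B: "\<And>i. B i \<ge> 0"
    "\<And>i x h. \<bar>partial_deriv i \<phi> (x + h) - partial_deriv i \<phi> x\<bar> \<le> B i * norm h" by blast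
  define M where "M = (\<Sum>i\<in>UNIV. B i)"
  have M: "M \<ge> 0" using B by (auto simp: M_def intro: sum_nonneg)
  have BM: "B i \<le> M" for i using member_le_sum[of i UNIV B] B(1) by (auto simp: M_def)
  show thesis
  proof (rule that[of "real CARD('n) * M"])
    fix x h :: "real ^ 'n"
    obtain s where s: "0 < s" "s < 1" "\<phi> (x + h) - \<phi> x = (\<Sum>i\<in>UNIV. h $ i * partial_deriv i \<phi> (x + s *\<^sub>R h))"
      using smooth_mvt[OF test_function_smooth[OF \<phi>]] by blast
    have "\<bar>partial_deriv i \<phi> (x + s *\<^sub>R h) - partial_deriv i \<phi> x\<bar> \<le> M * norm h" for i
    proof -
      have "B i * norm (s *\<^sub>R h) \<le> M * norm h"
        using s(1,2) M by (intro mult_mono BM) (simp_all add: mult_left_le_one_le)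
      with B(2)[of i x "s *\<^sub>R h"] show ?thesis by linarith
    qed
    from sum_component_bound[of "\<lambda>i. partial_deriv i \<phi> (x + s *\<^sub>R h) - partial_deriv i \<phi> x", OF this, of h]
    show "\<bar>\<phi> (x + h) - \<phi> x - (\<Sum>i\<in>UNIV. h $ i * partial_deriv i \<phi> x)\<bar> \<le> real CARD('n) * M * (norm h)\<^sup>2"
      by (simp add: s(3) sum_subtractf right_diff_distrib power2_eq_square mult_ac)
  qed (use M in auto)
qed

section \<open>Convolution with an integrable weight\<close>

lemma integrable_mult_bounded:
  fixes f g :: "'a \<Rightarrow> real"
  assumes f: "integrable M f" and g: "g \<in> borel_measurable M" "\<And>x. \<bar>g x\<bar> \<le> B"
  shows "integrable M (\<lambda>x. f x * g x)"
proof (rule Bochner_Integration.integrable_bound)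
  show "integrable M (\<lambda>x. B * f x)" using f by simp
  show "(\<lambda>x. f x * g x) \<in> borel_measurable M" using f g by measurable
  have "\<bar>f x\<bar> * \<bar>g x\<bar> \<le> \<bar>f x\<bar> * \<bar>B\<bar>" for x using g(2)[of x] by (intro mult_left_mono) auto
  then show "AE x in M. norm (f x * g x) \<le> norm (B * f x)" by (auto simp: abs_mult mult.commute)
qed

lemma convolution_integrable:
  assumes \<kappa>: "integrable M \<kappa>" and Y: "Y \<in> M \<rightarrow>\<^sub>M borel" and \<phi>: "test_function \<phi>"
  shows "integrable M (\<lambda>m. \<kappa> m * \<phi> (x - Y m))"
proof -
  obtain B where "\<And>x. \<bar>\<phi> x\<bar> \<le> B" using test_function_bounded[OF \<phi>] by blast
  moreover have "(\<lambda>m. \<phi> (x - Y m)) \<in> borel_measurable M"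
    by (rule measurable_compose[OF _ test_function_borel[OF \<phi>]]) (use Y in measurable)
  ultimately show ?thesis by (intro integrable_mult_bounded[OF \<kappa>, of _ B])
qed

text \<open>The integration variable runs over an arbitrary measure space and acts through the
  translation \<open>Y\<close>; this covers convolution over the whole space as well as averaging
  over a segment. By the uniform Taylor bound the remainder is at most C |h|^2 times the integral of
  |\<kappa>|.\<close>

lemma convolution_has_derivative:
  fixes \<phi> :: "real ^ 'n::finite \<Rightarrow> real"
  assumes \<kappa>: "integrable M \<kappa>" and Y: "Y \<in> M \<rightarrow>\<^sub>M borel" and \<phi>: "test_function \<phi>"
  shows "((\<lambda>x. \<integral>m. \<kappa> m * \<phi> (x - Y m) \<partial>M) has_derivative
    (\<lambda>h. \<Sum>i\<in>UNIV. h $ i * (\<integral>m. \<kappa> m * partial_deriv i \<phi> (x - Y m) \<partial>M))) (at x)"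
proof -
  obtain C where C: "C \<ge> 0"
    "\<And>x h. \<bar>\<phi> (x + h) - \<phi> x - (\<Sum>i\<in>UNIV. h $ i * partial_deriv i \<phi> x)\<bar> \<le> C * (norm h)\<^sup>2"
    using test_function_taylor[OF \<phi>] by blast
  note int = convolution_integrable[OF \<kappa> Y \<phi>] convolution_integrable[OF \<kappa> Y test_function_partial[OF \<phi>]]
  define K where "K = C * (\<integral>m. \<bar>\<kappa> m\<bar> \<partial>M)"
  define F where "F = (\<lambda>x. \<integral>m. \<kappa> m * \<phi> (x - Y m) \<partial>M)"
  define D where "D = (\<lambda>h. \<Sum>i\<in>UNIV. h $ i * (\<integral>m. \<kappa> m * partial_deriv i \<phi> (x - Y m) \<partial>M))"
  have bound: "\<bar>F y - F x - D (y - x)\<bar> \<le> K * (norm (y - x))\<^sup>2" for y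
  proof -
    define h where "h = y - x"
    have y: "y = x + h" by (simp add: h_def)
    have Dint: "D h = (\<integral>m. (\<Sum>i\<in>UNIV. h $ i * (\<kappa> m * partial_deriv i \<phi> (x - Y m))) \<partial>M)"
      unfolding D_def using int by (subst Bochner_Integration.integral_sum) auto
    have int3: "integrable M (\<lambda>m. \<Sum>i\<in>UNIV. h $ i * (\<kappa> m * partial_deriv i \<phi> (x - Y m)))"
      using int by (intro Bochner_Integration.integrable_sum) auto
    have "F y - F x - D h = (\<integral>m. \<kappa> m * \<phi> (y - Y m) - \<kappa> m * \<phi> (x - Y m) -
        (\<Sum>i\<in>UNIV. h $ i * (\<kappa> m * partial_deriv i \<phi> (x - Y m))) \<partial>M)"
      unfolding F_def Dint using int(1) int3 by simp
    also have "\<dots> = (\<integral>m. \<kappa> m * (\<phi> (x - Y m + h) - \<phi> (x - Y m) - (\<Sum>i\<in>UNIV. h $ i * partial_deriv i \<phi> (x - Y m))) \<partial>M)"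
      by (simp add: y algebra_simps sum_distrib_left)
    also have "\<bar>\<dots>\<bar> \<le> (\<integral>m. \<bar>\<kappa> m\<bar> * (C * (norm h)\<^sup>2) \<partial>M)"
    proof (rule order_trans[OF integral_abs_bound integral_mono])
      show "integrable M (\<lambda>m. \<bar>\<kappa> m\<bar> * (C * (norm h)\<^sup>2))" using \<kappa> by auto
      have "integrable M (\<lambda>m. \<kappa> m * \<phi> (y - Y m) - \<kappa> m * \<phi> (x - Y m) -
          (\<Sum>i\<in>UNIV. h $ i * (\<kappa> m * partial_deriv i \<phi> (x - Y m))))" using int(1) int3 by auto
      then show "integrable M (\<lambda>m. \<bar>\<kappa> m * (\<phi> (x - Y m + h) - \<phi> (x - Y m) - (\<Sum>i\<in>UNIV. h $ i * partial_deriv i \<phi> (x - Y m)))\<bar>)"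
        by (intro integrable_abs) (simp add: y algebra_simps sum_distrib_left)
      show "\<bar>\<kappa> m * (\<phi> (x - Y m + h) - \<phi> (x - Y m) - (\<Sum>i\<in>UNIV. h $ i * partial_deriv i \<phi> (x - Y m)))\<bar> \<le> \<bar>\<kappa> m\<bar> * (C * (norm h)\<^sup>2)" for m
        unfolding abs_mult by (intro mult_left_mono C) auto
    qed
    also have "\<dots> = K * (norm h)\<^sup>2" by (simp add: K_def)
    finally show ?thesis by (simp add: h_def)
  qed
  have "(F has_derivative D) (at x)"
    unfolding has_derivative_at_within[symmetric] has_derivative_iff_norm
  proof
    show "bounded_linear D" unfolding D_def
      by (intro bounded_linear_sum bounded_linear_mult_const bounded_linear_vec_nth)
    show "((\<lambda>y. norm (F y - F x - D (y - x)) / norm (y - x)) \<longlongrightarrow> 0) (at x)"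
    proof (rule tendsto_sandwich[of "\<lambda>_. 0"])
      show "((\<lambda>y. K * norm (y - x)) \<longlongrightarrow> 0) (at x)" by (auto intro!: tendsto_eq_intros)
      show "\<forall>\<^sub>F y in at x. norm (F y - F x - D (y - x)) / norm (y - x) \<le> K * norm (y - x)"
        using bound by (intro always_eventually allI)
          (auto simp: divide_simps power2_eq_square mult_ac)
    qed auto
  qed
  then show ?thesis by (simp add: F_def D_def)
qed

lemma convolution_partial:
  fixes \<phi> :: "real ^ 'n::finite \<Rightarrow> real"
  assumes "integrable M \<kappa>" "Y \<in> M \<rightarrow>\<^sub>M borel" "test_function \<phi>"
  shows "partial_deriv i (\<lambda>x. \<integral>m. \<kappa> m * \<phi> (x - Y m) \<partial>M) = (\<lambda>x. \<integral>m. \<kappa> m * partial_deriv i \<phi> (x - Y m) \<partial>M)"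
  by (rule ext) (simp add: partial_deriv_eq[OF convolution_has_derivative[OF assms]] axis_def if_distrib if_distribR cong: if_cong)

lemma convolution_iter:
  fixes \<phi> :: "real ^ 'n::finite \<Rightarrow> real"
  assumes "integrable M \<kappa>" "Y \<in> M \<rightarrow>\<^sub>M borel" "test_function \<phi>"
  shows "iter_partial_deriv is (\<lambda>x. \<integral>m. \<kappa> m * \<phi> (x - Y m) \<partial>M) = (\<lambda>x. \<integral>m. \<kappa> m * iter_partial_deriv is \<phi> (x - Y m) \<partial>M)"
  by (induction "is") (auto simp: convolution_partial[OF assms(1,2) test_function_iter[OF assms(3)]])

lemma convolution_test_function:
  fixes \<phi> :: "real ^ 'n::finite \<Rightarrow> real"
  assumes \<kappa>: "integrable M \<kappa>" and Y: "Y \<in> M \<rightarrow>\<^sub>M borel" and \<phi>: "test_function \<phi>"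
    and bd: "\<And>m. \<kappa> m \<noteq> 0 \<Longrightarrow> norm (Y m) \<le> R"
  shows "test_function (\<lambda>x. \<integral>m. \<kappa> m * \<phi> (x - Y m) \<partial>M)"
proof -
  obtain S where S: "\<And>x. norm x > S \<Longrightarrow> \<phi> x = 0" using test_function_support[OF \<phi>] by blast
  show ?thesis
  proof (rule test_functionI[of _ "R + S"])
    show "smooth_on UNIV (\<lambda>x. \<integral>m. \<kappa> m * \<phi> (x - Y m) \<partial>M)"
      unfolding smooth_on_def convolution_iter[OF \<kappa> Y \<phi>]
      using convolution_has_derivative[OF \<kappa> Y test_function_iter[OF \<phi>]] by (auto simp: differentiable_def)
    show "(\<integral>m. \<kappa> m * \<phi> (x - Y m) \<partial>M) = 0" if "norm x > R + S" for x
    proof -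
      have z: "\<kappa> m * \<phi> (x - Y m) = 0" for m
      proof (cases "\<kappa> m = 0")
        case False
        then have "norm (x - Y m) > S" using bd[of m] that norm_triangle_ineq2[of x "Y m"] by linarith
        then show ?thesis using S by simp
      qed simp
      show ?thesis unfolding z by simp
    qed
  qed
qed

section \<open>Affine substitution and integration by parts\<close>

lemma test_function_integrable:
  assumes \<phi>: "test_function \<phi>"
  shows "integrable lborel \<phi>"
proof -
  obtain R where R: "\<And>x. norm x > R \<Longrightarrow> \<phi> x = 0" using test_function_support[OF \<phi>] by blast
  have "integrable lborel (\<lambda>x. indicator (cball 0 R) x *\<^sub>R \<phi> x)"
    by (rule borel_integrable_compact)
      (auto intro: continuous_on_subset[OF smooth_on_continuous_on[OF test_function_smooth[OF \<phi>]]])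
  moreover have "(\<lambda>x. indicator (cball 0 R) x *\<^sub>R \<phi> x) = \<phi>" using R by (auto simp: fun_eq_iff indicator_def not_le)
  ultimately show ?thesis by simp
qed

lemma nn_integral_lborel_affine:
  fixes f :: "'a::euclidean_space \<Rightarrow> ennreal"
  assumes [measurable]: "f \<in> borel_measurable borel" and c: "c \<noteq> 0"
  shows "(\<integral>\<^sup>+x. f x \<partial>lborel) = ennreal (\<bar>c\<bar> ^ DIM('a)) * (\<integral>\<^sup>+x. f (t + c *\<^sub>R x) \<partial>lborel)"
  by (subst lborel_affine[OF c, of t]) (simp add: nn_integral_density nn_integral_distr nn_integral_cmult)

lemma integral_lborel_affine:
  fixes f :: "'a::euclidean_space \<Rightarrow> real"
  assumes f: "f \<in> borel_measurable borel" and c: "c \<noteq> 0"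
  shows "(\<integral>x. f x \<partial>lborel) = \<bar>c\<bar> ^ DIM('a) * (\<integral>x. f (t + c *\<^sub>R x) \<partial>lborel)"
  using f by (subst lborel_affine[OF c, of t]) (simp add: integral_density integral_distr)

lemma integrable_lborel_affine:
  fixes f :: "'a::euclidean_space \<Rightarrow> real"
  assumes f: "integrable lborel f" and c: "c \<noteq> 0"
  shows "integrable lborel (\<lambda>x. f (t + c *\<^sub>R x))"
proof -
  have m: "f \<in> borel_measurable borel" using f by auto
  have "integrable (density (distr lborel borel (\<lambda>x. t + c *\<^sub>R x)) (\<lambda>_. \<bar>c\<bar> ^ DIM('a))) f"
    using f by (subst lborel_affine[OF c, of t, symmetric])
  then have "integrable lborel (\<lambda>x. \<bar>c\<bar> ^ DIM('a) * f (t + c *\<^sub>R x))"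
    using m by (simp add: integrable_density integrable_distr_eq)
  then show ?thesis using c by simp
qed

text \<open>The convolution of \<phi> with the indicator of a large ball is constant near 0, because
  small translates of the reflected \<phi> still live in that ball and the integral is translation
  invariant. Its derivative at 0 is thus 0; differentiated under the integral sign it is the
  integral in question.\<close>

lemma integral_partial_test_function:
  fixes \<phi> :: "real ^ 'n::finite \<Rightarrow> real"
  assumes \<phi>: "test_function \<phi>"
  shows "(\<integral>x. partial_deriv i \<phi> x \<partial>lborel) = 0"
proof -
  obtain R where R: "R > 0" "\<And>x. norm x > R \<Longrightarrow> \<phi> x = 0" using test_function_support[OF \<phi>] by blast
  define \<kappa> where "\<kappa> = (\<lambda>y :: real ^ 'n. indicat_real (ball 0 (R + 1)) y)"
  have \<kappa>: "integrable lborel \<kappa>" unfolding \<kappa>_def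
    by (rule integrable_real_indicator) (use emeasure_lborel_ball_finite[of 0 "R + 1"] in auto)
  have Y: "(\<lambda>y. y) \<in> lborel \<rightarrow>\<^sub>M borel" by simp
  define F where "F = (\<lambda>x. \<integral>y. \<kappa> y * \<phi> (x - y) \<partial>lborel)"
  have shift: "(\<integral>y. \<psi> (x - y) \<partial>lborel) = (\<integral>y. \<psi> y \<partial>lborel)" if "test_function \<psi>" for \<psi> :: "real ^ 'n \<Rightarrow> real" and x
    using integral_lborel_affine[of \<psi> "-1" x] that by (simp add: test_function_borel)
  have loc: "\<kappa> y * \<psi> (x - y) = \<psi> (x - y)" if "norm x < 1" "\<And>x. norm x > R \<Longrightarrow> \<psi> x = 0" for x y and \<psi> :: "real ^ 'n \<Rightarrow> real"
  proof (cases "y \<in> ball 0 (R + 1)")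
    case False
    then have "norm (x - y) > R" using that(1) norm_triangle_ineq2[of y x] by (simp add: norm_minus_commute)
    then show ?thesis using that(2) by simp
  qed (simp add: \<kappa>_def)
  have "F x = (\<integral>y. \<phi> y \<partial>lborel)" if "x \<in> ball 0 1" for x
    using that R(2) by (simp add: F_def loc shift[OF \<phi>])
  then have z: "partial_deriv i F 0 = 0"
    using partial_deriv_cong[of "ball 0 1" 0 F "\<lambda>_. \<integral>y. \<phi> y \<partial>lborel" i] by simp
  have "open {x :: real ^ 'n. norm x > R}" by (intro open_Collect_less continuous_intros)
  then have "partial_deriv i \<phi> x = 0" if "norm x > R" for x
    using partial_deriv_cong[of "{x. norm x > R}" x \<phi> "\<lambda>_. 0" i] R that by simp
  note pz = this
  have "partial_deriv i F 0 = (\<integral>y. partial_deriv i \<phi> y \<partial>lborel)"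
  proof -
    from pz have l0: "\<kappa> y * partial_deriv i \<phi> (0 - y) = partial_deriv i \<phi> (0 - y)" for y
      by (intro loc) auto
    show ?thesis
      unfolding F_def convolution_partial[OF \<kappa> Y \<phi>] l0 by (rule shift[OF test_function_partial[OF \<phi>]])
  qed
  with z show ?thesis by simp
qed

lemma integration_by_parts:
  fixes \<phi> f :: "real ^ 'n::finite \<Rightarrow> real"
  assumes f: "smooth_on UNIV f" and \<phi>: "test_function \<phi>"
  shows "(\<integral>x. f x * partial_deriv i \<phi> x \<partial>lborel) = - (\<integral>x. partial_deriv i f x * \<phi> x \<partial>lborel)"
proof -
  have "partial_deriv i (\<lambda>x. f x * \<phi> x) x = partial_deriv i f x * \<phi> x + f x * partial_deriv i \<phi> x" for x
    using f test_function_smooth[OF \<phi>] by (intro partial_deriv_mult) (auto intro: smooth_on_differentiable)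
  then have "0 = (\<integral>x. partial_deriv i f x * \<phi> x + f x * partial_deriv i \<phi> x \<partial>lborel)"
    using integral_partial_test_function[OF test_function_mult[OF f \<phi>], of i] by simp
  also have "\<dots> = (\<integral>x. partial_deriv i f x * \<phi> x \<partial>lborel) + (\<integral>x. f x * partial_deriv i \<phi> x \<partial>lborel)"
    by (intro Bochner_Integration.integral_add test_function_integrable test_function_mult
        smooth_on_partial f \<phi> test_function_partial)
  finally show ?thesis by simp
qed

text \<open>The outermost derivative leaves \<phi> first and becomes the innermost one on f, hence
  \<open>rev is\<close>.\<close>

lemma integration_by_parts_iter:
  fixes \<phi> f :: "real ^ 'n::finite \<Rightarrow> real"
  assumes f: "smooth_on UNIV f" and \<phi>: "test_function \<phi>"
  shows "(\<integral>x. f x * iter_partial_deriv is \<phi> x \<partial>lborel) =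
    (- 1) ^ length is * (\<integral>x. iter_partial_deriv (rev is) f x * \<phi> x \<partial>lborel)"
  using f
proof (induction "is" arbitrary: f)
  case (Cons i "is")
  then show ?case
    using integration_by_parts[OF Cons.prems test_function_iter[OF \<phi>], of i "is"]
      Cons.IH[OF smooth_on_partial[OF Cons.prems], of i]
    by (simp add: iter_partial_deriv_append)
qed simp

section \<open>Uniqueness of weak derivatives\<close>

lemma locally_integrable_mult_indicator:
  assumes "locally_integrable f" "compact K"
  shows "integrable lebesgue (\<lambda>x. f x * indicator K x)"
  using assms by (simp add: locally_integrable_def set_integrable_def mult.commute)

lemma locally_integrable_measurable:
  fixes f :: "real ^ 'n::finite \<Rightarrow> real"
  assumes f: "locally_integrable f"
  shows "f \<in> borel_measurable lebesgue"
proof (rule borel_measurable_LIMSEQ_real)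
  show "(\<lambda>x. f x * indicator (cball 0 (real j)) x) \<in> borel_measurable lebesgue" for j
    using locally_integrable_mult_indicator[OF f, of "cball 0 (real j)"] by auto
  show "(\<lambda>j. f x * indicator (cball 0 (real j)) x) \<longlonglongrightarrow> f x" for x
  proof (rule tendsto_eventually)
    show "\<forall>\<^sub>F j in sequentially. f x * indicator (cball 0 (real j)) x = f x"
      using eventually_ge_at_top[of "nat \<lceil>norm x\<rceil>"]
      by eventually_elim (auto simp: indicator_def nat_le_iff ceiling_le_iff)
  qed
qed

lemma locally_integrable_mult_bounded:
  fixes f g :: "real ^ 'n::finite \<Rightarrow> real"
  assumes f: "locally_integrable f" and g: "g \<in> borel_measurable borel" "\<And>x. \<bar>g x\<bar> \<le> B" "\<And>x. norm x > R \<Longrightarrow> g x = 0"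
  shows "integrable lebesgue (\<lambda>x. f x * g x)"
proof -
  have "integrable lebesgue (\<lambda>x. (f x * indicator (cball 0 R) x) * g x)"
    using g by (intro integrable_mult_bounded[of _ _ _ B] locally_integrable_mult_indicator[OF f])
      (auto simp: measurable_completion)
  moreover have "(f x * indicator (cball 0 R) x) * g x = f x * g x" for x
    using g(3)[of x] by (auto simp: indicator_def)
  ultimately show ?thesis by simp
qed

lemma locally_integrable_mult_test:
  fixes f \<phi> :: "real ^ 'n::finite \<Rightarrow> real"
  assumes f: "locally_integrable f" and \<phi>: "test_function \<phi>"
  shows "integrable lebesgue (\<lambda>x. f x * \<phi> x)"
proof -
  obtain B where "\<And>x. \<bar>\<phi> x\<bar> \<le> B" using test_function_bounded[OF \<phi>] by blast
  moreover obtain R where "\<And>x. norm x > R \<Longrightarrow> \<phi> x = 0" using test_function_support[OF \<phi>] by blast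
  ultimately show ?thesis by (rule locally_integrable_mult_bounded[OF f test_function_borel[OF \<phi>]])
qed

lemma locally_integrable_diff:
  "locally_integrable f \<Longrightarrow> locally_integrable g \<Longrightarrow> locally_integrable (\<lambda>x. f x - g x)"
  by (simp add: locally_integrable_def)

text \<open>Dominated convergence with a multiple of |f| on a fixed ball as majorant; it carries
  identities from test functions over to indicators of boxes and balls.\<close>

lemma locally_integrable_limit:
  fixes f :: "real ^ 'n::finite \<Rightarrow> real"
  assumes f: "locally_integrable f"
    and g: "\<And>j. g j \<in> borel_measurable borel" "\<And>j x. \<bar>g j x\<bar> \<le> B" "\<And>j x. norm x > R \<Longrightarrow> g j x = 0"
    and lim: "\<And>x. (\<lambda>j. g j x) \<longlonglongrightarrow> h x"
  shows "(\<lambda>j. \<integral>x. f x * g j x \<partial>lebesgue) \<longlonglongrightarrow> (\<integral>x. f x * h x \<partial>lebesgue)"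
proof (rule integral_dominated_convergence[where w = "\<lambda>x. B * \<bar>f x * indicator (cball 0 R) x\<bar>"])
  have h: "h \<in> borel_measurable borel" using g(1) lim by (rule borel_measurable_LIMSEQ_real[rotated])
  show "(\<lambda>x. f x * h x) \<in> borel_measurable lebesgue" "(\<lambda>x. f x * g j x) \<in> borel_measurable lebesgue" for j
    using locally_integrable_measurable[OF f] h g(1) by (auto intro!: borel_measurable_times simp: measurable_completion)
  show "integrable lebesgue (\<lambda>x. B * \<bar>f x * indicator (cball 0 R) x\<bar>)"
    using locally_integrable_mult_indicator[OF f] by auto
  show "AE x in lebesgue. (\<lambda>j. f x * g j x) \<longlonglongrightarrow> f x * h x"
    using lim by (auto intro!: tendsto_mult)
  show "AE x in lebesgue. norm (f x * g j x) \<le> B * \<bar>f x * indicator (cball 0 R) x\<bar>" for j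
  proof (rule AE_I2)
    fix x show "norm (f x * g j x) \<le> B * \<bar>f x * indicator (cball 0 R) x\<bar>"
    proof (cases "norm x > R")
      case True
      have "0 \<le> B" using g(2)[of 0 0] by linarith
      with True show ?thesis using g(3) by simp
    next
      case False
      then show ?thesis using mult_right_mono[OF g(2)[of j x], of "\<bar>f x\<bar>"] by (simp add: abs_mult mult.commute)
    qed
  qed
qed

text \<open>In every coordinate, steps of slope proportional to j rise inward from the two faces.
  The functions vanish off the open box, and at each of its points they are eventually 1.\<close>

lemma box_test_functions:
  fixes a b :: "real ^ 'n::finite"
  obtains \<phi> :: "nat \<Rightarrow> real ^ 'n \<Rightarrow> real" and R where "\<And>j. test_function (\<phi> j)" "\<And>j x. \<bar>\<phi> j x\<bar> \<le> 1"
    "\<And>j x. norm x > R \<Longrightarrow> \<phi> j x = 0" "\<And>x. (\<lambda>j. \<phi> j x) \<longlonglongrightarrow> indicator (box a b) x"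
proof -
  define \<phi> where "\<phi> = (\<lambda>j x. \<Prod>i\<in>(UNIV :: 'n set).
      smooth_step (real j * (x $ i - a $ i)) * smooth_step (real j * (b $ i - x $ i)))"
  obtain R where R: "box a b \<subseteq> cball 0 R"
    using bounded_box[of a b] by (auto simp: bounded_iff subset_iff)
  have out: "\<phi> j x = 0" if xo: "x \<notin> box a b" for j x
  proof -
    obtain i where "x $ i \<le> a $ i \<or> b $ i \<le> x $ i" using xo by (auto simp: mem_box_cart not_less)
    then have "smooth_step (real j * (x $ i - a $ i)) * smooth_step (real j * (b $ i - x $ i)) = 0"
      by (auto simp: smooth_step(2) mult_nonneg_nonpos)
    then show ?thesis unfolding \<phi>_def by (intro prod_zero) auto
  qed
  have R0: "\<phi> j x = 0" if "norm x > R" for j x using R that by (intro out) auto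
  show thesis
  proof (rule that[of \<phi> R])
    show "test_function (\<phi> j)" for j
    proof (rule test_functionI)
      show "smooth_on UNIV (\<phi> j)" unfolding \<phi>_def
        by (intro smooth_on_prod smooth_on_mult smooth_on_compose1[OF open_UNIV _ smooth_step(1)]
            smooth_on_diff smooth_on_cmult smooth_on_component smooth_on_const) auto
    qed (rule R0)
    show "\<bar>\<phi> j x\<bar> \<le> 1" for j x
      unfolding \<phi>_def abs_prod abs_mult
      by (intro prod_le_1 conjI mult_le_one mult_nonneg_nonneg) (auto simp: smooth_step(4,5))
    show "(\<lambda>j. \<phi> j x) \<longlonglongrightarrow> indicator (box a b) x" for x
    proof (cases "x \<in> box a b")
      case True
      have "(\<lambda>j. \<phi> j x) \<longlonglongrightarrow> (\<Prod>i\<in>(UNIV :: 'n set). 1 * 1)" unfolding \<phi>_def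
      proof (intro tendsto_prod tendsto_mult)
        have *: "(\<lambda>j. smooth_step (real j * c)) \<longlonglongrightarrow> 1" if c: "c > 0" for c
        proof (rule tendsto_eventually)
          show "\<forall>\<^sub>F j in sequentially. smooth_step (real j * c) = 1"
            using eventually_ge_at_top[of "nat \<lceil>1 / c\<rceil>"]
          proof eventually_elim
            case (elim j)
            then have "1 / c \<le> real j" by (simp add: nat_le_iff ceiling_le_iff)
            then show ?case using c by (intro smooth_step(3)) (simp add: field_simps)
          qed
        qed
        show "(\<lambda>j. smooth_step (real j * (x $ i - a $ i))) \<longlonglongrightarrow> 1"
          "(\<lambda>j. smooth_step (real j * (b $ i - x $ i))) \<longlonglongrightarrow> 1" for i
          using True by (auto intro!: * simp: mem_box_cart)
      qed
      then show ?thesis using True by simp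
    qed (simp add: out)
  qed (rule R0)
qed

text \<open>Open boxes form an intersection-stable generator of the Borel sets, so on each cube the
  integral over every Borel set vanishes by Dynkin's argument; a density with this property is zero
  almost everywhere. The cubes serve to make \<open>w\<close> integrable.\<close>

lemma AE_zero_of_box_integrals:
  fixes w :: "real ^ 'n::finite \<Rightarrow> real"
  assumes w: "locally_integrable w" and box0: "\<And>a b. (\<integral>x. w x * indicator (box a b) x \<partial>lebesgue) = 0"
  shows "AE x in lebesgue. w x = 0"
proof -
  have "AE x in lebesgue. w x * indicator (box (- (real N *\<^sub>R One)) (real N *\<^sub>R One)) x = 0" for N
  proof -
    define Q :: "(real ^ 'n) set" where "Q = box (- (real N *\<^sub>R One)) (real N *\<^sub>R One)"
    have "bounded Q" by (simp add: Q_def)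
    then obtain R where R: "Q \<subseteq> cball 0 R" by (auto simp: bounded_iff subset_iff)
    have int: "integrable lebesgue (\<lambda>x. w x * indicator Q x)"
      by (rule locally_integrable_mult_bounded[OF w, of _ 1 R])
        (use R in \<open>auto simp: Q_def indicator_def subset_iff\<close>)
    \<comment> \<open>The Dynkin argument runs over Borel sets and \<open>lborel\<close>, whereas
      \<open>w\<close> is only Lebesgue measurable; hence a Borel version.\<close>
    then obtain w' where w': "w' \<in> borel_measurable lborel" "AE x in lborel. w x * indicator Q x = w' x"
      using completion_ex_borel_measurable_real[of "\<lambda>x. w x * indicator Q x" lborel] by auto
    have AE': "AE x in lebesgue. w x * indicator Q x = w' x" using w'(2) by (rule AE_completion)
    have w'm: "w' \<in> borel_measurable lebesgue" using w'(1) by (rule measurable_completion)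
    have int': "integrable lborel w'"
    proof -
      have "integrable lebesgue w'" using int integrable_cong_AE[OF _ w'm AE'] int by auto
      then show ?thesis using integrable_completion[OF w'(1)] by simp
    qed
    have zero: "(\<integral>x. indicator A x * w' x \<partial>lborel) = 0" if A: "A \<in> sets borel" for A
    proof -
      let ?G = "range (\<lambda>(a, b). box a b :: (real ^ 'n) set)"
      have "sets borel = sigma_sets UNIV ?G" unfolding borel_eq_box by (simp add: sets_measure_of)
      with A have A': "A \<in> sigma_sets UNIV ?G" by simp
      have intA: "integrable lborel (\<lambda>x. indicator A x * w' x)" if "A \<in> sigma_sets UNIV ?G" for A
        using integrable_real_mult_indicator[OF _ int', of A] that \<open>sets borel = sigma_sets UNIV ?G\<close>
        by (simp add: mult.commute)
      have G: "Int_stable ?G" "?G \<subseteq> Pow UNIV" by (auto simp: Int_stable_def box_Int_box)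
      from G A' show ?thesis
      proof (induction rule: sigma_sets_induct_disjoint)
        case (basic A)
        then obtain a b where A: "A = box a b" by auto
        have "(\<integral>x. indicator A x * w' x \<partial>lborel) = (\<integral>x. indicator A x * w' x \<partial>lebesgue)"
          using w'(1) A by (intro integral_completion[symmetric]) auto
        also have "\<dots> = (\<integral>x. w x * indicator (box a b \<inter> Q) x \<partial>lebesgue)"
        proof (rule integral_cong_AE)
          show "(\<lambda>x. indicator A x * w' x) \<in> borel_measurable lebesgue"
            using w'm A by (auto intro!: borel_measurable_times borel_measurable_indicator)
          show "(\<lambda>x. w x * indicator (box a b \<inter> Q) x) \<in> borel_measurable lebesgue"
            using locally_integrable_measurable[OF w] by (auto intro!: borel_measurable_times borel_measurable_indicator simp: Q_def)
          show "AE x in lebesgue. indicator A x * w' x = w x * indicator (box a b \<inter> Q) x"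
            using AE' by eventually_elim (auto simp: A indicator_def)
        qed
        also have "\<dots> = 0" unfolding Q_def box_Int_box by (rule box0)
        finally show ?case .
      next
        case (compl A)
        have "(\<integral>x. w' x \<partial>lborel) = (\<integral>x. w' x \<partial>lebesgue)"
          using w'(1) by (intro integral_completion[symmetric])
        also have "\<dots> = (\<integral>x. w x * indicator Q x \<partial>lebesgue)"
          using AE' w'm int by (intro integral_cong_AE) auto
        also have "\<dots> = 0" unfolding Q_def by (rule box0)
        finally have tot: "(\<integral>x. w' x \<partial>lborel) = 0" .
        have "(\<integral>x. indicator (UNIV - A) x * w' x \<partial>lborel) = (\<integral>x. w' x - indicator A x * w' x \<partial>lborel)"
          by (intro Bochner_Integration.integral_cong) (auto simp: indicator_def)
        also have "\<dots> = 0" using int' intA[OF compl(1)] compl(2) tot by simp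
        finally show ?case .
      next
        case (union A)
        have m: "A i \<in> sets lborel" for i
          using union(2) \<open>sets borel = sigma_sets UNIV ?G\<close> by auto
        have "(\<integral>x\<in>(\<Union>i. A i). w' x \<partial>lborel) = (\<Sum>i. \<integral>x\<in>A i. w' x \<partial>lborel)"
        proof (rule lebesgue_integral_countable_add)
          show "A i \<inter> A j = {}" if "i \<noteq> j" for i j
            using union(1) that by (auto simp: disjoint_family_on_def)
          show "set_integrable lborel (\<Union>i. A i) w'"
            unfolding set_integrable_def using int' m by (intro integrable_mult_indicator) auto
        qed (rule m)
        then show ?case using union(3) by (simp add: set_lebesgue_integral_def)
      qed auto
    qed
    have "AE x in lborel. w' x = 0"
      by (rule density_unique_real[OF int']) (use zero in \<open>auto simp: set_lebesgue_integral_def\<close>)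
    then have "AE x in lebesgue. w' x = 0" by (rule AE_completion)
    with AE' show ?thesis unfolding Q_def by eventually_elim simp
  qed
  then have "AE x in lebesgue. \<forall>N::nat. w x * indicator (box (- (real N *\<^sub>R One)) (real N *\<^sub>R One)) x = 0"
    by (subst AE_all_countable) blast
  then show ?thesis
  proof eventually_elim
    case (elim x)
    have "x \<in> (\<Union>i::nat. box (- (real i *\<^sub>R One)) (real i *\<^sub>R One))" by (simp add: UN_box_eq_UNIV)
    then obtain N :: nat where "x \<in> box (- (real N *\<^sub>R One)) (real N *\<^sub>R One)" by auto
    then show ?case using elim[rule_format, of N] by simp
  qed
qed

lemma fundamental_lemma:
  fixes w :: "real ^ 'n::finite \<Rightarrow> real"
  assumes w: "locally_integrable w" and 0: "\<And>\<phi>. test_function \<phi> \<Longrightarrow> (\<integral>x. w x * \<phi> x \<partial>lebesgue) = 0"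
  shows "AE x in lebesgue. w x = 0"
proof (rule AE_zero_of_box_integrals[OF w])
  fix a b
  obtain \<phi> :: "nat \<Rightarrow> real ^ 'n \<Rightarrow> real" and R where \<phi>: "\<And>j. test_function (\<phi> j)" "\<And>j x. \<bar>\<phi> j x\<bar> \<le> 1"
    "\<And>j x. norm x > R \<Longrightarrow> \<phi> j x = 0" "\<And>x. (\<lambda>j. \<phi> j x) \<longlonglongrightarrow> indicator (box a b) x"
    using box_test_functions[of a b] by blast
  have "(\<lambda>j. \<integral>x. w x * \<phi> j x \<partial>lebesgue) \<longlonglongrightarrow> (\<integral>x. w x * indicator (box a b) x \<partial>lebesgue)"
    by (rule locally_integrable_limit[OF w test_function_borel[OF \<phi>(1)] \<phi>(2-4)])
  then have "(\<lambda>j::nat. 0 :: real) \<longlonglongrightarrow> (\<integral>x. w x * indicator (box a b) x \<partial>lebesgue)"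
    by (simp only: 0[OF \<phi>(1)])
  then show "(\<integral>x. w x * indicator (box a b) x \<partial>lebesgue) = 0" by (simp add: LIMSEQ_const_iff)
qed

lemma has_weak_deriv_unique:
  fixes u :: "real ^ 'n::finite \<Rightarrow> real"
  assumes g: "has_weak_deriv u is g" and h: "has_weak_deriv u is h"
  shows "AE x in lebesgue. g x = h x"
proof -
  have li: "locally_integrable g" "locally_integrable h" using g h by (auto simp: has_weak_deriv_def)
  have "AE x in lebesgue. g x - h x = 0"
  proof (rule fundamental_lemma)
    fix \<phi> :: "real ^ 'n \<Rightarrow> real" assume \<phi>: "test_function \<phi>"
    have "(- 1) ^ length is * (\<integral>x. g x * \<phi> x \<partial>lebesgue) = (- 1) ^ length is * (\<integral>x. h x * \<phi> x \<partial>lebesgue)"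
      using g h \<phi> unfolding has_weak_deriv_def by metis
    then have "(\<integral>x. g x * \<phi> x \<partial>lebesgue) = (\<integral>x. h x * \<phi> x \<partial>lebesgue)" by simp
    then show "(\<integral>x. (g x - h x) * \<phi> x \<partial>lebesgue) = 0"
      using li locally_integrable_mult_test[OF _ \<phi>] by (simp add: left_diff_distrib)
  qed (intro locally_integrable_diff li)
  then show ?thesis by simp
qed

section \<open>Functions of a slowly varying logarithm\<close>

lemma iter_partial_deriv_add:
  fixes f g :: "real ^ 'n::finite \<Rightarrow> real"
  assumes U: "open U" and f: "smooth_on U f" and g: "smooth_on U g" and x: "x \<in> U"
  shows "iter_partial_deriv is (\<lambda>x. f x + g x) x = iter_partial_deriv is f x + iter_partial_deriv is g x"
  using x
proof (induction "is" arbitrary: x)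
  case (Cons i js)
  have "partial_deriv i (iter_partial_deriv js (\<lambda>x. f x + g x)) x =
      partial_deriv i (\<lambda>x. iter_partial_deriv js f x + iter_partial_deriv js g x) x"
    by (rule partial_deriv_cong[OF U Cons.prems]) (rule Cons.IH)
  also have "\<dots> = partial_deriv i (iter_partial_deriv js f) x + partial_deriv i (iter_partial_deriv js g) x"
    using f g Cons.prems by (intro partial_deriv_add) (auto simp: smooth_on_def)
  finally show ?case by simp
qed simp

lemma iter_partial_deriv_cmult:
  fixes f :: "real ^ 'n::finite \<Rightarrow> real"
  assumes U: "open U" and f: "smooth_on U f" and x: "x \<in> U"
  shows "iter_partial_deriv is (\<lambda>x. c * f x) x = c * iter_partial_deriv is f x"
  using x
proof (induction "is" arbitrary: x)
  case (Cons i js)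
  have "partial_deriv i (iter_partial_deriv js (\<lambda>x. c * f x)) x = partial_deriv i (\<lambda>x. c * iter_partial_deriv js f x) x"
    by (rule partial_deriv_cong[OF U Cons.prems]) (rule Cons.IH)
  also have "\<dots> = c * partial_deriv i (iter_partial_deriv js f) x"
    using f Cons.prems by (intro partial_deriv_cmult) (auto simp: smooth_on_def)
  finally show ?case by simp
qed simp

lemma iter_partial_deriv_zero: "iter_partial_deriv is (\<lambda>x. 0) = (\<lambda>x. 0)"
proof (induction "is")
  case (Cons i "is")
  have "partial_deriv i (\<lambda>x :: real ^ 'a. 0) = (\<lambda>x. 0)" by (rule ext) simp
  then show ?case by (simp add: Cons.IH)
qed simp

section \<open>Homogeneous functions off the origin\<close>

definition homogeneous :: "real \<Rightarrow> (real ^ 'n::finite \<Rightarrow> real) \<Rightarrow> bool" where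
  "homogeneous m P \<longleftrightarrow> smooth_on (- {0}) P \<and> (\<forall>c>0. \<forall>y. y \<noteq> 0 \<longrightarrow> P (c *\<^sub>R y) = c powr m * P y)"

lemma homogeneous_smooth: "homogeneous m P \<Longrightarrow> smooth_on (- {0}) P"
  by (simp add: homogeneous_def)

lemma homogeneous_mult:
  "homogeneous m P \<Longrightarrow> homogeneous l Q \<Longrightarrow> homogeneous (m + l) (\<lambda>y. P y * Q y)"
  by (auto simp: homogeneous_def powr_add intro: smooth_on_mult)

lemma homogeneous_norm_powr: "homogeneous m (\<lambda>y. norm y powr m)"
  by (auto simp: homogeneous_def powr_mult intro: smooth_on_norm_powr)

lemma homogeneous_one: "homogeneous 0 (\<lambda>y. 1)"
  by (auto simp: homogeneous_def intro: smooth_on_const)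

text \<open>Also covers \<open>ln (norm y)\<close>, which is homogeneous of degree zero only up to constants.\<close>

lemma homogeneous_partial_gen:
  fixes P :: "real ^ 'n::finite \<Rightarrow> real"
  assumes P: "smooth_on (- {0}) P"
    and hom: "\<And>c y. c > 0 \<Longrightarrow> y \<noteq> 0 \<Longrightarrow> P (c *\<^sub>R y) = c powr m * P y + b c"
  shows "homogeneous (m - 1) (partial_deriv i P)"
  unfolding homogeneous_def
proof (intro conjI allI impI)
  show "smooth_on (- {0}) (partial_deriv i P)" by (rule smooth_on_partial[OF P])
  fix c :: real and y :: "real ^ 'n" assume c: "c > 0" and y: "y \<noteq> 0"
  have "c * partial_deriv i P (c *\<^sub>R y) = partial_deriv i (\<lambda>y. P (0 + c *\<^sub>R y)) y"
    using iter_partial_deriv_scale[OF _ P, of 0 c y "[i]"] c y by simp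
  also have "\<dots> = partial_deriv i (\<lambda>y. c powr m * P y + b c) y"
    by (rule partial_deriv_cong[of "- {0}"]) (use hom c y in auto)
  also have "\<dots> = c powr m * partial_deriv i P y"
    using smooth_on_differentiable[OF P, of y] y
    by (subst partial_deriv_add) (auto simp: partial_deriv_cmult intro: differentiable_mult)
  finally show "partial_deriv i P (c *\<^sub>R y) = c powr (m - 1) * partial_deriv i P y"
    using c by (simp add: powr_diff field_simps)
qed

lemma homogeneous_partial:
  "homogeneous m P \<Longrightarrow> homogeneous (m - 1) (partial_deriv i P)"
  by (rule homogeneous_partial_gen[where b = "\<lambda>_. 0"]) (auto simp: homogeneous_def)

lemma homogeneous_iter:
  "homogeneous m P \<Longrightarrow> homogeneous (m - real (length is)) (iter_partial_deriv is P)"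
proof (induction "is")
  case (Cons i "is")
  from homogeneous_partial[OF Cons.IH[OF Cons.prems], of i] show ?case by (simp add: algebra_simps)
qed simp

lemma homogeneous_partial_ln: "homogeneous (- 1) (partial_deriv i (\<lambda>y. ln (norm y)))"
  using homogeneous_partial_gen[OF smooth_on_ln_norm, of 0 ln i] by (simp add: ln_mult)

lemma homogeneous_iter_ln:
  assumes "is \<noteq> []"
  shows "homogeneous (- real (length is)) (iter_partial_deriv is (\<lambda>y. ln (norm y)))"
proof -
  obtain js i where "is": "is = js @ [i]" using assms by (metis rev_exhaust)
  show ?thesis
    using homogeneous_iter[OF homogeneous_partial_ln[of i], of js] by (simp add: "is" iter_partial_deriv_append)
qed

text \<open>Continuity gives a bound on the unit sphere, and homogeneity carries it along the
  rays.\<close>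

lemma homogeneous_bound:
  fixes P :: "real ^ 'n::finite \<Rightarrow> real"
  assumes P: "homogeneous m P"
  obtains C where "C \<ge> 0" "\<And>y. y \<noteq> 0 \<Longrightarrow> \<bar>P y\<bar> \<le> C * norm y powr m"
proof -
  have "continuous_on (sphere 0 1) P"
    by (rule continuous_on_subset[OF smooth_on_continuous_on[OF homogeneous_smooth[OF P]]]) auto
  then have "bounded (P ` sphere 0 1)" by (intro compact_imp_bounded compact_continuous_image) auto
  then obtain C where C: "\<forall>y\<in>P ` sphere 0 1. norm y \<le> C" by (auto simp: bounded_iff)
  show thesis
  proof (rule that[of "max C 0"])
    fix y :: "real ^ 'n" assume y: "y \<noteq> 0"
    define z where "z = y /\<^sub>R norm y"
    have z: "norm z = 1" "norm y *\<^sub>R z = y" using y by (auto simp: z_def)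
    then have z0: "z \<noteq> 0" by auto
    have "P (norm y *\<^sub>R z) = norm y powr m * P z"
      using P y z0 unfolding homogeneous_def by (metis zero_less_norm_iff)
    moreover have "\<bar>P z\<bar> \<le> max C 0" using C z(1) by (force simp: max_def)
    ultimately show "\<bar>P y\<bar> \<le> max C 0 * norm y powr m"
      using z(2) by (simp add: abs_mult mult.commute mult_right_mono)
  qed simp
qed

section \<open>Products with a slowly varying cutoff\<close>

definition cutoff :: "real \<Rightarrow> (real \<Rightarrow> real) \<Rightarrow> bool" where
  "cutoff \<tau> f \<longleftrightarrow> smooth1_on UNIV f \<and> (\<forall>t. t > - \<tau> \<longrightarrow> f t = 0) \<and> (\<exists>c. \<forall>t. t < - 1 \<longrightarrow> f t = c)"

lemma cutoff_deriv_left: "cutoff \<tau> f \<Longrightarrow> t < -1 \<Longrightarrow> deriv f t = 0"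
proof -
  assume f: "cutoff \<tau> f" and t: "t < -1"
  then obtain c where c: "\<forall>t. t < - 1 \<longrightarrow> f t = c" by (auto simp: cutoff_def)
  have "\<forall>\<^sub>F s in nhds t. f s = c"
    by (rule eventually_mono[OF eventually_nhds_in_open[of "{..< - 1}"]]) (use c t in auto)
  then have "deriv f t = deriv (\<lambda>_. c) t" by (rule deriv_cong_ev) simp
  then show ?thesis by simp
qed

lemma cutoff_deriv_right: "cutoff \<tau> f \<Longrightarrow> t > - \<tau> \<Longrightarrow> deriv f t = 0"
proof -
  assume f: "cutoff \<tau> f" and t: "t > - \<tau>"
  then have c: "\<forall>t. t > - \<tau> \<longrightarrow> f t = 0" by (auto simp: cutoff_def)
  have "\<forall>\<^sub>F s in nhds t. f s = 0"
    by (rule eventually_mono[OF eventually_nhds_in_open[of "{- \<tau> <..}"]]) (use c t in auto)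
  then have "deriv f t = deriv (\<lambda>_. 0) t" by (rule deriv_cong_ev) simp
  then show ?thesis by simp
qed

text \<open>The left-hand constant in \<open>cutoff\<close> is arbitrary so that the class contains
  profiles starting at 1 as well as all their derivatives, which start at 0. Estimates for the class
  can then be iterated.\<close>

lemma cutoff_deriv: "cutoff \<tau> f \<Longrightarrow> cutoff \<tau> (deriv f)"
  using cutoff_deriv_left[of \<tau> f] cutoff_deriv_right[of \<tau> f] smooth1_on_deriv[of UNIV f]
  by (auto simp: cutoff_def)

lemma cutoff_bounded:
  assumes "cutoff \<tau> f"
  obtains B where "B \<ge> 0" "\<And>t. \<bar>f t\<bar> \<le> B"
proof -
  have s: "smooth1_on UNIV f" and r: "\<forall>t. t > - \<tau> \<longrightarrow> f t = 0" using assms by (auto simp: cutoff_def)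
  obtain c where c: "\<forall>t. t < - 1 \<longrightarrow> f t = c" using assms by (auto simp: cutoff_def)
  have "continuous_on {-1..-\<tau>} f"
    using smooth1_on_isCont[OF s] by (intro continuous_at_imp_continuous_on) auto
  then have "bounded (f ` {-1..-\<tau>})" by (intro compact_imp_bounded compact_continuous_image) auto
  then obtain B where B: "\<forall>y\<in>f ` {-1..-\<tau>}. norm y \<le> B" by (auto simp: bounded_iff)
  show thesis
  proof (rule that[of "max \<bar>c\<bar> B"])
    fix t
    consider "t < -1" | "t > - \<tau>" | "t \<in> {-1..-\<tau>}" by force
    then show "\<bar>f t\<bar> \<le> max \<bar>c\<bar> B" using c r B by cases (auto simp: le_max_iff_disj)
  qed simp
qed

abbreviation log_scale :: "(real \<Rightarrow> real) \<Rightarrow> real \<Rightarrow> real ^ 'n::finite \<Rightarrow> real" where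
  "log_scale f \<delta> y \<equiv> f (\<delta> * ln (norm y))"

lemma smooth_on_log_scale:
  assumes "smooth1_on UNIV f"
  shows "smooth_on (- {0}) (\<lambda>y :: real ^ 'n::finite. log_scale f \<delta> y)"
  by (rule smooth_on_compose1[OF _ _ assms]) (auto intro: smooth_on_cmult smooth_on_ln_norm)

lemma partial_log_scale:
  fixes y :: "real ^ 'n::finite"
  assumes "smooth1_on UNIV f" "y \<noteq> 0"
  shows "partial_deriv i (\<lambda>y. log_scale f \<delta> y) y =
    \<delta> * (log_scale (deriv f) \<delta> y * partial_deriv i (\<lambda>y. ln (norm y)) y)"
proof -
  have d: "(\<lambda>y :: real ^ 'n. ln (norm y)) differentiable (at y)"
    using smooth_on_differentiable[OF smooth_on_ln_norm] assms(2) by auto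
  have "partial_deriv i (\<lambda>y. f (\<delta> * ln (norm y))) y =
      deriv f (\<delta> * ln (norm y)) * partial_deriv i (\<lambda>y. \<delta> * ln (norm y)) y"
    using d smooth1_on_differentiable[OF assms(1)]
    by (intro partial_deriv_compose differentiable_mult) auto
  then show ?thesis by (simp add: partial_deriv_cmult[OF d])
qed

lemma open_log_scale: "open {y :: real ^ 'n::finite. y \<noteq> 0 \<and> a < \<delta> * ln (norm y)}"
  "open {y :: real ^ 'n::finite. y \<noteq> 0 \<and> \<delta> * ln (norm y) < a}"
proof -
  have c: "continuous_on (- {0}) (\<lambda>y :: real ^ 'n. \<delta> * ln (norm y))"
    by (intro continuous_intros) auto
  have "open (- {0} \<inter> (\<lambda>y :: real ^ 'n. \<delta> * ln (norm y)) -` {a<..})"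
    "open (- {0} \<inter> (\<lambda>y :: real ^ 'n. \<delta> * ln (norm y)) -` {..<a})"
    by (intro continuous_open_preimage[OF c]; simp)+
  moreover have "- {0} \<inter> (\<lambda>y :: real ^ 'n. \<delta> * ln (norm y)) -` {a<..} = {y. y \<noteq> 0 \<and> a < \<delta> * ln (norm y)}"
    "- {0} \<inter> (\<lambda>y :: real ^ 'n. \<delta> * ln (norm y)) -` {..<a} = {y. y \<noteq> 0 \<and> \<delta> * ln (norm y) < a}" by auto
  ultimately show "open {y :: real ^ 'n. y \<noteq> 0 \<and> a < \<delta> * ln (norm y)}"
    "open {y :: real ^ 'n. y \<noteq> 0 \<and> \<delta> * ln (norm y) < a}" by simp_all
qed

lemma iter_log_scale_vanish:
  fixes y :: "real ^ 'n::finite"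
  assumes f: "cutoff \<tau> f" and y: "y \<noteq> 0" "\<delta> * ln (norm y) > - \<tau>"
  shows "iter_partial_deriv is (\<lambda>y. \<phi> y * log_scale f \<delta> y * P y) y = 0"
  using iter_partial_deriv_cong[OF open_log_scale(1)[where a = "- \<tau>" and \<delta> = \<delta>], of _ "\<lambda>_. 0" y "is"] assms
  by (auto simp: iter_partial_deriv_zero cutoff_def)

lemma iter_log_scale_deriv_vanish:
  fixes y :: "real ^ 'n::finite"
  assumes f: "cutoff \<tau> f" and y: "y \<noteq> 0" "\<delta> * ln (norm y) < - 1"
  shows "iter_partial_deriv is (\<lambda>y. \<phi> y * log_scale (deriv f) \<delta> y * P y) y = 0"
  using iter_partial_deriv_cong[OF open_log_scale(2)[where a = "- 1" and \<delta> = \<delta>], of _ "\<lambda>_. 0" y "is"] y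
  by (auto simp: iter_partial_deriv_zero cutoff_deriv_left[OF f])

lemma smooth_on_log_scale_product:
  assumes "smooth_on UNIV \<phi>" "smooth1_on UNIV f" "smooth_on (- {0}) P"
  shows "smooth_on (- {0}) (\<lambda>y :: real ^ 'n::finite. \<phi> y * log_scale f \<delta> y * P y)"
  by (intro smooth_on_mult smooth_on_log_scale assms smooth_on_subset[OF assms(1)]) auto

text \<open>The innermost derivative is expanded by the product rule into three terms of the same
  shape: it falls on the smooth factor, on the slow one, which yields the factor \<delta>, or on the
  homogeneous one. The inductions that follow therefore remove indices from the end of the
  list.\<close>

lemma iter_snoc_log_scale:
  fixes y :: "real ^ 'n::finite"
  assumes \<phi>: "smooth_on UNIV \<phi>" and f: "smooth1_on UNIV f" and P: "smooth_on (- {0}) P" and y: "y \<noteq> 0"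
  shows "iter_partial_deriv (is @ [i]) (\<lambda>y. \<phi> y * log_scale f \<delta> y * P y) y =
      iter_partial_deriv is (\<lambda>y. partial_deriv i \<phi> y * log_scale f \<delta> y * P y) y
    + \<delta> * iter_partial_deriv is (\<lambda>y. \<phi> y * log_scale (deriv f) \<delta> y * (partial_deriv i (\<lambda>y. ln (norm y)) y * P y)) y
    + iter_partial_deriv is (\<lambda>y. \<phi> y * log_scale f \<delta> y * partial_deriv i P y) y"
proof -
  let ?U = "- {0} :: (real ^ 'n) set"
  let ?a = "\<lambda>y. partial_deriv i \<phi> y * log_scale f \<delta> y * P y"
  let ?b = "\<lambda>y. \<phi> y * log_scale (deriv f) \<delta> y * (partial_deriv i (\<lambda>y. ln (norm y)) y * P y)"
  let ?c = "\<lambda>y. \<phi> y * log_scale f \<delta> y * partial_deriv i P y"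
  have s: "smooth_on ?U ?a" "smooth_on ?U ?b" "smooth_on ?U ?c"
    by (intro smooth_on_log_scale_product smooth_on_partial smooth_on_mult smooth_on_ln_norm
        smooth1_on_deriv \<phi> f P open_minus_zero)+
  have "partial_deriv i (\<lambda>y. \<phi> y * log_scale f \<delta> y * P y) z = (?a z + \<delta> * ?b z) + ?c z" if z: "z \<in> ?U" for z
  proof -
    have d: "\<phi> differentiable (at z)" "(\<lambda>y. log_scale f \<delta> y) differentiable (at z)" "P differentiable (at z)"
      using smooth_on_differentiable[OF \<phi>] smooth_on_differentiable[OF smooth_on_log_scale[OF f] z]
        smooth_on_differentiable[OF P z] by auto
    have "partial_deriv i (\<lambda>y. \<phi> y * log_scale f \<delta> y * P y) z =
      (partial_deriv i \<phi> z * log_scale f \<delta> z + \<phi> z * partial_deriv i (\<lambda>y. log_scale f \<delta> y) z) * P z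
      + \<phi> z * log_scale f \<delta> z * partial_deriv i P z"
      using d by (simp add: partial_deriv_mult)
    then show ?thesis using z by (simp add: partial_log_scale[OF f] algebra_simps)
  qed
  then have "iter_partial_deriv (is @ [i]) (\<lambda>y. \<phi> y * log_scale f \<delta> y * P y) y =
      iter_partial_deriv is (\<lambda>z. (?a z + \<delta> * ?b z) + ?c z) y"
    unfolding iter_partial_deriv_append iter_partial_deriv_Cons iter_partial_deriv_Nil
    by (intro iter_partial_deriv_cong[OF open_minus_zero]) (use y in auto)
  also have "\<dots> = iter_partial_deriv is ?a y + \<delta> * iter_partial_deriv is ?b y + iter_partial_deriv is ?c y"
    using s y by (simp add: iter_partial_deriv_add[of ?U] iter_partial_deriv_cmult[of ?U] smooth_on_add smooth_on_cmult)
  finally show ?thesis .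
qed

text \<open>Where a profile does not vanish, |y| is exponentially small in 1/\<delta>. The
  inequality s \<le> exp(s) weakens this to the linear bound \<delta>/\<tau>, by which a spare power
  of |y| is traded for a factor \<delta>.\<close>

lemma norm_le_of_log_scale:
  fixes y :: "real ^ 'n::finite"
  assumes "y \<noteq> 0" "\<delta> > 0" "\<tau> > 0" "\<delta> * ln (norm y) \<le> - \<tau>"
  shows "norm y \<le> \<delta> / \<tau>" "norm y \<le> exp (- \<tau> / \<delta>)" "norm y < 1"
proof -
  have l: "ln (norm y) \<le> - \<tau> / \<delta>" using assms by (simp add: field_simps)
  then show e: "norm y \<le> exp (- \<tau> / \<delta>)" using assms by (metis exp_le_cancel_iff exp_ln zero_less_norm_iff)
  have "\<tau> / \<delta> \<le> exp (\<tau> / \<delta>)" using exp_ge_add_one_self[of "\<tau> / \<delta>"] by linarith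
  then have "exp (- \<tau> / \<delta>) \<le> \<delta> / \<tau>" using assms by (simp add: exp_minus field_simps)
  with e show "norm y \<le> \<delta> / \<tau>" by linarith
  have "exp (- \<tau> / \<delta>) < 1" using assms by simp
  with e show "norm y < 1" by linarith
qed

text \<open>A derivative on the homogeneous factor lowers the degree by one; one on the slow factor
  does the same, with an extra \<delta> \<le> 1; one on \<phi> leaves a higher power of |y|,
  harmless because |y| \<le> 1 on the support. Hence the bound is uniform in \<delta>.\<close>

lemma iter_log_scale_bound:
  fixes \<phi> P :: "real ^ 'n::finite \<Rightarrow> real"
  assumes \<tau>: "\<tau> > 0"
  shows "smooth_on UNIV \<phi> \<Longrightarrow> cutoff \<tau> f \<Longrightarrow> homogeneous m P \<Longrightarrow>
    \<exists>C\<ge>0. \<forall>\<delta> y. 0 < \<delta> \<longrightarrow> \<delta> \<le> 1 \<longrightarrow> y \<noteq> 0 \<longrightarrow>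
      \<bar>iter_partial_deriv is (\<lambda>y. \<phi> y * log_scale f \<delta> y * P y) y\<bar> \<le> C * norm y powr (m - real (length is))"
proof (induction "is" arbitrary: \<phi> f m P rule: rev_induct)
  case Nil
  have "continuous_on (cball 0 1) \<phi>"
    by (rule continuous_on_subset[OF smooth_on_continuous_on[OF Nil(1)]]) auto
  then have "bounded (\<phi> ` cball 0 1)" by (intro compact_imp_bounded compact_continuous_image) auto
  then obtain B where B: "\<forall>y\<in>\<phi> ` cball 0 1. norm y \<le> B" by (auto simp: bounded_iff)
  obtain B' where B': "B' \<ge> 0" "\<And>t. \<bar>f t\<bar> \<le> B'" using cutoff_bounded[OF Nil(2)] by blast
  obtain C where C: "C \<ge> 0" "\<And>y. y \<noteq> 0 \<Longrightarrow> \<bar>P y\<bar> \<le> C * norm y powr m" using homogeneous_bound[OF Nil(3)] by blast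
  have B0: "B \<ge> 0" using B[rule_format, of "\<phi> 0"] by (auto intro: order_trans[OF abs_ge_zero])
  show ?case
  proof (intro exI[of _ "B * B' * C"] conjI allI impI)
    show "0 \<le> B * B' * C" using B0 B' C by simp
    fix \<delta> :: real and y :: "real ^ 'n" assume *: "0 < \<delta>" "\<delta> \<le> 1" "y \<noteq> 0"
    show "\<bar>iter_partial_deriv [] (\<lambda>y. \<phi> y * log_scale f \<delta> y * P y) y\<bar> \<le> B * B' * C * norm y powr (m - real (length []))"
    proof (cases "\<delta> * ln (norm y) > - \<tau>")
      case True
      then have "f (\<delta> * ln (norm y)) = 0" using Nil(2) by (auto simp: cutoff_def)
      then show ?thesis using B0 B' C by simp
    next
      case False
      then have "norm y \<le> 1" using norm_le_of_log_scale[OF *(3,1) \<tau>] by simp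
      then have "\<bar>\<phi> y\<bar> \<le> B" using B by auto
      then have "\<bar>\<phi> y\<bar> * \<bar>log_scale f \<delta> y\<bar> * \<bar>P y\<bar> \<le> B * B' * (C * norm y powr m)"
        using B0 B' C *(3) by (intro mult_mono) auto
      then show ?thesis by (simp add: abs_mult mult.assoc)
    qed
  qed
next
  case (snoc i "is")
  let ?l = "real (length is)"
  have Q: "homogeneous (m - 1) (\<lambda>y. partial_deriv i (\<lambda>y. ln (norm y)) y * P y)"
    using homogeneous_mult[OF homogeneous_partial_ln[of i] snoc(4)] by (simp add: algebra_simps)
  obtain C1 where C1: "C1 \<ge> 0" "\<And>\<delta> y. 0 < \<delta> \<Longrightarrow> \<delta> \<le> 1 \<Longrightarrow> y \<noteq> 0 \<Longrightarrow>
      \<bar>iter_partial_deriv is (\<lambda>y. partial_deriv i \<phi> y * log_scale f \<delta> y * P y) y\<bar> \<le> C1 * norm y powr (m - ?l)"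
    using snoc.IH[OF smooth_on_partial[OF snoc(2)] snoc(3,4)] by blast
  obtain C2 where C2: "C2 \<ge> 0" "\<And>\<delta> y. 0 < \<delta> \<Longrightarrow> \<delta> \<le> 1 \<Longrightarrow> y \<noteq> 0 \<Longrightarrow>
      \<bar>iter_partial_deriv is (\<lambda>y. \<phi> y * log_scale (deriv f) \<delta> y * (partial_deriv i (\<lambda>y. ln (norm y)) y * P y)) y\<bar>
        \<le> C2 * norm y powr (m - 1 - ?l)"
    using snoc.IH[OF snoc(2) cutoff_deriv[OF snoc(3)] Q] by blast
  obtain C3 where C3: "C3 \<ge> 0" "\<And>\<delta> y. 0 < \<delta> \<Longrightarrow> \<delta> \<le> 1 \<Longrightarrow> y \<noteq> 0 \<Longrightarrow>
      \<bar>iter_partial_deriv is (\<lambda>y. \<phi> y * log_scale f \<delta> y * partial_deriv i P y) y\<bar> \<le> C3 * norm y powr (m - 1 - ?l)"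
    using snoc.IH[OF snoc(2,3) homogeneous_partial[OF snoc(4)], of i] by blast
  show ?case
  proof (intro exI[of _ "C1 + C2 + C3"] conjI allI impI)
    show "0 \<le> C1 + C2 + C3" using C1 C2 C3 by simp
    fix \<delta> :: real and y :: "real ^ 'n" assume *: "0 < \<delta>" "\<delta> \<le> 1" "y \<noteq> 0"
    show "\<bar>iter_partial_deriv (is @ [i]) (\<lambda>y. \<phi> y * log_scale f \<delta> y * P y) y\<bar>
      \<le> (C1 + C2 + C3) * norm y powr (m - real (length (is @ [i])))"
    proof (cases "\<delta> * ln (norm y) > - \<tau>")
      case True
      then show ?thesis
        using iter_log_scale_vanish[OF snoc(3) *(3), of \<delta> "is @ [i]" \<phi> P] C1 C2 C3 by simp
    next
      case False
      then have y1: "norm y \<le> 1" using norm_le_of_log_scale[OF *(3,1) \<tau>] by simp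
      let ?N = "norm y powr (m - 1 - ?l)"
      have "norm y powr (m - ?l) \<le> ?N" using y1 *(3) by (intro powr_mono') auto
      then have b1: "\<bar>iter_partial_deriv is (\<lambda>y. partial_deriv i \<phi> y * log_scale f \<delta> y * P y) y\<bar> \<le> C1 * ?N"
        using C1(2)[OF *] mult_left_mono[OF _ C1(1)] by (meson order_trans)
      let ?b = "iter_partial_deriv is (\<lambda>y. \<phi> y * log_scale (deriv f) \<delta> y * (partial_deriv i (\<lambda>y. ln (norm y)) y * P y)) y"
      have b2: "\<bar>\<delta> * ?b\<bar> \<le> C2 * ?N"
        using C2(2)[OF *] mult_mono[of \<delta> 1 "\<bar>?b\<bar>" "C2 * ?N"] * by (simp add: abs_mult)
      have "\<bar>iter_partial_deriv (is @ [i]) (\<lambda>y. \<phi> y * log_scale f \<delta> y * P y) y\<bar> \<le> C1 * ?N + C2 * ?N + C3 * ?N"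
        using iter_snoc_log_scale[OF snoc(2) _ homogeneous_smooth[OF snoc(4)] *(3), of f "is" i \<delta>]
          b1 b2 C3(2)[OF *] snoc(3) by (simp add: cutoff_def)
      then show ?thesis by (simp add: algebra_simps)
    qed
  qed
qed

text \<open>Derivatives falling on the slowly varying factor \<open>log_scale f \<delta>\<close> gain a factor \<open>\<delta>\<close>; derivatives falling
  on \<open>\<phi>\<close> gain \<open>norm y\<close>, which is at most \<open>\<delta> / \<tau>\<close> where \<open>log_scale f \<delta>\<close> does not vanish.\<close>

lemma iter_log_scale_expansion:
  fixes \<phi> P :: "real ^ 'n::finite \<Rightarrow> real"
  assumes \<tau>: "\<tau> > 0"
  shows "smooth_on UNIV \<phi> \<Longrightarrow> cutoff \<tau> f \<Longrightarrow> homogeneous m P \<Longrightarrow>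
    \<exists>C\<ge>0. \<forall>\<delta> y. 0 < \<delta> \<longrightarrow> \<delta> \<le> 1 \<longrightarrow> y \<noteq> 0 \<longrightarrow>
      \<bar>iter_partial_deriv is (\<lambda>y. \<phi> y * log_scale f \<delta> y * P y) y - \<phi> y * log_scale f \<delta> y * iter_partial_deriv is P y\<bar>
        \<le> C * \<delta> * norm y powr (m - real (length is))"
proof (induction "is" arbitrary: \<phi> f m P rule: rev_induct)
  case Nil
  show ?case by (rule exI[of _ 0]) simp
next
  case (snoc i "is")
  let ?l = "real (length is)"
  have Q: "homogeneous (m - 1) (\<lambda>y. partial_deriv i (\<lambda>y. ln (norm y)) y * P y)"
    using homogeneous_mult[OF homogeneous_partial_ln[of i] snoc(4)] by (simp add: algebra_simps)
  obtain C1 where C1: "C1 \<ge> 0" "\<And>\<delta> y. 0 < \<delta> \<Longrightarrow> \<delta> \<le> 1 \<Longrightarrow> y \<noteq> 0 \<Longrightarrow>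
      \<bar>iter_partial_deriv is (\<lambda>y. partial_deriv i \<phi> y * log_scale f \<delta> y * P y) y\<bar> \<le> C1 * norm y powr (m - ?l)"
    using iter_log_scale_bound[OF \<tau> smooth_on_partial[OF snoc(2)] snoc(3,4)] by blast
  obtain C2 where C2: "C2 \<ge> 0" "\<And>\<delta> y. 0 < \<delta> \<Longrightarrow> \<delta> \<le> 1 \<Longrightarrow> y \<noteq> 0 \<Longrightarrow>
      \<bar>iter_partial_deriv is (\<lambda>y. \<phi> y * log_scale (deriv f) \<delta> y * (partial_deriv i (\<lambda>y. ln (norm y)) y * P y)) y\<bar>
        \<le> C2 * norm y powr (m - 1 - ?l)"
    using iter_log_scale_bound[OF \<tau> snoc(2) cutoff_deriv[OF snoc(3)] Q] by blast
  obtain C3 where C3: "C3 \<ge> 0" "\<And>\<delta> y. 0 < \<delta> \<Longrightarrow> \<delta> \<le> 1 \<Longrightarrow> y \<noteq> 0 \<Longrightarrow>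
      \<bar>iter_partial_deriv is (\<lambda>y. \<phi> y * log_scale f \<delta> y * partial_deriv i P y) y
        - \<phi> y * log_scale f \<delta> y * iter_partial_deriv is (partial_deriv i P) y\<bar> \<le> C3 * \<delta> * norm y powr (m - 1 - ?l)"
    using snoc.IH[OF snoc(2,3) homogeneous_partial[OF snoc(4)], of i] by blast
  show ?case
  proof (intro exI[of _ "C1 / \<tau> + C2 + C3"] conjI allI impI)
    show "0 \<le> C1 / \<tau> + C2 + C3" using C1 C2 C3 \<tau> by simp
    fix \<delta> :: real and y :: "real ^ 'n" assume *: "0 < \<delta>" "\<delta> \<le> 1" "y \<noteq> 0"
    let ?N = "norm y powr (m - 1 - ?l)"
    show "\<bar>iter_partial_deriv (is @ [i]) (\<lambda>y. \<phi> y * log_scale f \<delta> y * P y) y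
      - \<phi> y * log_scale f \<delta> y * iter_partial_deriv (is @ [i]) P y\<bar>
      \<le> (C1 / \<tau> + C2 + C3) * \<delta> * norm y powr (m - real (length (is @ [i])))"
    proof (cases "\<delta> * ln (norm y) > - \<tau>")
      case True
      then have "log_scale f \<delta> y = 0" using snoc(3) by (auto simp: cutoff_def)
      with True show ?thesis
        using iter_log_scale_vanish[OF snoc(3) *(3), of \<delta> "is @ [i]" \<phi> P] C1 C2 C3 \<tau> * by simp
    next
      case False
      then have y1: "norm y \<le> \<delta> / \<tau>" using norm_le_of_log_scale[OF *(3,1) \<tau>] by simp
      have "norm y powr (m - ?l) = norm y powr (1 + (m - 1 - ?l))" by simp
      also have "\<dots> = norm y * ?N" using *(3) by (simp only: powr_add) simp
      also have "\<dots> \<le> \<delta> / \<tau> * ?N" by (rule mult_right_mono[OF y1]) simp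
      finally have b1: "\<bar>iter_partial_deriv is (\<lambda>y. partial_deriv i \<phi> y * log_scale f \<delta> y * P y) y\<bar> \<le> C1 * (\<delta> / \<tau> * ?N)"
        using C1(2)[OF *] mult_left_mono[OF _ C1(1)] by (meson order_trans)
      let ?b = "iter_partial_deriv is (\<lambda>y. \<phi> y * log_scale (deriv f) \<delta> y * (partial_deriv i (\<lambda>y. ln (norm y)) y * P y)) y"
      have b2: "\<bar>\<delta> * ?b\<bar> \<le> \<delta> * (C2 * ?N)"
        using C2(2)[OF *] * by (simp add: abs_mult)
      have "\<bar>iter_partial_deriv (is @ [i]) (\<lambda>y. \<phi> y * log_scale f \<delta> y * P y) y
          - \<phi> y * log_scale f \<delta> y * iter_partial_deriv (is @ [i]) P y\<bar>
        \<le> C1 * (\<delta> / \<tau> * ?N) + \<delta> * (C2 * ?N) + C3 * \<delta> * ?N"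
        using iter_snoc_log_scale[OF snoc(2) _ homogeneous_smooth[OF snoc(4)] *(3), of f "is" i \<delta>]
          b1 b2 C3(2)[OF *] snoc(3) by (simp add: cutoff_def iter_partial_deriv_append)
      then show ?thesis by (simp add: algebra_simps)
    qed
  qed
qed

section \<open>Polar coordinates in the logarithm of the radius\<close>

lemma omega_eq: "omega TYPE('n::finite) = unit_ball_vol (real CARD('n))"
proof -
  have "measure lborel (ball (0 :: real ^ 'n) 1) = unit_ball_vol (real DIM(real ^ 'n)) * 1 ^ DIM(real ^ 'n)"
    by (rule content_ball) simp
  then show ?thesis by (simp add: omega_def)
qed

lemma omega_pos: "omega TYPE('n::finite) > 0"
  by (simp add: omega_eq)

lemma emeasure_ball_omega:
  "r \<ge> 0 \<Longrightarrow> emeasure lborel (ball (x :: real ^ 'n::finite) r) = ennreal (omega TYPE('n) * r ^ CARD('n))"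
  using emeasure_ball[of r x] by (simp add: omega_eq)

lemma emeasure_cball_omega:
  "r \<ge> 0 \<Longrightarrow> emeasure lborel (cball (x :: real ^ 'n::finite) r) = ennreal (omega TYPE('n) * r ^ CARD('n))"
  using emeasure_cball[of r x] by (simp add: omega_eq)

text \<open>Polar coordinates for radial functions in terms of measures: the set where |y|^n \<le> s
  is a ball of volume \<omega> s, so |y|^n has constant density \<omega> on the half-line.\<close>

lemma distr_norm_power:
  "distr lborel borel (\<lambda>y :: real ^ 'n::finite. norm y ^ CARD('n)) =
    density lborel (\<lambda>s. ennreal (omega TYPE('n)) * indicator {0..} s)" (is "?M = ?N")
proof (rule measure_eqI_generator_eq[where E = "range atMost" and \<Omega> = UNIV and A = "\<lambda>i. {..real i}"])
  let ?n = "CARD('n)"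
  have n: "?n > 0" by simp
  have M: "emeasure ?M {..s} = ennreal (omega TYPE('n) * max 0 s)" for s
  proof -
    have "emeasure ?M {..s} = emeasure lborel {y :: real ^ 'n. norm y ^ ?n \<le> s}"
      by (subst emeasure_distr) (auto simp: vimage_def)
    also have "\<dots> = ennreal (omega TYPE('n) * max 0 s)"
    proof (cases "s \<ge> 0")
      case True
      have "norm y ^ ?n \<le> s \<longleftrightarrow> norm y \<le> root ?n s" for y :: "real ^ 'n"
        using True real_root_le_iff[OF n, of "norm y ^ ?n" s] by (simp add: real_root_power_cancel[OF n])
      then have "{y :: real ^ 'n. norm y ^ ?n \<le> s} = {y. norm y \<le> root ?n s}" by (intro Collect_cong)
      also have "\<dots> = cball 0 (root ?n s)" by (auto simp: dist_norm)
      finally have "{y :: real ^ 'n. norm y ^ ?n \<le> s} = cball 0 (root ?n s)" .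
      then show ?thesis using True by (simp add: emeasure_cball_omega)
    next
      case False
      have "\<not> norm y ^ ?n \<le> s" for y :: "real ^ 'n"
        using False zero_le_power[OF norm_ge_zero, of y ?n] by linarith
      then have "{y :: real ^ 'n. norm y ^ ?n \<le> s} = {}" by simp
      then show ?thesis using False by simp
    qed
    finally show ?thesis .
  qed
  have N: "emeasure ?N {..s} = ennreal (omega TYPE('n) * max 0 s)" for s
  proof -
    have i: "indicator {0..} x * indicator {..s} x = (indicator {0..s} x :: ennreal)" for x
      by (simp add: indicator_def)
    have "emeasure ?N {..s} = (\<integral>\<^sup>+x. ennreal (omega TYPE('n)) * (indicator {0..} x * indicator {..s} x) \<partial>lborel)"
      by (subst emeasure_density) (auto simp: mult.assoc)
    also have "\<dots> = ennreal (omega TYPE('n)) * (\<integral>\<^sup>+x. indicator {0..s} x \<partial>lborel)"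
      unfolding i by (rule nn_integral_cmult) auto
    also have "\<dots> = ennreal (omega TYPE('n) * max 0 s)"
      by (auto simp: ennreal_mult' omega_pos less_imp_le max_def)
    finally show ?thesis .
  qed
  show "Int_stable (range atMost :: real set set)" by (auto simp: Int_stable_def)
  show "emeasure ?M X = emeasure ?N X" if "X \<in> range atMost" for X using that M N by auto
  show "sets ?M = sigma_sets UNIV (range atMost)" "sets ?N = sigma_sets UNIV (range atMost)"
    by (simp_all add: borel_eq_atMost)
  show "(\<Union>i. {..real i}) = UNIV" by (auto intro: real_arch_simple)
  show "emeasure ?M {..real i} \<noteq> \<infinity>" for i by (simp add: M)
qed auto

text \<open>The substitution s = |y|^n turns |y|^(-n) dy into \<omega> ds / s; the factor n appears
  because ln s = n ln |y|.\<close>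

lemma shell_integral:
  assumes "l \<le> u"
  shows "(\<integral>\<^sup>+y. indicator {l<..<u} (ln (norm y)) * ennreal (norm y powr - real CARD('n::finite)) \<partial>(lborel :: (real ^ 'n) measure)) =
    ennreal (real CARD('n) * omega TYPE('n) * (u - l))" (is "?I = _")
proof -
  let ?n = "real CARD('n)"
  define g where "g = (\<lambda>s. indicator {exp (?n * l)<..<exp (?n * u)} s * ennreal (1 / s))"
  have g [measurable]: "g \<in> borel_measurable borel" by (simp add: g_def)
  have "indicator {l<..<u} (ln (norm y)) * ennreal (norm y powr - ?n) = g (norm y ^ CARD('n))" for y :: "real ^ 'n"
  proof (cases "y = 0")
    case False
    have p: "norm y ^ CARD('n) = exp (?n * ln (norm y))"
      using False by (simp add: exp_of_nat_mult)
    then have "norm y powr - ?n = 1 / norm y ^ CARD('n)"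
      using False by (simp add: powr_def exp_minus field_simps)
    moreover have "ln (norm y) \<in> {l<..<u} \<longleftrightarrow> norm y ^ CARD('n) \<in> {exp (?n * l)<..<exp (?n * u)}"
      unfolding p by simp
    ultimately show ?thesis by (simp add: g_def indicator_def)
  qed (simp add: g_def)
  then have "?I = (\<integral>\<^sup>+y. g (norm (y :: real ^ 'n) ^ CARD('n)) \<partial>lborel)" by simp
  also have "\<dots> = (\<integral>\<^sup>+s. g s \<partial>distr lborel borel (\<lambda>y :: real ^ 'n. norm y ^ CARD('n)))"
    by (subst nn_integral_distr) auto
  also have "\<dots> = (\<integral>\<^sup>+s. ennreal (omega TYPE('n)) * indicator {0..} s * g s \<partial>lborel)"
    unfolding distr_norm_power by (subst nn_integral_density) auto
  also have "\<dots> = (\<integral>\<^sup>+s. ennreal (omega TYPE('n)) * (ennreal (1 / s) * indicator {exp (?n * l)..exp (?n * u)} s) \<partial>lborel)"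
  proof (rule nn_integral_cong_AE)
    have "AE s in lborel. s \<noteq> exp (?n * l) \<and> s \<noteq> exp (?n * u)"
      using AE_lborel_singleton[of "exp (?n * l)"] AE_lborel_singleton[of "exp (?n * u)"] by eventually_elim simp
    then show "AE s in lborel. ennreal (omega TYPE('n)) * indicator {0..} s * g s =
        ennreal (omega TYPE('n)) * (ennreal (1 / s) * indicator {exp (?n * l)..exp (?n * u)} s)"
    proof eventually_elim
      case (elim s)
      have "0 < s" if "exp (?n * l) < s" using that exp_gt_zero[of "?n * l"] by linarith
      with elim show ?case by (auto simp: g_def indicator_def)
    qed
  qed
  also have "\<dots> = ennreal (omega TYPE('n)) * (\<integral>\<^sup>+s. ennreal (1 / s) * indicator {exp (?n * l)..exp (?n * u)} s \<partial>lborel)"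
    by (rule nn_integral_cmult) auto
  also have "(\<integral>\<^sup>+s. ennreal (1 / s) * indicator {exp (?n * l)..exp (?n * u)} s \<partial>lborel) = ennreal (ln (exp (?n * u)) - ln (exp (?n * l)))"
  proof (rule nn_integral_FTC_Icc)
    fix s assume "s \<in> {exp (?n * l)..exp (?n * u)}"
    then have "exp (?n * l) \<le> s" by simp
    then have "s > 0" using exp_gt_zero[of "?n * l"] by linarith
    then show "0 \<le> 1 / s" "(ln has_real_derivative 1 / s) (at s)"
      by (simp_all add: DERIV_ln_divide)
  qed (use assms in auto)
  also have "ennreal (omega TYPE('n)) * \<dots> = ennreal (real CARD('n) * omega TYPE('n) * (u - l))"
    by (simp only: ennreal_mult'[symmetric, OF less_imp_le[OF omega_pos]] ln_exp) (simp add: algebra_simps)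
  finally show ?thesis .
qed

lemma radial_integral:
  fixes H :: "real \<Rightarrow> ennreal"
  assumes [measurable]: "H \<in> borel_measurable borel"
  shows "(\<integral>\<^sup>+y. H (ln (norm y)) * ennreal (norm y powr - real CARD('n::finite)) \<partial>(lborel :: (real ^ 'n) measure)) =
    ennreal (real CARD('n) * omega TYPE('n)) * (\<integral>\<^sup>+t. H t \<partial>lborel)"
proof -
  let ?n = "real CARD('n)"
  let ?c = "?n * omega TYPE('n)"
  have c: "?c > 0" using omega_pos[where 'n = 'n] by simp
  \<comment> \<open>The image of the normalised measure |y|^(-n) dy under ln |y|. By the shell
    integral it gives each interval its length, so it is Lebesgue measure on the line.\<close>
  define M where "M = distr (density lborel (\<lambda>y :: real ^ 'n. ennreal (1 / ?c) * ennreal (norm y powr - ?n))) borel (\<lambda>y. ln (norm y))"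
  have int: "(\<integral>\<^sup>+t. F t \<partial>M) = ennreal (1 / ?c) * (\<integral>\<^sup>+y. F (ln (norm y)) * ennreal (norm y powr - ?n) \<partial>(lborel :: (real ^ 'n) measure))"
    if [measurable]: "F \<in> borel_measurable borel" for F
    unfolding M_def
    by (subst nn_integral_distr, simp, simp, subst nn_integral_density, simp, simp)
      (subst nn_integral_cmult[symmetric], auto intro!: nn_integral_cong simp: mult_ac)
  have "lborel = M"
  proof (rule lborel_eqI)
    have c0: "?c \<noteq> 0" using c by linarith
    fix l u :: real assume "\<And>b. b \<in> Basis \<Longrightarrow> l \<bullet> b \<le> u \<bullet> b"
    then have lu: "l \<le> u" by simp
    have "emeasure M (box l u) = (\<integral>\<^sup>+t. indicator {l<..<u} t \<partial>M)"
      by (simp add: M_def box_real)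
    also have "\<dots> = ennreal (1 / ?c) * ennreal (?c * (u - l))"
      by (subst int) (auto simp: shell_integral[OF lu])
    also have "\<dots> = ennreal (1 / ?c * (?c * (u - l)))" using c by (intro ennreal_mult'[symmetric]) simp
    also have "1 / ?c * (?c * (u - l)) = u - l" using nonzero_mult_div_cancel_left[OF c0, of "u - l"] by (simp only: times_divide_eq_left mult_1)
    finally show "emeasure M (box l u) = ennreal (\<Prod>b\<in>Basis. (u - l) \<bullet> b)" by simp
  qed (simp add: M_def)
  then have "(\<integral>\<^sup>+t. H t \<partial>lborel) = ennreal (1 / ?c) * (\<integral>\<^sup>+y. H (ln (norm y)) * ennreal (norm y powr - ?n) \<partial>(lborel :: (real ^ 'n) measure))"
    using int[of H] by simp
  then have "ennreal ?c * (\<integral>\<^sup>+t. H t \<partial>lborel) = ennreal (?c * (1 / ?c)) * (\<integral>\<^sup>+y. H (ln (norm y)) * ennreal (norm y powr - ?n) \<partial>(lborel :: (real ^ 'n) measure))"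
    using c by (subst ennreal_mult) (auto simp: mult.assoc)
  then show ?thesis using less_imp_neq[OF omega_pos[where 'n = 'n]] by simp
qed

lemma AE_lborel_nonzero: "AE y in lborel. y \<noteq> (0 :: real ^ 'n::finite)"
  by (rule AE_lborel_singleton)

lemma nn_integral_exp_atMost:
  assumes a: "a > 0"
  shows "(\<integral>\<^sup>+t. ennreal (exp (a * t)) * indicator {..b} t \<partial>lborel) = ennreal (exp (a * b) / a)"
proof -
  have "(\<integral>\<^sup>+t. ennreal (exp (a * t)) * indicator {..b} t \<partial>lborel) =
      (\<integral>\<^sup>+t. ennreal (exp (- (a * t))) * indicator {-b..} t \<partial>lborel)"
    using nn_integral_real_affine[of "\<lambda>t. ennreal (exp (a * t)) * indicator {..b} t" "-1" 0]
    by (simp add: indicator_def minus_le_iff cong: if_cong)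
  also have "\<dots> = ennreal (0 - (- exp (- (a * (- b))) / a))"
  proof (rule nn_integral_FTC_atLeast)
    show "((\<lambda>t. - exp (- (a * t)) / a) \<longlongrightarrow> 0) at_top"
    proof -
      have "filterlim (\<lambda>t. a * t) at_top at_top"
        by (rule filterlim_tendsto_pos_mult_at_top[OF tendsto_const a filterlim_ident])
      then have "((\<lambda>t. exp (- (a * t))) \<longlongrightarrow> 0) at_top"
        by (intro filterlim_compose[OF exp_at_bot] filterlim_compose[OF filterlim_uminus_at_bot_at_top])
      then have "((\<lambda>t. - exp (- (a * t)) / a) \<longlongrightarrow> - 0 / a) at_top" using a by (intro tendsto_intros) auto
      then show ?thesis by simp
    qed
    show "((\<lambda>t. - exp (- (a * t)) / a) has_real_derivative exp (- (a * t))) (at t)" for t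
      using a by (auto intro!: derivative_eq_intros)
  qed auto
  finally show ?thesis by simp
qed

text \<open>Written as exp(a ln |y|) |y|^(-n), the kernel reduces to an exponential integrated over
  a half-line in t = ln |y|.\<close>

lemma riesz_kernel_ball:
  assumes a: "a > 0" and R: "R > 0"
  shows "(\<integral>\<^sup>+y. ennreal (norm y powr (a - real CARD('n::finite))) * indicator {..R} (norm y) \<partial>(lborel :: (real ^ 'n) measure)) =
    ennreal (real CARD('n) * omega TYPE('n) * R powr a / a)"
proof -
  let ?n = "real CARD('n)"
  have "(\<integral>\<^sup>+y. ennreal (norm y powr (a - ?n)) * indicator {..R} (norm y) \<partial>(lborel :: (real ^ 'n) measure)) =
    (\<integral>\<^sup>+y. (ennreal (exp (a * ln (norm y))) * indicator {..ln R} (ln (norm y))) * ennreal (norm y powr - ?n) \<partial>(lborel :: (real ^ 'n) measure))"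
  proof (rule nn_integral_cong_AE)
    show "AE y in lborel. ennreal (norm y powr (a - ?n)) * indicator {..R} (norm y) =
      (ennreal (exp (a * ln (norm y))) * indicator {..ln R} (ln (norm y))) * ennreal (norm (y :: real ^ 'n) powr - ?n)"
      using AE_lborel_nonzero
    proof eventually_elim
      case (elim y)
      then have "norm y powr (a - ?n) = exp (a * ln (norm y)) * norm y powr - ?n"
        by (simp add: powr_def exp_add[symmetric] algebra_simps)
      then show ?case using elim R by (auto simp: indicator_def ennreal_mult')
    qed
  qed
  also have "\<dots> = ennreal (?n * omega TYPE('n)) * ennreal (exp (a * ln R) / a)"
    by (subst radial_integral) (auto simp: nn_integral_exp_atMost[OF a])
  also have "\<dots> = ennreal (?n * omega TYPE('n) * R powr a / a)"
    using R a omega_pos[where 'n = 'n] by (subst ennreal_mult[symmetric]) (auto simp: powr_def)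
  finally show ?thesis .
qed

lemma riesz_kernel_set_integrable:
  fixes f :: "real ^ 'n::finite \<Rightarrow> real"
  assumes a: "a > 0" and f: "f \<in> borel_measurable borel"
    and bd: "\<And>y. y \<noteq> 0 \<Longrightarrow> \<bar>f y\<bar> \<le> C * norm y powr (a - real CARD('n))" "\<And>y. norm y > R \<Longrightarrow> f y = 0" and R: "R > 0" and C: "C \<ge> 0"
  shows "integrable lborel f" "\<bar>\<integral>y. f y \<partial>lborel\<bar> \<le> C * (real CARD('n) * omega TYPE('n) * R powr a / a)"
proof -
  let ?n = "real CARD('n)"
  have nn: "(\<integral>\<^sup>+y. ennreal \<bar>f y\<bar> \<partial>lborel) \<le> ennreal (C * (?n * omega TYPE('n) * R powr a / a))"
  proof -
    have "(\<integral>\<^sup>+y. ennreal \<bar>f y\<bar> \<partial>lborel) \<le> (\<integral>\<^sup>+y. ennreal C * (ennreal (norm (y :: real ^ 'n) powr (a - ?n)) * indicator {..R} (norm y)) \<partial>lborel)"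
    proof (rule nn_integral_mono_AE)
      show "AE y in lborel. ennreal \<bar>f y\<bar> \<le> ennreal C * (ennreal (norm (y :: real ^ 'n) powr (a - ?n)) * indicator {..R} (norm y))"
        using AE_lborel_nonzero
      proof eventually_elim
        case (elim y)
        show ?case using bd(1)[OF elim] bd(2)[of y] C
          by (cases "norm y > R") (auto simp: indicator_def ennreal_mult[symmetric] intro!: ennreal_leI)
      qed
    qed
    also have "\<dots> = ennreal C * ennreal (?n * omega TYPE('n) * R powr a / a)"
      by (subst nn_integral_cmult) (auto simp: riesz_kernel_ball[OF a R])
    finally show ?thesis using C a omega_pos[where 'n = 'n] by (simp add: ennreal_mult[symmetric])
  qed
  show int: "integrable lborel f"
    using f nn by (intro integrableI_bounded) (auto intro: le_less_trans)
  have "\<bar>\<integral>y. f y \<partial>lborel\<bar> \<le> (\<integral>y. \<bar>f y\<bar> \<partial>lborel)" by (rule integral_abs_bound)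
  also have "\<dots> = enn2real (\<integral>\<^sup>+y. ennreal \<bar>f y\<bar> \<partial>lborel)" by (rule integral_eq_nn_integral) (use f in auto)
  also have "\<dots> \<le> C * (?n * omega TYPE('n) * R powr a / a)"
    using nn C a omega_pos[where 'n = 'n] by (intro enn2real_leI) auto
  finally show "\<bar>\<integral>y. f y \<partial>lborel\<bar> \<le> C * (?n * omega TYPE('n) * R powr a / a)" .
qed

section \<open>The kernel of the representation formula\<close>

text \<open>The value 1 at the origin is put in by hand, as the limit of the formula; with it the
  cutoff is smooth on the whole space.\<close>

definition log_cutoff :: "(real \<Rightarrow> real) \<Rightarrow> real \<Rightarrow> real ^ 'n::finite \<Rightarrow> real" where
  "log_cutoff G \<delta> y = (if y = 0 then 1 else log_scale G \<delta> y)"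

definition cutoff_one :: "real \<Rightarrow> (real \<Rightarrow> real) \<Rightarrow> bool" where
  "cutoff_one \<tau> G \<longleftrightarrow> 0 < \<tau> \<and> \<tau> < 1 \<and> cutoff \<tau> G \<and> (\<forall>t. t < - 1 \<longrightarrow> G t = 1) \<and>
    (\<forall>t. 0 \<le> G t \<and> G t \<le> 1 \<and> deriv G t \<le> 0)"

lemma cutoff_one_exists:
  assumes "e > 0"
  obtains \<tau> G where "cutoff_one \<tau> G" "\<And>t. \<bar>deriv G t\<bar> \<le> 1 + e"
proof -
  obtain G \<tau> where G: "smooth1_on UNIV G" "0 < \<tau>" "\<tau> < 1" "\<And>t. t \<le> -1 \<Longrightarrow> G t = 1" "\<And>t. t \<ge> - \<tau> \<Longrightarrow> G t = 0"
    "\<And>t. 0 \<le> G t" "\<And>t. G t \<le> 1" "\<And>t. deriv G t \<le> 0" "\<And>t. - deriv G t \<le> 1 + e"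
    using cutoff_exists[OF assms] by blast
  show thesis
  proof (rule that)
    show "cutoff_one \<tau> G" unfolding cutoff_one_def cutoff_def using G by auto
    show "\<bar>deriv G t\<bar> \<le> 1 + e" for t using G(8)[of t] G(9)[of t] by simp
  qed
qed

lemma log_scale_one_near_zero:
  fixes y :: "real ^ 'n::finite"
  assumes G: "\<forall>t. t < - 1 \<longrightarrow> G t = 1" and \<delta>: "\<delta> > 0" and y: "y \<noteq> 0" "norm y < exp (- 1 / \<delta>)"
  shows "log_scale G \<delta> y = 1"
proof -
  have "ln (norm y) < - 1 / \<delta>" using y by (metis ln_less_cancel_iff ln_exp exp_gt_zero zero_less_norm_iff)
  then have "\<delta> * ln (norm y) < - 1" using \<delta> by (simp add: field_simps)
  then show ?thesis using G by simp
qed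

lemma log_cutoff_near_zero:
  assumes "cutoff_one \<tau> G" "\<delta> > 0" "norm y < exp (- 1 / \<delta>)"
  shows "log_cutoff G \<delta> y = 1"
  using assms log_scale_one_near_zero[of G \<delta> y] by (auto simp: log_cutoff_def cutoff_one_def)

lemma log_cutoff_range:
  assumes "cutoff_one \<tau> G"
  shows "0 \<le> log_cutoff G \<delta> y" "log_cutoff G \<delta> y \<le> 1"
  using assms by (auto simp: log_cutoff_def cutoff_one_def)

lemma log_cutoff_eq_0:
  assumes "cutoff_one \<tau> G" "y \<noteq> 0" "\<delta> * ln (norm y) > - \<tau>"
  shows "log_cutoff G \<delta> y = 0"
  using assms by (auto simp: log_cutoff_def cutoff_one_def cutoff_def)

lemma log_cutoff_test_function:
  assumes G: "cutoff_one \<tau> G" and \<delta>: "\<delta> > 0"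
  shows "test_function (log_cutoff G \<delta> :: real ^ 'n::finite \<Rightarrow> real)"
proof (rule test_functionI[of _ 1])
  have Gs: "smooth1_on UNIV G" using G by (auto simp: cutoff_one_def cutoff_def)
  have "smooth_on (- {0}) (log_cutoff G \<delta> :: real ^ 'n \<Rightarrow> real)"
    by (rule smooth_on_cong[OF _ _ smooth_on_log_scale[OF Gs, of \<delta>]]) (auto simp: log_cutoff_def)
  moreover have "smooth_on (ball 0 (exp (- 1 / \<delta>))) (log_cutoff G \<delta> :: real ^ 'n \<Rightarrow> real)"
    by (rule smooth_on_cong[OF _ _ smooth_on_const[of _ 1]]) (auto simp: log_cutoff_near_zero[OF G \<delta>])
  moreover have "(UNIV :: (real ^ 'n) set) = - {0} \<union> ball 0 (exp (- 1 / \<delta>))" by auto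
  ultimately show "smooth_on UNIV (log_cutoff G \<delta> :: real ^ 'n \<Rightarrow> real)" using smooth_on_Un by metis
  show "log_cutoff G \<delta> y = 0" if "norm y > 1" for y :: "real ^ 'n"
  proof (rule log_cutoff_eq_0[OF G])
    show "y \<noteq> 0" using that by auto
    have "\<tau> > 0" using G by (simp add: cutoff_one_def)
    moreover have "\<delta> * ln (norm y) > 0" using that \<delta> by (intro mult_pos_pos ln_gt_zero)
    ultimately show "- \<tau> < \<delta> * ln (norm y)" by linarith
  qed
qed

text \<open>The weight gives degree k - n, that of the Riesz kernel. The tensor has norm sqrt \<ell>
  |y|^(k-n), and its contraction with the derivative tensor of the logarithm is \<ell>
  |y|^(-n).\<close>

definition kernel :: "nat \<Rightarrow> 'n::finite list \<Rightarrow> real ^ 'n \<Rightarrow> real" where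
  "kernel k is y = norm y powr (2 * real k - real CARD('n)) * iter_partial_deriv is (\<lambda>y. ln (norm y)) y"

lemma homogeneous_kernel:
  assumes "length is = k" "k \<ge> 1"
  shows "homogeneous (real k - real CARD('n)) (kernel k is :: real ^ 'n::finite \<Rightarrow> real)"
proof -
  have "is \<noteq> []" using assms by auto
  from homogeneous_mult[OF homogeneous_norm_powr[of "2 * real k - real CARD('n)"] homogeneous_iter_ln[OF this]]
  show ?thesis unfolding kernel_def[abs_def] assms(1) by (simp add: algebra_simps)
qed

lemma borel_measurable_smooth_off_zero:
  fixes f :: "real ^ 'n::finite \<Rightarrow> real"
  assumes "smooth_on (- {0}) f"
  shows "f \<in> borel_measurable borel"
proof -
  have "(\<lambda>y. if y \<in> - {0} then f y else f 0) \<in> borel_measurable borel"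
    by (rule borel_measurable_continuous_on_if[OF _ smooth_on_continuous_on[OF assms]]) auto
  moreover have "(\<lambda>y. if y \<in> - {0} then f y else f 0) = f" by auto
  ultimately show ?thesis by simp
qed

lemma kernel_measurable:
  "length is = k \<Longrightarrow> k \<ge> 1 \<Longrightarrow> kernel k is \<in> borel_measurable borel"
  using homogeneous_kernel homogeneous_smooth borel_measurable_smooth_off_zero by blast

lemma kernel_mult_integrable:
  fixes g :: "real ^ 'n::finite \<Rightarrow> real"
  assumes k: "length is = k" "k \<ge> 1" and g: "g \<in> borel_measurable borel" "\<And>x. \<bar>g x\<bar> \<le> B" "\<And>x. norm x > R \<Longrightarrow> g x = 0"
  shows "integrable lborel (\<lambda>y. kernel k is y * g y)"
proof -
  obtain C where C: "C \<ge> 0" "\<And>y. y \<noteq> 0 \<Longrightarrow> \<bar>kernel k is y\<bar> \<le> C * norm y powr (real k - real CARD('n))"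
    using homogeneous_bound[OF homogeneous_kernel[OF k]] by blast
  have B: "B \<ge> 0" using g(2)[of 0] by linarith
  show ?thesis
  proof (rule riesz_kernel_set_integrable(1)[of "real k" _ "C * B" "max R 1"])
    show "\<bar>kernel k is y * g y\<bar> \<le> C * B * norm y powr (real k - real CARD('n))" if "y \<noteq> 0" for y
      using mult_mono[OF C(2)[OF that] g(2)[of y]] B C(1) by (simp add: abs_mult mult_ac)
  qed (use k g kernel_measurable[OF k] C B in auto)
qed

lemma kernel_test_integrable:
  fixes \<phi> :: "real ^ 'n::finite \<Rightarrow> real"
  assumes k: "length is = k" "k \<ge> 1" and \<phi>: "test_function \<phi>"
  shows "integrable lborel (\<lambda>y. kernel k is y * \<phi> y)"
proof -
  obtain B where "\<And>x. \<bar>\<phi> x\<bar> \<le> B" using test_function_bounded[OF \<phi>] by blast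
  moreover obtain R where "\<And>x. norm x > R \<Longrightarrow> \<phi> x = 0" using test_function_support[OF \<phi>] by blast
  ultimately show ?thesis by (rule kernel_mult_integrable[OF k test_function_borel[OF \<phi>]])
qed

text \<open>Up to the sign (-1)^k, the k-fold distributional divergence of the kernel tensor tested
  with \<phi>.\<close>

definition kernel_pairing :: "nat \<Rightarrow> (real ^ 'n::finite \<Rightarrow> real) \<Rightarrow> real" where
  "kernel_pairing k \<phi> = (\<Sum>is\<in>{is. length is = k}. \<integral>y. kernel k is y * iter_partial_deriv is \<phi> y \<partial>lborel)"

text \<open>The same divergence taken pointwise off the origin; the reversed list is the one that
  integration by parts produces.\<close>

definition kernel_div :: "nat \<Rightarrow> real ^ 'n::finite \<Rightarrow> real" where
  "kernel_div k y = (\<Sum>is\<in>{is. length is = k}. iter_partial_deriv (rev is) (kernel k is) y)"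

section \<open>Divergence of the kernel tensor off the origin\<close>

lemma kernel_conformal:
  fixes A :: "real ^ 'n::finite ^ 'n"
  assumes A: "\<And>z. norm (A *v z) = s * norm z" and s: "s > 0" and y: "y \<noteq> 0" and k: "length is = k" "k \<ge> 1"
  shows "kernel k is y = s powr (real CARD('n) - 2 * real k) *
    (\<Sum>js\<in>{js. length js = k}. tensor_coef A js is * kernel k js (A *v y))"
proof -
  have "is \<noteq> []" using k by auto
  from iter_partial_deriv_ln_norm_conformal[OF A s y this]
  have "iter_partial_deriv is (\<lambda>y. ln (norm y)) y = (\<Sum>js\<in>{js. length js = k}.
    tensor_coef A js is * iter_partial_deriv js (\<lambda>y. ln (norm y)) (A *v y))" by (simp add: k)
  moreover have "norm y powr (2 * real k - real CARD('n)) =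
      s powr (real CARD('n) - 2 * real k) * norm (A *v y) powr (2 * real k - real CARD('n))"
    using s y by (simp add: A powr_mult mult.assoc[symmetric] powr_add[symmetric])
  ultimately show ?thesis
    by (simp add: kernel_def sum_distrib_left mult_ac)
qed

lemma sum_lists_rev: "(\<Sum>is\<in>{is. length is = k}. F (rev is)) = (\<Sum>is\<in>{is. length is = k}. F is)"
  by (rule sum.reindex_bij_witness[of _ rev rev]) auto

lemma iter_partial_deriv_sum:
  fixes f :: "'b \<Rightarrow> real ^ 'n::finite \<Rightarrow> real"
  assumes U: "open U" and J: "finite J" and f: "\<And>j. j \<in> J \<Longrightarrow> smooth_on U (f j)" and x: "x \<in> U"
  shows "iter_partial_deriv is (\<lambda>x. \<Sum>j\<in>J. f j x) x = (\<Sum>j\<in>J. iter_partial_deriv is (f j) x)"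
  using J f
proof (induction J rule: finite_induct)
  case empty then show ?case by (simp add: iter_partial_deriv_zero)
next
  case (insert j J)
  have "iter_partial_deriv is (\<lambda>x. f j x + (\<Sum>j\<in>J. f j x)) x = iter_partial_deriv is (f j) x + iter_partial_deriv is (\<lambda>x. \<Sum>j\<in>J. f j x) x"
    by (rule iter_partial_deriv_add[OF U _ _ x]) (use insert.prems in \<open>auto intro: smooth_on_sum[OF U]\<close>)
  then show ?case using insert by simp
qed

text \<open>A similarity with factor s taking y to x pulls back the kernel by one tensor power and
  its derivatives by another. Summing over the indices contracts both to s^(2k); with the factor
  s^(n-2k) of the kernel this leaves s^n.\<close>

lemma kernel_div_conformal:
  fixes x y :: "real ^ 'n::finite"
  assumes x: "x \<noteq> 0" and y: "y \<noteq> 0" and k: "k \<ge> 1"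
  shows "kernel_div k y = (norm x / norm y) powr real CARD('n) * kernel_div k x"
proof -
  let ?S = "{js :: 'n list. length js = k}"
  define s where "s = norm x / norm y"
  have s: "s > 0" using x y by (simp add: s_def)
  obtain A :: "real ^ 'n ^ 'n" where A: "A *v y = x" "\<And>z. norm (A *v z) = s * norm z"
    "\<And>j m. (\<Sum>i\<in>UNIV. A $ j $ i * A $ m $ i) = (if j = m then s\<^sup>2 else 0)"
    unfolding s_def using conformal_matrix_exists[OF x y] by blast
  have Ay: "A *v z \<noteq> 0" if "z \<noteq> 0" for z using A(2)[of z] s that by auto
  define a where "a = s powr (real CARD('n) - 2 * real k)"
  have sm: "smooth_on (- {0}) (kernel k js :: real ^ 'n \<Rightarrow> real)" if "length js = k" for js
    by (rule homogeneous_smooth[OF homogeneous_kernel[OF that k]])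
  have smA: "smooth_on (- {0}) (\<lambda>y. kernel k js (0 + A *v y))" if "length js = k" for js
    by (rule smooth_on_subset[OF smooth_on_affine_compose[OF open_minus_zero sm[OF that]]]) (use Ay in auto)
  have 1: "iter_partial_deriv (rev is) (kernel k is) y =
      (\<Sum>js\<in>?S. tensor_coef A js is * (a * (\<Sum>ms\<in>?S. tensor_coef A ms is * iter_partial_deriv (rev ms) (kernel k js) x)))"
    if "is": "length is = k" for "is"
  proof -
    have "iter_partial_deriv (rev is) (kernel k is) y =
        iter_partial_deriv (rev is) (\<lambda>y. \<Sum>js\<in>?S. (a * tensor_coef A js is) * kernel k js (0 + A *v y)) y"
      by (rule iter_partial_deriv_cong[of "- {0}"])
        (use y kernel_conformal[OF A(2) s _ "is" k] in \<open>auto simp: a_def sum_distrib_left mult_ac\<close>)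
    also have "\<dots> = (\<Sum>js\<in>?S. (a * tensor_coef A js is) * iter_partial_deriv (rev is) (\<lambda>y. kernel k js (0 + A *v y)) y)"
      using y smA by (subst iter_partial_deriv_sum[of "- {0}"])
        (auto intro!: smooth_on_cmult sum.cong iter_partial_deriv_cmult[of "- {0}"])
    also have "\<dots> = (\<Sum>js\<in>?S. (a * tensor_coef A js is) * (\<Sum>ms\<in>?S. tensor_coef A ms is * iter_partial_deriv (rev ms) (kernel k js) x))"
    proof (intro sum.cong refl arg_cong2[of _ _ _ _ "(*)"])
      fix js assume js: "js \<in> ?S"
      have "iter_partial_deriv (rev is) (\<lambda>y. kernel k js (0 + A *v y)) y =
          (\<Sum>ms\<in>?S. tensor_coef A ms (rev is) * iter_partial_deriv ms (kernel k js) x)"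
        using iter_partial_deriv_affine[OF open_minus_zero sm, of js 0 A y "rev is"] js "is" x by (simp add: A(1))
      \<comment> \<open>Reversing both lists merely permutes the factors of the coefficient, so the
        two tensor powers become contractible.\<close>
      also have "\<dots> = (\<Sum>ms\<in>?S. tensor_coef A (rev ms) (rev is) * iter_partial_deriv (rev ms) (kernel k js) x)"
        by (rule sum_lists_rev[symmetric])
      also have "\<dots> = (\<Sum>ms\<in>?S. tensor_coef A ms is * iter_partial_deriv (rev ms) (kernel k js) x)"
        using "is" by (intro sum.cong) (auto simp: tensor_coef_rev)
      finally show "iter_partial_deriv (rev is) (\<lambda>y. kernel k js (0 + A *v y)) y =
          (\<Sum>ms\<in>?S. tensor_coef A ms is * iter_partial_deriv (rev ms) (kernel k js) x)" .
    qed
    finally show ?thesis by (simp add: mult_ac)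
  qed
  have "kernel_div k y = (\<Sum>is\<in>?S. \<Sum>js\<in>?S. \<Sum>ms\<in>?S.
      a * iter_partial_deriv (rev ms) (kernel k js) x * (tensor_coef A js is * tensor_coef A ms is))"
    unfolding kernel_div_def by (intro sum.cong refl) (simp add: 1 sum_distrib_left mult_ac)
  also have "\<dots> = (\<Sum>js\<in>?S. \<Sum>is\<in>?S. \<Sum>ms\<in>?S.
      a * iter_partial_deriv (rev ms) (kernel k js) x * (tensor_coef A js is * tensor_coef A ms is))"
    by (rule sum.swap)
  also have "\<dots> = (\<Sum>js\<in>?S. \<Sum>ms\<in>?S. \<Sum>is\<in>?S.
      a * iter_partial_deriv (rev ms) (kernel k js) x * (tensor_coef A js is * tensor_coef A ms is))"
    by (intro sum.cong refl sum.swap)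
  also have "\<dots> = (\<Sum>js\<in>?S. \<Sum>ms\<in>?S.
      a * iter_partial_deriv (rev ms) (kernel k js) x * (if js = ms then (s\<^sup>2) ^ k else 0))"
    by (intro sum.cong refl) (simp add: sum_distrib_left[symmetric] tensor_coef_orthogonal[OF A(3)])
  also have "\<dots> = (\<Sum>js\<in>?S. a * iter_partial_deriv (rev js) (kernel k js) x * (s\<^sup>2) ^ k)"
    by (simp add: if_distrib cong: if_cong)
  also have "\<dots> = a * s ^ (2 * k) * kernel_div k x"
    by (simp add: kernel_div_def sum_distrib_left power_mult[symmetric] mult_ac)
  also have "a * s ^ (2 * k) = s powr real CARD('n)"
    using s by (simp add: a_def powr_realpow[symmetric] powr_add[symmetric])
  finally show ?thesis by (simp add: s_def)
qed

lemma kernel_div_eq: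
  assumes k: "k \<ge> 1"
  obtains c where "\<And>y :: real ^ 'n::finite. y \<noteq> 0 \<Longrightarrow> kernel_div k y = c * norm y powr - real CARD('n)"
proof -
  define e :: "real ^ 'n" where "e = axis undefined 1"
  have e: "norm e = 1" "e \<noteq> 0" by (auto simp: e_def norm_axis_1)
  show thesis
    by (rule that[of "kernel_div k e"])
      (use kernel_div_conformal[OF e(2) _ k] e in \<open>simp add: powr_minus powr_divide field_simps\<close>)
qed

text \<open>Since the test function vanishes near the origin, the kernel may be multiplied by a
  smooth function that is 0 near the origin and 1 where the test function lives. The product is
  smooth everywhere and ordinary integration by parts applies.\<close>

lemma kernel_pairing_away:
  fixes \<psi> :: "real ^ 'n::finite \<Rightarrow> real"
  assumes \<psi>: "test_function \<psi>" and \<rho>: "\<rho> > 0" "\<And>y. norm y < \<rho> \<Longrightarrow> \<psi> y = 0" and k: "k \<ge> 1"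
    and c: "\<And>y :: real ^ 'n. y \<noteq> 0 \<Longrightarrow> kernel_div k y = c * norm y powr - real CARD('n)"
  shows "kernel_pairing k \<psi> = (- 1) ^ k * (c * (\<integral>y. norm y powr - real CARD('n) * \<psi> y \<partial>lborel))"
proof -
  let ?S = "{is :: 'n list. length is = k}"
  \<comment> \<open>The argument of the step is at most 0 for |y| \<le> \<rho>/2 and at least 1 from
    |y| = \<rho>/sqrt 2 on; the 3/4 below is a rational number above 1/sqrt 2.\<close>
  define \<theta> where "\<theta> = (\<lambda>y :: real ^ 'n. smooth_step (4 / \<rho>\<^sup>2 * (norm (y - 0))\<^sup>2 + (- 1)))"
  have \<theta>s: "smooth_on UNIV \<theta>" unfolding \<theta>_def
    by (intro smooth_on_compose1[OF open_UNIV _ smooth_step(1)] smooth_on_add smooth_on_cmult smooth_on_norm_square smooth_on_const) auto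
  have \<theta>0: "\<theta> y = 0" if "norm y < \<rho> / 2" for y
  proof -
    have "(norm y)\<^sup>2 \<le> (\<rho> / 2)\<^sup>2" using that by (intro power_mono) auto
    then show ?thesis unfolding \<theta>_def using \<rho>(1) by (intro smooth_step(2)) (simp add: field_simps power_divide)
  qed
  have \<theta>1: "\<theta> y = 1" if "norm y > 3 / 4 * \<rho>" for y
  proof -
    have "(3 / 4 * \<rho>)\<^sup>2 \<le> (norm y)\<^sup>2" using that \<rho>(1) by (intro power_mono) auto
    then have "9 / 16 * \<rho>\<^sup>2 \<le> (norm y)\<^sup>2" by (simp add: power_mult_distrib power_divide)
    then have "\<rho>\<^sup>2 * 2 \<le> 4 * (norm y)\<^sup>2" using zero_le_power2[of \<rho>] by linarith
    then show ?thesis unfolding \<theta>_def using \<rho>(1) by (intro smooth_step(3)) (simp add: field_simps)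
  qed
  have \<psi>0: "iter_partial_deriv is \<psi> y = 0" if "norm y < \<rho>" for "is" y
    using iter_partial_deriv_cong[of "ball 0 \<rho>" \<psi> "\<lambda>_. 0" y "is"] \<rho>(2) that by (simp add: iter_partial_deriv_zero)
  have op: "open {y :: real ^ 'n. norm y > 3 / 4 * \<rho>}" by (intro open_Collect_less continuous_intros)
  have 1: "(\<integral>y. kernel k is y * iter_partial_deriv is \<psi> y \<partial>lborel) =
      (- 1) ^ k * (\<integral>y. iter_partial_deriv (rev is) (kernel k is) y * \<psi> y \<partial>lborel)"
    and int: "integrable lborel (\<lambda>y. iter_partial_deriv (rev is) (kernel k is) y * \<psi> y)"
    if "is": "length is = k" for "is" :: "'n list"
  proof -
    let ?K = "\<lambda>y. \<theta> y * kernel k is y"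
    have "smooth_on (- {0}) ?K"
      by (intro smooth_on_mult smooth_on_subset[OF \<theta>s] homogeneous_smooth[OF homogeneous_kernel[OF "is" k]]) auto
    moreover have "smooth_on (ball 0 (\<rho> / 2)) ?K"
      by (rule smooth_on_cong[OF _ _ smooth_on_const[of _ 0]]) (auto simp: \<theta>0)
    moreover have "(UNIV :: (real ^ 'n) set) = - {0} \<union> ball 0 (\<rho> / 2)" using \<rho>(1) by auto
    ultimately have K: "smooth_on UNIV ?K" using smooth_on_Un by metis
    have eq: "iter_partial_deriv (rev is) ?K y * \<psi> y = iter_partial_deriv (rev is) (kernel k is) y * \<psi> y" for y
    proof (cases "norm y < \<rho>")
      case False
      then have "norm y > 3 / 4 * \<rho>" using \<rho>(1) by linarith
      then show ?thesis using iter_partial_deriv_cong[OF op, of ?K "kernel k is" y "rev is"] \<theta>1 by simp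
    qed (simp add: \<rho>(2))
    have eq': "kernel k is y * iter_partial_deriv is \<psi> y = ?K y * iter_partial_deriv is \<psi> y" for y
      using \<psi>0[of y "is"] \<theta>1[of y] \<rho>(1) by (cases "norm y < \<rho>") auto
    show "(\<integral>y. kernel k is y * iter_partial_deriv is \<psi> y \<partial>lborel) =
      (- 1) ^ k * (\<integral>y. iter_partial_deriv (rev is) (kernel k is) y * \<psi> y \<partial>lborel)"
      using integration_by_parts_iter[OF K \<psi>, of "is"] by (simp add: eq eq' "is")
    show "integrable lborel (\<lambda>y. iter_partial_deriv (rev is) (kernel k is) y * \<psi> y)"
      using test_function_integrable[OF test_function_mult[OF smooth_on_iter[OF K, of "rev is"] \<psi>]] by (simp add: eq)
  qed
  have "kernel_pairing k \<psi> = (- 1) ^ k * (\<Sum>is\<in>?S. \<integral>y. iter_partial_deriv (rev is) (kernel k is) y * \<psi> y \<partial>lborel)"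
    unfolding kernel_pairing_def by (simp add: 1 sum_distrib_left)
  also have "(\<Sum>is\<in>?S. \<integral>y. iter_partial_deriv (rev is) (kernel k is) y * \<psi> y \<partial>lborel) =
      (\<integral>y. (\<Sum>is\<in>?S. iter_partial_deriv (rev is) (kernel k is) y * \<psi> y) \<partial>lborel)"
    using int by (intro Bochner_Integration.integral_sum[symmetric]) auto
  also have "\<dots> = (\<integral>y. c * (norm y powr - real CARD('n) * \<psi> y) \<partial>lborel)"
  proof (intro Bochner_Integration.integral_cong refl)
    fix y
    have "(\<Sum>is\<in>?S. iter_partial_deriv (rev is) (kernel k is) y * \<psi> y) = kernel_div k y * \<psi> y"
      by (simp add: kernel_div_def sum_distrib_right)
    also have "\<dots> = c * (norm y powr - real CARD('n) * \<psi> y)"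
      using c[of y] \<rho> by (cases "y = 0") auto
    finally show "(\<Sum>is\<in>?S. iter_partial_deriv (rev is) (kernel k is) y * \<psi> y) = c * (norm y powr - real CARD('n) * \<psi> y)" .
  qed
  finally show ?thesis by simp
qed

text \<open>The innermost derivative of the cutoff is \<delta> G'(\<delta> ln |y|) times a
  derivative of ln |y|. The remaining derivatives act on the latter up to an error of order
  \<delta>^2 on the transition shell. If the innermost derivative falls on \<phi> it leaves the
  other, less singular error; its absence for \<phi> = 1 is what the extremal functions rely
  on.\<close>

lemma iter_log_cutoff_expansion:
  fixes \<phi> :: "real ^ 'n::finite \<Rightarrow> real"
  assumes G: "cutoff_one \<tau> G" and \<phi>: "smooth_on UNIV \<phi>" and k: "length is = k" "k \<ge> 1"
  obtains C where "C \<ge> 0" "\<And>\<delta> y. 0 < \<delta> \<Longrightarrow> \<delta> \<le> 1 \<Longrightarrow> y \<noteq> 0 \<Longrightarrow>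
    \<bar>iter_partial_deriv is (\<lambda>y. \<phi> y * log_cutoff G \<delta> y) y
      - \<delta> * \<phi> y * log_scale (deriv G) \<delta> y * iter_partial_deriv is (\<lambda>y. ln (norm y)) y\<bar>
    \<le> C * ((if \<phi> = (\<lambda>_. 1) then 0 else norm y powr (1 - real k) * indicator {..\<delta> / \<tau>} (norm y))
        + \<delta>\<^sup>2 * norm y powr (- real k) * indicator {-1..-\<tau>} (\<delta> * ln (norm y)))"
proof -
  have \<tau>: "\<tau> > 0" and cG: "cutoff \<tau> G" and Gs: "smooth1_on UNIV G"
    using G by (auto simp: cutoff_one_def cutoff_def)
  \<comment> \<open>One index is split off because ln |y| is not homogeneous, whereas its first
    derivatives are, of degree -1.\<close>
  obtain js i where "is": "is = js @ [i]" using k by (metis rev_exhaust list.size(3) not_one_le_zero)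
  have lj: "real (length js) = real k - 1" using k by (simp add: "is")
  have P: "homogeneous (- 1) (\<lambda>y :: real ^ 'n. partial_deriv i (\<lambda>y. ln (norm y)) y)"
    using homogeneous_partial_ln[of i] by simp
  obtain C1 where C1: "C1 \<ge> 0" "\<And>\<delta> y. 0 < \<delta> \<Longrightarrow> \<delta> \<le> 1 \<Longrightarrow> y \<noteq> 0 \<Longrightarrow>
      \<bar>iter_partial_deriv js (\<lambda>y. partial_deriv i \<phi> y * log_scale G \<delta> y * 1) y\<bar> \<le> C1 * norm y powr (0 - real (length js))"
    using iter_log_scale_bound[OF \<tau> smooth_on_partial[OF \<phi>] cG homogeneous_one] by blast
  obtain C2 where C2: "C2 \<ge> 0" "\<And>\<delta> y. 0 < \<delta> \<Longrightarrow> \<delta> \<le> 1 \<Longrightarrow> y \<noteq> 0 \<Longrightarrow>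
      \<bar>iter_partial_deriv js (\<lambda>y. \<phi> y * log_scale (deriv G) \<delta> y * partial_deriv i (\<lambda>y. ln (norm y)) y) y
        - \<phi> y * log_scale (deriv G) \<delta> y * iter_partial_deriv js (\<lambda>y. partial_deriv i (\<lambda>y. ln (norm y)) y) y\<bar>
      \<le> C2 * \<delta> * norm y powr (- 1 - real (length js))"
    using iter_log_scale_expansion[OF \<tau> \<phi> cutoff_deriv[OF cG] P] by blast
  show thesis
  proof (rule that[of "C1 + C2"])
    fix \<delta> and y :: "real ^ 'n" assume *: "0 < \<delta>" "\<delta> \<le> (1 :: real)" "y \<noteq> 0"
    let ?a = "iter_partial_deriv js (\<lambda>y. partial_deriv i \<phi> y * log_scale G \<delta> y * 1) y"
    let ?b = "iter_partial_deriv js (\<lambda>y. \<phi> y * log_scale (deriv G) \<delta> y * partial_deriv i (\<lambda>y. ln (norm y)) y) y"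
    let ?m = "\<phi> y * log_scale (deriv G) \<delta> y * iter_partial_deriv js (\<lambda>y. partial_deriv i (\<lambda>y. ln (norm y)) y) y"
    let ?X = "(if \<phi> = (\<lambda>_. 1) then 0 else norm y powr (1 - real k) * indicator {..\<delta> / \<tau>} (norm y)) :: real"
    let ?Y = "\<delta>\<^sup>2 * norm y powr (- real k) * indicator {-1..-\<tau>} (\<delta> * ln (norm y))"
    have "iter_partial_deriv is (\<lambda>y. \<phi> y * log_cutoff G \<delta> y) y = iter_partial_deriv is (\<lambda>y. \<phi> y * log_scale G \<delta> y * 1) y"
      by (rule iter_partial_deriv_cong[of "- {0}"]) (use * in \<open>auto simp: log_cutoff_def\<close>)
    also have "\<dots> = ?a + \<delta> * ?b"
      using iter_snoc_log_scale[OF \<phi> Gs homogeneous_smooth[OF homogeneous_one] *(3), of js i \<delta>]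
      by (simp add: "is" iter_partial_deriv_zero)
    finally have eq: "iter_partial_deriv is (\<lambda>y. \<phi> y * log_cutoff G \<delta> y) y = ?a + \<delta> * ?b" .
    have a: "\<bar>?a\<bar> \<le> C1 * ?X"
    proof (cases "\<phi> = (\<lambda>_. 1)")
      case True
      then show ?thesis by (simp add: iter_partial_deriv_zero)
    next
      case False
      show ?thesis
      proof (cases "\<delta> * ln (norm y) > - \<tau>")
        case True
        then show ?thesis using iter_log_scale_vanish[OF cG *(3) True, of js "partial_deriv i \<phi>" "\<lambda>_. 1"] C1(1) by simp
      next
        case F: False
        then have "norm y \<le> \<delta> / \<tau>" using norm_le_of_log_scale(1)[OF *(3,1) \<tau>] by simp
        then show ?thesis using C1(2)[OF *] False by (simp add: lj)
      qed
    qed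
    have b: "\<bar>\<delta> * ?b - \<delta> * ?m\<bar> \<le> C2 * ?Y"
    proof -
      consider "\<delta> * ln (norm y) > - \<tau>" | "\<delta> * ln (norm y) < - 1" | "\<delta> * ln (norm y) \<in> {-1..-\<tau>}" by force
      then show ?thesis
      proof cases
        case 1
        then show ?thesis
          using iter_log_scale_vanish[OF cutoff_deriv[OF cG] *(3) 1] cutoff_deriv_right[OF cG 1] C2(1) by simp
      next
        case 2
        then show ?thesis
          using iter_log_scale_deriv_vanish[OF cG *(3) 2] cutoff_deriv_left[OF cG 2] C2(1) by simp
      next
        case 3
        have "\<bar>\<delta> * ?b - \<delta> * ?m\<bar> = \<delta> * \<bar>?b - ?m\<bar>" using * by (simp add: abs_mult right_diff_distrib[symmetric])
        also have "\<dots> \<le> \<delta> * (C2 * \<delta> * norm y powr (- 1 - real (length js)))" using C2(2)[OF *] * by (intro mult_left_mono) auto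
        finally show ?thesis using 3 by (simp add: lj power2_eq_square mult_ac)
      qed
    qed
    have X: "?X \<ge> 0" "?Y \<ge> 0" by auto
    have "\<bar>?a + \<delta> * ?b - \<delta> * ?m\<bar> \<le> C1 * ?X + C2 * ?Y" using a b by linarith
    also have "\<dots> \<le> (C1 + C2) * (?X + ?Y)"
      using mult_nonneg_nonneg[OF C1(1) X(2)] mult_nonneg_nonneg[OF C2(1) X(1)] by (simp only: algebra_simps)
    finally show "\<bar>iter_partial_deriv is (\<lambda>y. \<phi> y * log_cutoff G \<delta> y) y
      - \<delta> * \<phi> y * log_scale (deriv G) \<delta> y * iter_partial_deriv is (\<lambda>y. ln (norm y)) y\<bar> \<le> (C1 + C2) * (?X + ?Y)"
      unfolding eq by (simp add: "is" iter_partial_deriv_append mult.assoc)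
  qed (use C1 C2 in auto)
qed

text \<open>In logarithmic coordinates the slope is the derivative of G(\<delta> t), so the integral
  is n \<omega> times the total change -1 of the profile, for every \<delta>.\<close>

lemma log_slope_integral:
  assumes G: "cutoff_one \<tau> G" and \<delta>: "\<delta> > 0"
  shows "integrable lborel (\<lambda>y :: real ^ 'n::finite. \<delta> * log_scale (deriv G) \<delta> y * norm y powr - real CARD('n))"
    and "(\<integral>y. \<delta> * log_scale (deriv G) \<delta> y * norm (y :: real ^ 'n) powr - real CARD('n) \<partial>lborel) = - (real CARD('n) * omega TYPE('n))"
proof -
  let ?n = "real CARD('n)"
  let ?f = "\<lambda>y :: real ^ 'n. \<delta> * log_scale (deriv G) \<delta> y * norm y powr - ?n"
  have \<tau>: "\<tau> > 0" and cG: "cutoff \<tau> G" and Gs: "smooth1_on UNIV G" and G1: "\<And>t. t < - 1 \<Longrightarrow> G t = 1"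
    and Gd: "\<And>t. deriv G t \<le> 0"
    using G by (auto simp: cutoff_one_def cutoff_def)
  have [measurable]: "deriv G \<in> borel_measurable borel"
    using smooth1_on_isCont[OF smooth1_on_deriv[OF Gs]]
    by (intro borel_measurable_continuous_onI continuous_at_imp_continuous_on) auto
  have "(\<integral>\<^sup>+t. ennreal (- \<delta> * deriv G (\<delta> * t)) \<partial>lborel) = (\<integral>\<^sup>+t. ennreal (- \<delta> * deriv G (\<delta> * t)) * indicator {- 2 / \<delta>..0} t \<partial>lborel)"
  proof (intro nn_integral_cong)
    fix t
    show "ennreal (- \<delta> * deriv G (\<delta> * t)) = ennreal (- \<delta> * deriv G (\<delta> * t)) * indicator {- 2 / \<delta>..0} t"
    proof (cases "t \<in> {- 2 / \<delta>..0}")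
      case False
      then consider "\<delta> * t < - 2" | "\<delta> * t > 0" using \<delta> by (auto simp: field_simps not_le)
      then have "deriv G (\<delta> * t) = 0"
        using cutoff_deriv_left[OF cG, of "\<delta> * t"] cutoff_deriv_right[OF cG, of "\<delta> * t"] \<tau> by cases auto
      then show ?thesis by simp
    qed simp
  qed
  also have "\<dots> = ennreal (- G (\<delta> * 0) - (- G (\<delta> * (- 2 / \<delta>))))"
  proof (rule nn_integral_FTC_Icc)
    show "((\<lambda>t. - G (\<delta> * t)) has_real_derivative - \<delta> * deriv G (\<delta> * t)) (at t)" for t
      using DERIV_minus[OF DERIV_chain2[OF smooth1_on_DERIV[OF Gs UNIV_I, of "\<delta> * t"] DERIV_cmult_Id[of \<delta>]]]
      by (simp add: mult.commute)
    show "0 \<le> - \<delta> * deriv G (\<delta> * t)" for t using Gd[of "\<delta> * t"] \<delta> by (simp add: mult_nonneg_nonpos)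
  qed (use \<delta> in auto)
  also have "\<dots> = 1" using \<delta> \<tau> G1[of "-2"] cG by (simp add: cutoff_def)
  finally have one: "(\<integral>\<^sup>+t. ennreal (- \<delta> * deriv G (\<delta> * t)) \<partial>lborel) = 1" .
  have nn: "(\<integral>\<^sup>+y. ennreal (- ?f y) \<partial>lborel) = ennreal (?n * omega TYPE('n))"
  proof -
    have "(\<integral>\<^sup>+y. ennreal (- ?f y) \<partial>lborel) = (\<integral>\<^sup>+y. ennreal (- \<delta> * deriv G (\<delta> * ln (norm y))) * ennreal (norm y powr - ?n) \<partial>(lborel :: (real ^ 'n) measure))"
      by (intro nn_integral_cong) (simp add: ennreal_mult''[symmetric])
    also have "\<dots> = ennreal (?n * omega TYPE('n)) * 1"
      by (subst radial_integral[of "\<lambda>t. ennreal (- \<delta> * deriv G (\<delta> * t))"]) (simp_all only: one, measurable)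
    finally show ?thesis by simp
  qed
  have m: "?f \<in> borel_measurable lborel" by measurable
  have f0: "0 \<le> - ?f y" for y
    using mult_nonneg_nonneg[of "\<delta> * - deriv G (\<delta> * ln (norm y))" "norm y powr - ?n"] Gd[of "\<delta> * ln (norm y)"] \<delta>
    by (simp add: mult_nonneg_nonpos)
  have "integrable lborel (\<lambda>y. - ?f y)"
    by (rule integrableI_nonneg) (use m nn f0 in auto)
  then show "integrable lborel ?f" by simp
  have "(\<integral>y. - ?f y \<partial>lborel) = enn2real (\<integral>\<^sup>+y. ennreal (- ?f y) \<partial>lborel)"
    by (rule integral_eq_nn_integral) (use m f0 in auto)
  also have "\<dots> = ?n * omega TYPE('n)" using omega_pos[where 'n = 'n] by (simp add: nn less_imp_le)
  finally show "(\<integral>y. ?f y \<partial>lborel) = - (?n * omega TYPE('n))" by simp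
qed

text \<open>The main term is \<ell> |y|^(-n) times the slope of the cutoff, with \<phi>(0) in front,
  and its integral is the same at all scales. The errors are O(\<delta>): the one like |y|^(1-n)
  lives on a ball of radius \<delta>/\<tau>, and the one like \<delta>^2 |y|^(-n) on a shell of
  logarithmic width (1 - \<tau>)/\<delta>.\<close>

lemma kernel_pairing_cutoff:
  fixes \<phi> :: "real ^ 'n::finite \<Rightarrow> real"
  assumes G: "cutoff_one \<tau> G" and \<phi>: "test_function \<phi>" and k: "k \<ge> 1"
  obtains C where "C \<ge> 0" "\<And>\<delta>. 0 < \<delta> \<Longrightarrow> \<delta> \<le> 1 \<Longrightarrow>
    \<bar>kernel_pairing k (\<lambda>y. \<phi> y * log_cutoff G \<delta> y) + ell TYPE('n) k * real CARD('n) * omega TYPE('n) * \<phi> 0\<bar> \<le> C * \<delta>"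
proof -
  let ?n = "real CARD('n)"
  let ?S = "{is :: 'n list. length is = k}"
  let ?L = "\<lambda>y :: real ^ 'n. ln (norm y)"
  let ?l = "ell TYPE('n) k"
  have \<tau>: "\<tau> > 0" "\<tau> < 1" and cG: "cutoff \<tau> G" using G by (auto simp: cutoff_one_def)
  have l0: "?l \<ge> 0" by (rule ell_properties[OF k])
  define X where "X = (\<lambda>\<delta> (y :: real ^ 'n). norm y powr (1 - ?n) * indicator {..\<delta> / \<tau>} (norm y))"
  define Y where "Y = (\<lambda>\<delta> (y :: real ^ 'n). \<delta>\<^sup>2 * norm y powr (- ?n) * indicator {-1..-\<tau>} (\<delta> * ln (norm y)))"
  have XY0: "X \<delta> y \<ge> 0" "Y \<delta> y \<ge> 0" for \<delta> y by (auto simp: X_def Y_def)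
  obtain B where B: "B \<ge> 0" "\<And>t. \<bar>deriv G t\<bar> \<le> B" using cutoff_bounded[OF cutoff_deriv[OF cG]] by blast
  obtain Lp where Lp: "Lp \<ge> 0" "\<And>x h. \<bar>\<phi> (x + h) - \<phi> x\<bar> \<le> Lp * norm h" using test_function_lipschitz[OF \<phi>] by blast
  have "\<exists>C\<ge>0. \<forall>\<delta> y. 0 < \<delta> \<longrightarrow> \<delta> \<le> 1 \<longrightarrow> y \<noteq> 0 \<longrightarrow>
    \<bar>kernel k is y * (iter_partial_deriv is (\<lambda>y. \<phi> y * log_cutoff G \<delta> y) y
      - \<delta> * \<phi> y * log_scale (deriv G) \<delta> y * iter_partial_deriv is ?L y)\<bar> \<le> C * (X \<delta> y + Y \<delta> y)" if "is": "is \<in> ?S" for "is"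
  proof -
    have is': "length is = k" using "is" by simp
    obtain C1 where C1: "C1 \<ge> 0" "\<And>y. y \<noteq> 0 \<Longrightarrow> \<bar>kernel k is y\<bar> \<le> C1 * norm y powr (real k - ?n)"
      using homogeneous_bound[OF homogeneous_kernel[OF is' k]] by blast
    obtain C2 where C2: "C2 \<ge> 0" "\<And>\<delta> y. 0 < \<delta> \<Longrightarrow> \<delta> \<le> 1 \<Longrightarrow> y \<noteq> 0 \<Longrightarrow>
      \<bar>iter_partial_deriv is (\<lambda>y. \<phi> y * log_cutoff G \<delta> y) y
        - \<delta> * \<phi> y * log_scale (deriv G) \<delta> y * iter_partial_deriv is ?L y\<bar>
      \<le> C2 * ((if \<phi> = (\<lambda>_. 1) then 0 else norm y powr (1 - real k) * indicator {..\<delta> / \<tau>} (norm y))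
          + \<delta>\<^sup>2 * norm y powr (- real k) * indicator {-1..-\<tau>} (\<delta> * ln (norm y)))"
      using iter_log_cutoff_expansion[OF G test_function_smooth[OF \<phi>] is' k] by blast
    show ?thesis
    proof (intro exI[of _ "C1 * C2"] conjI allI impI)
      fix \<delta> :: real and y :: "real ^ 'n" assume *: "0 < \<delta>" "\<delta> \<le> 1" "y \<noteq> 0"
      let ?D = "iter_partial_deriv is (\<lambda>y. \<phi> y * log_cutoff G \<delta> y) y
        - \<delta> * \<phi> y * log_scale (deriv G) \<delta> y * iter_partial_deriv is ?L y"
      let ?Z = "norm y powr (1 - real k) * indicator {..\<delta> / \<tau>} (norm y)
          + \<delta>\<^sup>2 * norm y powr (- real k) * indicator {-1..-\<tau>} (\<delta> * ln (norm y))"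
      have "\<bar>?D\<bar> \<le> C2 * ?Z"
        by (rule order_trans[OF C2(2)[OF *] mult_left_mono[OF _ C2(1)]]) auto
      then have "\<bar>kernel k is y\<bar> * \<bar>?D\<bar> \<le> (C1 * norm y powr (real k - ?n)) * (C2 * ?Z)"
        using C1 C2(1) *(3) by (intro mult_mono) auto
      also have "\<dots> = C1 * C2 * (norm y powr (real k - ?n) * norm y powr (1 - real k) * indicator {..\<delta> / \<tau>} (norm y)
          + \<delta>\<^sup>2 * (norm y powr (real k - ?n) * norm y powr (- real k)) * indicator {-1..-\<tau>} (\<delta> * ln (norm y)))"
        by (simp add: algebra_simps)
      also have "\<dots> = C1 * C2 * (X \<delta> y + Y \<delta> y)"
        by (simp add: powr_add[symmetric] X_def Y_def)
      finally show "\<bar>kernel k is y * ?D\<bar> \<le> C1 * C2 * (X \<delta> y + Y \<delta> y)" by (simp add: abs_mult)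
    qed (use C1 C2 in auto)
  qed
  then have "\<forall>is\<in>?S. \<exists>C. C \<ge> 0 \<and> (\<forall>\<delta> y. 0 < \<delta> \<longrightarrow> \<delta> \<le> 1 \<longrightarrow> y \<noteq> 0 \<longrightarrow>
    \<bar>kernel k is y * (iter_partial_deriv is (\<lambda>y. \<phi> y * log_cutoff G \<delta> y) y
      - \<delta> * \<phi> y * log_scale (deriv G) \<delta> y * iter_partial_deriv is ?L y)\<bar> \<le> C * (X \<delta> y + Y \<delta> y))"
    by blast
  from bchoice[OF this] obtain Cf where Cf: "\<forall>is\<in>?S. Cf is \<ge> 0 \<and> (\<forall>\<delta> y. 0 < \<delta> \<longrightarrow> \<delta> \<le> 1 \<longrightarrow> y \<noteq> 0 \<longrightarrow>
    \<bar>kernel k is y * (iter_partial_deriv is (\<lambda>y. \<phi> y * log_cutoff G \<delta> y) y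
      - \<delta> * \<phi> y * log_scale (deriv G) \<delta> y * iter_partial_deriv is ?L y)\<bar> \<le> Cf is * (X \<delta> y + Y \<delta> y))" ..
  \<comment> \<open>The sum collects the expansion errors of the components. The last summand pays
    for replacing \<phi>(y) by \<phi>(0): \<open>Lp\<close> is a Lipschitz constant of \<phi> and
    \<open>B\<close> bounds G'.\<close>
  define M where "M = (\<Sum>is\<in>?S. Cf is) + ?l * Lp * B"
  have M: "M \<ge> 0" using Cf l0 Lp B by (auto simp: M_def intro!: add_nonneg_nonneg sum_nonneg mult_nonneg_nonneg)
  have bound: "\<bar>(\<Sum>is\<in>?S. kernel k is y * iter_partial_deriv is (\<lambda>y. \<phi> y * log_cutoff G \<delta> y) y)
      - ?l * \<phi> 0 * (\<delta> * log_scale (deriv G) \<delta> y * norm y powr - ?n)\<bar> \<le> M * (X \<delta> y + Y \<delta> y)"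
    if *: "0 < \<delta>" "\<delta> \<le> 1" "y \<noteq> 0" for \<delta> y
  proof -
    let ?g = "\<delta> * log_scale (deriv G) \<delta> y"
    have "(\<Sum>is\<in>?S. kernel k is y * iter_partial_deriv is ?L y) = norm y powr (2 * real k - ?n) * log_tensor_square TYPE('n) k y"
      by (simp add: kernel_def log_tensor_square_def sum_distrib_left power2_eq_square mult_ac)
    also have "\<dots> = ?l * norm y powr - ?n"
    proof -
      have "norm y powr - ?n = norm y powr ((2 * real k - ?n) - real (2 * k))" by simp
      also have "\<dots> = norm y powr (2 * real k - ?n) / norm y ^ (2 * k)"
        using powr_realpow[of "norm y" "2 * k"] *(3) by (simp only: powr_diff zero_less_norm_iff) simp
      finally have "norm y powr - ?n = norm y powr (2 * real k - ?n) / norm y ^ (2 * k)" .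
      then show ?thesis unfolding ell_properties(2)[OF k *(3)] by simp
    qed
    finally have sq: "(\<Sum>is\<in>?S. kernel k is y * iter_partial_deriv is ?L y) = ?l * norm y powr - ?n" .
    have "(\<Sum>is\<in>?S. kernel k is y * (iter_partial_deriv is (\<lambda>y. \<phi> y * log_cutoff G \<delta> y) y
        - \<delta> * \<phi> y * log_scale (deriv G) \<delta> y * iter_partial_deriv is ?L y))
      = (\<Sum>is\<in>?S. kernel k is y * iter_partial_deriv is (\<lambda>y. \<phi> y * log_cutoff G \<delta> y) y)
        - (?g * \<phi> y) * (\<Sum>is\<in>?S. kernel k is y * iter_partial_deriv is ?L y)"
      unfolding right_diff_distrib sum_subtractf sum_distrib_left by (simp add: mult_ac)
    moreover have "\<bar>\<Sum>is\<in>?S. kernel k is y * (iter_partial_deriv is (\<lambda>y. \<phi> y * log_cutoff G \<delta> y) y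
        - \<delta> * \<phi> y * log_scale (deriv G) \<delta> y * iter_partial_deriv is ?L y)\<bar> \<le> (\<Sum>is\<in>?S. Cf is) * (X \<delta> y + Y \<delta> y)"
      unfolding sum_distrib_right using Cf * by (intro order_trans[OF sum_abs] sum_mono) blast
    moreover have "\<bar>(?g * \<phi> y) * (?l * norm y powr - ?n) - ?l * \<phi> 0 * (?g * norm y powr - ?n)\<bar> \<le> ?l * Lp * B * (X \<delta> y + Y \<delta> y)"
    proof (cases "\<delta> * ln (norm y) > - \<tau>")
      case True
      then show ?thesis using cutoff_deriv_right[OF cG True] l0 Lp B XY0[of \<delta> y] by simp
    next
      case False
      then have ny: "norm y \<le> \<delta> / \<tau>" using norm_le_of_log_scale(1)[OF *(3,1) \<tau>(1)] by simp
      have "(?g * \<phi> y) * (?l * norm y powr - ?n) - ?l * \<phi> 0 * (?g * norm y powr - ?n) = ?l * ((\<phi> y - \<phi> 0) * (?g * norm y powr - ?n))"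
        by (simp add: algebra_simps)
      then have "\<bar>(?g * \<phi> y) * (?l * norm y powr - ?n) - ?l * \<phi> 0 * (?g * norm y powr - ?n)\<bar> = ?l * (\<bar>\<phi> y - \<phi> 0\<bar> * (\<bar>?g\<bar> * norm y powr - ?n))"
        using l0 by (simp add: abs_mult)
      also have "\<dots> \<le> ?l * ((Lp * norm y) * (B * norm y powr - ?n))"
      proof (intro mult_left_mono mult_mono mult_right_mono)
        show "\<bar>\<phi> y - \<phi> 0\<bar> \<le> Lp * norm y" using Lp(2)[of 0 y] by simp
        have "\<delta> * \<bar>log_scale (deriv G) \<delta> y\<bar> \<le> 1 * B" using * B by (intro mult_mono) auto
        then show "\<bar>?g\<bar> \<le> B" using * by (simp add: abs_mult)
      qed (use l0 Lp B in auto)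
      also have "\<dots> = ?l * Lp * B * X \<delta> y"
        using *(3) ny by (simp add: X_def powr_diff powr_minus field_simps)
      also have "\<dots> \<le> ?l * Lp * B * (X \<delta> y + Y \<delta> y)" using l0 Lp B XY0 by (intro mult_left_mono mult_nonneg_nonneg) auto
      finally show ?thesis .
    qed
    ultimately show ?thesis unfolding sq M_def distrib_right by linarith
  qed
  define c where "c = M * (?n * omega TYPE('n) * (1 / \<tau> + (1 - \<tau>)))"
  have w: "omega TYPE('n) > 0" by (rule omega_pos)
  have iX: "(\<integral>\<^sup>+y. ennreal (X \<delta> y) \<partial>lborel) = ennreal (?n * omega TYPE('n) * (\<delta> / \<tau>))" if "\<delta> > 0" for \<delta>
    using riesz_kernel_ball[where 'n = 'n, of 1 "\<delta> / \<tau>"] that \<tau>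
    by (simp add: X_def ennreal_mult' ennreal_indicator)
  have iY: "(\<integral>\<^sup>+y. ennreal (Y \<delta> y) \<partial>lborel) = ennreal (?n * omega TYPE('n) * (\<delta> * (1 - \<tau>)))" if \<delta>: "\<delta> > 0" for \<delta>
  proof -
    have "(\<integral>\<^sup>+y. ennreal (Y \<delta> y) \<partial>lborel) = (\<integral>\<^sup>+y. (ennreal (\<delta>\<^sup>2) * indicator {-1..-\<tau>} (\<delta> * ln (norm y))) * ennreal (norm y powr - ?n) \<partial>(lborel :: (real ^ 'n) measure))"
      by (intro nn_integral_cong) (simp add: Y_def ennreal_mult' ennreal_indicator mult_ac)
    also have "\<dots> = ennreal (?n * omega TYPE('n)) * (\<integral>\<^sup>+t. ennreal (\<delta>\<^sup>2) * indicator {-1..-\<tau>} (\<delta> * t) \<partial>lborel)"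
      by (rule radial_integral) measurable
    also have "(\<integral>\<^sup>+t. ennreal (\<delta>\<^sup>2) * indicator {-1..-\<tau>} (\<delta> * t) \<partial>lborel) = (\<integral>\<^sup>+t. ennreal (\<delta>\<^sup>2) * indicator {-1 / \<delta>..-\<tau> / \<delta>} t \<partial>lborel)"
      using \<delta> by (intro nn_integral_cong) (auto simp: indicator_def field_simps)
    also have "\<dots> = ennreal (\<delta>\<^sup>2) * emeasure lborel {-1 / \<delta>..-\<tau> / \<delta>}"
      by (rule nn_integral_cmult_indicator) simp
    also have "emeasure lborel {-1 / \<delta>..-\<tau> / \<delta>} = ennreal (- \<tau> / \<delta> - (- 1 / \<delta>))"
      by (rule emeasure_lborel_Icc) (use \<delta> \<tau> in \<open>simp add: divide_right_mono\<close>)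
    also have "- \<tau> / \<delta> - (- 1 / \<delta>) = (1 - \<tau>) / \<delta>" by (simp add: diff_divide_distrib)
    finally show ?thesis using \<delta> \<tau> w by (simp add: ennreal_mult'[symmetric] power2_eq_square)
  qed
  show thesis
  proof (rule that[of c])
    show "c \<ge> 0" using M \<tau> w by (simp add: c_def)
    fix \<delta> :: real assume \<delta>: "0 < \<delta>" "\<delta> \<le> 1"
    define f where "f = (\<lambda>y. \<Sum>is\<in>?S. kernel k is y * iter_partial_deriv is (\<lambda>y. \<phi> y * log_cutoff G \<delta> y) y)"
    define h where "h = (\<lambda>y :: real ^ 'n. ?l * \<phi> 0 * (\<delta> * log_scale (deriv G) \<delta> y * norm y powr - ?n))"
    have test: "test_function (\<lambda>y. \<phi> y * log_cutoff G \<delta> y)"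
      by (rule test_function_mult[OF test_function_smooth[OF \<phi>] log_cutoff_test_function[OF G \<delta>(1)]])
    have fi: "integrable lborel (\<lambda>y. kernel k is y * iter_partial_deriv is (\<lambda>y. \<phi> y * log_cutoff G \<delta> y) y)" if "is \<in> ?S" for "is"
      using that k test_function_iter[OF test] by (intro kernel_test_integrable) auto
    have f: "integrable lborel f" "(\<integral>y. f y \<partial>lborel) = kernel_pairing k (\<lambda>y. \<phi> y * log_cutoff G \<delta> y)"
      unfolding f_def kernel_pairing_def using fi
      by (auto intro!: Bochner_Integration.integrable_sum Bochner_Integration.integral_sum)
    have h: "integrable lborel h" "(\<integral>y. h y \<partial>lborel) = - (?l * \<phi> 0 * (?n * omega TYPE('n)))"
      unfolding h_def using log_slope_integral[OF G \<delta>(1), where 'n = 'n] by auto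
    have "\<bar>\<integral>y. f y - h y \<partial>lborel\<bar> \<le> (\<integral>y. \<bar>f y - h y\<bar> \<partial>lborel)" by (rule integral_abs_bound)
    also have "\<dots> = enn2real (\<integral>\<^sup>+y. ennreal \<bar>f y - h y\<bar> \<partial>lborel)"
      using f h by (intro integral_eq_nn_integral) auto
    also have "\<dots> \<le> c * \<delta>"
    proof (rule enn2real_leI)
      show "0 \<le> c * \<delta>" using \<open>c \<ge> 0\<close> \<delta> by simp
      have "(\<integral>\<^sup>+y. ennreal \<bar>f y - h y\<bar> \<partial>lborel) \<le> (\<integral>\<^sup>+y. ennreal M * (ennreal (X \<delta> y) + ennreal (Y \<delta> y)) \<partial>lborel)"
      proof (rule nn_integral_mono_AE)
        show "AE y in lborel. ennreal \<bar>f y - h y\<bar> \<le> ennreal M * (ennreal (X \<delta> y) + ennreal (Y \<delta> y))"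
          using AE_lborel_nonzero
        proof eventually_elim
          case (elim y)
          show ?case using bound[OF \<delta> elim] XY0 M
            by (simp add: f_def h_def ennreal_plus[symmetric] ennreal_mult[symmetric] del: ennreal_plus)
        qed
      qed
      also have "\<dots> = ennreal M * ((\<integral>\<^sup>+y. ennreal (X \<delta> y) \<partial>lborel) + (\<integral>\<^sup>+y. ennreal (Y \<delta> y) \<partial>lborel))"
        by (subst nn_integral_cmult, simp add: X_def Y_def, subst nn_integral_add) (simp_all add: X_def Y_def)
      also have "\<dots> = ennreal (c * \<delta>)"
      proof -
        define p q where "p = ?n * omega TYPE('n) * (\<delta> / \<tau>)" and "q = ?n * omega TYPE('n) * (\<delta> * (1 - \<tau>))"
        have "p \<ge> 0" "q \<ge> 0" using \<delta> \<tau> w by (auto simp: p_def q_def)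
        then have "ennreal M * (ennreal p + ennreal q) = ennreal (M * (p + q))"
          using M by (simp add: ennreal_mult')
        also have "M * (p + q) = c * \<delta>" by (simp add: p_def q_def c_def algebra_simps)
        finally show ?thesis unfolding iX[OF \<delta>(1)] iY[OF \<delta>(1)] p_def q_def .
      qed
      finally show "(\<integral>\<^sup>+y. ennreal \<bar>f y - h y\<bar> \<partial>lborel) \<le> ennreal (c * \<delta>)" .
    qed
    finally show "\<bar>kernel_pairing k (\<lambda>y. \<phi> y * log_cutoff G \<delta> y) + ?l * ?n * omega TYPE('n) * \<phi> 0\<bar> \<le> c * \<delta>"
      using f h by (simp add: mult_ac)
  qed
qed

section \<open>The distributional divergence is a Dirac mass\<close>

lemma kernel_pairing_add:
  assumes k: "k \<ge> 1" and f: "test_function f" and g: "test_function g"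
  shows "kernel_pairing k (\<lambda>y. f y + g y) = kernel_pairing k f + kernel_pairing k g"
proof -
  have "(\<integral>y. kernel k is y * iter_partial_deriv is (\<lambda>y. f y + g y) y \<partial>lborel) =
      (\<integral>y. kernel k is y * iter_partial_deriv is f y \<partial>lborel) + (\<integral>y. kernel k is y * iter_partial_deriv is g y \<partial>lborel)"
    if "length is = k" for "is"
    using kernel_test_integrable[OF that k test_function_iter[OF f]] kernel_test_integrable[OF that k test_function_iter[OF g]]
    by (simp add: iter_partial_deriv_add[OF open_UNIV test_function_smooth[OF f] test_function_smooth[OF g]] distrib_left)
  then show ?thesis by (simp add: kernel_pairing_def sum.distrib)
qed

text \<open>Only the part of \<phi> multiplied by the cutoff sees the origin; on the rest the
  divergence is a classical integral.\<close>

lemma kernel_pairing_split: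
  fixes \<phi> :: "real ^ 'n::finite \<Rightarrow> real"
  assumes G: "cutoff_one \<tau> G" and \<phi>: "test_function \<phi>" and k: "k \<ge> 1" and \<delta>: "\<delta> > 0"
    and c: "\<And>y :: real ^ 'n. y \<noteq> 0 \<Longrightarrow> kernel_div k y = c * norm y powr - real CARD('n)"
  shows "kernel_pairing k \<phi> = kernel_pairing k (\<lambda>y. \<phi> y * log_cutoff G \<delta> y)
    + (- 1) ^ k * (c * (\<integral>y. norm y powr - real CARD('n) * ((1 - log_cutoff G \<delta> y) * \<phi> y) \<partial>lborel))"
proof -
  have Gt: "test_function (log_cutoff G \<delta> :: real ^ 'n \<Rightarrow> real)" by (rule log_cutoff_test_function[OF G \<delta>])
  have t1: "test_function (\<lambda>y. \<phi> y * log_cutoff G \<delta> y)" by (rule test_function_mult[OF test_function_smooth[OF \<phi>] Gt])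
  have t2: "test_function (\<lambda>y. (1 - log_cutoff G \<delta> y) * \<phi> y)"
    by (intro test_function_mult \<phi> smooth_on_diff smooth_on_const test_function_smooth[OF Gt]) auto
  have "kernel_pairing k \<phi> = kernel_pairing k (\<lambda>y. \<phi> y * log_cutoff G \<delta> y + (1 - log_cutoff G \<delta> y) * \<phi> y)"
    by (simp add: algebra_simps)
  also have "\<dots> = kernel_pairing k (\<lambda>y. \<phi> y * log_cutoff G \<delta> y) + kernel_pairing k (\<lambda>y. (1 - log_cutoff G \<delta> y) * \<phi> y)"
    by (rule kernel_pairing_add[OF k t1 t2])
  also have "kernel_pairing k (\<lambda>y. (1 - log_cutoff G \<delta> y) * \<phi> y) =
      (- 1) ^ k * (c * (\<integral>y. norm y powr - real CARD('n) * ((1 - log_cutoff G \<delta> y) * \<phi> y) \<partial>lborel))"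
    by (rule kernel_pairing_away[OF t2 exp_gt_zero[of "- 1 / \<delta>"] _ k c]) (auto simp: log_cutoff_near_zero[OF G \<delta>])
  finally show ?thesis .
qed

text \<open>If c were nonzero, the part away from the origin would grow like 1/\<delta> although the
  full pairing and the part near the origin stay bounded. With c = 0, letting \<delta> tend to 0
  leaves the value at the origin.\<close>

lemma kernel_pairing_eq:
  fixes \<phi> :: "real ^ 'n::finite \<Rightarrow> real"
  assumes \<phi>: "test_function \<phi>" and k: "k \<ge> 1"
  shows "kernel_pairing k \<phi> = - (ell TYPE('n) k * real CARD('n) * omega TYPE('n)) * \<phi> 0"
proof -
  let ?n = "real CARD('n)"
  let ?l = "ell TYPE('n) k * ?n * omega TYPE('n)"
  have w: "?n * omega TYPE('n) > 0" using omega_pos[where 'n = 'n] by simp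
  obtain \<tau> G where G: "cutoff_one \<tau> G" using cutoff_one_exists[OF zero_less_one] by blast
  have \<tau>: "0 < \<tau>" "\<tau> < 1" using G by (auto simp: cutoff_one_def)
  obtain c where c: "\<And>y :: real ^ 'n. y \<noteq> 0 \<Longrightarrow> kernel_div k y = c * norm y powr - ?n"
    using kernel_div_eq[OF k] by blast
  have "c = 0"
  proof (rule ccontr)
    assume c0: "c \<noteq> 0"
    \<comment> \<open>A fixed nonnegative test function that equals 1 for |y| < exp(-1).\<close>
    define \<eta> where "\<eta> = (log_cutoff G 1 :: real ^ 'n \<Rightarrow> real)"
    have \<eta>: "test_function \<eta>" unfolding \<eta>_def by (rule log_cutoff_test_function[OF G]) simp
    obtain C where C: "C \<ge> 0" "\<And>\<delta>. 0 < \<delta> \<Longrightarrow> \<delta> \<le> 1 \<Longrightarrow>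
        \<bar>kernel_pairing k (\<lambda>y. \<eta> y * log_cutoff G \<delta> y) + ?l * \<eta> 0\<bar> \<le> C * \<delta>"
      using kernel_pairing_cutoff[OF G \<eta> k] by blast
    define M where "M = \<bar>kernel_pairing k \<eta>\<bar> + \<bar>?l * \<eta> 0\<bar> + C"
    have M0: "M \<ge> 0" using C by (simp add: M_def)
    define I where "I = (\<lambda>\<delta>. \<integral>y. norm y powr - ?n * ((1 - log_cutoff G \<delta> y) * \<eta> y) \<partial>lborel)"
    have upper: "\<bar>c\<bar> * \<bar>I \<delta>\<bar> \<le> M" if \<delta>: "0 < \<delta>" "\<delta> \<le> 1" for \<delta>
    proof -
      have "kernel_pairing k \<eta> = kernel_pairing k (\<lambda>y. \<eta> y * log_cutoff G \<delta> y) + (- 1) ^ k * (c * I \<delta>)"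
        unfolding I_def by (rule kernel_pairing_split[OF G \<eta> k \<delta>(1) c])
      moreover have "\<bar>(- 1) ^ k * (c * I \<delta>)\<bar> = \<bar>c\<bar> * \<bar>I \<delta>\<bar>" by (simp add: abs_mult)
      moreover have "C * \<delta> \<le> C" using C(1) \<delta> by (simp add: mult_left_le)
      ultimately show ?thesis using C(2)[OF \<delta>] unfolding M_def by linarith
    qed
    \<comment> \<open>On the shell -\<tau>/\<delta> < ln |y| < -1 the cutoff at scale \<delta> is 0
      and \<eta> is 1, so the integrand is |y|^(-n) there.\<close>
    have lower: "?n * omega TYPE('n) * (\<tau> / \<delta> - 1) \<le> I \<delta>" if \<delta>: "0 < \<delta>" "\<delta> \<le> \<tau>" for \<delta>
    proof -
      let ?f = "\<lambda>y :: real ^ 'n. norm y powr - ?n * ((1 - log_cutoff G \<delta> y) * \<eta> y)"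
      have f0: "?f y \<ge> 0" for y
        unfolding \<eta>_def by (intro mult_nonneg_nonneg) (auto simp: log_cutoff_range[OF G])
      have m: "?f \<in> borel_measurable lborel"
        using test_function_borel[OF \<eta>] test_function_borel[OF log_cutoff_test_function[OF G \<delta>(1)]] by measurable
      let ?\<rho> = "exp (- 1 / \<delta>)"
      have int: "integrable lborel ?f"
      proof (rule Bochner_Integration.integrable_bound)
        show "integrable lborel (\<lambda>y. ?\<rho> powr - ?n * \<eta> y)" using test_function_integrable[OF \<eta>] by simp
        show "AE y in lborel. norm (?f y) \<le> norm (?\<rho> powr - ?n * \<eta> y)"
        proof (rule AE_I2)
          fix y :: "real ^ 'n"
          show "norm (?f y) \<le> norm (?\<rho> powr - ?n * \<eta> y)"
          proof (cases "norm y < ?\<rho>")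
            case True then show ?thesis by (simp add: log_cutoff_near_zero[OF G \<delta>(1)])
          next
            case False
            have "norm y powr - ?n * ((1 - log_cutoff G \<delta> y) * \<eta> y) \<le> ?\<rho> powr - ?n * (1 * \<eta> y)"
              using False log_cutoff_range[OF G, of \<delta> y] log_cutoff_range[OF G, of 1 y]
              by (intro mult_mono powr_mono2') (auto simp: \<eta>_def)
            then show ?thesis using f0[of y] by (simp add: \<eta>_def log_cutoff_range[OF G])
          qed
        qed
      qed (rule m)
      have "ennreal (?n * omega TYPE('n) * (\<tau> / \<delta> - 1)) =
          (\<integral>\<^sup>+y. indicator {- \<tau> / \<delta><..< - 1} (ln (norm y)) * ennreal (norm y powr - ?n) \<partial>(lborel :: (real ^ 'n) measure))"
        using \<delta> by (subst shell_integral) (auto simp: field_simps)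
      also have "\<dots> \<le> (\<integral>\<^sup>+y. ennreal (?f y) \<partial>lborel)"
      proof (rule nn_integral_mono)
        fix y :: "real ^ 'n"
        show "indicator {- \<tau> / \<delta><..< - 1} (ln (norm y)) * ennreal (norm y powr - ?n) \<le> ennreal (?f y)"
        proof (cases "y \<noteq> 0 \<and> ln (norm y) \<in> {- \<tau> / \<delta><..< - 1}")
          case True
          then have "\<delta> * ln (norm y) > - \<tau>" using \<delta> by (simp add: field_simps)
          then have "log_cutoff G \<delta> y = 0" using True by (intro log_cutoff_eq_0[OF G]) auto
          moreover have "\<eta> y = 1" using True G by (simp add: \<eta>_def log_cutoff_def cutoff_one_def)
          ultimately show ?thesis using True by simp
        qed auto
      qed
      also have "\<dots> = ennreal (I \<delta>)" unfolding I_def by (rule nn_integral_eq_integral[OF int]) (use f0 in auto)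
      finally show ?thesis
        by (subst (asm) ennreal_le_iff) (auto simp: I_def intro!: integral_nonneg_AE f0)
    qed
    \<comment> \<open>At \<delta> = \<tau>/q the lower bound is n \<omega> (q - 1). With this q, its
      product with |c| is M + |c| n \<omega>, more than the upper bound M.\<close>
    define q where "q = M / (\<bar>c\<bar> * (?n * omega TYPE('n))) + 2"
    have q: "q \<ge> 2" using M0 w by (simp add: q_def)
    have d: "0 < \<tau> / q" "\<tau> / q \<le> \<tau>" "\<tau> / q \<le> 1" using \<tau> q by (auto simp: field_simps intro: order_trans[of _ 1])
    have "\<bar>c\<bar> * (?n * omega TYPE('n) * (q - 1)) \<le> \<bar>c\<bar> * \<bar>I (\<tau> / q)\<bar>"
      using lower[OF d(1,2)] \<tau> q by (intro mult_left_mono) auto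
    also have "\<dots> \<le> M" by (rule upper[OF d(1,3)])
    finally have "\<bar>c\<bar> * (?n * omega TYPE('n)) * (q - 1) \<le> M" by (simp add: mult.assoc)
    moreover have pos: "\<bar>c\<bar> * (?n * omega TYPE('n)) > 0" using c0 w by simp
    have "\<bar>c\<bar> * (?n * omega TYPE('n)) * (q - 1) = M + \<bar>c\<bar> * (?n * omega TYPE('n))"
      using c0 less_imp_neq[OF omega_pos[where 'n = 'n]] by (simp add: q_def distrib_left)
    ultimately show False using pos by linarith
  qed
  obtain C where C: "C \<ge> 0" "\<And>\<delta>. 0 < \<delta> \<Longrightarrow> \<delta> \<le> 1 \<Longrightarrow>
      \<bar>kernel_pairing k (\<lambda>y. \<phi> y * log_cutoff G \<delta> y) + ?l * \<phi> 0\<bar> \<le> C * \<delta>"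
    using kernel_pairing_cutoff[OF G \<phi> k] by blast
  have *: "\<bar>kernel_pairing k \<phi> + ?l * \<phi> 0\<bar> \<le> C * \<delta>" if "0 < \<delta>" "\<delta> \<le> 1" for \<delta>
    using C(2)[OF that] kernel_pairing_split[OF G \<phi> k that(1) c] \<open>c = 0\<close> by simp
  have "((\<lambda>\<delta>. C * \<delta>) \<longlongrightarrow> C * 0) (at_right 0)" by (intro tendsto_intros)
  moreover have "\<forall>\<^sub>F \<delta> in at_right 0. \<bar>kernel_pairing k \<phi> + ?l * \<phi> 0\<bar> \<le> C * \<delta>"
    unfolding eventually_at_right_field by (rule exI[of _ 1]) (auto intro: *)
  ultimately have "\<bar>kernel_pairing k \<phi> + ?l * \<phi> 0\<bar> \<le> C * 0"
    by (intro tendsto_lowerbound[of "\<lambda>\<delta>. C * \<delta>" "C * 0" "at_right 0"]) auto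
  then show ?thesis by simp
qed

section \<open>Testing weak derivatives with the truncated kernel\<close>

text \<open>The kernel is truncated so that its convolution with a test function is again a test function.\<close>

definition cut_kernel :: "nat \<Rightarrow> real \<Rightarrow> 'n::finite list \<Rightarrow> real ^ 'n \<Rightarrow> real" where
  "cut_kernel k R is z = kernel k is z * indicator (cball 0 R) z"

lemma cut_kernel_integrable:
  assumes "length is = k" "k \<ge> 1"
  shows "integrable lborel (cut_kernel k R is :: real ^ 'n::finite \<Rightarrow> real)"
  unfolding cut_kernel_def[abs_def]
  by (rule kernel_mult_integrable[OF assms, of _ 1 R]) (auto simp: indicator_def)

text \<open>The weak derivatives are tested with the convolutions of \<psi> with the kernel
  components. The sum of their derivatives at x pairs the kernel with \<psi>(x - z) as a function of
  z, which gives a multiple of \<psi>(x). For |x| \<le> \<rho>, the only place where u can be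
  nonzero, the truncation at R is not felt.\<close>

lemma weak_representation_test:
  fixes u :: "real ^ 'n::finite \<Rightarrow> real"
  assumes k: "k \<ge> 1" and g: "\<And>is. length is = k \<Longrightarrow> has_weak_deriv u is (g is)"
    and u0: "\<And>x. norm x > \<rho> \<Longrightarrow> u x = 0" and \<psi>: "test_function \<psi>" and \<psi>0: "\<And>x. norm x > \<rho>' \<Longrightarrow> \<psi> x = 0" and R: "R \<ge> \<rho> + \<rho>'"
  shows "- (ell TYPE('n) k * real CARD('n) * omega TYPE('n)) * (\<integral>x. u x * \<psi> x \<partial>lebesgue) =
    (\<Sum>is\<in>{is. length is = k}. \<integral>y. g is y * (\<integral>z. cut_kernel k R is z * \<psi> (y - z) \<partial>lborel) \<partial>lebesgue)"
proof -
  let ?S = "{is :: 'n list. length is = k}"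
  let ?c = "- (ell TYPE('n) k * real CARD('n) * omega TYPE('n))"
  define \<Phi> where "\<Phi> = (\<lambda>is y. \<integral>z. cut_kernel k R is z * \<psi> (y - z) \<partial>lborel)"
  have \<Phi>: "test_function (\<Phi> is)" "iter_partial_deriv is (\<Phi> is) = (\<lambda>x. \<integral>z. cut_kernel k R is z * iter_partial_deriv is \<psi> (x - z) \<partial>lborel)"
    if "is \<in> ?S" for "is"
  proof -
    have "length is = k" using that by simp
    note int = cut_kernel_integrable[OF this k, of R]
    show "test_function (\<Phi> is)" unfolding \<Phi>_def
      by (rule convolution_test_function[OF int _ \<psi>, of _ R]) (auto simp: cut_kernel_def indicator_def split: if_splits)
    show "iter_partial_deriv is (\<Phi> is) = (\<lambda>x. \<integral>z. cut_kernel k R is z * iter_partial_deriv is \<psi> (x - z) \<partial>lborel)"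
      unfolding \<Phi>_def by (rule convolution_iter[OF int _ \<psi>]) simp
  qed
  \<comment> \<open>The sign (-1)^k comes from differentiating the reflected function; it cancels
    against the sign in the definition of weak derivatives.\<close>
  have pair: "(\<Sum>is\<in>?S. iter_partial_deriv is (\<Phi> is) x) = (- 1) ^ k * (?c * \<psi> x)" if x: "norm x \<le> \<rho>" for x
  proof -
    have t: "test_function (\<lambda>z. \<psi> (x + (- 1) *\<^sub>R z))"
    proof (rule test_functionI[of _ "\<rho>' + norm x"])
      show "smooth_on UNIV (\<lambda>z. \<psi> (x + (- 1) *\<^sub>R z))"
        using smooth_on_scale_compose[OF open_UNIV test_function_smooth[OF \<psi>], of x "-1"] by simp
      show "\<psi> (x + (- 1) *\<^sub>R z) = 0" if "norm z > \<rho>' + norm x" for z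
        using that norm_triangle_ineq2[of z x] by (intro \<psi>0) (simp add: norm_minus_commute)
    qed
    have "iter_partial_deriv is (\<Phi> is) x = (- 1) ^ k * (\<integral>z. kernel k is z * iter_partial_deriv is (\<lambda>z. \<psi> (x + (- 1) *\<^sub>R z)) z \<partial>lborel)"
      if "is": "is \<in> ?S" for "is"
    proof -
      have op: "open {z :: real ^ 'n. norm z > \<rho>'}" by (intro open_Collect_less continuous_intros)
      have \<psi>i: "iter_partial_deriv is \<psi> z = 0" if "norm z > \<rho>'" for z
        using iter_partial_deriv_cong[OF op, of \<psi> "\<lambda>_. 0" z "is"] \<psi>0 that by (simp add: iter_partial_deriv_zero)
      have "cut_kernel k R is z * iter_partial_deriv is \<psi> (x - z) =
          (- 1) ^ k * (kernel k is z * iter_partial_deriv is (\<lambda>z. \<psi> (x + (- 1) *\<^sub>R z)) z)" for z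
      proof -
        have "iter_partial_deriv is (\<lambda>z. \<psi> (x + (- 1) *\<^sub>R z)) z = (- 1) ^ k * iter_partial_deriv is \<psi> (x - z)"
          using iter_partial_deriv_scale[OF open_UNIV test_function_smooth[OF \<psi>], of x "-1" z "is"] "is" by simp
        moreover have "iter_partial_deriv is \<psi> (x - z) = 0" if "norm z > R"
          using that x R norm_triangle_ineq2[of z x] by (intro \<psi>i) (simp add: norm_minus_commute)
        ultimately show ?thesis
        proof (cases "norm z > R")
          case False
          have "(- 1 :: real) ^ k * (- 1) ^ k = 1" by (simp add: power_mult_distrib[symmetric])
          then have "(- 1) ^ k * (kernel k is z * ((- 1) ^ k * a)) = kernel k is z * a" for a :: real
            by (metis mult.left_commute mult.assoc mult_1)
          with False \<open>iter_partial_deriv is (\<lambda>z. \<psi> (x + (- 1) *\<^sub>R z)) z = _\<close> show ?thesis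
            by (simp only:) (simp add: cut_kernel_def)
        qed (simp add: cut_kernel_def)
      qed
      then show ?thesis unfolding \<Phi>(2)[OF "is"] by simp
    qed
    then have "(\<Sum>is\<in>?S. iter_partial_deriv is (\<Phi> is) x) = (- 1) ^ k * kernel_pairing k (\<lambda>z. \<psi> (x + (- 1) *\<^sub>R z))"
      by (simp add: kernel_pairing_def sum_distrib_left)
    then show ?thesis using kernel_pairing_eq[OF t k] by simp
  qed
  have li: "locally_integrable u" using g[of "replicate k undefined"] by (simp add: has_weak_deriv_def)
  have "(- 1) ^ k * (\<Sum>is\<in>?S. \<integral>y. g is y * \<Phi> is y \<partial>lebesgue) = (\<Sum>is\<in>?S. \<integral>x. u x * iter_partial_deriv is (\<Phi> is) x \<partial>lebesgue)"
    unfolding sum_distrib_left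
  proof (rule sum.cong[OF refl])
    fix "is" assume "is": "is \<in> ?S"
    then show "(- 1) ^ k * (\<integral>y. g is y * \<Phi> is y \<partial>lebesgue) = (\<integral>x. u x * iter_partial_deriv is (\<Phi> is) x \<partial>lebesgue)"
      using g[of "is"] \<Phi>(1)[OF "is"] by (auto simp: has_weak_deriv_def)
  qed
  also have "\<dots> = (\<integral>x. (\<Sum>is\<in>?S. u x * iter_partial_deriv is (\<Phi> is) x) \<partial>lebesgue)"
    using \<Phi>(1) by (intro Bochner_Integration.integral_sum[symmetric] locally_integrable_mult_test[OF li] test_function_iter)
  also have "\<dots> = (\<integral>x. ((- 1) ^ k * ?c) * (u x * \<psi> x) \<partial>lebesgue)"
  proof (rule Bochner_Integration.integral_cong[OF refl])
    fix x
    have "(\<Sum>is\<in>?S. u x * iter_partial_deriv is (\<Phi> is) x) = u x * (\<Sum>is\<in>?S. iter_partial_deriv is (\<Phi> is) x)"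
      by (simp add: sum_distrib_left)
    also have "\<dots> = ((- 1) ^ k * ?c) * (u x * \<psi> x)"
    proof (cases "norm x > \<rho>")
      case False then show ?thesis by (subst pair) (simp_all add: not_less)
    qed (simp add: u0)
    finally show "(\<Sum>is\<in>?S. u x * iter_partial_deriv is (\<Phi> is) x) = ((- 1) ^ k * ?c) * (u x * \<psi> x)" .
  qed
  also have "\<dots> = (- 1) ^ k * (?c * (\<integral>x. u x * \<psi> x \<partial>lebesgue))" by simp
  finally have "(\<Sum>is\<in>?S. \<integral>y. g is y * \<Phi> is y \<partial>lebesgue) = ?c * (\<integral>x. u x * \<psi> x \<partial>lebesgue)"
    by (subst (asm) mult_left_cancel) simp_all
  then show ?thesis by (simp add: \<Phi>_def)
qed

lemma ball_test_functions:
  fixes a :: "real ^ 'n::finite"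
  assumes r: "r > 0"
  obtains \<phi> :: "nat \<Rightarrow> real ^ 'n \<Rightarrow> real" where "\<And>j. test_function (\<phi> j)" "\<And>j x. \<bar>\<phi> j x\<bar> \<le> 1"
    "\<And>j x. norm x > norm a + r \<Longrightarrow> \<phi> j x = 0" "\<And>x. (\<lambda>j. \<phi> j x) \<longlonglongrightarrow> indicator (ball a r) x"
proof -
  define \<phi> where "\<phi> = (\<lambda>(j::nat) x. smooth_step (- real j * (norm (x - a))\<^sup>2 + real j * r\<^sup>2))"
  have out: "\<phi> j x = 0" if "norm (x - a) \<ge> r" for j x
  proof -
    have "r\<^sup>2 \<le> (norm (x - a))\<^sup>2" using that r by (intro power_mono) auto
    then have "real j * r\<^sup>2 \<le> real j * (norm (x - a))\<^sup>2" by (intro mult_left_mono) auto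
    then show ?thesis unfolding \<phi>_def by (intro smooth_step(2)) simp
  qed
  have R0: "\<phi> j x = 0" if "norm x > norm a + r" for j x
    using that norm_triangle_ineq2[of x a] by (intro out) simp
  show thesis
  proof (rule that[of \<phi>])
    show "test_function (\<phi> j)" for j
    proof (rule test_functionI)
      show "smooth_on UNIV (\<phi> j)" unfolding \<phi>_def
        by (intro smooth_on_compose1[OF open_UNIV _ smooth_step(1)] smooth_on_add smooth_on_cmult smooth_on_norm_square smooth_on_const) auto
    qed (rule R0)
    show "\<bar>\<phi> j x\<bar> \<le> 1" for j x using smooth_step(4,5) by (simp add: \<phi>_def)
    show "(\<lambda>j. \<phi> j x) \<longlonglongrightarrow> indicator (ball a r) x" for x
    proof (cases "x \<in> ball a r")
      case True
      then have "norm (x - a) < r" by (simp add: dist_norm norm_minus_commute)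
      then have d: "r\<^sup>2 - (norm (x - a))\<^sup>2 > 0" using r by (simp add: power_strict_mono)
      have "\<forall>\<^sub>F j in sequentially. \<phi> j x = 1"
        using eventually_ge_at_top[of "nat \<lceil>1 / (r\<^sup>2 - (norm (x - a))\<^sup>2)\<rceil>"]
      proof eventually_elim
        case (elim j)
        then have "1 / (r\<^sup>2 - (norm (x - a))\<^sup>2) \<le> real j" by (simp add: nat_le_iff ceiling_le_iff)
        then have "1 \<le> real j * (r\<^sup>2 - (norm (x - a))\<^sup>2)" using d by (simp add: pos_divide_le_eq)
        then show ?case unfolding \<phi>_def by (intro smooth_step(3)) (simp add: algebra_simps)
      qed
      then show ?thesis using True by (simp add: tendsto_eventually)
    next
      case False
      then have "\<phi> j x = 0" for j by (intro out) (simp add: dist_norm norm_minus_commute)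
      then show ?thesis using False by simp
    qed
  qed (rule R0)
qed

section \<open>Representation of the precise values\<close>

lemma locally_integrable_borelI:
  fixes f :: "real ^ 'n::finite \<Rightarrow> real"
  assumes f: "f \<in> borel_measurable borel" and int: "\<And>R. integrable lborel (\<lambda>x. f x * indicator (cball 0 R) x)"
  shows "locally_integrable f"
  unfolding locally_integrable_def set_integrable_def
proof (intro allI impI)
  fix K :: "(real ^ 'n) set" assume K: "compact K"
  then obtain R where R: "\<forall>x\<in>K. norm x \<le> R" using compact_imp_bounded bounded_iff by blast
  have Kb: "K \<in> sets borel" by (rule borel_closed[OF compact_imp_closed[OF K]])
  have "integrable lborel (\<lambda>x. indicator K x *\<^sub>R (f x * indicator (cball 0 R) x))"
    using Kb int by (intro integrable_mult_indicator) auto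
  moreover have "(\<lambda>x. indicator K x *\<^sub>R (f x * indicator (cball 0 R) x)) = (\<lambda>x. indicator K x *\<^sub>R f x)"
    using R by (auto simp: indicator_def)
  ultimately have "integrable lborel (\<lambda>x. indicator K x *\<^sub>R f x)" by (simp only:)
  then show "integrable lebesgue (\<lambda>x. indicator K x *\<^sub>R f x)"
    using f Kb by (subst integrable_completion) auto
qed

section \<open>Averages over balls\<close>

lemma content_ball_omega:
  "r \<ge> 0 \<Longrightarrow> measure lborel (ball (x :: real ^ 'n::finite) r) = omega TYPE('n) * r ^ CARD('n)"
  using content_ball[of r x] by (simp add: omega_eq)

lemma ball_average_eq:
  "r \<ge> 0 \<Longrightarrow> ball_average f x r = (\<integral>y. f y * indicator (ball x r) y \<partial>lebesgue) / (omega TYPE('n) * r ^ CARD('n))"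
  for x :: "real ^ 'n::finite"
  by (simp add: ball_average_def set_lebesgue_integral_def content_ball_omega mult.commute)

lemma integrable_mult_ball:
  fixes f :: "real ^ 'n::finite \<Rightarrow> real"
  assumes "locally_integrable f"
  shows "integrable lebesgue (\<lambda>y. f y * indicator (ball x r) y)"
proof (rule locally_integrable_mult_bounded[OF assms, of _ 1 "norm x + r"])
  show "indicat_real (ball x r) y = 0" if "norm x + r < norm y" for y
    using that norm_triangle_ineq2[of y x] by (auto simp: indicator_def dist_norm norm_minus_commute)
qed (auto simp: indicator_def)

lemma integrable_ball_indicator: "integrable lebesgue (indicat_real (ball (x :: real ^ 'n::finite) r))"
  by (rule integrable_real_indicator) (use emeasure_lborel_ball_finite[of x r] in auto)

lemma integral_ball_indicator:
  "r \<ge> 0 \<Longrightarrow> (\<integral>y. indicat_real (ball (x :: real ^ 'n::finite) r) y \<partial>lebesgue) = omega TYPE('n) * r ^ CARD('n)"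
  by (simp add: content_ball_omega)

lemma ball_average_tendsto:
  fixes f :: "real ^ 'n::finite \<Rightarrow> real"
  assumes f: "locally_integrable f" and cont: "isCont f x"
  shows "(ball_average f x \<longlongrightarrow> f x) (at_right 0)"
proof (rule tendstoI)
  fix e :: real assume e: "e > 0"
  obtain d where d: "d > 0" "\<And>y. dist y x < d \<Longrightarrow> dist (f y) (f x) < e / 2"
    using cont e unfolding continuous_at_eps_delta by (metis half_gt_zero)
  have "dist (ball_average f x r) (f x) < e" if r: "0 < r" "r < d" for r
  proof -
    let ?B = "ball x r"
    have V: "omega TYPE('n) * r ^ CARD('n) > 0" using r omega_pos[where 'n = 'n] by simp
    have "ball_average f x r - f x = (\<integral>y. f y * indicator ?B y \<partial>lebesgue) / (omega TYPE('n) * r ^ CARD('n)) - f x"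
      using r by (simp add: ball_average_eq)
    also have "\<dots> = ((\<integral>y. f y * indicator ?B y \<partial>lebesgue) - f x * (\<integral>y. indicator ?B y \<partial>lebesgue)) / (omega TYPE('n) * r ^ CARD('n))"
      using less_imp_neq[OF omega_pos[where 'n = 'n]] r unfolding integral_ball_indicator[OF less_imp_le[OF r(1)]] by (simp add: diff_divide_distrib)
    also have "(\<integral>y. f y * indicator ?B y \<partial>lebesgue) - f x * (\<integral>y. indicator ?B y \<partial>lebesgue) =
        (\<integral>y. f y * indicator ?B y - f x * indicator ?B y \<partial>lebesgue)"
      using integrable_mult_ball[OF f] integrable_ball_indicator by (subst Bochner_Integration.integral_diff) auto
    finally have 1: "ball_average f x r - f x = (\<integral>y. f y * indicator ?B y - f x * indicator ?B y \<partial>lebesgue) / (omega TYPE('n) * r ^ CARD('n))" .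
    have "\<bar>\<integral>y. f y * indicator ?B y - f x * indicator ?B y \<partial>lebesgue\<bar> \<le> (\<integral>y. \<bar>f y * indicator ?B y - f x * indicator ?B y\<bar> \<partial>lebesgue)"
      by (rule integral_abs_bound)
    also have "\<dots> \<le> (\<integral>y. e / 2 * indicator ?B y \<partial>lebesgue)"
    proof (rule integral_mono)
      show "integrable lebesgue (\<lambda>y. \<bar>f y * indicator ?B y - f x * indicator ?B y\<bar>)"
        by (intro integrable_abs Bochner_Integration.integrable_diff integrable_mult_right integrable_mult_ball[OF f] integrable_ball_indicator)
      show "integrable lebesgue (\<lambda>y. e / 2 * indicat_real ?B y)" by (intro integrable_mult_right integrable_ball_indicator)
      show "\<bar>f y * indicator ?B y - f x * indicator ?B y\<bar> \<le> e / 2 * indicator ?B y" for y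
        using d(2)[of y] r by (cases "y \<in> ?B") (auto simp: dist_commute dist_real_def abs_minus_commute)
    qed
    also have "\<dots> = e / 2 * (omega TYPE('n) * r ^ CARD('n))"
      using r by (simp add: content_ball_omega)
    finally have "\<bar>ball_average f x r - f x\<bar> \<le> e / 2"
      unfolding 1 using V by (simp add: abs_divide pos_divide_le_eq)
    then show ?thesis using e by (simp add: dist_real_def)
  qed
  then show "\<forall>\<^sub>F r in at_right 0. dist (ball_average f x r) (f x) < e"
    unfolding eventually_at_right_field using d(1) by auto
qed

text \<open>The average of the Riesz kernel over a ball is at most a multiple of its value at the
  centre w. If |w| \<ge> 2 r, the kernel is comparable with that value on the whole ball; otherwise
  the ball lies in the one of radius 3 r about the origin, and r is comparable with or larger than
  |w|. This supplies the majorant for letting r tend to 0.\<close>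

lemma riesz_ball_bound:
  fixes w :: "real ^ 'n::finite"
  assumes k: "1 \<le> k" "k < CARD('n)"
  obtains C where "C \<ge> 0" "\<And>w :: real ^ 'n. \<And>r. w \<noteq> 0 \<Longrightarrow> r > 0 \<Longrightarrow>
    (\<integral>\<^sup>+z. ennreal (norm z powr (real k - real CARD('n))) * indicator (ball w r) z \<partial>lborel)
      \<le> ennreal (C * (omega TYPE('n) * r ^ CARD('n)) * norm w powr (real k - real CARD('n)))"
proof -
  let ?n = "real CARD('n)" and ?k = "real k"
  let ?a = "2 powr (?n - ?k)"
  have w: "omega TYPE('n) > 0" by (rule omega_pos)
  define C where "C = ?a + ?n * 3 powr ?k / ?k * ?a"
  have C: "C \<ge> ?a" "C \<ge> ?n * 3 powr ?k / ?k * ?a" by (auto simp: C_def)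
  have "(\<integral>\<^sup>+z. ennreal (norm z powr (?k - ?n)) * indicator (ball w r) z \<partial>lborel)
      \<le> ennreal (C * (omega TYPE('n) * r ^ CARD('n)) * norm w powr (?k - ?n))" if wr: "w \<noteq> 0" "r > 0" for w :: "real ^ 'n" and r
  proof (cases "norm w \<ge> 2 * r")
    case True
    have "(\<integral>\<^sup>+z. ennreal (norm z powr (?k - ?n)) * indicator (ball w r) z \<partial>lborel)
      \<le> (\<integral>\<^sup>+z. ennreal (?a * norm w powr (?k - ?n)) * indicator (ball w r) z \<partial>lborel)"
    proof (intro nn_integral_mono)
      fix z :: "real ^ 'n"
      show "ennreal (norm z powr (?k - ?n)) * indicator (ball w r) z \<le> ennreal (?a * norm w powr (?k - ?n)) * indicator (ball w r) z"
      proof (cases "z \<in> ball w r")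
        case T: True
        then have "norm z \<ge> norm w / 2" using True norm_triangle_ineq2[of w z] by (simp add: dist_norm)
        then have "norm z powr (?k - ?n) \<le> (norm w / 2) powr (?k - ?n)" using k wr by (intro powr_mono2') auto
        also have "\<dots> = ?a * norm w powr (?k - ?n)" by (simp add: powr_divide powr_diff field_simps)
        finally show ?thesis using T by (simp add: ennreal_leI)
      qed simp
    qed
    also have "\<dots> = ennreal (?a * norm w powr (?k - ?n) * (omega TYPE('n) * r ^ CARD('n)))"
      using wr w by (subst nn_integral_cmult_indicator) (auto simp: emeasure_ball_omega ennreal_mult[symmetric])
    also have "\<dots> \<le> ennreal (C * (omega TYPE('n) * r ^ CARD('n)) * norm w powr (?k - ?n))"
    proof (rule ennreal_leI)
      have "?a * (norm w powr (?k - ?n) * (omega TYPE('n) * r ^ CARD('n))) \<le> C * (norm w powr (?k - ?n) * (omega TYPE('n) * r ^ CARD('n)))"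
        using C wr w by (intro mult_right_mono) auto
      then show "?a * norm w powr (?k - ?n) * (omega TYPE('n) * r ^ CARD('n)) \<le> C * (omega TYPE('n) * r ^ CARD('n)) * norm w powr (?k - ?n)"
        by (simp add: mult_ac)
    qed
    finally show ?thesis .
  next
    case False
    have "(\<integral>\<^sup>+z. ennreal (norm z powr (?k - ?n)) * indicator (ball w r) z \<partial>lborel)
      \<le> (\<integral>\<^sup>+z. ennreal (norm (z :: real ^ 'n) powr (?k - ?n)) * indicator {..3 * r} (norm z) \<partial>lborel)"
    proof (intro nn_integral_mono mult_left_mono)
      fix z :: "real ^ 'n"
      have "norm z \<le> 3 * r" if "z \<in> ball w r"
        using that False norm_triangle_ineq2[of z w] by (simp add: dist_norm norm_minus_commute)
      then show "indicator (ball w r) z \<le> (indicator {..3 * r} (norm z) :: ennreal)" by (auto simp: indicator_def)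
    qed auto
    also have "\<dots> = ennreal (?n * omega TYPE('n) * (3 * r) powr ?k / ?k)"
      using k wr by (subst riesz_kernel_ball) auto
    also have "\<dots> \<le> ennreal (C * (omega TYPE('n) * r ^ CARD('n)) * norm w powr (?k - ?n))"
    proof (rule ennreal_leI)
      have "r powr ?k = r powr ?n * r powr (?k - ?n)" using wr by (simp add: powr_add[symmetric])
      also have "r powr (?k - ?n) \<le> ?a * norm w powr (?k - ?n)"
      proof -
        have "(2 * r) powr (?k - ?n) \<le> norm w powr (?k - ?n)" using False k wr by (intro powr_mono2') auto
        then have "?a * (2 * r) powr (?k - ?n) \<le> ?a * norm w powr (?k - ?n)" by (intro mult_left_mono) auto
        moreover have "?a * (2 * r) powr (?k - ?n) = r powr (?k - ?n)"
          using wr by (simp add: powr_mult mult.assoc[symmetric] powr_add[symmetric])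
        ultimately show ?thesis by simp
      qed
      finally have 1: "r powr ?k \<le> r ^ CARD('n) * (?a * norm w powr (?k - ?n))"
        using wr by (simp add: powr_realpow mult_left_mono)
      have "?n * omega TYPE('n) * (3 * r) powr ?k / ?k = (?n * 3 powr ?k / ?k) * omega TYPE('n) * r powr ?k"
        using wr by (simp add: powr_mult)
      also have "\<dots> \<le> (?n * 3 powr ?k / ?k) * omega TYPE('n) * (r ^ CARD('n) * (?a * norm w powr (?k - ?n)))"
        using w by (intro mult_left_mono[OF 1]) auto
      also have "\<dots> = (?n * 3 powr ?k / ?k * ?a) * ((omega TYPE('n) * r ^ CARD('n)) * norm w powr (?k - ?n))"
        by (simp add: mult_ac)
      also have "\<dots> \<le> C * ((omega TYPE('n) * r ^ CARD('n)) * norm w powr (?k - ?n))"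
        using C wr w by (intro mult_right_mono) auto
      finally show "?n * omega TYPE('n) * (3 * r) powr ?k / ?k \<le> C * (omega TYPE('n) * r ^ CARD('n)) * norm w powr (?k - ?n)"
        by (simp add: mult.assoc)
    qed
    finally show ?thesis .
  qed
  moreover have "C \<ge> 0" by (simp add: C_def)
  ultimately show thesis by (rule that[rotated])
qed

lemma cut_kernel_measurable:
  "length is = k \<Longrightarrow> k \<ge> 1 \<Longrightarrow> cut_kernel k R is \<in> borel_measurable borel"
  using borel_measurable_integrable[OF cut_kernel_integrable] by simp

lemma cut_kernel_ball_average_bound:
  assumes k: "1 \<le> k" "k < CARD('n::finite)" and "is": "length (is :: 'n list) = k"
  obtains C where "C \<ge> 0" "\<And>R w r. w \<noteq> 0 \<Longrightarrow> r > 0 \<Longrightarrow>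
    \<bar>ball_average (cut_kernel k R is) w r\<bar> \<le> C * norm w powr (real k - real CARD('n))"
proof -
  let ?n = "real CARD('n)" and ?k = "real k"
  have wp: "omega TYPE('n) > 0" by (rule omega_pos)
  obtain C where C: "C \<ge> 0" "\<And>w :: real ^ 'n. \<And>r. w \<noteq> 0 \<Longrightarrow> r > 0 \<Longrightarrow>
    (\<integral>\<^sup>+z. ennreal (norm z powr (?k - ?n)) * indicator (ball w r) z \<partial>lborel)
      \<le> ennreal (C * (omega TYPE('n) * r ^ CARD('n)) * norm w powr (?k - ?n))"
    using riesz_ball_bound[OF k] by blast
  obtain C' where C': "C' \<ge> 0" "\<And>y. y \<noteq> 0 \<Longrightarrow> \<bar>kernel k is y\<bar> \<le> C' * norm y powr (?k - ?n)"
    using homogeneous_bound[OF homogeneous_kernel[OF "is" k(1)]] by blast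
  have "\<bar>ball_average (cut_kernel k R is) w r\<bar> \<le> C' * C * norm w powr (?k - ?n)" if wr: "w \<noteq> 0" "r > 0" for R w r
  proof -
    let ?f = "\<lambda>z. cut_kernel k R is z * indicator (ball w r) z"
    have m: "?f \<in> borel_measurable borel" 
      by (intro borel_measurable_times cut_kernel_measurable[OF "is" k(1)] borel_measurable_indicator) auto
    have V: "omega TYPE('n) * r ^ CARD('n) > 0" using wr wp by simp
    have "(\<integral>\<^sup>+z. ennreal \<bar>?f z\<bar> \<partial>lborel) \<le> (\<integral>\<^sup>+z. ennreal C' * (ennreal (norm z powr (?k - ?n)) * indicator (ball w r) z) \<partial>lborel)"
    proof (rule nn_integral_mono_AE)
      show "AE z in lborel. ennreal \<bar>?f z\<bar> \<le> ennreal C' * (ennreal (norm z powr (?k - ?n)) * indicator (ball w r) z)"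
        using AE_lborel_nonzero
      proof eventually_elim
        case (elim z)
        have "\<bar>?f z\<bar> \<le> C' * norm z powr (?k - ?n) * indicator (ball w r) z"
          using C'(2)[OF elim] C'(1) by (auto simp: cut_kernel_def indicator_def abs_mult)
        then show ?case using C'(1)
          by (auto simp: ennreal_mult[symmetric] indicator_def intro: ennreal_leI)
      qed
    qed
    also have "\<dots> = ennreal C' * (\<integral>\<^sup>+z. ennreal (norm z powr (?k - ?n)) * indicator (ball w r) z \<partial>lborel)"
      by (intro nn_integral_cmult borel_measurable_times_ennreal borel_measurable_indicator) auto
    also have "\<dots> \<le> ennreal C' * ennreal (C * (omega TYPE('n) * r ^ CARD('n)) * norm w powr (?k - ?n))"
      by (rule mult_left_mono[OF C(2)[OF wr]]) simp
    also have "\<dots> = ennreal (C' * C * norm w powr (?k - ?n) * (omega TYPE('n) * r ^ CARD('n)))"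
      using C'(1) by (simp add: ennreal_mult'[symmetric] mult_ac)
    finally have nn: "(\<integral>\<^sup>+z. ennreal \<bar>?f z\<bar> \<partial>lborel) \<le> ennreal (C' * C * norm w powr (?k - ?n) * (omega TYPE('n) * r ^ CARD('n)))" .
    have "\<bar>\<integral>z. ?f z \<partial>lebesgue\<bar> = \<bar>\<integral>z. ?f z \<partial>lborel\<bar>" using m by (simp add: integral_completion)
    also have "\<dots> \<le> (\<integral>z. \<bar>?f z\<bar> \<partial>lborel)" by (rule integral_abs_bound)
    also have "\<dots> = enn2real (\<integral>\<^sup>+z. ennreal \<bar>?f z\<bar> \<partial>lborel)" by (rule integral_eq_nn_integral) (use m in auto)
    also have "\<dots> \<le> C' * C * norm w powr (?k - ?n) * (omega TYPE('n) * r ^ CARD('n))"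
      using nn C(1) C'(1) V by (intro enn2real_leI) auto
    finally show ?thesis using V wr by (simp add: ball_average_eq abs_divide pos_divide_le_eq del: mult.assoc)
  qed
  moreover have "C' * C \<ge> 0" using C C' by simp
  ultimately show thesis by (rule that[rotated])
qed

text \<open>The identity passes from test functions to the indicator of a ball. Convolving the
  kernel with that indicator gives, up to the volume, the averages of the kernel over balls centred
  at y - x.\<close>

lemma weak_representation_ball:
  fixes u :: "real ^ 'n::finite \<Rightarrow> real"
  assumes k: "k \<ge> 1" and g: "\<And>is. length is = k \<Longrightarrow> has_weak_deriv u is (g is)"
    and u0: "\<And>x. norm x > \<rho> \<Longrightarrow> u x = 0" and r: "r > 0" and R: "R \<ge> \<rho> + (norm x + r)" "R \<ge> 0"
  shows "- (ell TYPE('n) k * real CARD('n) * omega TYPE('n)) * ball_average u x r =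
    (\<Sum>is\<in>{is. length is = k}. \<integral>y. g is y * ball_average (cut_kernel k R is) (y - x) r \<partial>lebesgue)"
proof -
  let ?S = "{is :: 'n list. length is = k}"
  let ?c = "- (ell TYPE('n) k * real CARD('n) * omega TYPE('n))"
  let ?V = "omega TYPE('n) * r ^ CARD('n)"
  have V: "?V > 0" using r omega_pos[where 'n = 'n] by simp
  obtain \<phi> :: "nat \<Rightarrow> real ^ 'n \<Rightarrow> real" where \<phi>: "\<And>j. test_function (\<phi> j)" "\<And>j y. \<bar>\<phi> j y\<bar> \<le> 1"
    "\<And>j y. norm y > norm x + r \<Longrightarrow> \<phi> j y = 0" "\<And>y. (\<lambda>j. \<phi> j y) \<longlonglongrightarrow> indicator (ball x r) y"
    using ball_test_functions[OF r, of x] by blast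
  have li: "locally_integrable u" using g[of "replicate k undefined"] by (simp add: has_weak_deriv_def)
  have lim1: "(\<lambda>j. \<integral>y. u y * \<phi> j y \<partial>lebesgue) \<longlonglongrightarrow> (\<integral>y. u y * indicator (ball x r) y \<partial>lebesgue)"
    by (rule locally_integrable_limit[OF li test_function_borel[OF \<phi>(1)] \<phi>(2-4)])
  have lim2: "(\<lambda>j. \<integral>y. g is y * (\<integral>z. cut_kernel k R is z * \<phi> j (y - z) \<partial>lborel) \<partial>lebesgue) \<longlonglongrightarrow>
      (\<integral>y. g is y * (?V * ball_average (cut_kernel k R is) (y - x) r) \<partial>lebesgue)" if "is": "length is = k" for "is"
  proof (rule locally_integrable_limit[where B = "\<integral>z. \<bar>cut_kernel k R is z\<bar> \<partial>lborel" and R = "R + (norm x + r)"])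
    note int = cut_kernel_integrable[OF "is" k, of R]
    show "locally_integrable (g is)" using g[OF "is"] by (simp add: has_weak_deriv_def)
    have t: "test_function (\<lambda>y. \<integral>z. cut_kernel k R is z * \<phi> j (y - z) \<partial>lborel)" for j
      by (rule convolution_test_function[OF int _ \<phi>(1), of _ R]) (auto simp: cut_kernel_def indicator_def split: if_splits)
    show "(\<lambda>y. \<integral>z. cut_kernel k R is z * \<phi> j (y - z) \<partial>lborel) \<in> borel_measurable borel" for j
      by (rule test_function_borel[OF t])
    have b: "\<bar>cut_kernel k R is z * \<phi> j (y - z)\<bar> \<le> \<bar>cut_kernel k R is z\<bar>" for j y z
      using mult_left_mono[OF \<phi>(2)[of j "y - z"], of "\<bar>cut_kernel k R is z\<bar>"] by (simp add: abs_mult)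
    have m: "(\<lambda>z. \<phi> j (y - z)) \<in> borel_measurable lborel" for j y
      by (rule measurable_compose[OF _ test_function_borel[OF \<phi>(1)]]) measurable
    have ci: "integrable lborel (\<lambda>z. cut_kernel k R is z * \<phi> j (y - z))" for j y
      by (rule integrable_mult_bounded[OF int m \<phi>(2)])
    show "\<bar>\<integral>z. cut_kernel k R is z * \<phi> j (y - z) \<partial>lborel\<bar> \<le> (\<integral>z. \<bar>cut_kernel k R is z\<bar> \<partial>lborel)" for j y
      by (rule order_trans[OF integral_abs_bound integral_mono]) (use ci int b in auto)
    show "(\<integral>z. cut_kernel k R is z * \<phi> j (y - z) \<partial>lborel) = 0" if y: "norm y > R + (norm x + r)" for j y
    proof -
      have z: "cut_kernel k R is z * \<phi> j (y - z) = 0" for z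
      proof (cases "norm z \<le> R")
        case True
        then have "norm (y - z) > norm x + r" using y norm_triangle_ineq2[of y z] by linarith
        then show ?thesis using \<phi>(3) by simp
      qed (simp add: cut_kernel_def)
      show ?thesis unfolding z by simp
    qed
    show "(\<lambda>j. \<integral>z. cut_kernel k R is z * \<phi> j (y - z) \<partial>lborel) \<longlonglongrightarrow> ?V * ball_average (cut_kernel k R is) (y - x) r" for y
    proof -
      have "(\<lambda>j. \<integral>z. cut_kernel k R is z * \<phi> j (y - z) \<partial>lborel) \<longlonglongrightarrow> (\<integral>z. cut_kernel k R is z * indicator (ball x r) (y - z) \<partial>lborel)"
      proof (rule integral_dominated_convergence[where w = "\<lambda>z. \<bar>cut_kernel k R is z\<bar>"])
        show "(\<lambda>z. cut_kernel k R is z * indicator (ball x r) (y - z)) \<in> borel_measurable lborel"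
          "\<And>j. (\<lambda>z. cut_kernel k R is z * \<phi> j (y - z)) \<in> borel_measurable lborel"
          using int m by (auto intro!: borel_measurable_times
              measurable_compose[of "\<lambda>z. y - z" _ borel "indicat_real (ball x r)"] borel_measurable_indicator)
        show "AE z in lborel. (\<lambda>j. cut_kernel k R is z * \<phi> j (y - z)) \<longlonglongrightarrow> cut_kernel k R is z * indicator (ball x r) (y - z)"
          using \<phi>(4) by (auto intro!: tendsto_mult)
      qed (use int b in auto)
      also have "(\<integral>z. cut_kernel k R is z * indicator (ball x r) (y - z) \<partial>lborel) = (\<integral>z. cut_kernel k R is z * indicator (ball (y - x) r) z \<partial>lborel)"
      proof -
        have "norm (x - (y - z)) = norm (y - x - z)" for z by (subst norm_minus_commute) (simp add: algebra_simps)
        then show ?thesis by (simp add: indicator_def dist_norm)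
      qed
      also have "\<dots> = (\<integral>z. cut_kernel k R is z * indicator (ball (y - x) r) z \<partial>lebesgue)"
        using int by (intro integral_completion[symmetric] borel_measurable_times borel_measurable_indicator) auto
      also have "\<dots> = ?V * ball_average (cut_kernel k R is) (y - x) r"
        using less_imp_neq[OF omega_pos[where 'n = 'n]] r by (simp add: ball_average_eq)
      finally show ?thesis .
    qed
  qed
  have "(\<lambda>j. ?c * (\<integral>y. u y * \<phi> j y \<partial>lebesgue)) \<longlonglongrightarrow> ?c * (\<integral>y. u y * indicator (ball x r) y \<partial>lebesgue)"
    by (intro tendsto_intros lim1)
  moreover have "(\<lambda>j. ?c * (\<integral>y. u y * \<phi> j y \<partial>lebesgue)) \<longlonglongrightarrow>
      (\<Sum>is\<in>?S. \<integral>y. g is y * (?V * ball_average (cut_kernel k R is) (y - x) r) \<partial>lebesgue)"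
  proof -
    have "(\<lambda>j. \<Sum>is\<in>?S. \<integral>y. g is y * (\<integral>z. cut_kernel k R is z * \<phi> j (y - z) \<partial>lborel) \<partial>lebesgue) \<longlonglongrightarrow>
      (\<Sum>is\<in>?S. \<integral>y. g is y * (?V * ball_average (cut_kernel k R is) (y - x) r) \<partial>lebesgue)"
      by (intro tendsto_sum lim2) simp
    moreover have "?c * (\<integral>y. u y * \<phi> j y \<partial>lebesgue) =
        (\<Sum>is\<in>?S. \<integral>y. g is y * (\<integral>z. cut_kernel k R is z * \<phi> j (y - z) \<partial>lborel) \<partial>lebesgue)" for j
      by (rule weak_representation_test[OF k g u0 \<phi>(1,3) R(1)])
    ultimately show ?thesis by simp
  qed
  ultimately have "?c * (\<integral>y. u y * indicator (ball x r) y \<partial>lebesgue) =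
      (\<Sum>is\<in>?S. \<integral>y. g is y * (?V * ball_average (cut_kernel k R is) (y - x) r) \<partial>lebesgue)"
    by (rule LIMSEQ_unique)
  also have "\<dots> = ?V * (\<Sum>is\<in>?S. \<integral>y. g is y * ball_average (cut_kernel k R is) (y - x) r \<partial>lebesgue)"
    unfolding sum_distrib_left
  proof (rule sum.cong[OF refl])
    fix "is" assume "is \<in> ?S"
    have "(\<integral>y. g is y * (?V * ball_average (cut_kernel k R is) (y - x) r) \<partial>lebesgue) =
        (\<integral>y. ?V * (g is y * ball_average (cut_kernel k R is) (y - x) r) \<partial>lebesgue)"
      by (rule Bochner_Integration.integral_cong[OF refl]) (rule mult.left_commute)
    then show "(\<integral>y. g is y * (?V * ball_average (cut_kernel k R is) (y - x) r) \<partial>lebesgue) =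
        ?V * (\<integral>y. g is y * ball_average (cut_kernel k R is) (y - x) r \<partial>lebesgue)"
      by (simp only: Bochner_Integration.integral_mult_right_zero)
  qed
  finally show ?thesis using V r by (simp add: ball_average_eq field_simps)
qed

text \<open>Dominated convergence as r tends to 0: the kernel is continuous at y - x for y different
  from x, and its averages are dominated by the Riesz kernel. Finiteness of the potential at x thus
  yields convergence of the ball averages at that very x.\<close>

lemma weak_representation:
  fixes u :: "real ^ 'n::finite \<Rightarrow> real"
  assumes k: "1 \<le> k" "k < CARD('n)" and g: "\<And>is. length is = k \<Longrightarrow> has_weak_deriv u is (g is)"
    and u0: "\<And>x. norm x > \<rho> \<Longrightarrow> u x = 0" and g0: "\<And>is x. length is = k \<Longrightarrow> norm x > \<rho> \<Longrightarrow> g is x = 0" and \<rho>: "\<rho> \<ge> 0"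
    and fin: "\<And>is. length is = k \<Longrightarrow>
      (\<integral>\<^sup>+y. ennreal (norm (y - x) powr (real k - real CARD('n)) * \<bar>g is y\<bar>) \<partial>lebesgue) < \<infinity>"
  shows "((\<lambda>r. - (ell TYPE('n) k * real CARD('n) * omega TYPE('n)) * ball_average u x r) \<longlongrightarrow>
    (\<Sum>is\<in>{is. length is = k}. \<integral>y. g is y * kernel k is (y - x) \<partial>lebesgue)) (at_right 0)"
proof -
  let ?n = "real CARD('n)" and ?k = "real k"
  let ?S = "{is :: 'n list. length is = k}"
  \<comment> \<open>One truncation that serves all r < 1; the points y - x with |y| \<le> \<rho> lie
    inside it, where the truncated kernel is still continuous off the origin.\<close>
  define R where "R = \<rho> + (norm x + 1)"
  have lim: "((\<lambda>r. \<integral>y. g is y * ball_average (cut_kernel k R is) (y - x) r \<partial>lebesgue) \<longlongrightarrow>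
      (\<integral>y. g is y * kernel k is (y - x) \<partial>lebesgue)) (at_right 0)" if "is": "length is = k" for "is"
  proof -
    obtain C where C: "C \<ge> 0" "\<And>R w r. w \<noteq> 0 \<Longrightarrow> r > 0 \<Longrightarrow>
      \<bar>ball_average (cut_kernel k R is) w r\<bar> \<le> C * norm w powr (?k - ?n)"
      using cut_kernel_ball_average_bound[OF k "is"] by blast
    note int = cut_kernel_integrable[OF "is" k(1), of R]
    have lig: "locally_integrable (g is)" using g[OF "is"] by (simp add: has_weak_deriv_def)
    note gm = locally_integrable_measurable[OF lig]
    have lic: "locally_integrable (cut_kernel k R is)"
      by (rule locally_integrable_borelI[OF cut_kernel_measurable[OF "is" k(1)] integrable_real_mult_indicator[OF _ int]]) simp
    have ae: "AE y in lebesgue. y \<noteq> x" using AE_completion[OF AE_lborel_singleton[of x]] by simp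
    have ptw: "((\<lambda>r. g is y * ball_average (cut_kernel k R is) (y - x) r) \<longlongrightarrow> g is y * kernel k is (y - x)) (at_right 0)"
      if y: "y \<noteq> x" for y
    proof (cases "norm y > \<rho>")
      case True then show ?thesis by (simp add: g0[OF "is"])
    next
      case False
      have "norm (y - x) < R" using False norm_triangle_ineq4[of y x] by (simp add: R_def)
      moreover have "isCont (kernel k is) (y - x)"
        using y by (intro smooth_on_isCont[OF homogeneous_smooth[OF homogeneous_kernel[OF "is" k(1)]]]) auto
      moreover have "\<forall>\<^sub>F z in nhds (y - x). cut_kernel k R is z = kernel k is z"
        using eventually_nhds_in_open[OF open_ball, of "y - x" 0 R] \<open>norm (y - x) < R\<close>
        by (auto elim!: eventually_mono simp: cut_kernel_def)
      ultimately have "isCont (cut_kernel k R is) (y - x)" by (subst isCont_cong)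
      from ball_average_tendsto[OF lic this]
      have "(ball_average (cut_kernel k R is) (y - x) \<longlongrightarrow> kernel k is (y - x)) (at_right 0)"
        using \<open>norm (y - x) < R\<close> by (simp add: cut_kernel_def)
      then show ?thesis by (intro tendsto_intros)
    qed
    have avm: "(\<lambda>y. ball_average (cut_kernel k R is) (y - x) r) \<in> borel_measurable lebesgue" if r: "r > 0" for r
    proof -
      have m [measurable]: "cut_kernel k R is \<in> borel_measurable borel" by (rule cut_kernel_measurable[OF "is" k(1)])
      have "(\<lambda>y. \<integral>z. cut_kernel k R is z * (if dist (y - x) z < r then 1 else 0) \<partial>lborel) \<in> borel_measurable lborel"
        by measurable
      moreover have "(\<integral>z. cut_kernel k R is z * (if dist (y - x) z < r then 1 else 0) \<partial>lborel) =
          (\<integral>z. cut_kernel k R is z * indicator (ball (y - x) r) z \<partial>lebesgue)" for y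
        by (subst integral_completion) (auto simp: indicator_def intro!: Bochner_Integration.integral_cong)
      ultimately have "(\<lambda>y. \<integral>z. cut_kernel k R is z * indicator (ball (y - x) r) z \<partial>lebesgue) \<in> borel_measurable lborel" by simp
      then have "(\<lambda>y. ball_average (cut_kernel k R is) (y - x) r) \<in> borel_measurable lborel"
        using r by (simp add: ball_average_eq)
      then show ?thesis by (rule measurable_completion)
    qed
    have km: "(\<lambda>y. kernel k is (y - x)) \<in> borel_measurable lebesgue"
      by (intro measurable_completion measurable_compose[OF _ kernel_measurable[OF "is" k(1)]]) measurable
    show ?thesis unfolding tendsto_at_iff_sequentially
    proof (intro allI impI)
      fix r :: "nat \<Rightarrow> real" assume r: "\<forall>i. r i \<in> {0<..} - {0}" "r \<longlonglongrightarrow> 0"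
      have rp: "r i > 0" for i using r(1) by auto
      show "((\<lambda>r. \<integral>y. g is y * ball_average (cut_kernel k R is) (y - x) r \<partial>lebesgue) \<circ> r) \<longlonglongrightarrow> (\<integral>y. g is y * kernel k is (y - x) \<partial>lebesgue)"
        unfolding o_def
      proof (rule integral_dominated_convergence[where w = "\<lambda>y. C * (norm (y - x) powr (?k - ?n) * \<bar>g is y\<bar>)"])
        show "(\<lambda>y. g is y * kernel k is (y - x)) \<in> borel_measurable lebesgue" using gm km by auto
        show "(\<lambda>y. g is y * ball_average (cut_kernel k R is) (y - x) (r i)) \<in> borel_measurable lebesgue" for i
          using gm avm[OF rp] by auto
        have "integrable lebesgue (\<lambda>y. norm (y - x) powr (?k - ?n) * \<bar>g is y\<bar>)"
        proof (rule integrableI_bounded)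
          show "(\<lambda>y. norm (y - x) powr (?k - ?n) * \<bar>g is y\<bar>) \<in> borel_measurable lebesgue"
            by (intro borel_measurable_times borel_measurable_abs gm) (rule measurable_completion, measurable)
        qed (use fin[OF "is"] in \<open>simp add: abs_mult\<close>)
        then show "integrable lebesgue (\<lambda>y. C * (norm (y - x) powr (?k - ?n) * \<bar>g is y\<bar>))" by simp
        show "AE y in lebesgue. (\<lambda>i. g is y * ball_average (cut_kernel k R is) (y - x) (r i)) \<longlonglongrightarrow> g is y * kernel k is (y - x)"
          using ae
        proof eventually_elim
          case (elim y)
          show ?case using ptw[OF elim] r unfolding tendsto_at_iff_sequentially o_def by blast
        qed
        show "AE y in lebesgue. norm (g is y * ball_average (cut_kernel k R is) (y - x) (r i)) \<le> C * (norm (y - x) powr (?k - ?n) * \<bar>g is y\<bar>)" for i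
          using ae
        proof eventually_elim
          case (elim y)
          then have "\<bar>g is y\<bar> * \<bar>ball_average (cut_kernel k R is) (y - x) (r i)\<bar> \<le> \<bar>g is y\<bar> * (C * norm (y - x) powr (?k - ?n))"
            using C(2)[of "y - x" "r i" R] rp by (intro mult_left_mono) auto
          then show ?case by (simp add: abs_mult mult_ac)
        qed
      qed
    qed
  qed
  have "((\<lambda>r. \<Sum>is\<in>?S. \<integral>y. g is y * ball_average (cut_kernel k R is) (y - x) r \<partial>lebesgue) \<longlongrightarrow>
    (\<Sum>is\<in>?S. \<integral>y. g is y * kernel k is (y - x) \<partial>lebesgue)) (at_right 0)"
    by (intro tendsto_sum lim) simp
  moreover have "\<forall>\<^sub>F r in at_right 0. (\<Sum>is\<in>?S. \<integral>y. g is y * ball_average (cut_kernel k R is) (y - x) r \<partial>lebesgue) =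
      - (ell TYPE('n) k * ?n * omega TYPE('n)) * ball_average u x r"
    unfolding eventually_at_right_field
  proof (intro exI[of _ 1] conjI allI impI)
    fix r :: real assume r: "0 < r" "r < 1"
    show "(\<Sum>is\<in>?S. \<integral>y. g is y * ball_average (cut_kernel k R is) (y - x) r \<partial>lebesgue) =
      - (ell TYPE('n) k * ?n * omega TYPE('n)) * ball_average u x r"
      by (rule weak_representation_ball[OF k(1) g u0, symmetric]) (use r \<rho> in \<open>auto simp: R_def\<close>)
  qed simp
  ultimately show ?thesis by (rule Lim_transform_eventually)
qed

section \<open>Weak derivatives off an open set\<close>

text \<open>Moves integrals of Borel functions to \<open>lborel\<close>, where Fubini's theorem and
  affine substitution are applied.\<close>

lemma locally_integrable_borelD:
  fixes f \<xi> :: "real ^ 'n::finite \<Rightarrow> real"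
  assumes f: "locally_integrable f" "f \<in> borel_measurable borel"
    and \<xi>: "\<xi> \<in> borel_measurable borel" "\<And>x. \<bar>\<xi> x\<bar> \<le> B" "\<And>x. norm x > R \<Longrightarrow> \<xi> x = 0"
  shows "integrable lborel (\<lambda>x. f x * \<xi> x)" "(\<integral>x. f x * \<xi> x \<partial>lebesgue) = (\<integral>x. f x * \<xi> x \<partial>lborel)"
proof -
  have m: "(\<lambda>x. f x * \<xi> x) \<in> borel_measurable lborel" using f \<xi> by simp
  then show "integrable lborel (\<lambda>x. f x * \<xi> x)"
    using locally_integrable_mult_bounded[OF f(1) \<xi>] by (subst (asm) integrable_completion) auto
  show "(\<integral>x. f x * \<xi> x \<partial>lebesgue) = (\<integral>x. f x * \<xi> x \<partial>lborel)" by (rule integral_completion[OF m])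
qed

lemma locally_integrable_cong_AE:
  fixes f f' :: "real ^ 'n::finite \<Rightarrow> real"
  assumes f: "locally_integrable f" and f': "f' \<in> borel_measurable lebesgue" and eq: "AE x in lebesgue. f x = f' x"
  shows "locally_integrable f'"
  unfolding locally_integrable_def set_integrable_def
proof (intro allI impI)
  fix K :: "(real ^ 'n) set" assume K: "compact K"
  have int: "integrable lebesgue (\<lambda>x. indicator K x *\<^sub>R f x)" using f K by (simp add: locally_integrable_def set_integrable_def)
  have ae: "AE x in lebesgue. indicator K x *\<^sub>R f x = indicator K x *\<^sub>R f' x" using eq by eventually_elim simp
  have Kb: "K \<in> sets lebesgue" using borel_closed[OF compact_imp_closed[OF K]] by simp
  show "integrable lebesgue (\<lambda>x. indicator K x *\<^sub>R f' x)"
    by (rule integrable_cong_AE_imp[OF int _ ae])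
      (intro borel_measurable_scaleR borel_measurable_indicator Kb f')
qed

lemma has_weak_deriv_cong_AE:
  fixes u u' :: "real ^ 'n::finite \<Rightarrow> real"
  assumes ug: "has_weak_deriv u is g" and m: "u' \<in> borel_measurable lebesgue" "g' \<in> borel_measurable lebesgue"
    and eq: "AE x in lebesgue. u x = u' x" "AE x in lebesgue. g x = g' x"
  shows "has_weak_deriv u' is g'"
  unfolding has_weak_deriv_def
proof (intro conjI allI impI)
  have li: "locally_integrable u" "locally_integrable g" using ug by (auto simp: has_weak_deriv_def)
  then show "locally_integrable u'" "locally_integrable g'" using m eq locally_integrable_cong_AE by blast+
  fix \<phi> :: "real ^ 'n \<Rightarrow> real" assume \<phi>: "test_function \<phi>"
  have \<phi>m: "iter_partial_deriv is \<phi> \<in> borel_measurable lebesgue" "\<phi> \<in> borel_measurable lebesgue"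
    using test_function_borel[OF test_function_iter[OF \<phi>]] test_function_borel[OF \<phi>] by (auto simp: measurable_completion)
  have "(\<integral>x. u' x * iter_partial_deriv is \<phi> x \<partial>lebesgue) = (\<integral>x. u x * iter_partial_deriv is \<phi> x \<partial>lebesgue)"
    using eq(1) \<phi>m m locally_integrable_measurable[OF li(1)] by (intro integral_cong_AE) auto
  also have "\<dots> = (- 1) ^ length is * (\<integral>x. g x * \<phi> x \<partial>lebesgue)" using ug \<phi> by (simp add: has_weak_deriv_def)
  also have "(\<integral>x. g x * \<phi> x \<partial>lebesgue) = (\<integral>x. g' x * \<phi> x \<partial>lebesgue)"
    using eq(2) \<phi>m m locally_integrable_measurable[OF li(2)] by (intro integral_cong_AE) auto
  finally show "(\<integral>x. u' x * iter_partial_deriv is \<phi> x \<partial>lebesgue) = (- 1) ^ length is * (\<integral>x. g' x * \<phi> x \<partial>lebesgue)" .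
qed

section \<open>Line integrals and difference quotients\<close>

lemma integrable_strip:
  fixes F :: "real \<Rightarrow> real ^ 'n::finite \<Rightarrow> real"
  assumes m: "(\<lambda>(t, x). F t x) \<in> borel_measurable (lborel \<Otimes>\<^sub>M lborel)"
    and bd: "\<And>t. t \<in> {0..h} \<Longrightarrow> (\<integral>\<^sup>+x. ennreal \<bar>F t x\<bar> \<partial>lborel) \<le> ennreal K"
  shows "integrable (lborel \<Otimes>\<^sub>M lborel) (\<lambda>(t, x). indicator {0..h} t * F t x)"
proof (rule integrableI_bounded)
  show m': "(\<lambda>(t, x). indicator {0..h} t * F t x) \<in> borel_measurable (lborel \<Otimes>\<^sub>M lborel)"
  proof -
    have "(\<lambda>p. indicator {0..h} (fst p) * (case p of (t, x) \<Rightarrow> F t x)) \<in> borel_measurable (lborel \<Otimes>\<^sub>M lborel)"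
      using m by measurable
    then show ?thesis by (simp add: split_beta)
  qed
  have "(\<integral>\<^sup>+p. ennreal (norm (case p of (t, x) \<Rightarrow> indicator {0..h} t * F t x)) \<partial>(lborel \<Otimes>\<^sub>M lborel)) =
    (\<integral>\<^sup>+t. \<integral>\<^sup>+x. ennreal (norm (indicator {0..h} t * F t x)) \<partial>lborel \<partial>lborel)"
    by (subst lborel.nn_integral_fst[symmetric]) (use m' in \<open>auto simp: split_beta\<close>)
  also have "\<dots> \<le> (\<integral>\<^sup>+t. ennreal K * indicator {0..h} t \<partial>lborel)"
    using bd by (intro nn_integral_mono) (auto simp: indicator_def abs_mult)
  also have "\<dots> < \<infinity>"
    by (subst nn_integral_cmult_indicator) (auto simp: ennreal_mult_less_top emeasure_lborel_Icc_eq)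
  finally show "(\<integral>\<^sup>+p. ennreal (norm (case p of (t, x) \<Rightarrow> indicator {0..h} t * F t x)) \<partial>(lborel \<Otimes>\<^sub>M lborel)) < \<infinity>" .
qed

context
  fixes g :: "real ^ 'n::finite \<Rightarrow> real" and e :: "real ^ 'n" and h :: real
  assumes g: "locally_integrable g" and gm [measurable]: "g \<in> borel_measurable borel" and h: "h \<ge> 0"
begin

text \<open>The integral of \<open>g\<close> over the segment from x to x + h e. For a weak
  derivative in direction e it will be the increment of the function.\<close>

definition line_integral :: "real ^ 'n \<Rightarrow> real" where
  "line_integral x = (\<integral>t. indicator {0..h} t * g (x + t *\<^sub>R e) \<partial>lborel)"

lemma strip_integrable:
  assumes \<xi> [measurable]: "\<xi> \<in> borel_measurable borel" and bd: "\<And>x. \<bar>\<xi> x\<bar> \<le> 1" "\<And>x. norm x > R \<Longrightarrow> \<xi> x = 0"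
  shows "integrable (lborel \<Otimes>\<^sub>M lborel) (\<lambda>(t, x). indicator {0..h} t * (g (x + t *\<^sub>R e) * \<xi> x))"
    and "integrable (lborel \<Otimes>\<^sub>M lborel) (\<lambda>(t, x). indicator {0..h} t * (g x * \<xi> (x - t *\<^sub>R e)))"
proof -
  define S where "S = R + h * norm e"
  have "integrable lborel (\<lambda>x. g x * indicator (cball 0 S) x)"
    by (rule locally_integrable_borelD(1)[OF g gm, of _ 1 S]) (auto simp: indicator_def)
  then have fin: "(\<integral>\<^sup>+x. ennreal \<bar>g x * indicator (cball 0 S) x\<bar> \<partial>lborel) < \<infinity>"
    by (simp add: integrable_iff_bounded)
  define K where "K = enn2real (\<integral>\<^sup>+x. ennreal \<bar>g x * indicator (cball 0 S) x\<bar> \<partial>lborel)"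
  have K: "(\<integral>\<^sup>+x. ennreal \<bar>g x * indicator (cball 0 S) x\<bar> \<partial>lborel) \<le> ennreal K"
    using fin by (simp add: K_def ennreal_enn2real)
  have 2: "(\<integral>\<^sup>+x. ennreal \<bar>g x * \<xi> (x - t *\<^sub>R e)\<bar> \<partial>lborel) \<le> ennreal K" if t: "t \<in> {0..h}" for t
  proof (rule order_trans[OF nn_integral_mono K], rule ennreal_leI)
    fix x
    show "\<bar>g x * \<xi> (x - t *\<^sub>R e)\<bar> \<le> \<bar>g x * indicator (cball 0 S) x\<bar>"
    proof (cases "x \<in> cball 0 S")
      case True
      then show ?thesis using mult_left_mono[OF bd(1)[of "x - t *\<^sub>R e"], of "\<bar>g x\<bar>"] by (simp add: abs_mult)
    next
      case False
      have "norm (t *\<^sub>R e) \<le> h * norm e" using t by (simp add: mult_right_mono)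
      then have "norm (x - t *\<^sub>R e) > R" using False norm_triangle_ineq2[of x "t *\<^sub>R e"] by (simp add: S_def)
      then show ?thesis using bd(2) by simp
    qed
  qed
  have 1: "(\<integral>\<^sup>+x. ennreal \<bar>g (x + t *\<^sub>R e) * \<xi> x\<bar> \<partial>lborel) \<le> ennreal K" if t: "t \<in> {0..h}" for t
  proof -
    have "(\<integral>\<^sup>+x. ennreal \<bar>g x * \<xi> (x - t *\<^sub>R e)\<bar> \<partial>lborel) = (\<integral>\<^sup>+x. ennreal \<bar>g (t *\<^sub>R e + 1 *\<^sub>R x) * \<xi> (t *\<^sub>R e + 1 *\<^sub>R x - t *\<^sub>R e)\<bar> \<partial>lborel)"
      by (subst nn_integral_lborel_affine[of _ 1 "t *\<^sub>R e"]) auto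
    then show ?thesis using 2[OF t] by (simp add: add.commute)
  qed
  show "integrable (lborel \<Otimes>\<^sub>M lborel) (\<lambda>(t, x). indicator {0..h} t * (g (x + t *\<^sub>R e) * \<xi> x))"
  proof (rule integrable_strip[OF _ 1])
    have "(\<lambda>p. g (snd p + fst p *\<^sub>R e) * \<xi> (snd p)) \<in> borel_measurable (lborel \<Otimes>\<^sub>M lborel)" by measurable
    then show "(\<lambda>(t, x). g (x + t *\<^sub>R e) * \<xi> x) \<in> borel_measurable (lborel \<Otimes>\<^sub>M lborel)" by (simp add: split_beta')
  qed
  show "integrable (lborel \<Otimes>\<^sub>M lborel) (\<lambda>(t, x). indicator {0..h} t * (g x * \<xi> (x - t *\<^sub>R e)))"
  proof (rule integrable_strip[OF _ 2])
    have "(\<lambda>p. g (snd p) * \<xi> (snd p - fst p *\<^sub>R e)) \<in> borel_measurable (lborel \<Otimes>\<^sub>M lborel)" by measurable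
    then show "(\<lambda>(t, x). g x * \<xi> (x - t *\<^sub>R e)) \<in> borel_measurable (lborel \<Otimes>\<^sub>M lborel)" by (simp add: split_beta')
  qed
qed

text \<open>Fubini's theorem: averaging \<open>g\<close> over segments is dual to averaging the test
  function over the reversed segments, and either expression equals an integral over t of pairings
  with translates.\<close>

lemma line_integral_mult:
  assumes \<xi> [measurable]: "\<xi> \<in> borel_measurable borel" and bd: "\<And>x. \<bar>\<xi> x\<bar> \<le> 1" "\<And>x. norm x > R \<Longrightarrow> \<xi> x = 0"
  shows "integrable lborel (\<lambda>x. line_integral x * \<xi> x)"
    and "(\<integral>x. line_integral x * \<xi> x \<partial>lborel) = (\<integral>t. indicator {0..h} t * (\<integral>x. g x * \<xi> (x - t *\<^sub>R e) \<partial>lborel) \<partial>lborel)"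
    and "(\<integral>x. line_integral x * \<xi> x \<partial>lborel) = (\<integral>x. g x * (\<integral>t. indicator {0..h} t * \<xi> (x - t *\<^sub>R e) \<partial>lborel) \<partial>lborel)"
    and "integrable lborel (\<lambda>t. indicator {0..h} t * (\<integral>x. g x * \<xi> (x - t *\<^sub>R e) \<partial>lborel))"
proof -
  note int = strip_integrable[OF \<xi> bd]
  have eq: "(\<integral>t. indicator {0..h} t * (g (x + t *\<^sub>R e) * \<xi> x) \<partial>lborel) = line_integral x * \<xi> x" for x
    unfolding line_integral_def by (subst Bochner_Integration.integral_mult_left_zero[symmetric]) (simp add: mult.assoc)
  have tr: "(\<integral>x. g (x + t *\<^sub>R e) * \<xi> x \<partial>lborel) = (\<integral>x. g x * \<xi> (x - t *\<^sub>R e) \<partial>lborel)" for t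
    using integral_lborel_affine[of "\<lambda>x. g x * \<xi> (x - t *\<^sub>R e)" 1 "t *\<^sub>R e"] by (simp add: add.commute)
  show "integrable lborel (\<lambda>x. line_integral x * \<xi> x)"
    using lborel_pair.integrable_snd[OF int(1)] by (simp add: eq)
  have "(\<integral>x. line_integral x * \<xi> x \<partial>lborel) = (\<integral>t. \<integral>x. indicator {0..h} t * (g (x + t *\<^sub>R e) * \<xi> x) \<partial>lborel \<partial>lborel)"
    using lborel_pair.Fubini_integral[OF int(1)] by (simp add: eq)
  then show F: "(\<integral>x. line_integral x * \<xi> x \<partial>lborel) = (\<integral>t. indicator {0..h} t * (\<integral>x. g x * \<xi> (x - t *\<^sub>R e) \<partial>lborel) \<partial>lborel)"
    by (simp add: tr)
  show "integrable lborel (\<lambda>t. indicator {0..h} t * (\<integral>x. g x * \<xi> (x - t *\<^sub>R e) \<partial>lborel))"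
    using lborel_pair.integrable_fst[OF int(2)] by simp
  have "(\<integral>x. \<integral>t. indicator {0..h} t * (g x * \<xi> (x - t *\<^sub>R e)) \<partial>lborel \<partial>lborel) = (\<integral>t. indicator {0..h} t * (\<integral>x. g x * \<xi> (x - t *\<^sub>R e) \<partial>lborel) \<partial>lborel)"
    using lborel_pair.Fubini_integral[OF int(2)] by simp
  moreover have "(\<integral>t. indicator {0..h} t * (g x * \<xi> (x - t *\<^sub>R e)) \<partial>lborel) = g x * (\<integral>t. indicator {0..h} t * \<xi> (x - t *\<^sub>R e) \<partial>lborel)" for x
    by (subst Bochner_Integration.integral_mult_right_zero[symmetric]) (simp add: mult_ac)
  ultimately show "(\<integral>x. line_integral x * \<xi> x \<partial>lborel) = (\<integral>x. g x * (\<integral>t. indicator {0..h} t * \<xi> (x - t *\<^sub>R e) \<partial>lborel) \<partial>lborel)"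
    using F by simp
qed

lemma line_integral_borel: "line_integral \<in> borel_measurable borel"
  unfolding line_integral_def by measurable

lemma line_integral_locally_integrable: "locally_integrable line_integral"
proof (rule locally_integrable_borelI[OF line_integral_borel])
  show "integrable lborel (\<lambda>x. line_integral x * indicator (cball 0 R) x)" for R
    by (rule line_integral_mult(1)[of _ R]) (auto simp: indicator_def)
qed

end

lemma locally_integrable_translate:
  fixes f :: "real ^ 'n::finite \<Rightarrow> real"
  assumes f: "locally_integrable f" "f \<in> borel_measurable borel"
  shows "locally_integrable (\<lambda>x. f (x + a))"
proof (rule locally_integrable_borelI)
  fix R
  have "integrable lborel (\<lambda>x. f x * indicator (cball 0 R) (x - a))"
  proof (rule locally_integrable_borelD(1)[OF f, of _ 1 "R + norm a"])
    show "indicat_real (cball 0 R) (x - a) = 0" if "R + norm a < norm x" for x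
      using that norm_triangle_ineq2[of x a] by (simp add: indicator_def)
    show "(\<lambda>x. indicat_real (cball 0 R) (x - a)) \<in> borel_measurable borel"
      by (rule measurable_compose[of "\<lambda>x. x - a" borel borel "indicat_real (cball 0 R)"])
        (simp, rule borel_measurable_indicator, simp)
  qed (auto simp: indicator_def)
  from integrable_lborel_affine[OF this, of 1 a]
  show "integrable lborel (\<lambda>x. f (x + a) * indicator (cball 0 R) x)" by (simp add: add.commute)
qed (use f(2) in measurable)

text \<open>The fundamental theorem of calculus for weak derivatives, by duality: the integral of a
  test function over a segment in direction i is a test function whose i-th derivative is an
  increment of the original one.\<close>

lemma weak_difference:
  fixes v g :: "real ^ 'n::finite \<Rightarrow> real"
  assumes vg: "has_weak_deriv v [i] g" and m: "v \<in> borel_measurable borel" "g \<in> borel_measurable borel" and h: "h \<ge> 0"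
  shows "AE x in lborel. v (x + h *\<^sub>R axis i 1) - v x = line_integral g (axis i 1) h x"
proof -
  let ?e = "axis i 1 :: real ^ 'n"
  have li: "locally_integrable v" "locally_integrable g" using vg by (auto simp: has_weak_deriv_def)
  define W where "W = (\<lambda>x. (v (x + h *\<^sub>R ?e) - v x) - line_integral g ?e h x)"
  have "AE x in lebesgue. W x = 0"
  proof (rule fundamental_lemma)
    show lW: "locally_integrable W" unfolding W_def
      by (intro locally_integrable_diff locally_integrable_translate li m line_integral_locally_integrable h)
    fix \<phi> :: "real ^ 'n \<Rightarrow> real" assume \<phi>: "test_function \<phi>"
    obtain B where B: "B \<ge> 0" "\<And>x. \<bar>\<phi> x\<bar> \<le> B" using test_function_bounded[OF \<phi>] by blast
    obtain R where R: "R > 0" "\<And>x. norm x > R \<Longrightarrow> \<phi> x = 0" using test_function_support[OF \<phi>] by blast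
    note \<phi>m [measurable] = test_function_borel[OF \<phi>]
    note [measurable] = m
    define A where "A = (\<lambda>x. \<integral>t. indicator {0..h} t * \<phi> (x - t *\<^sub>R ?e) \<partial>lborel)"
    have \<kappa>: "integrable lborel (indicat_real {0..h})"
      by (rule integrable_real_indicator) (auto simp: emeasure_lborel_Icc_eq)
    have Y: "(\<lambda>t. t *\<^sub>R ?e) \<in> lborel \<rightarrow>\<^sub>M borel" by measurable
    have At: "test_function A" unfolding A_def
      by (rule convolution_test_function[OF \<kappa> Y \<phi>, of h]) (auto simp: indicator_def norm_axis_1 split: if_splits)
    have dA: "partial_deriv i A x = \<phi> x - \<phi> (x - h *\<^sub>R ?e)" for x
    proof -
      have d: "((\<lambda>t. - \<phi> (x - t *\<^sub>R ?e)) has_real_derivative partial_deriv i \<phi> (x - t *\<^sub>R ?e)) (at t)" for t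
      proof -
        have "((\<lambda>s. \<phi> ((x - t *\<^sub>R ?e) + s *\<^sub>R (- ?e))) has_real_derivative
            (\<Sum>j\<in>UNIV. (- ?e) $ j * partial_deriv j \<phi> (x - t *\<^sub>R ?e))) (at 0)"
          by (rule has_derivative_line[OF has_derivative_partial_deriv[OF smooth_on_differentiable[OF test_function_smooth[OF \<phi>]]]]) simp
        then have "((\<lambda>s. \<phi> (x - (s + t) *\<^sub>R ?e)) has_real_derivative - partial_deriv i \<phi> (x - t *\<^sub>R ?e)) (at 0)"
          by (simp add: axis_def if_distrib if_distribR sum_negf algebra_simps cong: if_cong)
        then have "((\<lambda>s. \<phi> (x - s *\<^sub>R ?e)) has_real_derivative - partial_deriv i \<phi> (x - t *\<^sub>R ?e)) (at (0 + t))"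
          using DERIV_shift[of "\<lambda>s. \<phi> (x - s *\<^sub>R ?e)" _ 0 t] by blast
        from DERIV_minus[OF this] show ?thesis by simp
      qed
      have "(\<integral>t. partial_deriv i \<phi> (x - t *\<^sub>R ?e) * indicator {0..h} t \<partial>lborel) = - \<phi> (x - h *\<^sub>R ?e) - (- \<phi> (x - 0 *\<^sub>R ?e))"
      proof (rule integral_FTC_Icc_real[OF h d])
        show "isCont (\<lambda>t. partial_deriv i \<phi> (x - t *\<^sub>R ?e)) t" for t
        proof (rule isCont_o2[where f = "\<lambda>t. x - t *\<^sub>R ?e" and g = "partial_deriv i \<phi>"])
          show "isCont (\<lambda>t. x - t *\<^sub>R ?e) t" by (intro continuous_intros)
          show "isCont (partial_deriv i \<phi>) (x - t *\<^sub>R ?e)"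
            by (rule smooth_on_isCont[OF smooth_on_partial[OF test_function_smooth[OF \<phi>]]]) simp
        qed
      qed
      then show ?thesis unfolding A_def convolution_partial[OF \<kappa> Y \<phi>] by (simp add: mult.commute)
    qed
    have "(\<integral>x. v x * iter_partial_deriv [i] A x \<partial>lebesgue) = (- 1) ^ length [i] * (\<integral>x. g x * A x \<partial>lebesgue)"
      using vg At unfolding has_weak_deriv_def by blast
    then have 1: "(\<integral>x. v x * (\<phi> x - \<phi> (x - h *\<^sub>R ?e)) \<partial>lebesgue) = - (\<integral>x. g x * A x \<partial>lebesgue)"
      by (simp add: dA[abs_def])
    note ish = locally_integrable_borelD[OF li(1) m(1), of "\<lambda>x. \<phi> (x - h *\<^sub>R ?e)" B "R + h"]
    have sh0: "\<phi> (x - h *\<^sub>R ?e) = 0" if "norm x > R + h" for x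
      using that norm_triangle_ineq2[of x "h *\<^sub>R ?e"] h by (intro R) (simp add: norm_axis_1)
    have i1: "integrable lborel (\<lambda>x. v x * \<phi> x)" by (rule locally_integrable_borelD(1)[OF li(1) m(1) \<phi>m B(2) R(2)])
    have i2: "integrable lborel (\<lambda>x. v x * \<phi> (x - h *\<^sub>R ?e))" by (rule ish(1)) (use B sh0 in auto)
    have "(\<integral>x. v x * (\<phi> x - \<phi> (x - h *\<^sub>R ?e)) \<partial>lebesgue) = (\<integral>x. v x * \<phi> x \<partial>lborel) - (\<integral>x. v x * \<phi> (x - h *\<^sub>R ?e) \<partial>lborel)"
      using i1 i2 by (subst integral_completion) (auto simp: right_diff_distrib)
    also have "(\<integral>x. v x * \<phi> (x - h *\<^sub>R ?e) \<partial>lborel) = (\<integral>x. v (x + h *\<^sub>R ?e) * \<phi> x \<partial>lborel)"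
      by (subst integral_lborel_affine[of _ 1 "h *\<^sub>R ?e"]) (auto simp: add.commute)
    finally have 2: "(\<integral>x. v x * (\<phi> x - \<phi> (x - h *\<^sub>R ?e)) \<partial>lebesgue) = (\<integral>x. v x * \<phi> x \<partial>lborel) - (\<integral>x. v (x + h *\<^sub>R ?e) * \<phi> x \<partial>lborel)" .
    \<comment> \<open>Normalisation, because the duality for segment integrals is stated for
      functions bounded by 1; adding 1 keeps the divisor positive.\<close>
    define B' where "B' = B + 1"
    have B': "B' > 0" using B by (simp add: B'_def)
    have B'': "\<bar>\<phi> x / B'\<bar> \<le> 1" for x using B(2)[of x] B' by (simp add: B'_def abs_divide)
    have l1: "(\<integral>x. line_integral g ?e h x * (\<phi> x / B') \<partial>lborel) = (\<integral>x. g x * (\<integral>t. indicator {0..h} t * (\<phi> (x - t *\<^sub>R ?e) / B') \<partial>lborel) \<partial>lborel)"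
      and l2: "integrable lborel (\<lambda>x. line_integral g ?e h x * (\<phi> x / B'))"
      by (rule line_integral_mult[OF li(2) m(2) h _ B'', where R = R]; use R in simp)+
    have "(\<integral>x. line_integral g ?e h x * \<phi> x \<partial>lborel) = (\<integral>x. g x * A x \<partial>lborel)"
      using l1 B' by (simp add: A_def)
    moreover have "(\<integral>x. g x * A x \<partial>lborel) = (\<integral>x. g x * A x \<partial>lebesgue)"
      using test_function_borel[OF At] m by (intro integral_completion[symmetric]) simp
    ultimately have 3: "(\<integral>x. line_integral g ?e h x * \<phi> x \<partial>lborel) = (\<integral>x. g x * A x \<partial>lebesgue)" by simp
    have i3: "integrable lborel (\<lambda>x. line_integral g ?e h x * \<phi> x)"
      using integrable_mult_right[OF l2, of B'] B' by simp
    have i4: "integrable lborel (\<lambda>x. v (x + h *\<^sub>R ?e) * \<phi> x)"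
      using integrable_lborel_affine[OF i2, of 1 "h *\<^sub>R ?e"] by (simp add: add.commute)
    have "(\<integral>x. W x * \<phi> x \<partial>lebesgue) = (\<integral>x. W x * \<phi> x \<partial>lborel)"
      using line_integral_borel[OF li(2) m(2) h] by (intro integral_completion) (simp add: W_def)
    also have "\<dots> = (\<integral>x. v (x + h *\<^sub>R ?e) * \<phi> x \<partial>lborel) - (\<integral>x. v x * \<phi> x \<partial>lborel) - (\<integral>x. line_integral g ?e h x * \<phi> x \<partial>lborel)"
      using i1 i3 i4 by (simp add: W_def left_diff_distrib)
    also have "\<dots> = 0" using 1 2 3 by simp
    finally show "(\<integral>x. W x * \<phi> x \<partial>lebesgue) = 0" .
  qed
  then have "AE x in lborel. W x = 0" by (simp add: AE_completion_iff)
  then show ?thesis by eventually_elim (simp add: W_def)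
qed

lemma integrable_borel_of_locally:
  fixes g \<xi> :: "real ^ 'n::finite \<Rightarrow> real"
  assumes "locally_integrable g" "g \<in> borel_measurable borel" "A \<in> sets borel" "A \<subseteq> cball 0 R"
  shows "integrable lborel (\<lambda>x. g x * indicator A x)"
  by (rule locally_integrable_borelD(1)[OF assms(1,2), of _ 1 R]) (use assms(3,4) in \<open>auto simp: indicator_def subset_iff\<close>)

text \<open>If \<open>v\<close> vanishes on the closed set \<open>Z = - \<Omega>\<close>, its difference quotients vanish on
  \<open>Z \<inter> (Z - h e)\<close>, which exhausts \<open>Z\<close> in measure as \<open>h\<close> tends to zero; hence so does its weak derivative.\<close>

lemma weak_partial_vanishes:
  fixes v g :: "real ^ 'n::finite \<Rightarrow> real"
  assumes \<Omega>: "open \<Omega>" and vg: "has_weak_deriv v [i] g" and v0: "AE x in lebesgue. x \<notin> \<Omega> \<longrightarrow> v x = 0"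
  shows "AE x in lebesgue. x \<notin> \<Omega> \<longrightarrow> g x = 0"
proof -
  let ?e = "axis i 1 :: real ^ 'n"
  have li: "locally_integrable v" "locally_integrable g" using vg by (auto simp: has_weak_deriv_def)
  obtain v' where v': "v' \<in> borel_measurable lborel" "AE x in lborel. v x = v' x"
    using completion_ex_borel_measurable_real[OF locally_integrable_measurable[OF li(1)]] by blast
  obtain g' where g': "g' \<in> borel_measurable lborel" "AE x in lborel. g x = g' x"
    using completion_ex_borel_measurable_real[OF locally_integrable_measurable[OF li(2)]] by blast
  \<comment> \<open>A Borel version that is zero at every point off \<Omega>, so that its increments
    vanish exactly whenever both endpoints lie off \<Omega>.\<close>
  define w where "w = (\<lambda>x. v' x * indicator \<Omega> x)"
  have wm [measurable]: "w \<in> borel_measurable borel" unfolding w_def using v'(1) \<Omega> by (auto intro!: borel_measurable_times borel_measurable_indicator)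
  have gm [measurable]: "g' \<in> borel_measurable borel" using g'(1) by simp
  have gAE: "AE x in lebesgue. g x = g' x" using g'(2) by (rule AE_completion)
  have wAE: "AE x in lebesgue. v x = w x"
    using AE_completion[OF v'(2)] v0 by eventually_elim (auto simp: w_def indicator_def)
  have wg: "has_weak_deriv w [i] g'"
    by (rule has_weak_deriv_cong_AE[OF vg _ _ wAE gAE]) (simp_all add: measurable_completion)
  have lig: "locally_integrable g'" using wg by (simp add: has_weak_deriv_def)
  have E0: "(\<integral>x. g' x * indicator (- \<Omega> \<inter> cbox a b) x \<partial>lborel) = 0" for a b
  proof -
    \<comment> \<open>A compact piece of the complement. Zero integrals over all such pieces
      suffice.\<close>
    define E where "E = - \<Omega> \<inter> cbox a b"
    have Ec: "compact E" unfolding E_def using \<Omega> by (intro closed_Int_compact) auto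
    then have Ecl: "closed E" by (rule compact_imp_closed)
    have Eb: "E \<in> sets borel" using Ecl by (rule borel_closed)
    show ?thesis
    proof (cases "E = {}")
      case True then show ?thesis by (simp add: E_def[symmetric])
    next
      case False
      obtain R where R: "R > 0" "E \<subseteq> cball 0 R"
        using compact_imp_bounded[OF Ec] by (auto simp: bounded_pos subset_iff)
      define h where "h = (\<lambda>j::nat. inverse (real (Suc j)))"
      have h: "h j > 0" "h j \<le> 1" for j by (auto simp: h_def inverse_le_1_iff)
      \<comment> \<open>\<open>D j\<close> is the neighbourhood of E of width h_j without E itself;
        \<open>S j\<close> consists of the points of E whose translate by h_j stays off \<Omega>.
        Both \<open>D j\<close> and the rest of E outside \<open>S j\<close> become
        negligible.\<close>
      define D where "D = (\<lambda>j. {y. infdist y E \<le> h j} - E)"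
      define S where "S = (\<lambda>j. E \<inter> {x. x + h j *\<^sub>R ?e \<notin> \<Omega>})"
      have Db: "D j \<in> sets borel" for j
      proof -
        have "closed {y. infdist y E \<le> h j}" by (intro closed_Collect_le continuous_intros)
        then show ?thesis using Eb by (auto simp: D_def)
      qed
      have Sb: "S j \<in> sets borel" for j
      proof -
        have "closed ((\<lambda>x. x + h j *\<^sub>R ?e) -` (- \<Omega>))" using \<Omega> by (intro continuous_closed_vimage) (auto intro!: continuous_intros)
        then have "closed {x. x + h j *\<^sub>R ?e \<notin> \<Omega>}" by (simp add: vimage_def)
        then show ?thesis using Eb by (auto simp: S_def)
      qed
      have near: "y \<in> D j" if "x \<in> E" "y \<notin> E" "dist y x \<le> h j" for x y j
        using infdist_le[OF that(1), of y] that by (auto simp: D_def)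
      have Dsub: "D j \<subseteq> cball 0 (R + 1)" for j
      proof
        fix y assume "y \<in> D j"
        then have "infdist y E \<le> 1" using h(2)[of j] by (simp add: D_def)
        moreover obtain x where x: "x \<in> E" "infdist y E = dist y x" using infdist_attains_inf[OF Ecl False] by blast
        moreover have "norm x \<le> R" using R x(1) by auto
        ultimately have "norm y \<le> R + 1" using norm_triangle_ineq2[of y x] by (simp add: dist_norm)
        then show "y \<in> cball 0 (R + 1)" by simp
      qed
      have Dlim: "(\<lambda>j. indicat_real (D j) y) \<longlonglongrightarrow> 0" for y
      proof (cases "y \<in> E")
        case True then show ?thesis by (simp add: D_def)
      next
        case F: False
        have pos: "infdist y E > 0" using infdist_pos_not_in_closed[OF Ecl False F] .
        have "h \<longlonglongrightarrow> 0" unfolding h_def by (rule LIMSEQ_inverse_real_of_nat)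
        then have "\<forall>\<^sub>F j in sequentially. h j < infdist y E" using pos by (auto dest: order_tendstoD)
        then have "\<forall>\<^sub>F j in sequentially. indicat_real (D j) y = 0" by eventually_elim (simp add: D_def)
        then show ?thesis by (rule tendsto_eventually)
      qed
      define q where "q = (\<lambda>j. \<integral>y. \<bar>g' y\<bar> * indicator (D j) y \<partial>lborel)"
      define d where "d = (\<lambda>j. \<integral>y. indicat_real (D j) y \<partial>lborel)"
      have gabs: "locally_integrable (\<lambda>y. \<bar>g' y\<bar>)"
      proof (rule locally_integrable_borelI)
        show "integrable lborel (\<lambda>y. \<bar>g' y\<bar> * indicator (cball 0 R') y)" for R'
          using integrable_abs[OF integrable_borel_of_locally[OF lig gm, of "cball 0 R'" R']] by (simp add: abs_mult)
      qed measurable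
      have gabsm: "(\<lambda>y. \<bar>g' y\<bar>) \<in> borel_measurable borel" by measurable
      note ig = integrable_borel_of_locally[OF gabs gabsm]
      have i1: "integrable lborel (indicat_real A)" if "A \<in> sets borel" "A \<subseteq> cball 0 R'" for A :: "(real ^ 'n) set" and R'
      proof (rule integrable_real_indicator)
        show "emeasure lborel A < \<infinity>"
          using emeasure_mono[OF that(2), of lborel] emeasure_lborel_cball_finite[of 0 R'] by (auto intro: le_less_trans)
      qed (use that in auto)
      have qlim: "q \<longlonglongrightarrow> 0"
      proof -
        have "q \<longlonglongrightarrow> (\<integral>y. 0 \<partial>(lborel :: (real ^ 'n) measure))" unfolding q_def
        proof (rule integral_dominated_convergence[where w = "\<lambda>y. \<bar>g' y\<bar> * indicator (cball 0 (R + 1)) y"])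
          show "integrable lborel (\<lambda>y. \<bar>g' y\<bar> * indicator (cball 0 (R + 1)) y)" by (rule ig) auto
          show "AE y in lborel. (\<lambda>j. \<bar>g' y\<bar> * indicator (D j) y) \<longlonglongrightarrow> 0"
            using tendsto_mult_right_zero[OF Dlim] by auto
          show "AE y in lborel. norm (\<bar>g' y\<bar> * indicator (D j) y) \<le> \<bar>g' y\<bar> * indicator (cball 0 (R + 1)) y" for j
            using Dsub[of j] by (intro AE_I2) (auto simp: indicator_def)
        qed (use Db in \<open>auto intro!: borel_measurable_times borel_measurable_indicator\<close>)
        then show ?thesis by simp
      qed
      have dlim: "d \<longlonglongrightarrow> 0"
      proof -
        have "d \<longlonglongrightarrow> (\<integral>y. 0 \<partial>(lborel :: (real ^ 'n) measure))" unfolding d_def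
        proof (rule integral_dominated_convergence[where w = "indicat_real (cball 0 (R + 1))"])
          show "integrable lborel (indicat_real (cball (0 :: real ^ 'n) (R + 1)))" by (rule i1) auto
          show "AE y in lborel. norm (indicat_real (D j) y) \<le> indicat_real (cball 0 (R + 1)) y" for j
            using Dsub[of j] by (intro AE_I2) (auto simp: indicator_def)
        qed (use Db Dlim in \<open>auto intro!: borel_measurable_indicator\<close>)
        then show ?thesis by simp
      qed
      define I where "I = (\<integral>y. g' y * indicator E y \<partial>lborel)"
      \<comment> \<open>The tail of \<open>g'\<close> on E above height K. Translations are
        controlled in measure only, and truncation at K converts measures into integrals.\<close>
      define r where "r = (\<lambda>K. \<integral>y. \<bar>g' y\<bar> * indicator (E \<inter> {y. \<bar>g' y\<bar> > K}) y \<partial>lborel)"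
      have gK: "E \<inter> {y. \<bar>g' y\<bar> > K} \<in> sets borel" for K using Eb by measurable
      have iE: "integrable lborel (\<lambda>y. g' y * indicator E y)" by (rule integrable_borel_of_locally[OF lig gm Eb R(2)])
      have iS: "integrable lborel (\<lambda>y. g' y * indicator (S j) (y - t *\<^sub>R ?e))" if t: "t \<in> {0..h j}" for t j
      proof (rule locally_integrable_borelD(1)[OF lig gm, of _ 1 "R + 1"])
        show "(\<lambda>y. indicat_real (S j) (y - t *\<^sub>R ?e)) \<in> borel_measurable borel"
          by (rule measurable_compose[of "\<lambda>y. y - t *\<^sub>R ?e" borel borel "indicat_real (S j)"])
            (simp, rule borel_measurable_indicator, rule Sb)
        show "indicat_real (S j) (y - t *\<^sub>R ?e) = 0" if "R + 1 < norm y" for y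
        proof -
          have "norm (t *\<^sub>R ?e) \<le> 1" using t h(2)[of j] by (simp add: norm_axis_1)
          then have "norm (y - t *\<^sub>R ?e) > R" using that norm_triangle_ineq2[of y "t *\<^sub>R ?e"] by simp
          then have "y - t *\<^sub>R ?e \<notin> S j" using R(2) by (auto simp: S_def)
          then show ?thesis by simp
        qed
      qed (auto simp: indicator_def)
      \<comment> \<open>Replacing E by a translate of \<open>S j\<close> through at most h_j costs
        the integral over \<open>D j\<close>, K times the measure of what E loses, and the tail
        above K.\<close>
      have key: "\<bar>I - (\<integral>y. g' y * indicator (S j) (y - t *\<^sub>R ?e) \<partial>lborel)\<bar> \<le> q j + 2 * K * d j + r K"
        if t: "t \<in> {0..h j}" and K: "K \<ge> 0" for t j K
      proof -
        have nt: "norm (t *\<^sub>R ?e) \<le> h j" using t by (simp add: norm_axis_1)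
        have nh: "norm (h j *\<^sub>R ?e) \<le> h j" using h(1)[of j] by (simp add: norm_axis_1)
        have iSt: "integrable lborel (\<lambda>y. indicat_real (S j) (y - t *\<^sub>R ?e))"
          using integrable_lborel_affine[OF i1[OF Sb[of j], of R], of 1 "- (t *\<^sub>R ?e)"] R(2) by (auto simp: S_def)
        have St: "(\<integral>y. indicat_real (S j) (y - t *\<^sub>R ?e) \<partial>lborel) = (\<integral>y. indicat_real (S j) y \<partial>lborel)"
          using integral_lborel_affine[of "indicat_real (S j)" 1 "- (t *\<^sub>R ?e)"] Sb[of j] by (simp add: borel_measurable_indicator)
        \<comment> \<open>A point of E outside \<open>S j\<close> is moved by h_j into \<Omega>,
          hence out of E but not farther than h_j from it. So this part of E is translated into
          \<open>D j\<close>.\<close>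
        have "(\<integral>y. indicat_real E y \<partial>lborel) - (\<integral>y. indicat_real (S j) y \<partial>lborel) = (\<integral>y. indicat_real E y - indicat_real (S j) y \<partial>lborel)"
          using i1[OF Eb R(2)] i1[OF Sb[of j], of R] R(2) by (subst Bochner_Integration.integral_diff) (auto simp: S_def)
        also have "\<dots> \<le> (\<integral>y. indicat_real (D j) (h j *\<^sub>R ?e + 1 *\<^sub>R y) \<partial>lborel)"
        proof (rule integral_mono)
          show "integrable lborel (\<lambda>y. indicat_real E y - indicat_real (S j) y)"
            using i1[OF Eb R(2)] i1[OF Sb[of j], of R] R(2) by (auto simp: S_def)
          show "integrable lborel (\<lambda>y. indicat_real (D j) (h j *\<^sub>R ?e + 1 *\<^sub>R y))"
            by (rule integrable_lborel_affine[OF i1[OF Db Dsub]]) simp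
          fix y
          show "indicat_real E y - indicat_real (S j) y \<le> indicat_real (D j) (h j *\<^sub>R ?e + 1 *\<^sub>R y)"
          proof (cases "y \<in> E \<and> y \<notin> S j")
            case True
            then have "h j *\<^sub>R ?e + 1 *\<^sub>R y \<in> D j"
              using nh by (intro near[of y]) (auto simp: S_def E_def dist_norm add.commute)
            then show ?thesis by (simp add: indicator_def)
          qed (auto simp: indicator_def S_def)
        qed
        also have "\<dots> = d j"
          unfolding d_def using integral_lborel_affine[of "indicat_real (D j)" 1 "h j *\<^sub>R ?e"] Db[of j] by (simp add: borel_measurable_indicator)
        finally have ES: "(\<integral>y. indicat_real E y \<partial>lborel) - (\<integral>y. indicat_real (S j) y \<partial>lborel) \<le> d j" .
        have irK: "integrable lborel (\<lambda>y. \<bar>g' y\<bar> * indicator (E \<inter> {y. \<bar>g' y\<bar> > K}) y)"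
          by (rule ig[OF gK[of K], of R]) (use R(2) in auto)
        have "I - (\<integral>y. g' y * indicator (S j) (y - t *\<^sub>R ?e) \<partial>lborel) = (\<integral>y. g' y * indicator E y - g' y * indicator (S j) (y - t *\<^sub>R ?e) \<partial>lborel)"
          unfolding I_def using iE iS[OF t] by simp
        also have "\<bar>\<dots>\<bar> \<le> (\<integral>y. \<bar>g' y * indicator E y - g' y * indicator (S j) (y - t *\<^sub>R ?e)\<bar> \<partial>lborel)"
          by (rule integral_abs_bound)
        also have "\<dots> \<le> (\<integral>y. \<bar>g' y\<bar> * indicator (D j) y + K * (indicat_real E y - indicat_real (S j) (y - t *\<^sub>R ?e) + indicat_real (D j) y)
            + \<bar>g' y\<bar> * indicator (E \<inter> {y. \<bar>g' y\<bar> > K}) y \<partial>lborel)"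
        proof (rule integral_mono)
          show "integrable lborel (\<lambda>y. \<bar>g' y * indicator E y - g' y * indicator (S j) (y - t *\<^sub>R ?e)\<bar>)"
            using iE iS[OF t] by auto
          show "integrable lborel (\<lambda>y. \<bar>g' y\<bar> * indicator (D j) y + K * (indicat_real E y - indicat_real (S j) (y - t *\<^sub>R ?e) + indicat_real (D j) y)
            + \<bar>g' y\<bar> * indicator (E \<inter> {y. \<bar>g' y\<bar> > K}) y)"
            using R(2) by (intro Bochner_Integration.integrable_add Bochner_Integration.integrable_diff integrable_mult_right
                iSt i1[OF Eb R(2)] i1[OF Db Dsub] ig[OF Db Dsub] ig[OF gK, of _ R]) auto
          fix y
          have SD: "y \<in> E \<or> y \<in> D j" if "y - t *\<^sub>R ?e \<in> S j"
            using near[of "y - t *\<^sub>R ?e" y j] that nt by (auto simp: S_def dist_norm)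
          show "\<bar>g' y * indicator E y - g' y * indicator (S j) (y - t *\<^sub>R ?e)\<bar> \<le> \<bar>g' y\<bar> * indicator (D j) y + K * (indicat_real E y - indicat_real (S j) (y - t *\<^sub>R ?e) + indicat_real (D j) y)
            + \<bar>g' y\<bar> * indicator (E \<inter> {y. \<bar>g' y\<bar> > K}) y"
            using SD K by (cases "y \<in> E"; cases "y - t *\<^sub>R ?e \<in> S j"; cases "y \<in> D j"; cases "\<bar>g' y\<bar> > K") (auto simp: D_def)
        qed
        also have "\<dots> = q j + K * ((\<integral>y. indicat_real E y \<partial>lborel) - (\<integral>y. indicat_real (S j) y \<partial>lborel) + d j) + r K"
          unfolding q_def d_def r_def St[symmetric]
          using ig[OF Db Dsub] i1[OF Eb R(2)] iSt i1[OF Db Dsub] irK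
          by (subst Bochner_Integration.integral_add, auto intro!: Bochner_Integration.integrable_add Bochner_Integration.integrable_diff integrable_mult_right)+
        also have "\<dots> \<le> q j + K * (d j + d j) + r K" using mult_left_mono[OF ES K] by (simp add: algebra_simps)
        finally show ?thesis by (simp add: algebra_simps)
      qed
      have Ij: "\<bar>I\<bar> \<le> q j + 2 * K * d j + r K" if K: "K \<ge> 0" for j K
      proof -
        have Sm: "(\<lambda>y. indicat_real (S j) y) \<in> borel_measurable borel" by (rule borel_measurable_indicator[OF Sb])
        note li = line_integral_mult[OF lig gm less_imp_le[OF h(1)[of j]] Sm, of R ?e]
        have Sb1: "\<bar>indicat_real (S j) y\<bar> \<le> 1" for y by (simp add: indicator_def)
        have SR: "indicat_real (S j) y = 0" if "norm y > R" for y using that R(2) by (auto simp: S_def indicator_def)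
        \<comment> \<open>Integrated over t, the integrals over translates of \<open>S j\<close>
          give the integral over \<open>S j\<close> of the increments of w, which are zero
          there.\<close>
        have "(\<integral>x. line_integral g' ?e (h j) x * indicator (S j) x \<partial>lborel) = (\<integral>x. 0 \<partial>(lborel :: (real ^ 'n) measure))"
        proof (rule integral_cong_AE)
          show "(\<lambda>x. line_integral g' ?e (h j) x * indicator (S j) x) \<in> borel_measurable lborel"
            using line_integral_borel[OF lig gm less_imp_le[OF h(1)[of j]], of ?e] Sm by simp
          show "AE x in lborel. line_integral g' ?e (h j) x * indicator (S j) x = 0"
            using weak_difference[OF wg wm gm less_imp_le[OF h(1)[of j]]]
          proof eventually_elim
            case (elim x)
            show ?case
            proof (cases "x \<in> S j")
              case True
              then have "x \<notin> \<Omega>" "x + h j *\<^sub>R ?e \<notin> \<Omega>" by (auto simp: S_def E_def)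
              then show ?thesis using elim by (simp add: w_def)
            qed simp
          qed
        qed simp
        then have z: "(\<integral>t. indicator {0..h j} t * (\<integral>y. g' y * indicator (S j) (y - t *\<^sub>R ?e) \<partial>lborel) \<partial>lborel) = 0"
          using li(2)[OF Sb1 SR] by simp
        have ih: "integrable lborel (indicat_real {0..h j})"
          by (rule integrable_real_indicator) (auto simp: emeasure_lborel_Icc_eq)
        have "h j * I = (\<integral>t. indicat_real {0..h j} t * I \<partial>lborel)" using h(1)[of j] by simp
        also have "\<dots> = (\<integral>t. indicator {0..h j} t * I - indicator {0..h j} t * (\<integral>y. g' y * indicator (S j) (y - t *\<^sub>R ?e) \<partial>lborel) \<partial>lborel)"
          using ih li(4)[OF Sb1 SR] z by (subst Bochner_Integration.integral_diff) auto
        finally have eq: "h j * I = (\<integral>t. indicator {0..h j} t * I - indicator {0..h j} t * (\<integral>y. g' y * indicator (S j) (y - t *\<^sub>R ?e) \<partial>lborel) \<partial>lborel)" .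
        have "\<bar>h j * I\<bar> \<le> (\<integral>t. \<bar>indicator {0..h j} t * I - indicator {0..h j} t * (\<integral>y. g' y * indicator (S j) (y - t *\<^sub>R ?e) \<partial>lborel)\<bar> \<partial>lborel)"
          unfolding eq
          by (rule integral_abs_bound)
        also have "\<dots> \<le> (\<integral>t. indicator {0..h j} t * (q j + 2 * K * d j + r K) \<partial>lborel)"
        proof (rule integral_mono)
          show "integrable lborel (\<lambda>t. \<bar>indicator {0..h j} t * I - indicator {0..h j} t * (\<integral>y. g' y * indicator (S j) (y - t *\<^sub>R ?e) \<partial>lborel)\<bar>)"
            by (intro integrable_abs Bochner_Integration.integrable_diff integrable_mult_left ih li(4)[OF Sb1 SR])
          show "integrable lborel (\<lambda>t. indicator {0..h j} t * (q j + 2 * K * d j + r K))"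
            by (intro integrable_mult_left ih)
          show "\<bar>indicator {0..h j} t * I - indicator {0..h j} t * (\<integral>y. g' y * indicator (S j) (y - t *\<^sub>R ?e) \<partial>lborel)\<bar>
              \<le> indicator {0..h j} t * (q j + 2 * K * d j + r K)" for t
            using key[OF _ K, of t j] by (cases "t \<in> {0..h j}") auto
        qed
        also have "\<dots> = h j * (q j + 2 * K * d j + r K)" using h(1)[of j] by simp
        finally show ?thesis using h(1)[of j] by (simp add: abs_mult)
      qed
      \<comment> \<open>The limit in j is taken at fixed K; only afterwards does K tend to infinity,
        which removes the tail.\<close>
      have IK: "\<bar>I\<bar> \<le> r K" if K: "K \<ge> 0" for K
      proof -
        have "(\<lambda>j. q j + 2 * K * d j + r K) \<longlonglongrightarrow> 0 + 2 * K * 0 + r K" by (intro tendsto_intros qlim dlim)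
        then show ?thesis using Ij[OF K] by (intro LIMSEQ_le_const[of "\<lambda>j. q j + 2 * K * d j + r K"]) auto
      qed
      have rlim: "(\<lambda>m. r (real m)) \<longlonglongrightarrow> (\<integral>y. 0 \<partial>(lborel :: (real ^ 'n) measure))" unfolding r_def
      proof (rule integral_dominated_convergence[where w = "\<lambda>y. \<bar>g' y\<bar> * indicator E y"])
        show "integrable lborel (\<lambda>y. \<bar>g' y\<bar> * indicator E y)" by (rule ig[OF Eb R(2)])
        show "AE y in lborel. (\<lambda>m. \<bar>g' y\<bar> * indicator (E \<inter> {y. \<bar>g' y\<bar> > real m}) y) \<longlonglongrightarrow> 0"
        proof (rule AE_I2, rule tendsto_eventually)
          fix y
          show "\<forall>\<^sub>F m in sequentially. \<bar>g' y\<bar> * indicator (E \<inter> {y. \<bar>g' y\<bar> > real m}) y = 0"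
            using eventually_ge_at_top[of "nat \<lceil>\<bar>g' y\<bar>\<rceil>"]
            by eventually_elim (auto simp: indicator_def nat_le_iff ceiling_le_iff)
        qed
        show "AE y in lborel. norm (\<bar>g' y\<bar> * indicator (E \<inter> {y. \<bar>g' y\<bar> > real m}) y) \<le> \<bar>g' y\<bar> * indicator E y" for m
          by (intro AE_I2) (auto simp: indicator_def)
      qed (use gK in \<open>auto intro!: borel_measurable_times borel_measurable_indicator\<close>)
      have "\<bar>I\<bar> \<le> 0"
        by (rule LIMSEQ_le_const[of "\<lambda>m. r (real m)"]) (use rlim IK in auto)
      then show ?thesis by (simp add: I_def E_def)
    qed
  qed
  have liw: "locally_integrable (\<lambda>x. g' x * indicator (- \<Omega>) x)"
  proof (rule locally_integrable_borelI)
    show "(\<lambda>x. g' x * indicator (- \<Omega>) x) \<in> borel_measurable borel"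
      using \<Omega> by (intro borel_measurable_times borel_measurable_indicator gm) auto
    have "integrable lborel (\<lambda>x. g' x * indicator (- \<Omega> \<inter> cball 0 R) x)" for R
      by (rule integrable_borel_of_locally[OF lig gm, of _ R]) (use \<Omega> in \<open>auto intro!: borel_closed closed_Int\<close>)
    then show "integrable lborel (\<lambda>x. g' x * indicator (- \<Omega>) x * indicator (cball 0 R) x)" for R
      by (simp add: indicator_inter_arith mult.assoc)
  qed
  have "AE x in lebesgue. g' x * indicator (- \<Omega>) x = 0"
  proof (rule AE_zero_of_box_integrals[OF liw])
    fix a b :: "real ^ 'n"
    have m: "(\<lambda>x. g' x * indicator (- \<Omega>) x * indicator (box a b) x) \<in> borel_measurable lborel"
      "(\<lambda>x. g' x * indicator (- \<Omega> \<inter> cbox a b) x) \<in> borel_measurable lborel"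
      using \<Omega> gm by (auto intro!: borel_measurable_times borel_measurable_indicator borel_closed closed_Int)
    have "(\<integral>x. g' x * indicator (- \<Omega>) x * indicator (box a b) x \<partial>lebesgue) = (\<integral>x. g' x * indicator (- \<Omega>) x * indicator (box a b) x \<partial>lborel)"
      by (rule integral_completion[OF m(1)])
    also have "\<dots> = (\<integral>x. g' x * indicator (- \<Omega> \<inter> cbox a b) x \<partial>lborel)"
    proof (rule integral_cong_AE[OF m])
      have "AE x in lborel. x \<notin> cbox a b - box a b" by (rule AE_not_in[OF null_sets_cbox_Diff_box])
      then show "AE x in lborel. g' x * indicator (- \<Omega>) x * indicator (box a b) x = g' x * indicator (- \<Omega> \<inter> cbox a b) x"
        by eventually_elim (use box_subset_cbox[of a b] in \<open>auto simp: indicator_def\<close>)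
    qed
    also have "\<dots> = 0" by (rule E0)
    finally show "(\<integral>x. g' x * indicator (- \<Omega>) x * indicator (box a b) x \<partial>lebesgue) = 0" .
  qed
  with gAE show ?thesis by eventually_elim (auto simp: indicator_def)
qed

lemma has_weak_deriv_snoc:
  fixes v :: "real ^ 'n::finite \<Rightarrow> real"
  assumes "has_weak_deriv v is g" "has_weak_deriv v (is @ [i]) g'"
  shows "has_weak_deriv g [i] g'"
  unfolding has_weak_deriv_def
proof (intro conjI allI impI)
  show "locally_integrable g" "locally_integrable g'" using assms by (auto simp: has_weak_deriv_def)
  fix \<phi> :: "real ^ 'n \<Rightarrow> real" assume \<phi>: "test_function \<phi>"
  have "(- 1) ^ length is * (\<integral>x. g x * partial_deriv i \<phi> x \<partial>lebesgue) = (\<integral>x. v x * iter_partial_deriv is (partial_deriv i \<phi>) x \<partial>lebesgue)"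
    using assms(1) test_function_partial[OF \<phi>, of i] by (simp add: has_weak_deriv_def)
  also have "\<dots> = (- 1) ^ length (is @ [i]) * (\<integral>x. g' x * \<phi> x \<partial>lebesgue)"
    using assms(2) \<phi> unfolding has_weak_deriv_def by (simp add: iter_partial_deriv_append)
  finally have "(- 1) ^ length is * (\<integral>x. g x * partial_deriv i \<phi> x \<partial>lebesgue) = (- 1) ^ length is * (- (\<integral>x. g' x * \<phi> x \<partial>lebesgue))"
    by simp
  then have "(\<integral>x. g x * partial_deriv i \<phi> x \<partial>lebesgue) = - (\<integral>x. g' x * \<phi> x \<partial>lebesgue)"
    by (subst (asm) mult_left_cancel) simp_all
  then show "(\<integral>x. g x * iter_partial_deriv [i] \<phi> x \<partial>lebesgue) = (- 1) ^ length [i] * (\<integral>x. g' x * \<phi> x \<partial>lebesgue)"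
    by simp
qed

lemma has_weak_deriv_Nil:
  assumes "locally_integrable v" shows "has_weak_deriv v [] v"
  using assms by (simp add: has_weak_deriv_def)

text \<open>Induction on the order from the last index: each derivative is a first weak derivative
  of one that already vanishes off \<Omega>.\<close>

lemma weak_deriv_vanishes:
  fixes v :: "real ^ 'n::finite \<Rightarrow> real"
  assumes \<Omega>: "open \<Omega>" and v: "weakly_differentiable k v" and v0: "\<And>x. x \<notin> \<Omega> \<Longrightarrow> v x = 0"
  shows "length is \<le> k \<Longrightarrow> has_weak_deriv v is g \<Longrightarrow> AE x in lebesgue. x \<notin> \<Omega> \<longrightarrow> g x = 0"
proof (induction "is" arbitrary: g rule: rev_induct)
  case Nil
  have "locally_integrable v" using Nil by (simp add: has_weak_deriv_def)
  from has_weak_deriv_unique[OF Nil(2) has_weak_deriv_Nil[OF this]] show ?case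
    by eventually_elim (simp add: v0)
next
  case (snoc i "is")
  then obtain f where f: "has_weak_deriv v is f" using v by (force simp: weakly_differentiable_def)
  have "AE x in lebesgue. x \<notin> \<Omega> \<longrightarrow> f x = 0" using snoc.IH[OF _ f] snoc.prems(1) by simp
  then show ?case by (rule weak_partial_vanishes[OF \<Omega> has_weak_deriv_snoc[OF f snoc.prems(2)]])
qed

section \<open>Riesz potentials of weak Lebesgue functions\<close>

lemma nn_integral_layer_cake:
  fixes f :: "real ^ 'n::finite \<Rightarrow> ennreal" and g :: "real ^ 'n \<Rightarrow> real"
  assumes [measurable]: "f \<in> borel_measurable borel" "g \<in> borel_measurable borel" and g0: "\<And>y. 0 \<le> g y"
  shows "(\<integral>\<^sup>+y. f y * ennreal (g y) \<partial>lborel) = (\<integral>\<^sup>+b. (\<integral>\<^sup>+y. f y * indicator {y. b < g y} y \<partial>lborel) * indicator {0..} b \<partial>lborel)"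
proof -
  define F where "F = (\<lambda>(y, b :: real). f y * (if 0 \<le> b \<and> b < g y then 1 else 0))"
  have Fm: "F \<in> borel_measurable (lborel \<Otimes>\<^sub>M lborel)" unfolding F_def by measurable
  have "ennreal (g y) = (\<integral>\<^sup>+b. (if 0 \<le> b \<and> b < g y then 1 else 0) \<partial>lborel)" for y
  proof -
    have "(\<integral>\<^sup>+b. (if 0 \<le> b \<and> b < g y then 1 else 0) \<partial>lborel) = (\<integral>\<^sup>+b. indicator {0..<g y} b \<partial>lborel)"
      by (intro nn_integral_cong) (auto simp: indicator_def)
    then show ?thesis using g0[of y] by (simp add: emeasure_lborel_Ico)
  qed
  then have "(\<integral>\<^sup>+y. f y * ennreal (g y) \<partial>lborel) = (\<integral>\<^sup>+y. (\<integral>\<^sup>+b. F (y, b) \<partial>lborel) \<partial>lborel)"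
    unfolding F_def by (intro nn_integral_cong) (simp add: nn_integral_cmult)
  also have "\<dots> = (\<integral>\<^sup>+b. (\<integral>\<^sup>+y. F (y, b) \<partial>lborel) \<partial>lborel)"
    by (rule lborel_pair.Fubini'[symmetric]) (use Fm in simp)
  also have "\<dots> = (\<integral>\<^sup>+b. (\<integral>\<^sup>+y. f y * indicator {y. b < g y} y \<partial>lborel) * indicator {0..} b \<partial>lborel)"
  proof (intro nn_integral_cong)
    fix b :: real
    show "(\<integral>\<^sup>+y. F (y, b) \<partial>lborel) = (\<integral>\<^sup>+y. f y * indicator {y. b < g y} y \<partial>lborel) * indicator {0..} b"
    proof (cases "b \<ge> 0")
      case True
      have "F (y, b) = f y * indicator {y. b < g y} y" for y using True by (simp add: F_def)
      then show ?thesis using True by simp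
    next
      case False
      have "F (y, b) = 0" for y using False by (simp add: F_def)
      then show ?thesis using False by simp
    qed
  qed
  finally show ?thesis .
qed

lemma nn_integral_powr_atLeast:
  assumes q: "q > 1" and b: "b > 0"
  shows "(\<integral>\<^sup>+t. ennreal (t powr - q) * indicator {b..} t \<partial>lborel) = ennreal (b powr (1 - q) / (q - 1))"
proof -
  have "(\<integral>\<^sup>+t. ennreal (t powr - q) * indicator {b..} t \<partial>lborel) = ennreal (0 - (- (b powr (1 - q) / (q - 1))))"
  proof (rule nn_integral_FTC_atLeast)
    show "((\<lambda>t. - (t powr (1 - q) / (q - 1))) has_real_derivative t powr - q) (at t)" if t: "b \<le> t" for t
    proof -
      have "t > 0" using b t by linarith
      from DERIV_cdivide[OF has_real_derivative_powr[OF this, of "1 - q"], of "q - 1"]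
      have "((\<lambda>t. t powr (1 - q) / (q - 1)) has_real_derivative (1 - q) * t powr (1 - q - 1) / (q - 1)) (at t)" .
      from DERIV_minus[OF this]
      have "((\<lambda>t. - (t powr (1 - q) / (q - 1))) has_real_derivative - ((1 - q) * t powr (1 - q - 1) / (q - 1))) (at t)" .
      moreover have "(1 - q) * t powr (1 - q - 1) / (q - 1) = - (t powr - q)"
        using q by (simp add: nonzero_divide_eq_eq algebra_simps)
      ultimately show ?thesis by simp
    qed
    have "((\<lambda>t::real. t powr (1 - q)) \<longlongrightarrow> 0) at_top"
      using tendsto_neg_powr[of "1 - q" "\<lambda>t::real. t" at_top] q filterlim_ident[of at_top] by simp
    then have "((\<lambda>t. - (t powr (1 - q) / (q - 1))) \<longlongrightarrow> - (0 / (q - 1))) at_top" using q by (intro tendsto_intros) auto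
    then show "((\<lambda>t. - (t powr (1 - q) / (q - 1))) \<longlongrightarrow> 0) at_top" by simp
  qed auto
  then show ?thesis by simp
qed

text \<open>Among sets of given measure the integral of the kernel is largest over a ball.\<close>

lemma riesz_kernel_set:
  fixes x :: "real ^ 'n::finite"
  assumes k: "1 \<le> k" "k < CARD('n)" and A: "A \<in> sets borel" and m: "m \<ge> 0" "emeasure lborel A \<le> ennreal m"
  shows "(\<integral>\<^sup>+y. ennreal (norm (x - y) powr (real k - real CARD('n))) * indicator A y \<partial>lborel) \<le>
    ennreal (real CARD('n) / real k * omega TYPE('n) powr (1 - real k / real CARD('n)) * m powr (real k / real CARD('n)))"
proof (cases "m = 0")
  case True
  then have "A \<in> null_sets lborel" using A m by (auto simp: null_sets_def)
  then have "AE y in lborel. y \<notin> A" by (rule AE_not_in)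
  then have "AE y in lborel. ennreal (norm (x - y) powr (real k - real CARD('n))) * indicator A y = 0"
    by eventually_elim simp
  then have "(\<integral>\<^sup>+y. ennreal (norm (x - y) powr (real k - real CARD('n))) * indicator A y \<partial>lborel) = (\<integral>\<^sup>+y. 0 \<partial>(lborel :: (real ^ 'n) measure))"
    by (rule nn_integral_cong_AE)
  then show ?thesis by simp
next
  case False
  let ?n = "real CARD('n)" and ?k = "real k" and ?w = "omega TYPE('n)"
  have w: "?w > 0" by (rule omega_pos)
  have m0: "m > 0" using False m by simp
  define R where "R = (m / ?w) powr (1 / ?n)"
  have R: "R > 0" using m0 w by (simp add: R_def)
  have Rn: "?w * R ^ CARD('n) = m"
    using m0 w by (simp add: R_def powr_realpow[symmetric] powr_powr)
  define B where "B = cball x R"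
  have Bb: "B \<in> sets borel" by (simp add: B_def)
  have Bm: "emeasure lborel B = ennreal m" using R by (simp add: B_def emeasure_cball_omega Rn)
  let ?f = "\<lambda>y. ennreal (norm (x - y) powr (?k - ?n))"
  have fm: "?f \<in> borel_measurable borel" by measurable
  have split: "emeasure lborel (C \<inter> D) + emeasure lborel (C - D) = emeasure lborel C" if "C \<in> sets borel" "D \<in> sets borel" for C D :: "(real ^ 'n) set"
  proof -
    have "emeasure lborel (C \<inter> D) + emeasure lborel (C - D) = emeasure lborel ((C \<inter> D) \<union> (C - D))"
      using that by (intro plus_emeasure) auto
    then show ?thesis by (simp add: Int_Diff_Un)
  qed
  \<comment> \<open>The comparison takes place outside the common part: A - B has at most the
    measure of B - A, and R^(k-n) bounds the kernel from above on the former and from below on the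
    latter.\<close>
  have "emeasure lborel (A \<inter> B) + emeasure lborel (A - B) \<le> emeasure lborel (A \<inter> B) + emeasure lborel (B - A)"
    using split[OF A Bb] split[OF Bb A] m Bm by (simp add: Int_commute)
  moreover have "emeasure lborel (A \<inter> B) \<noteq> \<infinity>"
    using emeasure_mono[of "A \<inter> B" B lborel] Bb Bm by (auto simp: top_unique)
  ultimately have AB: "emeasure lborel (A - B) \<le> emeasure lborel (B - A)"
    by (simp add: ennreal_add_left_cancel_le)
  have "(\<integral>\<^sup>+y. ?f y * indicator (A - B) y \<partial>lborel) \<le> (\<integral>\<^sup>+y. ennreal (R powr (?k - ?n)) * indicator (A - B) y \<partial>lborel)"
  proof (intro nn_integral_mono)
    fix y
    show "?f y * indicator (A - B) y \<le> ennreal (R powr (?k - ?n)) * indicator (A - B) y"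
      using R k by (auto simp: indicator_def B_def dist_norm intro!: ennreal_leI powr_mono2')
  qed
  also have "\<dots> = ennreal (R powr (?k - ?n)) * emeasure lborel (A - B)"
    using A Bb by (intro nn_integral_cmult_indicator) auto
  also have "\<dots> \<le> ennreal (R powr (?k - ?n)) * emeasure lborel (B - A)" by (intro mult_left_mono AB) auto
  also have "\<dots> = (\<integral>\<^sup>+y. ennreal (R powr (?k - ?n)) * indicator (B - A) y \<partial>lborel)"
    using A Bb by (intro nn_integral_cmult_indicator[symmetric]) auto
  also have "\<dots> \<le> (\<integral>\<^sup>+y. ?f y * indicator (B - A) y \<partial>lborel)"
  proof (rule nn_integral_mono_AE)
    have "AE y in lborel. y \<noteq> x" by (rule AE_lborel_singleton)
    then show "AE y in lborel. ennreal (R powr (?k - ?n)) * indicator (B - A) y \<le> ?f y * indicator (B - A) y"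
    proof eventually_elim
      case (elim y)
      then show ?case using k by (auto simp: indicator_def B_def dist_norm intro!: ennreal_leI powr_mono2')
    qed
  qed
  finally have le: "(\<integral>\<^sup>+y. ?f y * indicator (A - B) y \<partial>lborel) \<le> (\<integral>\<^sup>+y. ?f y * indicator (B - A) y \<partial>lborel)" .
  have fs: "(\<integral>\<^sup>+y. ?f y * indicator C y \<partial>lborel) = (\<integral>\<^sup>+y. ?f y * indicator (C \<inter> D) y \<partial>lborel) + (\<integral>\<^sup>+y. ?f y * indicator (C - D) y \<partial>lborel)"
    if "C \<in> sets borel" "D \<in> sets borel" for C D :: "(real ^ 'n) set"
  proof -
    have "(\<integral>\<^sup>+y. ?f y * indicator (C \<inter> D) y \<partial>lborel) + (\<integral>\<^sup>+y. ?f y * indicator (C - D) y \<partial>lborel) = (\<integral>\<^sup>+y. ?f y * indicator (C \<inter> D) y + ?f y * indicator (C - D) y \<partial>lborel)"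
      using that by (intro nn_integral_add[symmetric] borel_measurable_times_ennreal borel_measurable_indicator) auto
    also have "\<dots> = (\<integral>\<^sup>+y. ?f y * indicator C y \<partial>lborel)"
      by (intro nn_integral_cong) (auto simp: indicator_def)
    finally show ?thesis ..
  qed
  have "(\<integral>\<^sup>+y. ?f y * indicator A y \<partial>lborel) \<le> (\<integral>\<^sup>+y. ?f y * indicator B y \<partial>lborel)"
    unfolding fs[OF A Bb] fs[OF Bb A] Int_commute[of B A] by (intro add_left_mono le)
  also have "\<dots> = (\<integral>\<^sup>+z. ennreal (norm z powr (?k - ?n)) * indicator {..R} (norm z) \<partial>(lborel :: (real ^ 'n) measure))"
    by (subst nn_integral_lborel_affine[of _ "-1" x])
      (auto intro!: borel_measurable_times_ennreal borel_measurable_indicator fm Bb nn_integral_cong simp: B_def indicator_def dist_norm)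
  also have "\<dots> = ennreal (?n * ?w * R powr ?k / ?k)" using k R by (intro riesz_kernel_ball) auto
  also have "?n * ?w * R powr ?k / ?k = ?n / ?k * ?w powr (1 - ?k / ?n) * m powr (?k / ?n)"
  proof -
    have "?w powr (1 - ?k / ?n) = ?w / ?w powr (?k / ?n)" using w by (simp add: powr_diff)
    then show ?thesis using m0 w by (simp add: R_def powr_powr powr_divide)
  qed
  finally show ?thesis .
qed

text \<open>Norm at most 1 in weak L^(n/k), expressed by the distribution function on \<Omega>, for
  a nonnegative Borel function that will stand for the norm of the k-th gradient.\<close>

definition weak_bound :: "nat \<Rightarrow> (real ^ 'n::finite) set \<Rightarrow> (real ^ 'n \<Rightarrow> real) \<Rightarrow> bool" where
  "weak_bound k \<Omega> g \<longleftrightarrow> g \<in> borel_measurable borel \<and> (\<forall>y. 0 \<le> g y) \<and>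
     (\<forall>b>0. emeasure lborel {y \<in> \<Omega>. b < g y} \<le> ennreal (b powr - (real CARD('n) / real k)))"

context
  fixes k :: nat and \<Omega> :: "(real ^ 'n::finite) set" and V :: real
  assumes k: "1 \<le> k" "k < CARD('n)" and \<Omega>: "\<Omega> \<in> sets borel" and V: "V \<ge> 0" "emeasure lborel \<Omega> \<le> ennreal V"
begin

lemma super_level_set:
  assumes g: "weak_bound k \<Omega> g" shows "{y \<in> \<Omega>. b < g y} \<in> sets borel"
proof -
  have "\<Omega> \<inter> {y. b < g y} \<in> sets borel" using g \<Omega> by (auto simp: weak_bound_def)
  then show ?thesis by (simp add: Int_def)
qed

lemma exponent_gt_1: "real CARD('n) / real k > 1"
  using k by simp

text \<open>Layer cake over the heights b of g. A level set of measure b^(-n/k) contributes at most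
  c / b by rearrangement, and the integral of c / b from 1 to r^(-k) is c k ln (1/r): this is the
  sharp logarithm. For b \<le> 1 the measure of \<Omega> is used, and above r^(-k) the bound r^(k-n)
  of the kernel; both contribute constants.\<close>

lemma far_bound:
  fixes x :: "real ^ 'n"
  assumes g: "weak_bound k \<Omega> g" and r: "0 < r" "r \<le> 1"
  shows "(\<integral>\<^sup>+y. ennreal (norm (x - y) powr (real k - real CARD('n))) * indicator (\<Omega> - ball x r) y * ennreal (g y) \<partial>lborel) \<le>
    ennreal (real CARD('n) * omega TYPE('n) powr (1 - real k / real CARD('n)) * ln (1 / r) +
      (real CARD('n) / real k * omega TYPE('n) powr (1 - real k / real CARD('n)) * V powr (real k / real CARD('n)) + 1 / (real CARD('n) / real k - 1)))"
proof -
  let ?n = "real CARD('n)" and ?k = "real k"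
  define q where "q = ?n / ?k"
  have q: "q > 1" unfolding q_def by (rule exponent_gt_1)
  define c where "c = ?n / ?k * omega TYPE('n) powr (1 - ?k / ?n)"
  have c: "c \<ge> 0" by (simp add: c_def)
  have gm [measurable]: "g \<in> borel_measurable borel" and g0: "\<And>y. 0 \<le> g y"
    and gb: "\<And>b. b > 0 \<Longrightarrow> emeasure lborel {y \<in> \<Omega>. b < g y} \<le> ennreal (b powr - q)"
    using g by (auto simp: weak_bound_def q_def)
  let ?f = "\<lambda>y. ennreal (norm (x - y) powr (?k - ?n))"
  have fm: "(\<lambda>y. ?f y * indicator (\<Omega> - ball x r) y) \<in> borel_measurable borel"
    using \<Omega> by (intro borel_measurable_times_ennreal borel_measurable_indicator) auto
  \<comment> \<open>At this height the bound for the level set is r^n, comparable to a ball of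
    radius r; from there on the kernel is bounded by its value at distance r.\<close>
  define b1 where "b1 = r powr - ?k"
  have b1: "b1 \<ge> 1" using r powr_mono2'[of "- ?k" r 1] by (simp add: b1_def)
  define \<Phi> where "\<Phi> = (\<lambda>b. \<integral>\<^sup>+y. ?f y * indicator (\<Omega> - ball x r) y * indicator {y. b < g y} y \<partial>lborel)"
  have le1: "\<Phi> b \<le> (\<integral>\<^sup>+y. ?f y * indicator {y \<in> \<Omega>. b < g y} y \<partial>lborel)" for b
    unfolding \<Phi>_def by (intro nn_integral_mono) (auto simp: indicator_def)
  have B1: "\<Phi> b \<le> ennreal (c * V powr (?k / ?n))" for b
  proof -
    have "emeasure lborel {y \<in> \<Omega>. b < g y} \<le> ennreal V"
      using emeasure_mono[of "{y \<in> \<Omega>. b < g y}" \<Omega> lborel] \<Omega> V(2) by (auto intro: order_trans)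
    from riesz_kernel_set[OF k super_level_set[OF g] V(1) this] show ?thesis
      using le1 order_trans unfolding c_def by blast
  qed
  have B2: "\<Phi> b \<le> ennreal (c * (1 / b))" if b: "b > 0" for b
  proof -
    have "- q * (?k / ?n) = - 1" using k by (simp add: q_def)
    then have "(b powr - q) powr (?k / ?n) = b powr - 1" by (simp only: powr_powr)
    also have "\<dots> = 1 / b" using b by (simp add: powr_minus_divide)
    finally have "(b powr - q) powr (?k / ?n) = 1 / b" .
    then show ?thesis
      using order_trans[OF le1 riesz_kernel_set[OF k super_level_set[OF g] _ gb[OF b]]] by (simp add: c_def)
  qed
  have B3: "\<Phi> b \<le> ennreal (r powr (?k - ?n) * b powr - q)" if b: "b > 0" for b
  proof -
    have "\<Phi> b \<le> (\<integral>\<^sup>+y. ennreal (r powr (?k - ?n)) * indicator {y \<in> \<Omega>. b < g y} y \<partial>lborel)"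
      unfolding \<Phi>_def using r k
      by (intro nn_integral_mono) (auto simp: indicator_def dist_norm intro!: ennreal_leI powr_mono2')
    also have "\<dots> = ennreal (r powr (?k - ?n)) * emeasure lborel {y \<in> \<Omega>. b < g y}"
      using super_level_set[OF g] by (intro nn_integral_cmult_indicator) auto
    also have "\<dots> \<le> ennreal (r powr (?k - ?n)) * ennreal (b powr - q)" by (intro mult_left_mono gb b) auto
    finally show ?thesis by (simp add: ennreal_mult')
  qed
  have "(\<integral>\<^sup>+y. ?f y * indicator (\<Omega> - ball x r) y * ennreal (g y) \<partial>lborel) = (\<integral>\<^sup>+b. \<Phi> b * indicator {0..} b \<partial>lborel)"
    unfolding \<Phi>_def by (rule nn_integral_layer_cake[OF fm gm g0])
  also have "\<dots> \<le> (\<integral>\<^sup>+b. (ennreal (c * V powr (?k / ?n)) * indicator {0..1} b + ennreal (c * (1 / b)) * indicator {1..b1} b)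
      + ennreal (r powr (?k - ?n)) * (ennreal (b powr - q) * indicator {b1..} b) \<partial>lborel)"
  proof (intro nn_integral_mono)
    fix b :: real
    consider "b < 0" | "0 \<le> b" "b \<le> 1" | "1 < b" "b \<le> b1" | "b1 < b" by linarith
    then show "\<Phi> b * indicator {0..} b \<le> (ennreal (c * V powr (?k / ?n)) * indicator {0..1} b + ennreal (c * (1 / b)) * indicator {1..b1} b)
      + ennreal (r powr (?k - ?n)) * (ennreal (b powr - q) * indicator {b1..} b)"
    proof cases
      case 2
      then have "\<Phi> b * indicator {0..} b \<le> ennreal (c * V powr (?k / ?n)) * indicator {0..1} b" using B1[of b] by simp
      then show ?thesis by (intro add_increasing2) auto
    next
      case 3
      then show ?thesis using B2[of b] by (auto intro: add_increasing2 add_increasing)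
    next
      case 4
      then show ?thesis using B3[of b] b1 by (auto simp: ennreal_mult' intro: add_increasing)
    qed simp
  qed
  also have "\<dots> = (ennreal (c * V powr (?k / ?n)) + ennreal (c * ln b1)) + ennreal (r powr (?k - ?n)) * ennreal (b1 powr (1 - q) / (q - 1))"
  proof -
    have i1: "(\<integral>\<^sup>+b. ennreal (c * V powr (?k / ?n)) * indicator {0..1::real} b \<partial>lborel) = ennreal (c * V powr (?k / ?n))"
      by (subst nn_integral_cmult_indicator) auto
    have "(\<integral>\<^sup>+b. ennreal (c * (1 / b)) * indicator {1..b1} b \<partial>lborel) = ennreal (c * ln b1 - c * ln 1)"
    proof (rule nn_integral_FTC_Icc[where F = "\<lambda>b. c * ln b"])
      show "((\<lambda>b. c * ln b) has_real_derivative c * (1 / b)) (at b)" if "b \<in> {1..b1}" for b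
        using DERIV_cmult[OF DERIV_ln_divide[of b], of c] that by simp
      show "0 \<le> c * (1 / b)" if "b \<in> {1..b1}" for b using c that by simp
    qed (use b1 in auto)
    then have i2: "(\<integral>\<^sup>+b. ennreal (c * (1 / b)) * indicator {1..b1} b \<partial>lborel) = ennreal (c * ln b1)" by simp
    have i3: "(\<integral>\<^sup>+b. ennreal (b powr - q) * indicator {b1..} b \<partial>lborel) = ennreal (b1 powr (1 - q) / (q - 1))"
      by (rule nn_integral_powr_atLeast[OF q]) (use b1 in simp)
    show ?thesis
      by (subst nn_integral_add, simp, simp, subst nn_integral_add, simp, simp, subst nn_integral_cmult, simp) (simp only: i1 i2 i3)
  qed
  also have "\<dots> = ennreal (c * V powr (?k / ?n) + c * ln b1 + 1 / (q - 1))"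
  proof -
    have "r powr (?k - ?n) * b1 powr (1 - q) = 1"
      using r k by (simp add: b1_def powr_powr powr_add[symmetric] q_def right_diff_distrib)
    then have "ennreal (r powr (?k - ?n)) * ennreal (b1 powr (1 - q) / (q - 1)) = ennreal (1 / (q - 1))"
      using q by (simp add: ennreal_mult'[symmetric])
    moreover have "ln b1 \<ge> 0" using b1 by simp
    ultimately show ?thesis using c q by simp
  qed
  also have "c * V powr (?k / ?n) + c * ln b1 + 1 / (q - 1) = ?n * omega TYPE('n) powr (1 - ?k / ?n) * ln (1 / r) + (c * V powr (?k / ?n) + 1 / (q - 1))"
    using r k by (simp add: b1_def ln_powr ln_div c_def)
  finally show ?thesis by (simp add: c_def q_def)
qed

text \<open>Inside A the level sets have measure at most min(m, b^(-q)) with q = n/k. Integration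
  over b, with the two bounds crossing at b = m^(-1/q), gives a multiple of m^(1-1/q).\<close>

lemma near_mass_bound:
  assumes g: "weak_bound k \<Omega> g" and A: "A \<in> sets borel" and m: "m > 0" "emeasure lborel A \<le> ennreal m"
  shows "(\<integral>\<^sup>+y. indicator (\<Omega> \<inter> A) y * ennreal (g y) \<partial>lborel) \<le>
    ennreal ((real CARD('n) / real k) / (real CARD('n) / real k - 1) * m powr (1 - real k / real CARD('n)))"
proof -
  let ?n = "real CARD('n)" and ?k = "real k"
  define q where "q = ?n / ?k"
  have q: "q > 1" unfolding q_def by (rule exponent_gt_1)
  have iq: "1 / q = ?k / ?n" by (simp add: q_def)
  have gm [measurable]: "g \<in> borel_measurable borel" and g0: "\<And>y. 0 \<le> g y"
    and gb: "\<And>b. b > 0 \<Longrightarrow> emeasure lborel {y \<in> \<Omega>. b < g y} \<le> ennreal (b powr - q)"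
    using g by (auto simp: weak_bound_def q_def)
  have fm: "(\<lambda>y. indicator (\<Omega> \<inter> A) y :: ennreal) \<in> borel_measurable borel"
    using \<Omega> A by (intro borel_measurable_indicator) auto
  define b1 where "b1 = m powr - (1 / q)"
  have b1: "b1 > 0" using m by (simp add: b1_def)
  have \<Phi>: "(\<integral>\<^sup>+y. indicator (\<Omega> \<inter> A) y * indicator {y. b < g y} y \<partial>lborel) = emeasure lborel (A \<inter> {y \<in> \<Omega>. b < g y})" for b
  proof -
    have "(\<integral>\<^sup>+y. indicator (\<Omega> \<inter> A) y * indicator {y. b < g y} y \<partial>lborel) = (\<integral>\<^sup>+y. indicator (A \<inter> {y \<in> \<Omega>. b < g y}) y \<partial>lborel)"
      by (intro nn_integral_cong) (auto simp: indicator_def)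
    also have "\<dots> = emeasure lborel (A \<inter> {y \<in> \<Omega>. b < g y})" using A super_level_set[OF g] by (intro nn_integral_indicator) auto
    finally show ?thesis .
  qed
  have "(\<integral>\<^sup>+y. indicator (\<Omega> \<inter> A) y * ennreal (g y) \<partial>lborel) = (\<integral>\<^sup>+b. emeasure lborel (A \<inter> {y \<in> \<Omega>. b < g y}) * indicator {0..} b \<partial>lborel)"
    by (subst nn_integral_layer_cake[OF fm gm g0]) (simp add: \<Phi>)
  also have "\<dots> \<le> (\<integral>\<^sup>+b. ennreal m * indicator {0..b1} b + ennreal (b powr - q) * indicator {b1..} b \<partial>lborel)"
  proof (intro nn_integral_mono)
    fix b :: real
    have 1: "emeasure lborel (A \<inter> {y \<in> \<Omega>. b < g y}) \<le> ennreal m"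
      using emeasure_mono[of "A \<inter> {y \<in> \<Omega>. b < g y}" A lborel] A m(2) by (auto intro: order_trans)
    have 2: "emeasure lborel (A \<inter> {y \<in> \<Omega>. b < g y}) \<le> ennreal (b powr - q)" if "b > 0"
      using emeasure_mono[of "A \<inter> {y \<in> \<Omega>. b < g y}" "{y \<in> \<Omega>. b < g y}" lborel] super_level_set[OF g] gb[OF that]
      by (auto intro: order_trans)
    show "emeasure lborel (A \<inter> {y \<in> \<Omega>. b < g y}) * indicator {0..} b \<le> ennreal m * indicator {0..b1} b + ennreal (b powr - q) * indicator {b1..} b"
      using 1 2 b1 by (cases "b \<le> b1") (auto simp: indicator_def intro: add_increasing2)
  qed
  also have "\<dots> = ennreal m * ennreal b1 + ennreal (b1 powr (1 - q) / (q - 1))"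
    using b1 by (subst nn_integral_add) (auto simp: nn_integral_cmult_indicator nn_integral_powr_atLeast[OF q])
  also have "\<dots> = ennreal (m * b1 + b1 powr (1 - q) / (q - 1))"
    using m b1 q by (simp add: ennreal_mult')
  also have "m * b1 + b1 powr (1 - q) / (q - 1) = q / (q - 1) * m powr (1 - 1 / q)"
  proof -
    have "m powr (1 - 1 / q) = m powr 1 * m powr - (1 / q)" by (simp only: powr_add[symmetric]) simp
    then have e1: "m * b1 = m powr (1 - 1 / q)" using m by (simp add: b1_def)
    have e2: "b1 powr (1 - q) = m powr (1 - 1 / q)"
      using q by (simp add: b1_def powr_powr diff_divide_distrib right_diff_distrib)
    show ?thesis unfolding e1 e2 using q by (simp add: field_simps)
  qed
  finally show ?thesis by (simp add: iq q_def)
qed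

text \<open>Take a largest 2\<rho>-separated subset of the bad set. The balls of radius \<rho> about
  its N points are disjoint, so their union carries mass at least N \<mu> \<rho>^(n-k), while the
  mass bound allows only a multiple of (N \<rho>^n)^(1-k/n). The powers of \<rho> cancel and N is
  bounded in terms of \<mu>. By maximality the doubled balls cover.\<close>

lemma covering:
  assumes g: "weak_bound k \<Omega> g" and \<rho>: "\<rho> > 0" and \<mu>: "\<mu> > 0"
  defines "E \<equiv> {x. ennreal (\<mu> * \<rho> powr (real CARD('n) - real k)) < (\<integral>\<^sup>+y. indicator (\<Omega> \<inter> ball x \<rho>) y * ennreal (g y) \<partial>lborel)}"
  obtains F where "finite F" "E \<subseteq> (\<Union>x\<in>F. ball x (2 * \<rho>))"
    "real (card F) \<le> ((real CARD('n) / real k) / (real CARD('n) / real k - 1) * omega TYPE('n) powr (1 - real k / real CARD('n)) / \<mu>) powr (real CARD('n) / real k)"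
proof -
  let ?n = "real CARD('n)" and ?k = "real k" and ?w = "omega TYPE('n)"
  define q where "q = ?n / ?k"
  have q: "q > 1" unfolding q_def by (rule exponent_gt_1)
  have iq: "?k / ?n = 1 / q" by (simp add: q_def)
  define c where "c = q / (q - 1)"
  have c: "c > 0" using q by (simp add: c_def)
  have w: "?w > 0" by (rule omega_pos)
  have gm [measurable]: "g \<in> borel_measurable borel" using g by (simp add: weak_bound_def)
  define M where "M = (c * ?w powr (1 - 1 / q) / \<mu>) powr q"
  define sep where "sep = (\<lambda>F :: (real ^ 'n) set. finite F \<and> F \<subseteq> E \<and> (\<forall>x\<in>F. \<forall>y\<in>F. x \<noteq> y \<longrightarrow> 2 * \<rho> \<le> dist x y))"
  have bound: "real (card F) \<le> M" if F: "sep F" for F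
  proof (cases "F = {}")
    case True then show ?thesis by (simp add: M_def)
  next
    case False
    have fin: "finite F" and FE: "F \<subseteq> E" and dis: "\<And>x y. x \<in> F \<Longrightarrow> y \<in> F \<Longrightarrow> x \<noteq> y \<Longrightarrow> 2 * \<rho> \<le> dist x y"
      using F by (auto simp: sep_def)
    define N where "N = real (card F)"
    have N: "N > 0" using False fin by (simp add: N_def card_gt_0_iff)
    define U where "U = (\<Union>x\<in>F. ball x \<rho>)"
    have Ub: "U \<in> sets borel" unfolding U_def by (intro borel_open open_UN) auto
    have dj: "ball x \<rho> \<inter> ball y \<rho> = {}" if "x \<in> F" "y \<in> F" "x \<noteq> y" for x y
      using dis[OF that] dist_triangle_less_add[of x _ \<rho> y \<rho>] by (fastforce simp: dist_commute)
    have "emeasure lborel U \<le> (\<Sum>x\<in>F. emeasure lborel (ball x \<rho>))"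
      unfolding U_def using fin by (intro emeasure_subadditive_finite) auto
    also have "\<dots> = ennreal (N * (?w * \<rho> ^ CARD('n)))"
      using \<rho> w by (simp add: emeasure_ball_omega N_def ennreal_of_nat_eq_real_of_nat ennreal_mult'[symmetric])
    finally have Um: "emeasure lborel U \<le> ennreal (N * (?w * \<rho> ^ CARD('n)))" .
    have ind: "(\<Sum>x\<in>F. indicator (\<Omega> \<inter> ball x \<rho>) y) = (indicator (\<Omega> \<inter> U) y :: ennreal)" for y
    proof (cases "\<exists>x\<in>F. y \<in> ball x \<rho>")
      case True
      then obtain x where x: "x \<in> F" "y \<in> ball x \<rho>" by blast
      have "(\<Sum>z\<in>F. indicator (\<Omega> \<inter> ball z \<rho>) y) = (\<Sum>z\<in>{x}. indicator (\<Omega> \<inter> ball z \<rho>) y :: ennreal)"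
      proof (rule sum.mono_neutral_right[OF fin])
        show "\<forall>z\<in>F - {x}. indicator (\<Omega> \<inter> ball z \<rho>) y = (0 :: ennreal)"
          using dj[OF x(1)] x(2) by (fastforce simp: indicator_def)
      qed (use x in auto)
      then show ?thesis using x by (auto simp: U_def indicator_def)
    next
      case False
      then show ?thesis by (auto simp: U_def indicator_def)
    qed
    have "ennreal (N * (\<mu> * \<rho> powr (?n - ?k))) = (\<Sum>x\<in>F. ennreal (\<mu> * \<rho> powr (?n - ?k)))"
      using \<mu> by (simp add: N_def ennreal_of_nat_eq_real_of_nat ennreal_mult'[symmetric])
    also have "\<dots> \<le> (\<Sum>x\<in>F. \<integral>\<^sup>+y. indicator (\<Omega> \<inter> ball x \<rho>) y * ennreal (g y) \<partial>lborel)"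
      using FE by (intro sum_mono) (auto simp: E_def)
    also have "\<dots> = (\<integral>\<^sup>+y. (\<Sum>x\<in>F. indicator (\<Omega> \<inter> ball x \<rho>) y * ennreal (g y)) \<partial>lborel)"
      using \<Omega> by (intro nn_integral_sum[symmetric] borel_measurable_times_ennreal borel_measurable_indicator) auto
    also have "\<dots> = (\<integral>\<^sup>+y. indicator (\<Omega> \<inter> U) y * ennreal (g y) \<partial>lborel)"
      by (simp only: sum_distrib_right[symmetric] ind)
    also have "\<dots> \<le> ennreal (c * (N * (?w * \<rho> ^ CARD('n))) powr (1 - 1 / q))"
      using near_mass_bound[OF g Ub _ Um] N w \<rho> by (simp add: c_def q_def)
    finally have "N * (\<mu> * \<rho> powr (?n - ?k)) \<le> c * (N * (?w * \<rho> ^ CARD('n))) powr (1 - 1 / q)"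
      using c by (subst (asm) ennreal_le_iff) auto
    also have "\<dots> = c * ?w powr (1 - 1 / q) * N powr (1 - 1 / q) * \<rho> powr (?n - ?k)"
    proof -
      have "(\<rho> ^ CARD('n)) powr (1 - 1 / q) = \<rho> powr (?n - ?k)"
        using \<rho> k by (simp add: powr_realpow[symmetric] powr_powr right_diff_distrib q_def)
      then show ?thesis using N w \<rho> by (simp add: powr_mult)
    qed
    finally have "N * \<mu> \<le> c * ?w powr (1 - 1 / q) * N powr (1 - 1 / q)" using \<rho> by (simp add: mult.assoc[symmetric])
    moreover have "N = N powr (1 / q) * N powr (1 - 1 / q)" using N by (simp add: powr_add[symmetric])
    ultimately have "N powr (1 / q) * \<mu> * N powr (1 - 1 / q) \<le> c * ?w powr (1 - 1 / q) * N powr (1 - 1 / q)"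
      by (simp add: mult_ac)
    then have "N powr (1 / q) * \<mu> \<le> c * ?w powr (1 - 1 / q)" using N by simp
    then have "N powr (1 / q) \<le> c * ?w powr (1 - 1 / q) / \<mu>" using \<mu> by (simp add: pos_le_divide_eq)
    then have "(N powr (1 / q)) powr q \<le> M" unfolding M_def using q by (intro powr_mono2) auto
    then show ?thesis using N q by (simp add: powr_powr N_def)
  qed
  have "\<exists>F. sep F \<and> (\<forall>F'. sep F' \<longrightarrow> card F' \<le> card F)"
  proof -
    have "sep {}" by (simp add: sep_def)
    moreover have "\<forall>F. sep F \<longrightarrow> card F < Suc (nat \<lceil>M\<rceil>)"
      using bound by (auto simp: le_nat_iff ceiling_le_iff less_Suc_eq_le) (meson bound le_nat_iff of_nat_le_iff real_nat_ceiling_ge order_trans)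
    ultimately show ?thesis using ex_has_greatest_nat[of sep "{}" card] by blast
  qed
  then obtain F where F: "sep F" "\<And>F'. sep F' \<Longrightarrow> card F' \<le> card F" by blast
  show thesis
  proof (rule that[of F])
    show "finite F" using F(1) by (simp add: sep_def)
    show "E \<subseteq> (\<Union>x\<in>F. ball x (2 * \<rho>))"
    proof
      fix x assume x: "x \<in> E"
      show "x \<in> (\<Union>x\<in>F. ball x (2 * \<rho>))"
      proof (rule ccontr)
        assume "x \<notin> (\<Union>x\<in>F. ball x (2 * \<rho>))"
        then have far: "\<And>y. y \<in> F \<Longrightarrow> 2 * \<rho> \<le> dist y x" by (auto simp: not_less)
        then have "x \<notin> F" using \<rho> by force
        moreover have "sep (insert x F)" using F(1) x far by (auto simp: sep_def dist_commute)
        ultimately show False using F(2)[of "insert x F"] F(1) by (simp add: sep_def)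
      qed
    qed
    show "real (card F) \<le> ((?n / ?k) / (?n / ?k - 1) * ?w powr (1 - ?k / ?n) / \<mu>) powr (?n / ?k)"
      using bound[OF F(1)] unfolding M_def c_def q_def by simp
  qed
qed

end

section \<open>The potential off a set of small measure\<close>

lemma power_powr: "a > 0 \<Longrightarrow> (a ^ j) powr b = (a powr b) ^ j" for a b :: real
  by (simp add: powr_realpow[symmetric] powr_powr mult.commute)

lemma ennreal_suminf_geometric:
  assumes "0 \<le> a" "0 \<le> t" "t < 1"
  shows "(\<Sum>j. ennreal (a * t ^ j)) = ennreal (a / (1 - t))"
proof -
  have "(\<lambda>j. a * t ^ j) sums (a * (1 / (1 - t)))" using assms by (intro sums_mult geometric_sums) auto
  then have sm: "summable (\<lambda>j. a * t ^ j)" and val: "(\<Sum>j. a * t ^ j) = a / (1 - t)" by (auto simp: sums_iff)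
  have nn: "\<And>j. 0 \<le> a * t ^ j" using assms by simp
  show ?thesis by (simp only: suminf_ennreal2[OF nn sm] val)
qed

context
  fixes k :: nat and \<Omega> :: "(real ^ 'n::finite) set" and V :: real
  assumes k: "1 \<le> k" "k < CARD('n)" and \<Omega>: "\<Omega> \<in> sets borel" and V: "V \<ge> 0" "emeasure lborel \<Omega> \<le> ennreal V"
begin

text \<open>The near part exceeds 1 only where some mean of \<open>g\<close> over a dyadic ball is large; at scale
  \<open>2^(-j) r\<close> these points are covered by about \<open>2^(jd/2)\<close> balls, of \<open>\<nu>\<close>-measure about \<open>(2^(-j) r)^d\<close> each.\<close>

lemma near_bound:
  assumes d: "d > 0" and Cd: "C\<^sub>d \<ge> 0"
  obtains A where "A \<ge> 0" "\<And>\<nu> g r. sets \<nu> = sets borel \<Longrightarrow> upper_growth d C\<^sub>d \<nu> \<Longrightarrow> weak_bound k \<Omega> g \<Longrightarrow> 0 < r \<Longrightarrow>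
    \<exists>U. open U \<and> emeasure \<nu> U \<le> ennreal (A * r powr d) \<and>
      (\<forall>x. x \<notin> U \<longrightarrow> (\<integral>\<^sup>+y. ennreal (norm (x - y) powr (real k - real CARD('n))) * indicator (\<Omega> \<inter> ball x r) y * ennreal (g y) \<partial>lborel) \<le> 1)"
proof -
  let ?n = "real CARD('n)" and ?k = "real k"
  define q where "q = ?n / ?k"
  have q: "q > 1" unfolding q_def using k by simp
  define K where "K = q / (q - 1) * omega TYPE('n) powr (1 - ?k / ?n)"
  have K: "K \<ge> 0" using q by (simp add: K_def)
  \<comment> \<open>The \<nu>-measure of a ball of radius 2^(-j) r carries the factor t^(2j).
    Allowing t^(-j) balls at that scale, up to constants, leaves a geometric series of ratio
    t.\<close>
  define t where "t = (2 :: real) powr - (d / 2)"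
  have t: "0 < t" "t < 1" using d by (auto simp: t_def powr_minus_divide)
  \<comment> \<open>Thresholds \<mu>_j = c s^j admit (K / \<mu>_j)^q balls, which is a multiple of
    s^(-jq) = t^(-j).\<close>
  define s where "s = t powr (1 / q)"
  have s: "0 < s" "s < 1" using t q powr_less_mono2[of "1 / q" t 1] by (auto simp: s_def)
  have sq: "s powr q = t" using q t by (simp add: s_def powr_powr)
  have tt: "t * t = (1 / 2) powr d" by (simp add: t_def powr_add[symmetric] powr_minus_divide powr_divide)
  \<comment> \<open>The factor 1 - s makes the contributions of the scales sum to 1, and 2^(k-n)
    compensates for bounding |x - y| from below by half the radius.\<close>
  define c where "c = (1 - s) * 2 powr (?k - ?n)"
  have c: "c > 0" using s by (simp add: c_def)
  define A where "A = (K / c) powr q * C\<^sub>d * 2 powr d / (1 - t)"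
  show thesis
  proof (rule that[of A])
    show "A \<ge> 0" using Cd t by (simp add: A_def)
    fix \<nu> :: "(real ^ 'n) measure" and g :: "real ^ 'n \<Rightarrow> real" and r :: real
    assume \<nu>: "sets \<nu> = sets borel" "upper_growth d C\<^sub>d \<nu>" and g: "weak_bound k \<Omega> g" and r: "0 < r"
    have gm [measurable]: "g \<in> borel_measurable borel" using g by (simp add: weak_bound_def)
    define \<rho> where "\<rho> = (\<lambda>j. r * (1 / 2) ^ j)"
    have \<rho>: "\<rho> j > 0" for j using r by (simp add: \<rho>_def)
    define \<mu> where "\<mu> = (\<lambda>j. c * s ^ j)"
    have \<mu>: "\<mu> j > 0" for j using c s by (simp add: \<mu>_def)
    define mass where "mass = (\<lambda>x j. \<integral>\<^sup>+y. indicator (\<Omega> \<inter> ball x (\<rho> j)) y * ennreal (g y) \<partial>lborel)"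
    have "\<exists>F. finite F \<and> {x. ennreal (\<mu> j * \<rho> j powr (?n - ?k)) < mass x j} \<subseteq> (\<Union>x\<in>F. ball x (2 * \<rho> j)) \<and>
        real (card F) \<le> (K / \<mu> j) powr q" for j
      unfolding mass_def K_def q_def
      by (rule covering[OF k \<Omega> V g \<rho>[of j] \<mu>[of j]]) blast
    then obtain F where F: "\<And>j. finite (F j)" "\<And>j. {x. ennreal (\<mu> j * \<rho> j powr (?n - ?k)) < mass x j} \<subseteq> (\<Union>x\<in>F j. ball x (2 * \<rho> j))"
        "\<And>j. real (card (F j)) \<le> (K / \<mu> j) powr q"
      by metis
    define U where "U = (\<Union>j. \<Union>x\<in>F j. ball x (2 * \<rho> j))"
    have opj: "open (\<Union>x\<in>F j. ball x (2 * \<rho> j))" for j by auto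
    have "emeasure \<nu> U \<le> (\<Sum>j. emeasure \<nu> (\<Union>x\<in>F j. ball x (2 * \<rho> j)))"
      unfolding U_def using opj \<nu>(1) by (intro emeasure_subadditive_countably) auto
    also have "\<dots> \<le> (\<Sum>j. ennreal (((K / c) powr q * C\<^sub>d * 2 powr d * r powr d) * t ^ j))"
    proof (intro suminf_le allI)
      fix j
      have "emeasure \<nu> (\<Union>x\<in>F j. ball x (2 * \<rho> j)) \<le> (\<Sum>x\<in>F j. emeasure \<nu> (ball x (2 * \<rho> j)))"
        using F(1) \<nu>(1) by (intro emeasure_subadditive_finite) auto
      also have "\<dots> \<le> (\<Sum>x\<in>F j. ennreal (C\<^sub>d * (2 * \<rho> j) powr d))"
        using \<nu>(2) \<rho>[of j] by (intro sum_mono) (auto simp: upper_growth_def)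
      also have "\<dots> = ennreal (real (card (F j)) * (C\<^sub>d * (2 * \<rho> j) powr d))"
        using Cd by (simp add: ennreal_of_nat_eq_real_of_nat ennreal_mult'[symmetric])
      also have "\<dots> \<le> ennreal ((K / \<mu> j) powr q * (C\<^sub>d * (2 * \<rho> j) powr d))"
        using Cd by (intro ennreal_leI mult_right_mono F) auto
      also have "(K / \<mu> j) powr q = (K / c) powr q / t ^ j"
      proof -
        have "(K / \<mu> j) powr q = (K / c / s ^ j) powr q" by (simp add: \<mu>_def)
        also have "\<dots> = (K / c) powr q / (s ^ j) powr q" by (rule powr_divide)
        finally show ?thesis using s by (simp add: power_powr sq)
      qed
      also have "(2 * \<rho> j) powr d = 2 powr d * r powr d * (t ^ j * t ^ j)"
      proof -
        have "(2 * \<rho> j) powr d = 2 powr d * r powr d * ((1 / 2) ^ j) powr d"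
          using r by (simp only: \<rho>_def powr_mult mult.assoc)
        then show ?thesis by (simp only: power_powr zero_less_divide_1_iff zero_less_numeral tt[symmetric] power_mult_distrib)
      qed
      also have "(K / c) powr q / t ^ j * (C\<^sub>d * (2 powr d * r powr d * (t ^ j * t ^ j))) = ((K / c) powr q * C\<^sub>d * 2 powr d * r powr d) * t ^ j"
        using t by simp
      finally show "emeasure \<nu> (\<Union>x\<in>F j. ball x (2 * \<rho> j)) \<le> ennreal (((K / c) powr q * C\<^sub>d * 2 powr d * r powr d) * t ^ j)" .
    qed auto
    also have "\<dots> = ennreal (A * r powr d)"
      using Cd t by (subst ennreal_suminf_geometric) (auto simp: A_def)
    finally have Um: "emeasure \<nu> U \<le> ennreal (A * r powr d)" .
    have "(\<integral>\<^sup>+y. ennreal (norm (x - y) powr (?k - ?n)) * indicator (\<Omega> \<inter> ball x r) y * ennreal (g y) \<partial>lborel) \<le> 1" if x: "x \<notin> U" for x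
    proof -
      have small: "mass x j \<le> ennreal (\<mu> j * \<rho> j powr (?n - ?k))" for j
        using F(2)[of j] x by (force simp: U_def not_less[symmetric])
      have "(\<integral>\<^sup>+y. ennreal (norm (x - y) powr (?k - ?n)) * indicator (\<Omega> \<inter> ball x r) y * ennreal (g y) \<partial>lborel) \<le>
        (\<integral>\<^sup>+y. (\<Sum>j. ennreal (\<rho> (Suc j) powr (?k - ?n)) * (indicator (\<Omega> \<inter> ball x (\<rho> j)) y * ennreal (g y))) \<partial>lborel)"
      proof (rule nn_integral_mono_AE)
        have "AE y in lborel. y \<noteq> x" by (rule AE_lborel_singleton)
        then show "AE y in lborel. ennreal (norm (x - y) powr (?k - ?n)) * indicator (\<Omega> \<inter> ball x r) y * ennreal (g y) \<le>
          (\<Sum>j. ennreal (\<rho> (Suc j) powr (?k - ?n)) * (indicator (\<Omega> \<inter> ball x (\<rho> j)) y * ennreal (g y)))"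
        proof eventually_elim
          case (elim y)
          show ?case
          proof (cases "y \<in> \<Omega> \<inter> ball x r")
            case True
            have pos: "norm (x - y) > 0" using elim by simp
            have "\<exists>j. \<rho> j \<le> norm (x - y)"
              using real_arch_pow_inv[of "norm (x - y) / r" "1 / 2"] pos r by (auto simp: \<rho>_def field_simps intro: less_imp_le)
            \<comment> \<open>The first dyadic radius not exceeding |x - y|. It is not the radius r
              itself, so the preceding ball contains y.\<close>
            then obtain j where j: "\<rho> j \<le> norm (x - y)" "\<And>i. i < j \<Longrightarrow> \<not> \<rho> i \<le> norm (x - y)"
              using exists_least_iff[of "\<lambda>j. \<rho> j \<le> norm (x - y)"] by blast
            have "norm (x - y) < \<rho> 0" using True by (simp add: \<rho>_def dist_norm)
            then have "j \<noteq> 0" using j(1) by (metis not_le)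
            then obtain i where i: "j = Suc i" using not0_implies_Suc by blast
            have yi: "y \<in> \<Omega> \<inter> ball x (\<rho> i)" using True j(2)[of i] i by (auto simp: dist_norm)
            have "ennreal (norm (x - y) powr (?k - ?n)) * indicator (\<Omega> \<inter> ball x r) y * ennreal (g y) \<le>
                ennreal (\<rho> (Suc i) powr (?k - ?n)) * (indicator (\<Omega> \<inter> ball x (\<rho> i)) y * ennreal (g y))"
              using True yi j(1) i k \<rho>[of "Suc i"] by (auto intro!: mult_right_mono ennreal_leI powr_mono2')
            also have "\<dots> = (\<Sum>j\<in>{i}. ennreal (\<rho> (Suc j) powr (?k - ?n)) * (indicator (\<Omega> \<inter> ball x (\<rho> j)) y * ennreal (g y)))"
              by simp
            also have "\<dots> \<le> (\<Sum>j. ennreal (\<rho> (Suc j) powr (?k - ?n)) * (indicator (\<Omega> \<inter> ball x (\<rho> j)) y * ennreal (g y)))"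
              by (intro sum_le_suminf) auto
            finally show ?thesis .
          qed simp
        qed
      qed
      also have "\<dots> = (\<Sum>j. ennreal (\<rho> (Suc j) powr (?k - ?n)) * mass x j)"
      proof -
        have im: "(\<lambda>y. indicator (\<Omega> \<inter> ball x (\<rho> j)) y * ennreal (g y)) \<in> borel_measurable lborel" for j
          using \<Omega> by (intro borel_measurable_times_ennreal borel_measurable_indicator) auto
        show ?thesis unfolding mass_def
          by (subst nn_integral_suminf) (intro borel_measurable_times_ennreal im borel_measurable_const, simp only: nn_integral_cmult[OF im])
      qed
      also have "\<dots> \<le> (\<Sum>j. ennreal ((1 - s) * s ^ j))"
      proof (intro suminf_le allI)
        fix j
        have "ennreal (\<rho> (Suc j) powr (?k - ?n)) * mass x j \<le> ennreal (\<rho> (Suc j) powr (?k - ?n)) * ennreal (\<mu> j * \<rho> j powr (?n - ?k))"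
          by (intro mult_left_mono small) auto
        also have "\<dots> = ennreal (\<rho> (Suc j) powr (?k - ?n) * (\<mu> j * \<rho> j powr (?n - ?k)))" by (simp add: ennreal_mult')
        also have "\<rho> (Suc j) powr (?k - ?n) * (\<mu> j * \<rho> j powr (?n - ?k)) = (1 - s) * s ^ j"
        proof -
          have "\<rho> (Suc j) = \<rho> j / 2" by (simp add: \<rho>_def)
          then have "\<rho> (Suc j) powr (?k - ?n) = \<rho> j powr (?k - ?n) / 2 powr (?k - ?n)" by (simp only: powr_divide)
          moreover have "\<rho> j powr (?k - ?n) * \<rho> j powr (?n - ?k) = 1" using \<rho>[of j] by (simp add: powr_add[symmetric])
          ultimately show ?thesis by (simp add: \<mu>_def c_def mult_ac)
        qed
        finally show "ennreal (\<rho> (Suc j) powr (?k - ?n)) * mass x j \<le> ennreal ((1 - s) * s ^ j)" .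
      qed auto
      also have "\<dots> = 1" using s by (subst ennreal_suminf_geometric) auto
      finally show ?thesis .
    qed
    moreover have "open U" unfolding U_def using opj by blast
    ultimately show "\<exists>U. open U \<and> emeasure \<nu> U \<le> ennreal (A * r powr d) \<and>
      (\<forall>x. x \<notin> U \<longrightarrow> (\<integral>\<^sup>+y. ennreal (norm (x - y) powr (?k - ?n)) * indicator (\<Omega> \<inter> ball x r) y * ennreal (g y) \<partial>lborel) \<le> 1)"
      using Um by blast
  qed
qed

text \<open>Near and far parts combined. \<open>A\<close> and \<open>B\<close> are fixed before
  \<nu>, g and r, so r can later run through all scales exp(-m) with the same constants.\<close>

lemma potential_bound:
  assumes d: "d > 0" and Cd: "C\<^sub>d \<ge> 0"
  obtains A B where "A \<ge> 0" "B \<ge> 0" "\<And>\<nu> g r. sets \<nu> = sets borel \<Longrightarrow> upper_growth d C\<^sub>d \<nu> \<Longrightarrow> weak_bound k \<Omega> g \<Longrightarrow> 0 < r \<Longrightarrow> r \<le> 1 \<Longrightarrow>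
    \<exists>U. open U \<and> emeasure \<nu> U \<le> ennreal (A * r powr d) \<and>
      (\<forall>x. x \<notin> U \<longrightarrow> (\<integral>\<^sup>+y. ennreal (norm (x - y) powr (real k - real CARD('n))) * indicator \<Omega> y * ennreal (g y) \<partial>lborel) \<le>
        ennreal (real CARD('n) * omega TYPE('n) powr (1 - real k / real CARD('n)) * ln (1 / r) + B))"
proof -
  let ?n = "real CARD('n)" and ?k = "real k"
  define B0 where "B0 = ?n / ?k * omega TYPE('n) powr (1 - ?k / ?n) * V powr (?k / ?n) + 1 / (?n / ?k - 1)"
  have "?n / ?k > 1" using k by simp
  then have B0: "B0 \<ge> 0" by (simp add: B0_def)
  obtain A where A: "A \<ge> 0" "\<And>\<nu> g r. sets \<nu> = sets borel \<Longrightarrow> upper_growth d C\<^sub>d \<nu> \<Longrightarrow> weak_bound k \<Omega> g \<Longrightarrow> 0 < r \<Longrightarrow>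
    \<exists>U. open U \<and> emeasure \<nu> U \<le> ennreal (A * r powr d) \<and>
      (\<forall>x. x \<notin> U \<longrightarrow> (\<integral>\<^sup>+y. ennreal (norm (x - y) powr (?k - ?n)) * indicator (\<Omega> \<inter> ball x r) y * ennreal (g y) \<partial>lborel) \<le> 1)"
  proof (rule near_bound[OF d Cd], goal_cases)
    case (1 A)
    show ?case by (rule 1(1)[OF 1(2)]) (rule 1(3))
  qed
  show thesis
  proof (rule that[of A "B0 + 1"])
    fix \<nu> :: "(real ^ 'n) measure" and g :: "real ^ 'n \<Rightarrow> real" and r :: real
    assume \<nu>: "sets \<nu> = sets borel" "upper_growth d C\<^sub>d \<nu>" and g: "weak_bound k \<Omega> g" and r: "0 < r" "r \<le> 1"
    have gm [measurable]: "g \<in> borel_measurable borel" using g by (simp add: weak_bound_def)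
    obtain U where U: "open U" "emeasure \<nu> U \<le> ennreal (A * r powr d)"
      "\<And>x. x \<notin> U \<Longrightarrow> (\<integral>\<^sup>+y. ennreal (norm (x - y) powr (?k - ?n)) * indicator (\<Omega> \<inter> ball x r) y * ennreal (g y) \<partial>lborel) \<le> 1"
      using A(2)[OF \<nu> g r(1)] by blast
    have "(\<integral>\<^sup>+y. ennreal (norm (x - y) powr (?k - ?n)) * indicator \<Omega> y * ennreal (g y) \<partial>lborel) \<le>
        ennreal (?n * omega TYPE('n) powr (1 - ?k / ?n) * ln (1 / r) + (B0 + 1))" if x: "x \<notin> U" for x
    proof -
      let ?f = "\<lambda>S y. ennreal (norm (x - y) powr (?k - ?n)) * indicator S y * ennreal (g y)"
      have "(\<integral>\<^sup>+y. ?f \<Omega> y \<partial>lborel) = (\<integral>\<^sup>+y. ?f (\<Omega> - ball x r) y + ?f (\<Omega> \<inter> ball x r) y \<partial>lborel)"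
        by (intro nn_integral_cong) (auto simp: indicator_def)
      also have "\<dots> = (\<integral>\<^sup>+y. ?f (\<Omega> - ball x r) y \<partial>lborel) + (\<integral>\<^sup>+y. ?f (\<Omega> \<inter> ball x r) y \<partial>lborel)"
        using \<Omega> by (intro nn_integral_add) (auto intro!: borel_measurable_times_ennreal borel_measurable_indicator)
      also have "\<dots> \<le> ennreal (?n * omega TYPE('n) powr (1 - ?k / ?n) * ln (1 / r) + B0) + ennreal 1"
        using far_bound[OF k \<Omega> V g r, of x] U(3)[OF x] unfolding B0_def by (intro add_mono) auto
      also have "\<dots> = ennreal (?n * omega TYPE('n) powr (1 - ?k / ?n) * ln (1 / r) + (B0 + 1))"
        using B0 r by (subst ennreal_plus[symmetric]) (auto simp: add_ac)
      finally show ?thesis .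
    qed
    then show "\<exists>U. open U \<and> emeasure \<nu> U \<le> ennreal (A * r powr d) \<and>
      (\<forall>x. x \<notin> U \<longrightarrow> (\<integral>\<^sup>+y. ennreal (norm (x - y) powr (?k - ?n)) * indicator \<Omega> y * ennreal (g y) \<partial>lborel) \<le>
        ennreal (?n * omega TYPE('n) powr (1 - ?k / ?n) * ln (1 / r) + (B0 + 1)))"
      using U by blast
  qed (use A B0 in auto)
qed

end

section \<open>The weak norm and the distribution function\<close>

lemma abs_level_set_lebesgue:
  fixes g :: "real ^ 'n::finite \<Rightarrow> real"
  assumes \<Omega>: "\<Omega> \<in> sets lebesgue" and g: "g \<in> borel_measurable lebesgue"
  shows "{x \<in> \<Omega>. c < \<bar>g x\<bar>} \<in> sets lebesgue"
proof -
  have "{x \<in> space lebesgue. c < \<bar>g x\<bar>} \<in> sets lebesgue"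
    using borel_measurable_abs[OF g] by (simp only: borel_measurable_iff_greater)
  from sets.Int[OF \<Omega> this] show ?thesis by (simp add: Int_def)
qed

text \<open>If a level set were larger than b^(-p), some s would lie strictly between; then the
  rearrangement at s is at least b, and s^(1/p) b > 1. Such an s is admissible in the supremum
  because the level set is contained in \<Omega>.\<close>

lemma weak_Lp_norm_le_1_D:
  fixes \<Omega> :: "(real ^ 'n::finite) set"
  assumes le: "weak_Lp_norm p \<Omega> g \<le> 1" and p: "p > 0" and b: "b > 0" and \<Omega>: "\<Omega> \<in> sets lebesgue"
    and g: "g \<in> borel_measurable lebesgue"
  shows "emeasure lebesgue {x \<in> \<Omega>. b < \<bar>g x\<bar>} \<le> ennreal (b powr - p)"
proof (rule ccontr)
  let ?m = "emeasure lebesgue {x \<in> \<Omega>. b < \<bar>g x\<bar>}"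
  assume "\<not> ?thesis"
  then have "ennreal (b powr - p) < ?m" by (simp add: not_le)
  then obtain s' where s': "ennreal (b powr - p) < s'" "s' < ?m" using dense by blast
  then have "s' < \<infinity>" using order_less_le_trans[OF s'(2)] top_greatest by (metis infinity_ennreal_def)
  then obtain s where s: "s' = ennreal s" "s \<ge> 0" by (cases s') auto
  have sb: "b powr - p < s" using s s' by (simp add: ennreal_less_iff)
  have s0: "s > 0" using sb b by (meson less_trans powr_gt_zero less_imp_neq order.strict_trans1 powr_ge_zero)
  have "?m \<le> emeasure lebesgue \<Omega>" using \<Omega> by (intro emeasure_mono) auto
  then have sin: "s \<in> {s. 0 < s \<and> ennreal s < emeasure lebesgue \<Omega>}" using s0 s s'(2) by auto
  have "ennreal (s powr (1 / p)) * rearrangement \<Omega> g s \<le> weak_Lp_norm p \<Omega> g"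
    unfolding weak_Lp_norm_def by (rule SUP_upper[OF sin])
  moreover have "ennreal b \<le> rearrangement \<Omega> g s"
    unfolding rearrangement_def
  proof (rule Inf_greatest)
    fix z assume "z \<in> {ennreal c |c. c > 0 \<and> emeasure lebesgue {x \<in> \<Omega>. \<bar>g x\<bar> > c} \<le> ennreal s}"
    then obtain c where c: "z = ennreal c" "c > 0" "emeasure lebesgue {x \<in> \<Omega>. \<bar>g x\<bar> > c} \<le> ennreal s" by blast
    have "b \<le> c"
    proof (rule ccontr)
      assume "\<not> b \<le> c"
      moreover have "{x \<in> \<Omega>. \<bar>g x\<bar> > c} \<in> sets lebesgue" by (rule abs_level_set_lebesgue[OF \<Omega> g])
      ultimately have "?m \<le> emeasure lebesgue {x \<in> \<Omega>. \<bar>g x\<bar> > c}" by (intro emeasure_mono) auto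
      then have "?m \<le> s'" using c(3) s(1) by (auto intro: order_trans)
      then show False using s'(2) by simp
    qed
    then show "ennreal b \<le> z" using c by (simp add: ennreal_leI)
  qed
  ultimately have "ennreal (s powr (1 / p)) * ennreal b \<le> 1"
    using le by (meson mult_left_mono order_trans zero_le)
  then have "ennreal (s powr (1 / p) * b) \<le> ennreal 1" using b by (simp add: ennreal_mult')
  then have "s powr (1 / p) * b \<le> 1" by (subst (asm) ennreal_le_iff) auto
  moreover have "(b powr - p) powr (1 / p) < s powr (1 / p)" using sb p by (intro powr_less_mono2) auto
  moreover have "(b powr - p) powr (1 / p) = 1 / b" 
  proof -
    have "- p * (1 / p) = - 1" using p by simp
    then show ?thesis using b by (simp only: powr_powr) (simp add: powr_minus_divide)
  qed
  ultimately show False using b by (simp add: divide_less_eq mult.commute)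
qed

section \<open>The uniform bound\<close>

text \<open>On a positive coordinate half-axis ln |y| is the logarithm of the coordinate, with
  explicit derivatives. This one nonzero entry shows that \<ell> is positive, so that it may be
  divided by.\<close>

lemma iter_log_axis:
  fixes i :: "'n::finite"
  assumes s: "s > 0"
  shows "iter_partial_deriv (replicate (Suc m) i) (\<lambda>y. ln (norm y)) (s *\<^sub>R axis i 1) = (- 1) ^ m * fact m / s ^ Suc m"
  using s
proof (induction m arbitrary: s)
  case 0
  have "\<forall>\<^sub>F t in nhds 0. ln (norm ((s *\<^sub>R axis i 1 :: real ^ 'n) + t *\<^sub>R axis i 1)) = ln (s + t)"
    using eventually_nhds_in_open[of "{- s<..}" 0] 0
    by (auto elim!: eventually_mono simp: scaleR_left_distrib[symmetric] norm_axis_1)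
  then have "deriv (\<lambda>t. ln (norm ((s *\<^sub>R axis i 1 :: real ^ 'n) + t *\<^sub>R axis i 1))) 0 = deriv (\<lambda>t. ln (s + t)) 0"
    by (rule deriv_cong_ev) simp
  also have "\<dots> = 1 / s"
    using 0 by (intro DERIV_imp_deriv) (auto intro!: derivative_eq_intros)
  finally show ?case by (simp add: iter_partial_deriv_def partial_deriv_def)
next
  case (Suc m)
  let ?f = "iter_partial_deriv (replicate (Suc m) i) (\<lambda>y :: real ^ 'n. ln (norm y))"
  have "\<forall>\<^sub>F t in nhds 0. t \<in> {- s<..}" using Suc.prems by (intro eventually_nhds_in_open) auto
  then have "\<forall>\<^sub>F t in nhds 0. ?f (s *\<^sub>R axis i 1 + t *\<^sub>R axis i 1) = (- 1) ^ m * fact m / (s + t) ^ Suc m"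
    by eventually_elim (use Suc.IH in \<open>simp del: replicate.simps power_Suc add: scaleR_left_distrib[symmetric]\<close>)
  then have "deriv (\<lambda>t. ?f (s *\<^sub>R axis i 1 + t *\<^sub>R axis i 1)) 0 = deriv (\<lambda>t. (- 1) ^ m * fact m / (s + t) ^ Suc m) 0"
    by (rule deriv_cong_ev) simp
  also have "\<dots> = (- 1) ^ Suc m * fact (Suc m) / s ^ Suc (Suc m)"
  proof (rule DERIV_imp_deriv)
    have "((\<lambda>t. (s + t) ^ Suc m) has_real_derivative real (Suc m) * s ^ m) (at 0)"
    proof -
      have "((\<lambda>t. s + t) has_real_derivative 1) (at 0)" by (auto intro!: derivative_eq_intros)
      from DERIV_power_Suc[OF this, of m] show ?thesis by simp
    qed
    from DERIV_inverse'[OF this] have "((\<lambda>t. inverse ((s + t) ^ Suc m)) has_real_derivative - (inverse (s ^ Suc m) * (real (Suc m) * s ^ m) * inverse (s ^ Suc m))) (at 0)"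
      using Suc.prems by simp
    from DERIV_cmult[OF this, of "(- 1) ^ m * fact m"]
    have "((\<lambda>t. (- 1) ^ m * fact m / (s + t) ^ Suc m) has_real_derivative
      (- 1) ^ m * fact m * - (inverse (s ^ Suc m) * (real (Suc m) * s ^ m) * inverse (s ^ Suc m))) (at 0)"
      by (simp only: divide_inverse)
    moreover have "(- 1) ^ m * fact m * - (inverse (s ^ Suc m) * (real (Suc m) * s ^ m) * inverse (s ^ Suc m)) = (- 1) ^ Suc m * fact (Suc m) / s ^ Suc (Suc m)"
      using Suc.prems by (simp add: field_simps)
    ultimately show "((\<lambda>t. (- 1) ^ m * fact m / (s + t) ^ Suc m) has_real_derivative (- 1) ^ Suc m * fact (Suc m) / s ^ Suc (Suc m)) (at 0)"
      by simp
  qed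
  finally show ?case by (simp add: iter_partial_deriv_def partial_deriv_def del: power_Suc)
qed

lemma ell_pos:
  assumes k: "k \<ge> 1" shows "ell TYPE('n::finite) k > 0"
proof -
  define i :: 'n where "i = undefined"
  have nz: "axis i 1 \<noteq> (0 :: real ^ 'n)" using norm_axis_1[of i] by force
  obtain m where m: "k = Suc m" using k by (cases k) auto
  let ?L = "\<lambda>is. iter_partial_deriv is (\<lambda>y :: real ^ 'n. ln (norm y)) (axis i 1)"
  have "?L (replicate k i) \<noteq> 0" using iter_log_axis[of 1 m i] by (simp add: m)
  then have "0 < (?L (replicate k i))\<^sup>2" by simp
  also have "\<dots> \<le> (\<Sum>is\<in>{is. length is = k}. (?L is)\<^sup>2)"
    by (rule member_le_sum) (auto intro: finite_lists_length)
  also have "\<dots> = ell TYPE('n) k"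
    using ell_properties(2)[OF k nz] by (simp add: log_tensor_square_def norm_axis_1)
  finally show ?thesis .
qed

section \<open>Domination of the precise values by a Riesz potential\<close>

lemma kernel_square_sum:
  fixes z :: "real ^ 'n::finite"
  assumes k: "k \<ge> 1" and z: "z \<noteq> 0"
  shows "(\<Sum>is\<in>{is. length is = k}. (kernel k is z)\<^sup>2) = ell TYPE('n) k * (norm z powr (real k - real CARD('n)))\<^sup>2"
proof -
  have "(\<Sum>is\<in>{is. length is = k}. (kernel k is z)\<^sup>2) = (norm z powr (2 * real k - real CARD('n)))\<^sup>2 * log_tensor_square TYPE('n) k z"
    by (simp add: kernel_def log_tensor_square_def power_mult_distrib sum_distrib_left)
  also have "\<dots> = ell TYPE('n) k * ((norm z powr (2 * real k - real CARD('n))) / norm z powr real k)\<^sup>2"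
    using z by (simp add: ell_properties(2)[OF k] powr_realpow power_divide power_mult mult.commute[of 2])
  also have "norm z powr (2 * real k - real CARD('n)) / norm z powr real k = norm z powr (real k - real CARD('n))"
    using z by (simp add: powr_diff[symmetric])
  finally show ?thesis .
qed

text \<open>Cauchy-Schwarz over all n^k components at once; treating the tensors as a whole is what
  preserves the constant sqrt \<ell>.\<close>

lemma sum_mult_kernel_le:
  fixes z :: "real ^ 'n::finite"
  assumes k: "k \<ge> 1" and z: "z \<noteq> 0"
  shows "\<bar>\<Sum>is\<in>{is. length is = k}. a is * kernel k is z\<bar> \<le>
    sqrt (ell TYPE('n) k) * (norm z powr (real k - real CARD('n)) * sqrt (\<Sum>is\<in>{is. length is = k}. (a is)\<^sup>2))"
proof -
  have "\<bar>\<Sum>is\<in>{is. length is = k}. a is * kernel k is z\<bar> \<le> L2_set a {is. length is = k} * L2_set (\<lambda>is. kernel k is z) {is. length is = k}"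
    using L2_set_mult_ineq[of a "\<lambda>is. kernel k is z" "{is :: 'n list. length is = k}"]
      sum_abs[of "\<lambda>is. a is * kernel k is z" "{is :: 'n list. length is = k}"] by (simp add: abs_mult)
  also have "L2_set (\<lambda>is. kernel k is z) {is. length is = k} = sqrt (ell TYPE('n) k) * norm z powr (real k - real CARD('n))"
    by (simp add: L2_set_def kernel_square_sum[OF k z] real_sqrt_mult)
  finally show ?thesis by (simp add: L2_set_def mult_ac)
qed

text \<open>Packs everything needed about the weak derivatives into one nonnegative Borel function
  that vanishes off \<Omega> and equals the gradient norm almost everywhere. The conclusion holds at
  each single point x with finite potential.\<close>

lemma weak_gradient_majorant:
  fixes \<Omega> :: "(real ^ 'n::finite) set"
  assumes k: "1 \<le> k" "k < CARD('n)" and \<Omega>: "open \<Omega>" "bounded \<Omega>"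
    and u: "weakly_differentiable k (zero_ext \<Omega> u)" and norm1: "weak_Lp_norm (real CARD('n) / real k) \<Omega> (grad_norm k \<Omega> u) \<le> 1"
  obtains g where "weak_bound k \<Omega> g"
    "\<And>x D. (\<integral>\<^sup>+y. ennreal (norm (x - y) powr (real k - real CARD('n))) * indicator \<Omega> y * ennreal (g y) \<partial>lborel) \<le> ennreal D \<Longrightarrow> D \<ge> 0 \<Longrightarrow>
      \<exists>l. (ball_average (zero_ext \<Omega> u) x \<longlongrightarrow> l) (at_right 0) \<and> \<bar>l\<bar> \<le> D / (sqrt (ell TYPE('n) k) * (real CARD('n) * omega TYPE('n)))"
proof -
  let ?n = "real CARD('n)" and ?k = "real k"
  let ?S = "{is :: 'n list. length is = k}"
  have fS: "finite ?S" by (rule finite_lists_length)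
  define v where "v = zero_ext \<Omega> u"
  define w where "w = weak_deriv v"
  have \<Omega>b: "\<Omega> \<in> sets borel" using \<Omega> by simp
  have w: "has_weak_deriv v is (w is)" if "length is \<le> k" for "is"
    using u that unfolding w_def weak_deriv_def weakly_differentiable_def v_def by (metis someI_ex)
  have v0: "v x = 0" if "x \<notin> \<Omega>" for x using that by (simp add: v_def zero_ext_def)
  have vm: "v \<in> borel_measurable lebesgue"
    using w[of "[]"] by (auto simp: has_weak_deriv_def intro: locally_integrable_measurable)
  have wm: "w is \<in> borel_measurable lebesgue" if "is \<in> ?S" for "is"
    using w[of "is"] that by (auto simp: has_weak_deriv_def intro: locally_integrable_measurable)
  have wv: "AE x in lebesgue. x \<notin> \<Omega> \<longrightarrow> w is x = 0" if "is \<in> ?S" for "is"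
    using weak_deriv_vanishes[OF \<Omega>(1) u[folded v_def] v0 _ w[of "is"]] that by simp
  have "\<forall>is\<in>?S. \<exists>h. h \<in> borel_measurable borel \<and> (AE x in lborel. w is x = h x)"
  proof
    fix "is" :: "'n list" assume "is \<in> ?S"
    from completion_ex_borel_measurable_real[OF wm[OF this]]
    show "\<exists>h. h \<in> borel_measurable borel \<and> (AE x in lborel. w is x = h x)" by auto
  qed
  then obtain h where h: "\<And>is. is \<in> ?S \<Longrightarrow> h is \<in> borel_measurable borel" "\<And>is. is \<in> ?S \<Longrightarrow> AE x in lborel. w is x = h is x"
    by metis
  \<comment> \<open>Borel versions cut off at \<Omega>. They are still weak derivatives, since the
    original ones vanish almost everywhere off \<Omega>.\<close>
  define G where "G = (\<lambda>is x. h is x * indicator \<Omega> x)"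
  have Gm: "G is \<in> borel_measurable borel" if "is \<in> ?S" for "is"
    unfolding G_def using h(1)[OF that] \<Omega>b by (intro borel_measurable_times borel_measurable_indicator) auto
  have wG: "AE x in lebesgue. w is x = G is x" if "is \<in> ?S" for "is"
    using wv[OF that] AE_completion[OF h(2)[OF that]] by eventually_elim (auto simp: G_def indicator_def)
  have G: "has_weak_deriv v is (G is)" if "is \<in> ?S" for "is"
    by (rule has_weak_deriv_cong_AE[OF w vm _ _ wG[OF that]]) (use that Gm[OF that] in \<open>auto simp: measurable_completion\<close>)
  define g where "g = (\<lambda>x. sqrt (\<Sum>is\<in>?S. (G is x)\<^sup>2))"
  have gm: "g \<in> borel_measurable borel"
    unfolding g_def using Gm by (intro measurable_compose[OF _ borel_measurable_sqrt] borel_measurable_sum borel_measurable_power) auto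
  have g0: "g y \<ge> 0" for y by (auto simp: g_def intro: sum_nonneg)
  have gradm: "grad_norm k \<Omega> u \<in> borel_measurable lebesgue"
    unfolding grad_norm_def tensor_norm_def v_def[symmetric] w_def[symmetric]
    using wm by (intro measurable_compose[OF _ borel_measurable_sqrt] borel_measurable_sum borel_measurable_power) auto
  have gg: "AE x in lebesgue. grad_norm k \<Omega> u x = g x"
  proof -
    have "AE x in lebesgue. \<forall>is\<in>?S. w is x = G is x" using wG by (intro AE_finite_allI fS) auto
    then show ?thesis by eventually_elim (simp add: grad_norm_def tensor_norm_def g_def v_def[symmetric] w_def[symmetric])
  qed
  have wb: "weak_bound k \<Omega> g"
    unfolding weak_bound_def
  proof (intro conjI allI impI gm g0)
    fix b :: real assume b: "b > 0"
    have Sb: "{y \<in> \<Omega>. b < g y} \<in> sets borel"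
    proof -
      have "\<Omega> \<inter> {y. b < g y} \<in> sets borel" using gm \<Omega>b by auto
      then show ?thesis by (simp add: Int_def)
    qed
    have Sg: "{y \<in> \<Omega>. b < \<bar>grad_norm k \<Omega> u y\<bar>} \<in> sets lebesgue"
      using \<Omega>b gradm by (intro abs_level_set_lebesgue) auto
    have "emeasure lborel {y \<in> \<Omega>. b < g y} = emeasure lebesgue {y \<in> \<Omega>. b < g y}" using Sb by simp
    also have "\<dots> = emeasure lebesgue {y \<in> \<Omega>. b < \<bar>grad_norm k \<Omega> u y\<bar>}"
    proof (rule emeasure_eq_AE)
      show "AE y in lebesgue. y \<in> {y \<in> \<Omega>. b < g y} \<longleftrightarrow> y \<in> {y \<in> \<Omega>. b < \<bar>grad_norm k \<Omega> u y\<bar>}"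
        using gg by eventually_elim (use g0 in auto)
    qed (use Sb Sg in auto)
    also have "\<dots> \<le> ennreal (b powr - (?n / ?k))"
      using k b \<Omega>b gradm norm1 by (intro weak_Lp_norm_le_1_D) auto
    finally show "emeasure lborel {y \<in> \<Omega>. b < g y} \<le> ennreal (b powr - (?n / ?k))" .
  qed
  obtain \<rho> where \<rho>: "\<rho> > 0" "\<And>x. x \<in> \<Omega> \<Longrightarrow> norm x \<le> \<rho>" using \<Omega>(2) by (auto simp: bounded_pos)
  have G0: "G is x = 0" if "norm x > \<rho>" for "is" x using \<rho>(2)[of x] that by (auto simp: G_def indicator_def)
  have v0': "v x = 0" if "norm x > \<rho>" for x using \<rho>(2)[of x] that v0 by force
  have Gg: "\<bar>G is y\<bar> \<le> g y" if "is \<in> ?S" for "is" y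
  proof -
    have "(G is y)\<^sup>2 \<le> (\<Sum>is\<in>?S. (G is y)\<^sup>2)" by (rule member_le_sum[OF that]) (auto simp: fS)
    then show ?thesis unfolding g_def by (simp add: real_le_rsqrt)
  qed
  have gO: "g y = indicator \<Omega> y * g y" for y by (auto simp: g_def G_def indicator_def)
  have el: "ell TYPE('n) k > 0" using k by (intro ell_pos)
  have om: "omega TYPE('n) > 0" by (rule omega_pos)
  show thesis
  proof (rule that[OF wb])
    fix x :: "real ^ 'n" and D :: real
    assume P: "(\<integral>\<^sup>+y. ennreal (norm (x - y) powr (?k - ?n)) * indicator \<Omega> y * ennreal (g y) \<partial>lborel) \<le> ennreal D" and D: "D \<ge> 0"
    have Pg: "(\<integral>\<^sup>+y. ennreal (norm (y - x) powr (?k - ?n) * g y) \<partial>lborel) \<le> ennreal D"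
    proof -
      have "ennreal (norm (y - x) powr (?k - ?n) * g y) = ennreal (norm (x - y) powr (?k - ?n)) * indicator \<Omega> y * ennreal (g y)" for y
        using g0[of y] by (subst gO) (auto simp: indicator_def ennreal_mult' norm_minus_commute)
      then show ?thesis using P by simp
    qed
    \<comment> \<open>This componentwise estimate serves integrability only; the sharp estimate is
      applied to the sum.\<close>
    have Gk: "\<bar>G is y * kernel k is (y - x)\<bar> \<le> sqrt (ell TYPE('n) k) * (norm (y - x) powr (?k - ?n) * g y)" if "is \<in> ?S" "y \<noteq> x" for "is" y
    proof -
      have "(kernel k is (y - x))\<^sup>2 \<le> (\<Sum>is\<in>?S. (kernel k is (y - x))\<^sup>2)" by (rule member_le_sum[OF that(1)]) (auto simp: fS)
      also have "\<dots> = (sqrt (ell TYPE('n) k) * norm (y - x) powr (?k - ?n))\<^sup>2"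
        using kernel_square_sum[of k "y - x"] k that el by (simp add: power_mult_distrib)
      finally have "\<bar>kernel k is (y - x)\<bar> \<le> sqrt (ell TYPE('n) k) * norm (y - x) powr (?k - ?n)"
        using el by (simp add: abs_le_square_iff[symmetric] abs_mult)
      then have "\<bar>G is y\<bar> * \<bar>kernel k is (y - x)\<bar> \<le> g y * (sqrt (ell TYPE('n) k) * norm (y - x) powr (?k - ?n))"
        using Gg[OF that(1), of y] by (intro mult_mono g0) auto
      then show ?thesis by (simp add: abs_mult mult_ac)
    qed
    have km: "(\<lambda>y. kernel k is (y - x)) \<in> borel_measurable borel" if "is \<in> ?S" for "is"
      by (rule measurable_compose[OF _ kernel_measurable]) (use that k in auto)
    have prm: "(\<lambda>y. G is y * kernel k is (y - x)) \<in> borel_measurable borel" if "is \<in> ?S" for "is"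
      using Gm[OF that] km[OF that] by (rule borel_measurable_times)
    have AEx: "AE y in lborel. y \<noteq> x" by (rule AE_lborel_singleton)
    have fin: "(\<integral>\<^sup>+y. ennreal (sqrt (ell TYPE('n) k) * (norm (y - x) powr (?k - ?n) * g y)) \<partial>lborel) \<le> ennreal (sqrt (ell TYPE('n) k) * D)"
    proof -
      have "(\<integral>\<^sup>+y. ennreal (sqrt (ell TYPE('n) k) * (norm (y - x) powr (?k - ?n) * g y)) \<partial>lborel) =
          ennreal (sqrt (ell TYPE('n) k)) * (\<integral>\<^sup>+y. ennreal (norm (y - x) powr (?k - ?n) * g y) \<partial>lborel)"
        using gm el g0 by (subst nn_integral_cmult[symmetric]) (auto simp: ennreal_mult)
      also have "\<dots> \<le> ennreal (sqrt (ell TYPE('n) k)) * ennreal D" by (intro mult_left_mono Pg) auto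
      finally show ?thesis using el D by (simp add: ennreal_mult)
    qed
    have pint: "integrable lborel (\<lambda>y. G is y * kernel k is (y - x))" if "is \<in> ?S" for "is"
    proof (rule integrableI_bounded)
      have "(\<integral>\<^sup>+y. ennreal (norm (G is y * kernel k is (y - x))) \<partial>lborel) \<le> (\<integral>\<^sup>+y. ennreal (sqrt (ell TYPE('n) k) * (norm (y - x) powr (?k - ?n) * g y)) \<partial>lborel)"
      proof (rule nn_integral_mono_AE)
        show "AE y in lborel. ennreal (norm (G is y * kernel k is (y - x))) \<le> ennreal (sqrt (ell TYPE('n) k) * (norm (y - x) powr (?k - ?n) * g y))"
          using AEx by eventually_elim (unfold real_norm_def, rule ennreal_leI[OF Gk[OF that]])
      qed
      also have "\<dots> < \<infinity>" using fin by (rule order_le_less_trans) simp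
      finally show "(\<integral>\<^sup>+y. ennreal (norm (G is y * kernel k is (y - x))) \<partial>lborel) < \<infinity>" .
    qed (use prm[OF that] in simp)
    define L where "L = (\<Sum>is\<in>?S. \<integral>y. G is y * kernel k is (y - x) \<partial>lebesgue)"
    have "L = (\<Sum>is\<in>?S. \<integral>y. G is y * kernel k is (y - x) \<partial>lborel)"
      unfolding L_def using prm by (intro sum.cong refl integral_completion) auto
    also have "\<dots> = (\<integral>y. (\<Sum>is\<in>?S. G is y * kernel k is (y - x)) \<partial>lborel)"
      using pint by (intro Bochner_Integration.integral_sum[symmetric]) auto
    finally have Leq: "L = (\<integral>y. (\<Sum>is\<in>?S. G is y * kernel k is (y - x)) \<partial>lborel)" .
    have "ennreal \<bar>L\<bar> \<le> (\<integral>\<^sup>+y. ennreal (norm (\<Sum>is\<in>?S. G is y * kernel k is (y - x))) \<partial>lborel)"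
      unfolding Leq real_norm_def[symmetric] using pint by (intro integral_norm_bound_ennreal Bochner_Integration.integrable_sum) auto
    also have "\<dots> \<le> (\<integral>\<^sup>+y. ennreal (sqrt (ell TYPE('n) k) * (norm (y - x) powr (?k - ?n) * g y)) \<partial>lborel)"
    proof (rule nn_integral_mono_AE)
      show "AE y in lborel. ennreal (norm (\<Sum>is\<in>?S. G is y * kernel k is (y - x))) \<le> ennreal (sqrt (ell TYPE('n) k) * (norm (y - x) powr (?k - ?n) * g y))"
        using AEx
      proof eventually_elim
        case (elim y)
        then show ?case unfolding g_def real_norm_def using k by (intro ennreal_leI sum_mult_kernel_le) auto
      qed
    qed
    also note fin
    finally have Lb: "\<bar>L\<bar> \<le> sqrt (ell TYPE('n) k) * D" using el D by (simp add: ennreal_le_iff)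
    have lim: "((\<lambda>r. - (ell TYPE('n) k * ?n * omega TYPE('n)) * ball_average v x r) \<longlongrightarrow> L) (at_right 0)"
      unfolding L_def
    proof (rule weak_representation[OF k, where \<rho> = \<rho>])
      fix "is" :: "'n list" assume l: "length is = k"
      have "(\<integral>\<^sup>+y. ennreal (norm (y - x) powr (?k - ?n) * \<bar>G is y\<bar>) \<partial>lebesgue) = (\<integral>\<^sup>+y. ennreal (norm (y - x) powr (?k - ?n) * \<bar>G is y\<bar>) \<partial>lborel)"
        by (rule nn_integral_completion)
      also have "\<dots> \<le> (\<integral>\<^sup>+y. ennreal (norm (y - x) powr (?k - ?n) * g y) \<partial>lborel)"
        using l by (intro nn_integral_mono ennreal_leI mult_left_mono Gg) auto
      also have "\<dots> < \<infinity>" using Pg by (rule order_le_less_trans) simp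
      finally show "(\<integral>\<^sup>+y. ennreal (norm (y - x) powr (?k - ?n) * \<bar>G is y\<bar>) \<partial>lebesgue) < \<infinity>" .
    qed (use G v0' G0 \<rho> in auto)
    \<comment> \<open>Dividing by this factor turns the bound sqrt \<ell> D for the limit into D /
      (sqrt \<ell> n \<omega>).\<close>
    define a where "a = - (ell TYPE('n) k * ?n * omega TYPE('n))"
    have a: "a \<noteq> 0" "\<bar>a\<bar> = ell TYPE('n) k * (?n * omega TYPE('n))" using el om by (auto simp: a_def abs_mult)
    have "((\<lambda>r. a * ball_average v x r / a) \<longlongrightarrow> L / a) (at_right 0)"
      using lim a unfolding a_def[symmetric] by (intro tendsto_divide tendsto_const) auto
    then have conv: "(ball_average v x \<longlongrightarrow> L / a) (at_right 0)" using a by simp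
    have "\<bar>L / a\<bar> = \<bar>L\<bar> / (ell TYPE('n) k * (?n * omega TYPE('n)))" using a by simp
    also have "\<dots> \<le> sqrt (ell TYPE('n) k) * D / (ell TYPE('n) k * (?n * omega TYPE('n)))"
      using Lb el om by (intro divide_right_mono) auto
    also have "\<dots> = D / (sqrt (ell TYPE('n) k) * (?n * omega TYPE('n)))"
    proof -
      define s where "s = sqrt (ell TYPE('n) k)"
      have "ell TYPE('n) k = s * s" "s > 0" using el by (auto simp: s_def)
      then show ?thesis using om by (simp add: s_def[symmetric])
    qed
    finally show "\<exists>l. (ball_average (zero_ext \<Omega> u) x \<longlongrightarrow> l) (at_right 0) \<and> \<bar>l\<bar> \<le> D / (sqrt (ell TYPE('n) k) * (?n * omega TYPE('n)))"
      using conv unfolding v_def by blast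
  qed
qed

section \<open>Summation over the layers\<close>

lemma exp_neg_powr: "exp (- real m) powr d = exp (- d) ^ m"
  by (simp add: powr_def exp_of_nat_mult[symmetric])

lemma uniform_exp_bound:
  fixes \<Omega> :: "(real ^ 'n::finite) set"
  assumes k: "1 \<le> k" "k < CARD('n)" and \<Omega>: "open \<Omega>" "bounded \<Omega>" and d: "d > 0" and Cd: "C\<^sub>d \<ge> 0"
    and \<gamma>: "\<gamma> < critical_exponent TYPE('n) k d"
  obtains C where "C > 0"
    "\<And>\<nu> u. sets \<nu> = sets borel \<Longrightarrow> upper_growth d C\<^sub>d \<nu> \<Longrightarrow> weakly_differentiable k (zero_ext \<Omega> u) \<Longrightarrow>
      weak_Lp_norm (real CARD('n) / real k) \<Omega> (grad_norm k \<Omega> u) \<le> 1 \<Longrightarrow>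
      (AE x in \<nu>. x \<in> \<Omega> \<longrightarrow> has_precise_value (zero_ext \<Omega> u) x) \<and> exp_integral \<nu> \<Omega> \<gamma> u \<le> ennreal C"
proof -
  let ?n = "real CARD('n)" and ?k = "real k" and ?w = "omega TYPE('n)" and ?l = "ell TYPE('n) k"
  have w: "?w > 0" by (rule omega_pos)
  have l: "?l > 0" using k by (intro ell_pos)
  \<comment> \<open>The critical exponent is d \<Gamma>. At the scale r = exp(-m) the factor of m in
    the bound for |u| is 1/\<Gamma>: the coefficient n \<omega>^(1-k/n) of the potential divided by
    the normalisation \<open>N\<close>.\<close>
  define \<Gamma> where "\<Gamma> = ?w powr (?k / ?n) * sqrt ?l"
  have \<Gamma>: "\<Gamma> > 0" using w l by (simp add: \<Gamma>_def)
  have crit: "critical_exponent TYPE('n) k d = d * \<Gamma>" by (simp add: critical_exponent_def \<Gamma>_def)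
  define N where "N = sqrt ?l * (?n * ?w)"
  have N: "N > 0" using w l by (simp add: N_def)
  have N\<Gamma>: "?n * ?w powr (1 - ?k / ?n) / N = 1 / \<Gamma>"
    using w l by (simp add: N_def \<Gamma>_def powr_diff)
  obtain \<rho> where \<rho>: "\<rho> > 0" "\<And>x. x \<in> \<Omega> \<Longrightarrow> norm x \<le> \<rho>" using \<Omega>(2) by (auto simp: bounded_pos)
  have \<Omega>b: "\<Omega> \<in> sets borel" using \<Omega> by simp
  define V where "V = ?w * \<rho> ^ CARD('n)"
  have V0: "V \<ge> 0" using w \<rho> by (simp add: V_def)
  have V: "emeasure lborel \<Omega> \<le> ennreal V"
  proof -
    have "emeasure lborel \<Omega> \<le> emeasure lborel (cball (0 :: real ^ 'n) \<rho>)"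
      using \<rho> by (intro emeasure_mono) auto
    then show ?thesis using \<rho> by (simp add: emeasure_cball_omega V_def)
  qed
  obtain A B where A: "A \<ge> 0" and B: "B \<ge> 0" and AB: "\<And>\<nu> g r. sets \<nu> = sets borel \<Longrightarrow> upper_growth d C\<^sub>d \<nu> \<Longrightarrow> weak_bound k \<Omega> g \<Longrightarrow> 0 < r \<Longrightarrow> r \<le> 1 \<Longrightarrow>
    \<exists>U. open U \<and> emeasure \<nu> U \<le> ennreal (A * r powr d) \<and>
      (\<forall>x. x \<notin> U \<longrightarrow> (\<integral>\<^sup>+y. ennreal (norm (x - y) powr (?k - ?n)) * indicator \<Omega> y * ennreal (g y) \<partial>lborel) \<le>
        ennreal (?n * ?w powr (1 - ?k / ?n) * ln (1 / r) + B))"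
  proof (rule potential_bound[OF k \<Omega>b V0 V d Cd], goal_cases)
    case (1 A B)
    show ?case by (rule 1(1)[OF 1(2) 1(3)]) (rule 1(4))
  qed
  \<comment> \<open>\<gamma> may be negative; the integrand is monotone in \<gamma>, so the positive
    part is estimated.\<close>
  define \<gamma>' where "\<gamma>' = max \<gamma> 0"
  have \<gamma>': "\<gamma>' \<ge> 0" "\<gamma> \<le> \<gamma>'" by (auto simp: \<gamma>'_def)
  have "\<gamma>' < d * \<Gamma>" using \<gamma> d \<Gamma> by (simp add: \<gamma>'_def crit)
  then have "\<gamma>' / \<Gamma> < d" using \<Gamma> by (simp add: pos_divide_less_eq)
  \<comment> \<open>The ratio of the layer series: a layer gains exp(\<gamma>'/\<Gamma>) in the
    integrand and loses exp(-d) in measure.\<close>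
  define a where "a = exp (\<gamma>' / \<Gamma> - d)"
  have a: "0 \<le> a" "a < 1" using \<open>\<gamma>' / \<Gamma> < d\<close> by (auto simp: a_def)
  define B' where "B' = B / N"
  define c where "c = exp (\<gamma>' / \<Gamma> + \<gamma>' * B') * A"
  define C where "C = exp (\<gamma>' * B') * (C\<^sub>d * (\<rho> + 1) powr d) + c / (1 - a)"
  have c: "c \<ge> 0" using A by (simp add: c_def)
  have C0: "C \<ge> 0" using c a Cd by (simp add: C_def)
  show thesis
  \<comment> \<open>\<open>C\<close> is only known to be nonnegative, hence the added 1.\<close>
  proof (rule that[of "C + 1"])
    show "C + 1 > 0" using C0 by simp
    fix \<nu> :: "(real ^ 'n) measure" and u :: "real ^ 'n \<Rightarrow> real"
    assume \<nu>: "sets \<nu> = sets borel" "upper_growth d C\<^sub>d \<nu>" and u: "weakly_differentiable k (zero_ext \<Omega> u)"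
      "weak_Lp_norm (?n / ?k) \<Omega> (grad_norm k \<Omega> u) \<le> 1"
    define v where "v = zero_ext \<Omega> u"
    obtain g where g: "weak_bound k \<Omega> g"
      "\<And>x D. (\<integral>\<^sup>+y. ennreal (norm (x - y) powr (?k - ?n)) * indicator \<Omega> y * ennreal (g y) \<partial>lborel) \<le> ennreal D \<Longrightarrow> D \<ge> 0 \<Longrightarrow>
        \<exists>l. (ball_average v x \<longlongrightarrow> l) (at_right 0) \<and> \<bar>l\<bar> \<le> D / N"
      unfolding N_def v_def by (rule weak_gradient_majorant[OF k \<Omega> u]) blast
    have "\<exists>U. open U \<and> emeasure \<nu> U \<le> ennreal (A * exp (- d) ^ m) \<and>
        (\<forall>x. x \<notin> U \<longrightarrow> (\<exists>l. (ball_average v x \<longlongrightarrow> l) (at_right 0) \<and> \<bar>l\<bar> \<le> real m / \<Gamma> + B'))" for m :: nat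
    proof -
      obtain U where U: "open U" "emeasure \<nu> U \<le> ennreal (A * exp (- real m) powr d)"
        "\<And>x. x \<notin> U \<Longrightarrow> (\<integral>\<^sup>+y. ennreal (norm (x - y) powr (?k - ?n)) * indicator \<Omega> y * ennreal (g y) \<partial>lborel) \<le>
          ennreal (?n * ?w powr (1 - ?k / ?n) * ln (1 / exp (- real m)) + B)"
        using AB[OF \<nu> g(1), of "exp (- real m)"] by auto
      have ln: "ln (1 / exp (- real m)) = real m" by (simp add: ln_div)
      have D: "(?n * ?w powr (1 - ?k / ?n) * real m + B) / N = real m / \<Gamma> + B'"
      proof -
        have "(?n * ?w powr (1 - ?k / ?n) * real m + B) / N = (?n * ?w powr (1 - ?k / ?n) / N) * real m + B'"
          by (simp add: add_divide_distrib B'_def)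
        then show ?thesis by (simp add: N\<Gamma>)
      qed
      have "\<exists>l. (ball_average v x \<longlongrightarrow> l) (at_right 0) \<and> \<bar>l\<bar> \<le> real m / \<Gamma> + B'" if "x \<notin> U" for x
        using g(2)[OF U(3)[OF that, unfolded ln]] B by (simp add: D)
      then show ?thesis using U by (auto simp: exp_neg_powr)
    qed
    then obtain U where U: "\<And>m. open (U m)" "\<And>m. emeasure \<nu> (U m) \<le> ennreal (A * exp (- d) ^ m)"
      "\<And>m x. x \<notin> U m \<Longrightarrow> \<exists>l. (ball_average v x \<longlongrightarrow> l) (at_right 0) \<and> \<bar>l\<bar> \<le> real m / \<Gamma> + B'"
      by metis
    have Us: "U m \<in> sets \<nu>" for m using U(1) \<nu>(1) by simp
    \<comment> \<open>Every point outside some \<open>U m\<close> has a precise value, and the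
      points common to all of them form a null set because the measures tend to 0.\<close>
    have "emeasure \<nu> (\<Inter>m. U m) \<le> 0"
    proof (rule LIMSEQ_le_const)
      have "(\<lambda>m. A * exp (- d) ^ m) \<longlonglongrightarrow> A * 0" using d by (intro tendsto_mult tendsto_const LIMSEQ_power_zero) auto
      then show "(\<lambda>m. ennreal (A * exp (- d) ^ m)) \<longlonglongrightarrow> 0" using tendsto_ennrealI[of _ 0] by simp
      have "emeasure \<nu> (\<Inter>m. U m) \<le> ennreal (A * exp (- d) ^ m)" for m
      proof -
        have "emeasure \<nu> (\<Inter>m. U m) \<le> emeasure \<nu> (U m)" using Us by (intro emeasure_mono) auto
        then show ?thesis using U(2) order_trans by blast
      qed
      then show "\<exists>N. \<forall>m\<ge>N. emeasure \<nu> (\<Inter>m. U m) \<le> ennreal (A * exp (- d) ^ m)" by blast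
    qed
    moreover have "(\<Inter>m. U m) \<in> sets \<nu>" using Us by (intro sets.countable_INT) auto
    ultimately have "(\<Inter>m. U m) \<in> null_sets \<nu>" by (auto simp: null_sets_def)
    then have AEU: "AE x in \<nu>. x \<notin> (\<Inter>m. U m)" by (rule AE_not_in)
    have ae: "AE x in \<nu>. x \<in> \<Omega> \<longrightarrow> has_precise_value v x"
      using AEU by eventually_elim (use U(3) in \<open>auto simp: has_precise_value_def\<close>)
    have bs: "ball 0 (\<rho> + 1) \<in> sets \<nu>" using \<nu>(1) by simp
    \<comment> \<open>The shift to \<open>Suc m\<close>: a point that first escapes at
      \<open>Suc m\<close> still lies in \<open>U m\<close>, and the bound at scale
      \<open>Suc m\<close> applies to it. Points outside \<open>U 0\<close> are covered by the
      separate term on the ball.\<close>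
    let ?b = "\<lambda>m. ennreal (exp (\<gamma>' * (real (Suc m) / \<Gamma> + B')))"
    have "exp_integral \<nu> \<Omega> \<gamma> u \<le> (\<integral>\<^sup>+x. ennreal (exp (\<gamma>' * B')) * indicator (ball 0 (\<rho> + 1)) x + (\<Sum>m. ?b m * indicator (U m) x) \<partial>\<nu>)"
      unfolding exp_integral_def v_def[symmetric]
    proof (rule nn_integral_mono_AE)
      show "AE x in \<nu>. ennreal (exp (\<gamma> * \<bar>precise_rep v x\<bar>)) * indicator {x \<in> \<Omega>. has_precise_value v x} x \<le>
          ennreal (exp (\<gamma>' * B')) * indicator (ball 0 (\<rho> + 1)) x + (\<Sum>m. ?b m * indicator (U m) x)"
        using AEU
      proof eventually_elim
        case (elim x)
        show ?case
        proof (cases "x \<in> \<Omega>")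
          case True
          have "\<exists>m. x \<notin> U m" using elim by auto
          then obtain m where m: "x \<notin> U m" "\<And>i. i < m \<Longrightarrow> x \<in> U i" using exists_least_iff[of "\<lambda>m. x \<notin> U m"] by blast
          obtain l where l: "(ball_average v x \<longlongrightarrow> l) (at_right 0)" "\<bar>l\<bar> \<le> real m / \<Gamma> + B'" using U(3)[OF m(1)] by blast
          have pr: "precise_rep v x = l" unfolding precise_rep_def using l(1) by (intro tendsto_Lim) auto
          have "\<gamma> * \<bar>l\<bar> \<le> \<gamma>' * \<bar>l\<bar>" by (intro mult_right_mono \<gamma>') auto
          also have "\<dots> \<le> \<gamma>' * (real m / \<Gamma> + B')" by (intro mult_left_mono l \<gamma>')
          finally have le: "ennreal (exp (\<gamma> * \<bar>precise_rep v x\<bar>)) * indicator {x \<in> \<Omega>. has_precise_value v x} x \<le> ennreal (exp (\<gamma>' * (real m / \<Gamma> + B')))"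
            by (auto simp: indicator_def pr intro!: ennreal_leI)
          show ?thesis
          proof (cases m)
            case 0
            have "ennreal (exp (\<gamma>' * (real m / \<Gamma> + B'))) = ennreal (exp (\<gamma>' * B')) * indicator (ball 0 (\<rho> + 1)) x"
              using 0 \<rho>(2)[OF True] by simp
            then show ?thesis using le by (auto intro: add_increasing2)
          next
            case (Suc i)
            have "ennreal (exp (\<gamma>' * (real m / \<Gamma> + B'))) = (\<Sum>j\<in>{i}. ?b j * indicator (U j) x)"
              using Suc m(2)[of i] by simp
            also have "\<dots> \<le> (\<Sum>j. ?b j * indicator (U j) x)" by (intro sum_le_suminf) auto
            finally have "ennreal (exp (\<gamma>' * (real m / \<Gamma> + B'))) \<le> (\<Sum>j. ?b j * indicator (U j) x)" .
            from order_trans[OF le this] show ?thesis by (intro add_increasing) auto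
          qed
        qed simp
      qed
    qed
    also have "\<dots> = (\<integral>\<^sup>+x. ennreal (exp (\<gamma>' * B')) * indicator (ball 0 (\<rho> + 1)) x \<partial>\<nu>) + (\<integral>\<^sup>+x. (\<Sum>m. ?b m * indicator (U m) x) \<partial>\<nu>)"
    proof (rule nn_integral_add)
      show "(\<lambda>x. ennreal (exp (\<gamma>' * B')) * indicator (ball 0 (\<rho> + 1)) x) \<in> borel_measurable \<nu>"
        by (intro borel_measurable_times_ennreal borel_measurable_const borel_measurable_indicator bs)
      show "(\<lambda>x. \<Sum>m. ?b m * indicator (U m) x) \<in> borel_measurable \<nu>"
        by (intro borel_measurable_suminf_order borel_measurable_times_ennreal borel_measurable_const borel_measurable_indicator Us)
    qed
    also have "\<dots> = ennreal (exp (\<gamma>' * B')) * emeasure \<nu> (ball 0 (\<rho> + 1)) + (\<Sum>m. ?b m * emeasure \<nu> (U m))"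
    proof -
      have "(\<integral>\<^sup>+x. (\<Sum>m. ?b m * indicator (U m) x) \<partial>\<nu>) = (\<Sum>m. \<integral>\<^sup>+x. ?b m * indicator (U m) x \<partial>\<nu>)"
        using Us by (intro nn_integral_suminf borel_measurable_times_ennreal borel_measurable_indicator) auto
      then show ?thesis by (simp only: nn_integral_cmult_indicator[OF bs] nn_integral_cmult_indicator[OF Us])
    qed
    also have "\<dots> \<le> ennreal (exp (\<gamma>' * B')) * ennreal (C\<^sub>d * (\<rho> + 1) powr d) + (\<Sum>m. ennreal (c * a ^ m))"
    proof (intro add_mono mult_left_mono suminf_le allI)
      show "emeasure \<nu> (ball 0 (\<rho> + 1)) \<le> ennreal (C\<^sub>d * (\<rho> + 1) powr d)" using \<nu>(2) \<rho> by (simp add: upper_growth_def)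
      fix m
      have "?b m * emeasure \<nu> (U m) \<le> ?b m * ennreal (A * exp (- d) ^ m)" by (intro mult_left_mono U) auto
      also have "\<dots> = ennreal (exp (\<gamma>' * (real (Suc m) / \<Gamma> + B')) * (A * exp (- d) ^ m))" by (simp add: ennreal_mult')
      also have "exp (\<gamma>' * (real (Suc m) / \<Gamma> + B')) * (A * exp (- d) ^ m) = c * a ^ m"
      proof -
        have "exp (\<gamma>' * (real (Suc m) / \<Gamma> + B')) = exp (\<gamma>' / \<Gamma> + \<gamma>' * B') * exp (real m * (\<gamma>' / \<Gamma>))"
          by (simp add: exp_add[symmetric] algebra_simps add_divide_distrib)
        moreover have "a ^ m = exp (real m * (\<gamma>' / \<Gamma>)) * exp (- d) ^ m"
          by (simp add: a_def exp_of_nat_mult[symmetric] exp_add[symmetric] algebra_simps)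
        ultimately show ?thesis by (simp add: c_def)
      qed
      finally show "?b m * emeasure \<nu> (U m) \<le> ennreal (c * a ^ m)" .
    qed auto
    also have "\<dots> = ennreal C"
      using c a Cd by (simp only: ennreal_suminf_geometric[OF c a] C_def ennreal_mult'[symmetric] exp_ge_zero)
        (intro ennreal_plus[symmetric], auto)
    also have "\<dots> \<le> ennreal (C + 1)" by (intro ennreal_leI) simp
    finally show "(AE x in \<nu>. x \<in> \<Omega> \<longrightarrow> has_precise_value (zero_ext \<Omega> u) x) \<and> exp_integral \<nu> \<Omega> \<gamma> u \<le> ennreal (C + 1)"
      using ae unfolding v_def by blast
  qed
qed

section \<open>Sharpness\<close>

lemma test_function_has_weak_deriv:
  fixes f :: "real ^ 'n::finite \<Rightarrow> real"
  assumes f: "test_function f"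
  shows "has_weak_deriv f is (iter_partial_deriv (rev is) f)"
proof -
  have li: "locally_integrable h" if h: "test_function h" for h :: "real ^ 'n \<Rightarrow> real"
    unfolding locally_integrable_def set_integrable_def
  proof (intro allI impI)
    fix K :: "(real ^ 'n) set" assume "compact K"
    then have K: "K \<in> sets lebesgue" using borel_closed[of K] compact_imp_closed[of K] by simp
    have "integrable lebesgue h" using test_function_integrable[OF h] by (simp add: integrable_completion)
    then show "integrable lebesgue (\<lambda>x. indicator K x *\<^sub>R h x)" using K by (rule integrable_mult_indicator[rotated])
  qed
  have "(\<integral>x. f x * iter_partial_deriv is \<phi> x \<partial>lebesgue) = (- 1) ^ length is * (\<integral>x. iter_partial_deriv (rev is) f x * \<phi> x \<partial>lebesgue)"
    if \<phi>: "test_function \<phi>" for \<phi>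
  proof -
    have "(\<lambda>x. f x * iter_partial_deriv is \<phi> x) \<in> borel_measurable lborel"
        "(\<lambda>x. iter_partial_deriv (rev is) f x * \<phi> x) \<in> borel_measurable lborel"
      using test_function_borel[OF f] test_function_borel[OF \<phi>] test_function_borel[OF test_function_iter[OF f]]
        test_function_borel[OF test_function_iter[OF \<phi>]] by (auto intro!: borel_measurable_times)
    then show ?thesis
      using integration_by_parts_iter[OF test_function_smooth[OF f] \<phi>, of "is"] by (simp only: integral_completion)
  qed
  then show ?thesis using li[OF f] li[OF test_function_iter[OF f]] by (auto simp: has_weak_deriv_def)
qed

text \<open>The weak derivatives of a test function are the classical ones with reversed lists;
  reversal permutes the components and leaves the tensor norm unchanged.\<close>

lemma grad_norm_test_function:
  fixes u :: "real ^ 'n::finite \<Rightarrow> real"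
  assumes u: "test_function (zero_ext \<Omega> u)"
  shows "AE x in lebesgue. grad_norm k \<Omega> u x = tensor_norm k (\<lambda>is. iter_partial_deriv is (zero_ext \<Omega> u)) x"
proof -
  let ?v = "zero_ext \<Omega> u"
  have "AE x in lebesgue. weak_deriv ?v is x = iter_partial_deriv (rev is) ?v x" for "is"
    unfolding weak_deriv_def
    by (rule has_weak_deriv_unique[OF someI[where P = "has_weak_deriv ?v is", OF test_function_has_weak_deriv[OF u]] test_function_has_weak_deriv[OF u]])
  then have "AE x in lebesgue. \<forall>is\<in>{is. length is = k}. weak_deriv ?v is x = iter_partial_deriv (rev is) ?v x"
    by (intro AE_finite_allI) auto
  then show ?thesis
  proof eventually_elim
    case (elim x)
    then have "(\<Sum>is\<in>{is. length is = k}. (weak_deriv ?v is x)\<^sup>2) = (\<Sum>is\<in>{is. length is = k}. (iter_partial_deriv (rev is) ?v x)\<^sup>2)"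
      by (intro sum.cong) auto
    also have "\<dots> = (\<Sum>is\<in>{is. length is = k}. (iter_partial_deriv is ?v x)\<^sup>2)"
      by (rule sum_lists_rev[of "\<lambda>is. (iter_partial_deriv is ?v x)\<^sup>2" k])
    finally show ?case by (simp add: grad_norm_def tensor_norm_def)
  qed
qed

section \<open>Extremal functions\<close>

lemma weak_Lp_norm_le_1_I:
  assumes p: "p > 0" and dist: "\<And>b. b > 0 \<Longrightarrow> emeasure lebesgue {x \<in> \<Omega>. b < \<bar>g x\<bar>} \<le> ennreal (b powr - p)"
  shows "weak_Lp_norm p \<Omega> g \<le> 1"
  unfolding weak_Lp_norm_def
proof (rule SUP_least)
  fix s assume "s \<in> {s. 0 < s \<and> ennreal s < emeasure lebesgue \<Omega>}"
  then have s: "s > 0" by simp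
  define r where "r = s powr - (1 / p)"
  have r: "r > 0" using s by (simp add: r_def)
  have "- (1 / p) * - p = 1" using p by simp
  then have rp: "r powr - p = s" using s unfolding r_def by (simp only: powr_powr) simp
  have "rearrangement \<Omega> g s \<le> ennreal r"
    unfolding rearrangement_def using r dist[OF r, unfolded rp] by (intro Inf_lower CollectI exI[of _ r]) blast
  then have "ennreal (s powr (1 / p)) * rearrangement \<Omega> g s \<le> ennreal (s powr (1 / p)) * ennreal r"
    by (intro mult_left_mono) auto
  also have "\<dots> = ennreal (s powr (1 / p) * r)" by (rule ennreal_mult'[symmetric]) simp
  also have "s powr (1 / p) * r = 1" using s by (simp add: r_def powr_add[symmetric])
  finally show "ennreal (s powr (1 / p)) * rearrangement \<Omega> g s \<le> 1" by simp
qed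

text \<open>The level sets of \<omega>^(-k/n) |x - x0|^(-k) in the whole space are balls, and the
  one at height b has measure exactly b^(-n/k): the borderline case of the weak bound.\<close>

lemma weak_Lp_norm_inverse_power:
  fixes \<Omega> :: "(real ^ 'n::finite) set" and x\<^sub>0 :: "real ^ 'n"
  assumes k: "k \<ge> 1" and g: "AE x in lebesgue. \<bar>g x\<bar> \<le> omega TYPE('n) powr - (real k / real CARD('n)) / norm (x - x\<^sub>0) ^ k"
  shows "weak_Lp_norm (real CARD('n) / real k) \<Omega> g \<le> 1"
proof (rule weak_Lp_norm_le_1_I)
  let ?n = "real CARD('n)" and ?k = "real k" and ?w = "omega TYPE('n)"
  show "?n / ?k > 0" using k by simp
  fix b :: real assume b: "b > 0"
  have w: "?w > 0" by (rule omega_pos)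
  define c where "c = ?w powr - (?k / ?n)"
  have c: "c > 0" using w by (simp add: c_def)
  define r where "r = (c / b) powr (1 / ?k)"
  have r: "r > 0" using b c by (simp add: r_def)
  have rk: "r ^ k = c / b" using b c k by (simp add: r_def powr_realpow[symmetric] powr_powr)
  have "emeasure lebesgue {x \<in> \<Omega>. b < \<bar>g x\<bar>} \<le> emeasure lebesgue (ball x\<^sub>0 r)"
  proof (rule emeasure_mono_AE)
    have "AE x in lebesgue. x \<noteq> x\<^sub>0" by (intro AE_completion AE_lborel_singleton)
    with g show "AE x in lebesgue. x \<in> {x \<in> \<Omega>. b < \<bar>g x\<bar>} \<longrightarrow> x \<in> ball x\<^sub>0 r"
    proof eventually_elim
      case (elim x)
      have pos: "norm (x - x\<^sub>0) ^ k > 0" using elim(2) by simp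
      have "x \<in> ball x\<^sub>0 r" if "b < \<bar>g x\<bar>"
      proof -
        have "b < c / norm (x - x\<^sub>0) ^ k" using that elim(1) by (simp add: c_def)
        then have "norm (x - x\<^sub>0) ^ k < r ^ k" unfolding rk using pos b by (simp add: field_simps)
        then have "norm (x - x\<^sub>0) < r" using power_less_imp_less_base r less_imp_le by blast
        then show ?thesis by (simp add: dist_norm norm_minus_commute)
      qed
      then show ?case by blast
    qed
  qed simp
  also have "\<dots> = ennreal (?w * r ^ CARD('n))" using r by (simp add: emeasure_ball_omega)
  also have "?w * r ^ CARD('n) = b powr - (?n / ?k)"
  proof -
    have "r ^ CARD('n) = (c / b) powr (?n / ?k)" using b c by (simp add: r_def powr_realpow[symmetric] powr_powr)
    also have "\<dots> = c powr (?n / ?k) / b powr (?n / ?k)" by (rule powr_divide)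
    also have "c powr (?n / ?k) = 1 / ?w"
    proof -
      have "- (?k / ?n) * (?n / ?k) = - 1" using k by simp
      then show ?thesis using w by (simp only: c_def powr_powr) (simp add: powr_minus_divide)
    qed
    finally show ?thesis using w by (simp add: powr_minus_divide)
  qed
  finally show "emeasure lebesgue {x \<in> \<Omega>. b < \<bar>g x\<bar>} \<le> ennreal (b powr - (?n / ?k))" .
qed

text \<open>The main term has norm \<delta> |G'| sqrt \<ell> / |y|^k with |G'| \<le> 1 + e. With no
  other function multiplying the cutoff, the error is of order \<delta>^2 |y|^(-k), so for small
  \<delta> any factor above sqrt \<ell> is reached.\<close>

lemma log_cutoff_gradient:
  assumes k: "k \<ge> 1" and \<beta>: "\<beta> > sqrt (ell TYPE('n::finite) k)"
  obtains \<tau> G \<delta>\<^sub>0 where "cutoff_one \<tau> G" "\<delta>\<^sub>0 > 0"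
    "\<And>\<delta> (y :: real ^ 'n). 0 < \<delta> \<Longrightarrow> \<delta> \<le> \<delta>\<^sub>0 \<Longrightarrow> y \<noteq> 0 \<Longrightarrow>
      tensor_norm k (\<lambda>is. iter_partial_deriv is (log_cutoff G \<delta>)) y \<le> \<delta> * \<beta> / norm y ^ k"
proof -
  let ?l = "sqrt (ell TYPE('n) k)" and ?S = "{is :: 'n list. length is = k}"
  let ?L = "\<lambda>is. iter_partial_deriv is (\<lambda>y :: real ^ 'n. ln (norm y))"
  have l: "?l \<ge> 0" using ell_properties(1)[OF k] by simp
  \<comment> \<open>Solves \<beta> = sqrt \<ell> (1 + e) + e: the first summand pays for the slope
    of the profile, the second for the error term.\<close>
  define e where "e = (\<beta> - ?l) / (?l + 1)"
  have e: "e > 0" and \<beta>e: "\<beta> = ?l * (1 + e) + e"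
  proof -
    show "e > 0" unfolding e_def using l \<beta> by (intro divide_pos_pos) linarith+
    have "?l + 1 \<noteq> 0" using l by linarith
    then have "e * (?l + 1) = \<beta> - ?l" unfolding e_def by (rule nonzero_mult_div_cancel_right[of _ "\<beta> - ?l", unfolded times_divide_eq_left[symmetric]])
    then show "\<beta> = ?l * (1 + e) + e" by (simp add: algebra_simps)
  qed
  obtain \<tau> G where G: "cutoff_one \<tau> G" "\<And>t. \<bar>deriv G t\<bar> \<le> 1 + e" using cutoff_one_exists[OF e] by blast
  have "\<exists>C\<ge>0. \<forall>\<delta> y. 0 < \<delta> \<longrightarrow> \<delta> \<le> 1 \<longrightarrow> y \<noteq> 0 \<longrightarrow>
      \<bar>iter_partial_deriv is (log_cutoff G \<delta>) y - \<delta> * deriv G (\<delta> * ln (norm y)) * ?L is y\<bar> \<le> C * (\<delta>\<^sup>2 / norm y ^ k)"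
    if "is \<in> ?S" for "is"
  proof -
    have ik: "length is = k" using that by simp
    obtain C where C: "C \<ge> 0" "\<And>\<delta> y. 0 < \<delta> \<Longrightarrow> \<delta> \<le> 1 \<Longrightarrow> y \<noteq> 0 \<Longrightarrow>
      \<bar>iter_partial_deriv is (\<lambda>y. 1 * log_cutoff G \<delta> y) y - \<delta> * 1 * log_scale (deriv G) \<delta> y * ?L is y\<bar>
      \<le> C * ((if (\<lambda>_ :: real ^ 'n. 1 :: real) = (\<lambda>_. 1) then 0 else norm y powr (1 - real k) * indicator {..\<delta> / \<tau>} (norm y))
        + \<delta>\<^sup>2 * norm y powr (- real k) * indicator {-1..-\<tau>} (\<delta> * ln (norm y)))"
      by (rule iter_log_cutoff_expansion[OF G(1) smooth_on_const[OF open_UNIV, of 1] ik k]) blast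
    have "\<bar>iter_partial_deriv is (log_cutoff G \<delta>) y - \<delta> * deriv G (\<delta> * ln (norm y)) * ?L is y\<bar> \<le> C * (\<delta>\<^sup>2 / norm y ^ k)"
      if "0 < \<delta>" "\<delta> \<le> 1" "y \<noteq> 0" for \<delta> y
    proof -
      have "\<bar>iter_partial_deriv is (log_cutoff G \<delta>) y - \<delta> * deriv G (\<delta> * ln (norm y)) * ?L is y\<bar> \<le>
          C * (\<delta>\<^sup>2 * norm y powr (- real k) * indicator {-1..-\<tau>} (\<delta> * ln (norm y)))"
        using C(2)[OF that] by simp
      also have "\<dots> \<le> C * (\<delta>\<^sup>2 * norm y powr (- real k) * 1)"
        using C(1) by (intro mult_left_mono) (auto simp: indicator_def)
      finally show ?thesis using that by (simp add: powr_minus_divide powr_realpow)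
    qed
    then show ?thesis using C(1) by blast
  qed
  then obtain C where C: "\<And>is. is \<in> ?S \<Longrightarrow> C is \<ge> 0" "\<And>is \<delta> y. is \<in> ?S \<Longrightarrow> 0 < \<delta> \<Longrightarrow> \<delta> \<le> 1 \<Longrightarrow> y \<noteq> 0 \<Longrightarrow>
      \<bar>iter_partial_deriv is (log_cutoff G \<delta>) y - \<delta> * deriv G (\<delta> * ln (norm y)) * ?L is y\<bar> \<le> C is * (\<delta>\<^sup>2 / norm y ^ k)"
    by metis
  define K where "K = (\<Sum>is\<in>?S. C is)"
  have K: "K \<ge> 0" unfolding K_def using C(1) by (intro sum_nonneg) auto
  show thesis
  \<comment> \<open>The bound on \<delta> gives \<delta> K \<le> e, which turns the error \<delta>^2
    K into \<delta> e; the 1 added to K keeps the divisor positive.\<close>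
  proof (rule that[OF G(1), of "min 1 (e / (K + 1))"])
    show "min 1 (e / (K + 1)) > 0" using e K by simp
    fix \<delta> and y :: "real ^ 'n" assume \<delta>: "0 < \<delta>" "\<delta> \<le> min 1 (e / (K + 1))" and y: "y \<noteq> 0"
    define D where "D = (\<lambda>is. iter_partial_deriv is (log_cutoff G \<delta>) y)"
    define M where "M = (\<lambda>is. \<delta> * deriv G (\<delta> * ln (norm y)) * ?L is y)"
    have dK: "\<delta> * K \<le> e"
    proof -
      have "\<delta> * (K + 1) \<le> e" using \<delta> K by (simp add: pos_le_divide_eq)
      then show ?thesis using \<delta> by (simp add: algebra_simps)
    qed
    have "tensor_norm k (\<lambda>is. iter_partial_deriv is (log_cutoff G \<delta>)) y = L2_set (\<lambda>is. M is + (D is - M is)) ?S"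
      by (simp add: tensor_norm_def L2_set_def D_def)
    also have "\<dots> \<le> L2_set M ?S + L2_set (\<lambda>is. D is - M is) ?S" by (rule L2_set_triangle_ineq)
    also have "L2_set M ?S = \<bar>\<delta> * deriv G (\<delta> * ln (norm y))\<bar> * (?l / norm y ^ k)"
    proof -
      have "(\<Sum>is\<in>?S. (M is)\<^sup>2) = (\<delta> * deriv G (\<delta> * ln (norm y)))\<^sup>2 * log_tensor_square TYPE('n) k y"
        by (simp add: M_def log_tensor_square_def power_mult_distrib sum_distrib_left)
      also have "\<dots> = (\<bar>\<delta> * deriv G (\<delta> * ln (norm y))\<bar> * (?l / norm y ^ k))\<^sup>2"
        using ell_properties(1)[OF k, where 'n = 'n] by (simp add: ell_properties(2)[OF k y] power_mult_distrib power_divide power_mult[symmetric] mult.commute)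
      finally show ?thesis unfolding L2_set_def using l by (simp add: real_sqrt_abs del: real_sqrt_eq_iff) 
    qed
    also have "\<bar>\<delta> * deriv G (\<delta> * ln (norm y))\<bar> * (?l / norm y ^ k) \<le> (\<delta> * (1 + e)) * (?l / norm y ^ k)"
      using G(2) \<delta> l by (intro mult_right_mono) (auto simp: abs_mult)
    also have "L2_set (\<lambda>is. D is - M is) ?S \<le> (\<Sum>is\<in>?S. \<bar>D is - M is\<bar>)" by (rule L2_set_le_sum_abs)
    also have "\<dots> \<le> (\<Sum>is\<in>?S. C is * (\<delta>\<^sup>2 / norm y ^ k))"
      unfolding D_def M_def using \<delta> y by (intro sum_mono C) auto
    also have "\<dots> = K * \<delta> * (\<delta> / norm y ^ k)" by (simp only: K_def sum_distrib_right[symmetric]) (simp add: power2_eq_square)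
    also have "\<dots> \<le> e * (\<delta> / norm y ^ k)" using dK \<delta> by (intro mult_right_mono) (auto simp: mult.commute)
    also have "\<delta> * (1 + e) * (?l / norm y ^ k) + e * (\<delta> / norm y ^ k) = \<delta> * \<beta> / norm y ^ k"
      by (simp add: \<beta>e add_divide_distrib[symmetric] algebra_simps)
    finally show "tensor_norm k (\<lambda>is. iter_partial_deriv is (log_cutoff G \<delta>)) y \<le> \<delta> * \<beta> / norm y ^ k" by simp
  qed
qed

text \<open>The logarithmic cutoff is moved to x0 and scaled by R, so that its support fits into
  \<Omega> and into the range of the lower growth bound. A bound by a multiple of |x - x0|^(-k) is
  unaffected by the scaling, so the weak norm is governed by the constant factor alone.\<close>

lemma extremal_functions:
  fixes \<Omega> :: "(real ^ 'n::finite) set" and x\<^sub>0 :: "real ^ 'n"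
  assumes k: "k \<ge> 1" and \<beta>: "\<beta> > sqrt (ell TYPE('n) k)" and \<Omega>: "open \<Omega>" "x\<^sub>0 \<in> \<Omega>" and \<rho>: "\<rho>\<^sub>0 > 0"
  obtains R \<delta>\<^sub>0 where "0 < R" "R \<le> \<rho>\<^sub>0" "ball x\<^sub>0 R \<subseteq> \<Omega>" "\<delta>\<^sub>0 > 0" "\<And>\<delta>. 0 < \<delta> \<Longrightarrow> \<delta> \<le> \<delta>\<^sub>0 \<Longrightarrow>
    \<exists>u. test_function (zero_ext \<Omega> u) \<and> weak_Lp_norm (real CARD('n) / real k) \<Omega> (grad_norm k \<Omega> u) \<le> 1 \<and>
      (\<forall>x\<in>ball x\<^sub>0 (R * exp (- 1 / \<delta>)). zero_ext \<Omega> u x = 1 / (\<beta> * omega TYPE('n) powr (real k / real CARD('n)) * \<delta>))"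
proof -
  let ?W = "omega TYPE('n) powr (real k / real CARD('n))"
  have W: "?W > 0" using omega_pos[where 'n = 'n] by simp
  have b0: "\<beta> > 0" using \<beta> ell_properties(1)[OF k, where 'n = 'n] by (smt (verit) real_sqrt_ge_zero)
  obtain \<tau> G \<delta>\<^sub>0 where G: "cutoff_one \<tau> G" and \<delta>0: "\<delta>\<^sub>0 > 0"
    and grad: "\<And>\<delta> (y :: real ^ 'n). 0 < \<delta> \<Longrightarrow> \<delta> \<le> \<delta>\<^sub>0 \<Longrightarrow> y \<noteq> 0 \<Longrightarrow>
      tensor_norm k (\<lambda>is. iter_partial_deriv is (log_cutoff G \<delta>)) y \<le> \<delta> * \<beta> / norm y ^ k"
    using log_cutoff_gradient[OF k \<beta>] by blast
  obtain R0 where R0: "R0 > 0" "ball x\<^sub>0 R0 \<subseteq> \<Omega>" using \<Omega> by (auto simp: open_contains_ball)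
  define R where "R = min R0 \<rho>\<^sub>0"
  have R: "0 < R" "R \<le> \<rho>\<^sub>0" "ball x\<^sub>0 R \<subseteq> \<Omega>" using R0 \<rho> by (auto simp: R_def subset_iff)
  show thesis
  proof (rule that[OF R \<delta>0])
    fix \<delta> :: real assume \<delta>: "0 < \<delta>" "\<delta> \<le> \<delta>\<^sub>0"
    \<comment> \<open>Turns the gradient bound c \<delta> \<beta> |x - x0|^(-k) into \<omega>^(-k/n)
      |x - x0|^(-k), whose weak norm is at most 1.\<close>
    define c where "c = 1 / (\<beta> * ?W * \<delta>)"
    have c: "c > 0" using b0 W \<delta> by (simp add: c_def)
    define a where "a = - ((1 / R) *\<^sub>R x\<^sub>0)"
    define f where "f = (\<lambda>x. log_cutoff G \<delta> (a + (1 / R) *\<^sub>R x))"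
    define u where "u = (\<lambda>x. c * f x)"
    have ax: "a + (1 / R) *\<^sub>R x = (1 / R) *\<^sub>R (x - x\<^sub>0)" for x by (simp add: a_def algebra_simps)
    have nax: "norm (a + (1 / R) *\<^sub>R x) = norm (x - x\<^sub>0) / R" for x using R by (simp add: ax)
    have ls: "smooth_on UNIV (log_cutoff G \<delta> :: real ^ 'n \<Rightarrow> real)"
      by (intro test_function_smooth log_cutoff_test_function[OF G \<delta>(1)])
    have fs: "smooth_on UNIV f" using smooth_on_scale_compose[OF open_UNIV ls, of a "1 / R"] by (simp add: f_def)
    have us: "smooth_on UNIV u" unfolding u_def by (intro smooth_on_cmult fs) auto
    have u0: "u x = 0" if "norm (x - x\<^sub>0) \<ge> R" for x
    proof -
      have "1 \<le> norm (a + (1 / R) *\<^sub>R x)" using that R by (simp add: nax)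
      moreover from this have "a + (1 / R) *\<^sub>R x \<noteq> 0" by force
      moreover have "- \<tau> < \<delta> * ln (norm (a + (1 / R) *\<^sub>R x))"
      proof -
        have "0 \<le> \<delta> * ln (norm (a + (1 / R) *\<^sub>R x))" using calculation(1) \<delta> by simp
        then show ?thesis using G by (simp add: cutoff_one_def)
      qed
      ultimately have "log_cutoff G \<delta> (a + (1 / R) *\<^sub>R x) = 0" by (intro log_cutoff_eq_0[OF G])
      then show ?thesis by (simp add: u_def f_def)
    qed
    have zu: "zero_ext \<Omega> u = u"
    proof
      fix x :: "real ^ 'n"
      show "zero_ext \<Omega> u x = u x"
      proof (cases "x \<in> \<Omega>")
        case False
        then have "x \<notin> ball x\<^sub>0 R" using R(3) by blast
        then have "R \<le> norm (x - x\<^sub>0)" by (simp add: dist_norm norm_minus_commute)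
        then show ?thesis using False u0[of x] by (simp add: zero_ext_def)
      qed (simp add: zero_ext_def)
    qed
    have ut: "test_function u"
    proof (rule test_functionI[OF us])
      fix x :: "real ^ 'n" assume "norm x > norm x\<^sub>0 + R"
      then show "u x = 0" using norm_triangle_ineq2[of x x\<^sub>0] by (intro u0) linarith
    qed
    have ui: "iter_partial_deriv is u x = c * (1 / R) ^ length is * iter_partial_deriv is (log_cutoff G \<delta>) (a + (1 / R) *\<^sub>R x)" for "is" x
      unfolding u_def iter_partial_deriv_cmult[OF open_UNIV fs UNIV_I] unfolding f_def
      by (subst iter_partial_deriv_scale[OF open_UNIV ls UNIV_I]) simp
    have tn: "tensor_norm k (\<lambda>is. iter_partial_deriv is u) x = c * (1 / R) ^ k * tensor_norm k (\<lambda>is. iter_partial_deriv is (log_cutoff G \<delta>)) (a + (1 / R) *\<^sub>R x)" for x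
    proof -
      have "(\<Sum>is\<in>{is. length is = k}. (iter_partial_deriv is u x)\<^sup>2) =
          (c * (1 / R) ^ k)\<^sup>2 * (\<Sum>is\<in>{is. length is = k}. (iter_partial_deriv is (log_cutoff G \<delta>) (a + (1 / R) *\<^sub>R x))\<^sup>2)"
        by (simp add: ui power_mult_distrib sum_distrib_left)
      then show ?thesis using c R by (simp add: tensor_norm_def real_sqrt_mult)
    qed
    have "AE x in lebesgue. \<bar>grad_norm k \<Omega> u x\<bar> \<le> omega TYPE('n) powr - (real k / real CARD('n)) / norm (x - x\<^sub>0) ^ k"
    proof -
      have "AE x in lebesgue. x \<noteq> x\<^sub>0" by (intro AE_completion AE_lborel_singleton)
      with grad_norm_test_function[of \<Omega> u k, unfolded zu, OF ut] show ?thesis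
      proof eventually_elim
        case (elim x)
        have nz: "norm (x - x\<^sub>0) > 0" using elim by simp
        have "a + (1 / R) *\<^sub>R x \<noteq> 0" using nz R by (simp add: ax)
        from grad[OF \<delta> this] have "tensor_norm k (\<lambda>is. iter_partial_deriv is u) x \<le> c * (1 / R) ^ k * (\<delta> * \<beta> / (norm (x - x\<^sub>0) / R) ^ k)"
          unfolding tn nax using c R by (intro mult_left_mono) auto
        also have "\<dots> = 1 / ?W / norm (x - x\<^sub>0) ^ k" using R b0 \<delta> nz by (simp add: c_def power_divide)
        also have "1 / ?W = omega TYPE('n) powr - (real k / real CARD('n))" by (simp add: powr_minus_divide)
        finally show ?case using elim(1) by (auto simp: tensor_norm_def sum_nonneg)
      qed
    qed
    from weak_Lp_norm_inverse_power[OF k this]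
    have norm1: "weak_Lp_norm (real CARD('n) / real k) \<Omega> (grad_norm k \<Omega> u) \<le> 1" .
    have "zero_ext \<Omega> u x = c" if x: "x \<in> ball x\<^sub>0 (R * exp (- 1 / \<delta>))" for x
    proof -
      have "norm (a + (1 / R) *\<^sub>R x) < exp (- 1 / \<delta>)"
        using x R unfolding nax by (simp add: dist_norm norm_minus_commute pos_divide_less_eq mult.commute)
      then show ?thesis unfolding zu by (simp add: u_def f_def log_cutoff_near_zero[OF G \<delta>(1)])
    qed
    then show "\<exists>u. test_function (zero_ext \<Omega> u) \<and> weak_Lp_norm (real CARD('n) / real k) \<Omega> (grad_norm k \<Omega> u) \<le> 1 \<and>
      (\<forall>x\<in>ball x\<^sub>0 (R * exp (- 1 / \<delta>)). zero_ext \<Omega> u x = 1 / (\<beta> * ?W * \<delta>))"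
      using ut norm1 unfolding c_def[symmetric] zu by (intro exI[of _ u]) (simp add: zu)
  qed
qed

section \<open>Unboundedness above the critical exponent\<close>

lemma exp_integral_test_function_ge:
  fixes \<Omega> :: "(real ^ 'n::finite) set"
  assumes v: "test_function (zero_ext \<Omega> u)" and \<nu>: "sets \<nu> = sets borel" and A: "A \<in> sets borel" "A \<subseteq> \<Omega>"
    and c: "\<And>x. x \<in> A \<Longrightarrow> zero_ext \<Omega> u x = c" "c \<ge> 0"
  shows "ennreal (exp (\<gamma> * c)) * emeasure \<nu> A \<le> exp_integral \<nu> \<Omega> \<gamma> u"
proof -
  let ?v = "zero_ext \<Omega> u"
  have lim: "(ball_average ?v x \<longlongrightarrow> ?v x) (at_right 0)" for x
    using test_function_has_weak_deriv[OF v, of "[]"] smooth_on_isCont[OF test_function_smooth[OF v]]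
    by (intro ball_average_tendsto) (auto simp: has_weak_deriv_def)
  have hp: "has_precise_value ?v x" for x using lim by (auto simp: has_precise_value_def)
  have pr: "precise_rep ?v x = ?v x" for x unfolding precise_rep_def using lim by (intro tendsto_Lim) auto
  have "ennreal (exp (\<gamma> * c)) * emeasure \<nu> A = (\<integral>\<^sup>+x. ennreal (exp (\<gamma> * c)) * indicator A x \<partial>\<nu>)"
    using A \<nu> by (intro nn_integral_cmult_indicator[symmetric]) auto
  also have "\<dots> \<le> exp_integral \<nu> \<Omega> \<gamma> u"
    unfolding exp_integral_def using A(2) c by (intro nn_integral_mono) (auto simp: indicator_def hp pr)
  finally show ?thesis .
qed

lemma exp_integral_unbounded:
  fixes \<Omega> :: "(real ^ 'n::finite) set"
  assumes k: "1 \<le> k" and \<Omega>: "open \<Omega>" and d: "d > 0" and \<nu>: "sets \<nu> = sets borel" "lower_growth d \<Omega> \<nu>"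
    and \<gamma>: "\<gamma> > critical_exponent TYPE('n) k d"
  obtains u where "test_function (zero_ext \<Omega> u)" "weak_Lp_norm (real CARD('n) / real k) \<Omega> (grad_norm k \<Omega> u) \<le> 1"
    "ennreal C < exp_integral \<nu> \<Omega> \<gamma> u"
proof -
  let ?W = "omega TYPE('n) powr (real k / real CARD('n))" and ?l = "sqrt (ell TYPE('n) k)"
  have W: "?W > 0" using omega_pos[where 'n = 'n] by simp
  have "?l < \<gamma> / (d * ?W)" using \<gamma> W d by (simp add: critical_exponent_def pos_less_divide_eq mult_ac)
  \<comment> \<open>Room on both sides: \<beta> above sqrt \<ell> admits the extremal functions, and
    \<beta> below \<gamma> / (d \<omega>^(k/n)) makes the growth exponent a of the integrand exceed
    the decay d of the measure.\<close>
  then obtain \<beta> where \<beta>: "?l < \<beta>" "\<beta> < \<gamma> / (d * ?W)" using dense by blast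
  have l: "?l > 0" using ell_pos[OF k, where 'n = 'n] by simp
  have b0: "\<beta> > 0" using l \<beta> by linarith
  define a where "a = \<gamma> / (\<beta> * ?W)"
  have a: "a > d"
  proof -
    have "\<beta> * (d * ?W) < \<gamma>" using \<beta>(2) W d by (simp add: pos_less_divide_eq)
    then show ?thesis using b0 W by (simp add: a_def pos_less_divide_eq mult_ac)
  qed
  obtain x\<^sub>0 \<rho>\<^sub>0 C\<^sub>0 where x0: "x\<^sub>0 \<in> \<Omega>" "\<rho>\<^sub>0 > 0" "C\<^sub>0 > 0"
    and growth: "\<And>\<rho>. 0 < \<rho> \<Longrightarrow> \<rho> \<le> \<rho>\<^sub>0 \<Longrightarrow> ennreal (C\<^sub>0 * \<rho> powr d) \<le> emeasure \<nu> (ball x\<^sub>0 \<rho> \<inter> \<Omega>)"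
    using \<nu>(2) unfolding lower_growth_def by blast
  obtain R \<delta>\<^sub>0 where R: "0 < R" "R \<le> \<rho>\<^sub>0" "ball x\<^sub>0 R \<subseteq> \<Omega>" and \<delta>0: "\<delta>\<^sub>0 > 0" and ex: "\<And>\<delta>. 0 < \<delta> \<Longrightarrow> \<delta> \<le> \<delta>\<^sub>0 \<Longrightarrow>
    \<exists>u. test_function (zero_ext \<Omega> u) \<and> weak_Lp_norm (real CARD('n) / real k) \<Omega> (grad_norm k \<Omega> u) \<le> 1 \<and>
      (\<forall>x\<in>ball x\<^sub>0 (R * exp (- 1 / \<delta>)). zero_ext \<Omega> u x = 1 / (\<beta> * ?W * \<delta>))"
    using extremal_functions[OF k \<beta>(1) \<Omega> x0(1,2)] by blast
  define M where "M = C\<^sub>0 * R powr d"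
  have M: "M > 0" using x0 R by (simp add: M_def)
  \<comment> \<open>With t = 1/\<delta> the integral is at least M exp((a - d) t). By exp(s) \<ge> 1
    + s the third entry makes this larger than C, and the first ensures \<delta> \<le>
    \<delta>0.\<close>
  define t where "t = max (1 / \<delta>\<^sub>0) (max 1 (\<bar>C\<bar> / M / (a - d)))"
  have t: "t \<ge> 1" "1 / \<delta>\<^sub>0 \<le> t" "\<bar>C\<bar> / M / (a - d) \<le> t" by (auto simp: t_def)
  define \<delta> where "\<delta> = 1 / t"
  have \<delta>: "0 < \<delta>" "\<delta> \<le> \<delta>\<^sub>0" "1 / \<delta> = t"
    using t \<delta>0 by (auto simp: \<delta>_def field_simps)
  define r where "r = R * exp (- 1 / \<delta>)"
  have r: "0 < r" "r \<le> R" using R \<delta> mult_left_le[of "exp (- 1 / \<delta>)" R] by (auto simp: r_def)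
  obtain u where u: "test_function (zero_ext \<Omega> u)" "weak_Lp_norm (real CARD('n) / real k) \<Omega> (grad_norm k \<Omega> u) \<le> 1"
      "\<And>x. x \<in> ball x\<^sub>0 r \<Longrightarrow> zero_ext \<Omega> u x = t / (\<beta> * ?W)"
    using ex[OF \<delta>(1,2)] unfolding r_def by (auto simp: \<delta>_def)
  show thesis
  proof (rule that[OF u(1,2)])
    have "C < M * exp ((a - d) * t)"
    proof -
      have "C / M < 1 + (a - d) * t"
      proof -
        have "C / M \<le> \<bar>C\<bar> / M" using M by (intro divide_right_mono) auto
        also have "\<dots> \<le> t * (a - d)" using t(3) a by (subst (asm) pos_divide_le_eq) auto
        finally show ?thesis by (simp add: mult.commute)
      qed
      also have "\<dots> \<le> exp ((a - d) * t)" by (rule exp_ge_add_one_self)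
      finally show ?thesis using M by (simp add: pos_divide_less_eq mult.commute)
    qed
    then have "ennreal C < ennreal (M * exp ((a - d) * t))" using M by (intro ennreal_lessI) auto
    also have "M * exp ((a - d) * t) = exp (\<gamma> * (t / (\<beta> * ?W))) * (C\<^sub>0 * r powr d)"
    proof -
      have "r powr d = R powr d * exp (- (d * t))"
      proof -
        have "exp (- t) powr d = exp (- (d * t))" by (simp add: powr_def)
        moreover have "r = R * exp (- t)" using \<delta>(3) by (simp add: r_def)
        ultimately show ?thesis by (simp add: powr_mult)
      qed
      moreover have "\<gamma> * (t / (\<beta> * ?W)) = a * t" by (simp add: a_def)
      ultimately show ?thesis by (simp add: M_def left_diff_distrib exp_diff exp_minus field_simps)
    qed
    also have "ennreal \<dots> = ennreal (exp (\<gamma> * (t / (\<beta> * ?W)))) * ennreal (C\<^sub>0 * r powr d)"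
      by (rule ennreal_mult') simp
    also have "\<dots> \<le> ennreal (exp (\<gamma> * (t / (\<beta> * ?W)))) * emeasure \<nu> (ball x\<^sub>0 r \<inter> \<Omega>)"
      using r R by (intro mult_left_mono growth) auto
    also have "\<dots> \<le> exp_integral \<nu> \<Omega> \<gamma> u"
      using t b0 W \<Omega> by (intro exp_integral_test_function_ge[OF u(1) \<nu>(1)] u(3)) auto
    finally show "ennreal C < exp_integral \<nu> \<Omega> \<gamma> u" .
  qed
qed

theorem theorem1p5:
  fixes \<Omega> :: "(real ^ 'n::finite) set" and k :: nat and d :: real
  assumes "CARD('n) \<ge> 2"
    and "open \<Omega>" and "bounded \<Omega>"
    and "1 \<le> k" and "k < CARD('n)"
    and "0 < d" and "d \<le> real CARD('n)"
  shows "(\<forall>C\<^sub>d>0. \<forall>\<gamma>. \<gamma> < critical_exponent TYPE('n) k d \<longrightarrow>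
           (\<exists>C>0. \<forall>\<nu>. borel_measure_on \<Omega> \<nu> \<and> upper_growth d C\<^sub>d \<nu> \<and> lower_growth d \<Omega> \<nu> \<longrightarrow>
              (\<forall>u\<in>W0_weak_Lp k (real CARD('n) / real k) \<Omega>.
                 weak_Lp_norm (real CARD('n) / real k) \<Omega> (grad_norm k \<Omega> u) \<le> 1 \<longrightarrow>
                 (AE x in \<nu>. x \<in> \<Omega> \<longrightarrow> has_precise_value (zero_ext \<Omega> u) x) \<and>
                 exp_integral \<nu> \<Omega> \<gamma> u \<le> ennreal C))) \<and>
         (\<forall>\<nu>. borel_measure_on \<Omega> \<nu> \<and> (\<exists>C\<^sub>d>0. upper_growth d C\<^sub>d \<nu>) \<and> lower_growth d \<Omega> \<nu> \<longrightarrow>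
           (\<forall>\<gamma>. \<gamma> > critical_exponent TYPE('n) k d \<longrightarrow>
              \<not> (\<exists>C::real. \<forall>u\<in>W0_weak_Lp k (real CARD('n) / real k) \<Omega>.
                 weak_Lp_norm (real CARD('n) / real k) \<Omega> (grad_norm k \<Omega> u) \<le> 1 \<longrightarrow>
                 exp_integral \<nu> \<Omega> \<gamma> u \<le> ennreal C)))"
proof (intro conjI allI impI)
  fix C\<^sub>d \<gamma> :: real
  assume Cd: "C\<^sub>d > 0" and \<gamma>: "\<gamma> < critical_exponent TYPE('n) k d"
  obtain C where "C > 0"
    "\<And>\<nu> u. sets \<nu> = sets borel \<Longrightarrow> upper_growth d C\<^sub>d \<nu> \<Longrightarrow> weakly_differentiable k (zero_ext \<Omega> u) \<Longrightarrow>
      weak_Lp_norm (real CARD('n) / real k) \<Omega> (grad_norm k \<Omega> u) \<le> 1 \<Longrightarrow>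
      (AE x in \<nu>. x \<in> \<Omega> \<longrightarrow> has_precise_value (zero_ext \<Omega> u) x) \<and> exp_integral \<nu> \<Omega> \<gamma> u \<le> ennreal C"
    by (rule uniform_exp_bound[OF assms(4,5,2,3,6) less_imp_le[OF Cd] \<gamma>]) blast
  then show "\<exists>C>0. \<forall>\<nu>. borel_measure_on \<Omega> \<nu> \<and> upper_growth d C\<^sub>d \<nu> \<and> lower_growth d \<Omega> \<nu> \<longrightarrow>
      (\<forall>u\<in>W0_weak_Lp k (real CARD('n) / real k) \<Omega>.
         weak_Lp_norm (real CARD('n) / real k) \<Omega> (grad_norm k \<Omega> u) \<le> 1 \<longrightarrow>
         (AE x in \<nu>. x \<in> \<Omega> \<longrightarrow> has_precise_value (zero_ext \<Omega> u) x) \<and> exp_integral \<nu> \<Omega> \<gamma> u \<le> ennreal C)"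
    by (intro exI[of _ C]) (simp add: borel_measure_on_def W0_weak_Lp_def)
next
  fix \<nu> :: "(real ^ 'n) measure" and \<gamma> :: real
  assume \<nu>: "borel_measure_on \<Omega> \<nu> \<and> (\<exists>C\<^sub>d>0. upper_growth d C\<^sub>d \<nu>) \<and> lower_growth d \<Omega> \<nu>"
    and \<gamma>: "\<gamma> > critical_exponent TYPE('n) k d"
  show "\<not> (\<exists>C::real. \<forall>u\<in>W0_weak_Lp k (real CARD('n) / real k) \<Omega>.
      weak_Lp_norm (real CARD('n) / real k) \<Omega> (grad_norm k \<Omega> u) \<le> 1 \<longrightarrow> exp_integral \<nu> \<Omega> \<gamma> u \<le> ennreal C)"
  proof
    assume "\<exists>C::real. \<forall>u\<in>W0_weak_Lp k (real CARD('n) / real k) \<Omega>.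
      weak_Lp_norm (real CARD('n) / real k) \<Omega> (grad_norm k \<Omega> u) \<le> 1 \<longrightarrow> exp_integral \<nu> \<Omega> \<gamma> u \<le> ennreal C"
    then obtain C :: real where C: "\<And>u. u \<in> W0_weak_Lp k (real CARD('n) / real k) \<Omega> \<Longrightarrow>
      weak_Lp_norm (real CARD('n) / real k) \<Omega> (grad_norm k \<Omega> u) \<le> 1 \<Longrightarrow> exp_integral \<nu> \<Omega> \<gamma> u \<le> ennreal C" by blast
    have "sets \<nu> = sets borel" "lower_growth d \<Omega> \<nu>" using \<nu> by (auto simp: borel_measure_on_def)
    from exp_integral_unbounded[OF assms(4,2,6) this \<gamma>, of C]
    obtain u where u: "test_function (zero_ext \<Omega> u)" "weak_Lp_norm (real CARD('n) / real k) \<Omega> (grad_norm k \<Omega> u) \<le> 1"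
      "ennreal C < exp_integral \<nu> \<Omega> \<gamma> u" by blast
    have "weakly_differentiable k (zero_ext \<Omega> u)"
      using test_function_has_weak_deriv[OF u(1)] by (auto simp: weakly_differentiable_def)
    moreover have "weak_Lp_norm (real CARD('n) / real k) \<Omega> (grad_norm k \<Omega> u) < \<infinity>"
      using u(2) by (rule order_le_less_trans) simp
    ultimately have "u \<in> W0_weak_Lp k (real CARD('n) / real k) \<Omega>" by (simp add: W0_weak_Lp_def)
    from C[OF this u(2)] u(3) show False by simp
  qed
qed

end
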